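(* Let $d\ge2$, let $\Omega\subset\mathbb{R}^d$ be a bounded Lipschitz domain with $\mathbb{R}^d\setminus\overline\Omega$ connected, and let $\Psi:\overline\Omega\to\overline\Omega$ be a $\mathscr{C}^2(\overline\Omega)$ diffeomorphism satisfying $\Psi=\mathrm{Id}$ on $\partial\Omega$. Define in $\Omega$ $$A=\frac{D\Psi\, D^T\Psi}{|\det D\Psi|}\circ\Psi^{-1},\qquad q=\frac{1}{|\det D\Psi|}\circ\Psi^{-1},$$ and set $A=\mathrm{Id}$, $q=1$ in $\mathbb{R}^d\setminus\overline\Omega$. Then $A\in \mathrm{L}^\infty(\Omega,\mathbb{R}^{d\times d})$ and $q\in \mathrm{L}^\infty(\Omega,\mathbb{R})$ satisfy $$\operatorname*{ess\,inf}_{x\in\Omega}\ \inf_{\xi\in\mathbb{C}^d,|\xi|=1}(\xi\cdot A(x)\overline\xi)>0,\qquad \operatorname*{ess\,inf}_{x\in\Omega}q(x)>0,$$ and $(A,q;\Omega)$ is non-scattering for any incident wave at any frequency: for every $k>0$ and every incident field $u_i$ at frequency $k$, the corresponding scattered field $u_s$ satisfies $u_s=0$ in $\mathbb{R}^d\setminus\Omega$.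
   Context: $D\Psi$ is the Jacobian matrix of $\Psi$ and $D^T\Psi$ its transpose. Given $k>0$, an incident field at frequency $k$ is a function $u_i$ solving $\Delta u_i+k^2u_i=0$ in some domain $\tilde\Omega$ with $\overline\Omega\subset\tilde\Omega$. The corresponding scattered field is the function $u_s$, in $\mathrm{H}^1$ of every bounded domain, solving in the weak sense $$\mathrm{div}(A\nabla u_s)+k^2qu_s=-\mathrm{div}((A-\mathrm{Id})\nabla u_i)-k^2(q-1)u_i\ \text{ in }\mathbb{R}^d,\qquad \lim_{R\to+\infty}\int_{|x|=R}\Big|\frac{\partial u_s}{\partial r}-iku_s\Big|^2ds=0,$$ where $u_i$ is extended by zero outside $\tilde\Omega$. *)

theory Defs
  imports "HOL-Probability.Essential_Supremum"
begin

section \<open>Differentiability classes\<close>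

text \<open>
  The derivative used throughout is \<^const>\<open>frechet_derivative\<close> at a point, so the classes below
  are meant for open sets: there, all partial derivatives of order at most \<open>m\<close> exist and are
  continuous.
\<close>

primrec Ck_on :: "nat \<Rightarrow> 'a::euclidean_space set \<Rightarrow> ('a \<Rightarrow> 'b::real_normed_vector) \<Rightarrow> bool" where
  "Ck_on 0 S f \<longleftrightarrow> continuous_on S f"
| "Ck_on (Suc m) S f \<longleftrightarrow>
     f differentiable_on S \<and> (\<forall>b\<in>Basis. Ck_on m S (\<lambda>x. frechet_derivative f (at x) b))"

definition extends_to_closure ::
    "'a::euclidean_space set \<Rightarrow> ('a \<Rightarrow> 'b::real_normed_vector) \<Rightarrow> bool" where
  "extends_to_closure S f \<longleftrightarrow> (\<exists>g. continuous_on (closure S) g \<and> (\<forall>x\<in>S. g x = f x))"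

primrec Ck_extends :: "nat \<Rightarrow> 'a::euclidean_space set \<Rightarrow> ('a \<Rightarrow> 'b::real_normed_vector) \<Rightarrow> bool" where
  "Ck_extends 0 S f \<longleftrightarrow> extends_to_closure S f"
| "Ck_extends (Suc m) S f \<longleftrightarrow>
     extends_to_closure S f \<and> f differentiable_on S \<and>
     (\<forall>b\<in>Basis. Ck_extends m S (\<lambda>x. frechet_derivative f (at x) b))"

text \<open>
  The class \<open>C\<^sup>m\<close> of the closure of an open set \<open>S\<close>: the derivatives of order at most \<open>m\<close>, taken in
  \<open>S\<close>, extend continuously to the closure, and the values of \<open>f\<close> itself on the boundary are those
  of its extension.
\<close>

definition Ck_closure :: "nat \<Rightarrow> 'a::euclidean_space set \<Rightarrow> ('a \<Rightarrow> 'b::real_normed_vector) \<Rightarrow> bool" where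
  "Ck_closure m S f \<longleftrightarrow> continuous_on (closure S) f \<and> Ck_extends m S f"

definition Ck_closure_diffeomorphism ::
    "nat \<Rightarrow> 'a::euclidean_space set \<Rightarrow> ('a \<Rightarrow> 'a) \<Rightarrow> bool" where
  "Ck_closure_diffeomorphism m S \<Psi> \<longleftrightarrow>
     bij_betw \<Psi> (closure S) (closure S) \<and>
     Ck_closure m S \<Psi> \<and> Ck_closure m S (inv_into (closure S) \<Psi>)"

section \<open>Lipschitz domains\<close>

definition domain_set :: "'a::euclidean_space set \<Rightarrow> bool" where
  "domain_set S \<longleftrightarrow> open S \<and> connected S \<and> S \<noteq> {}"

text \<open>
  Near each boundary point, \<open>S\<close> is the strict epigraph of a Lipschitz function \<open>g\<close> over the
  hyperplane orthogonal to some unit vector \<open>e\<close>; the coordinates of \<open>x\<close> are its orthogonal projection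
  \<open>x - (x \<bullet> e) e\<close> on that hyperplane and its height \<open>x \<bullet> e\<close>.
\<close>

definition lipschitz_boundary :: "'a::euclidean_space set \<Rightarrow> bool" where
  "lipschitz_boundary S \<longleftrightarrow>
     (\<forall>p\<in>frontier S. \<exists>e r L g. norm e = 1 \<and> r > 0 \<and> L-lipschitz_on {y. y \<bullet> e = 0} g \<and>
        (\<forall>x\<in>ball p r. x \<in> S \<longleftrightarrow> g (x - (x \<bullet> e) *\<^sub>R e) < x \<bullet> e))"

definition bounded_lipschitz_domain :: "'a::euclidean_space set \<Rightarrow> bool" where
  "bounded_lipschitz_domain S \<longleftrightarrow> domain_set S \<and> bounded S \<and> lipschitz_boundary S"

section \<open>Essential bounds\<close>

definition essinf :: "'a measure \<Rightarrow> ('a \<Rightarrow> ereal) \<Rightarrow> ereal" where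
  "essinf M f = - esssup M (\<lambda>x. - f x)"

definition Linfty_on :: "'a::euclidean_space set \<Rightarrow> ('a \<Rightarrow> 'b::euclidean_space) \<Rightarrow> bool" where
  "Linfty_on S f \<longleftrightarrow>
     f \<in> borel_measurable (lebesgue_on S) \<and> esssup (lebesgue_on S) (\<lambda>x. ereal (norm (f x))) < \<infinity>"

section \<open>Sobolev spaces of complex-valued functions\<close>

definition test_function :: "'a::euclidean_space set \<Rightarrow> ('a \<Rightarrow> complex) \<Rightarrow> bool" where
  "test_function S \<phi> \<longleftrightarrow>
     (\<forall>m. Ck_on m UNIV \<phi>) \<and> (\<exists>K. compact K \<and> K \<subseteq> S \<and> (\<forall>x. x \<notin> K \<longrightarrow> \<phi> x = 0))"

definition L2_on :: "'a::euclidean_space set \<Rightarrow> ('a \<Rightarrow> 'b::euclidean_space) \<Rightarrow> bool" where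
  "L2_on S f \<longleftrightarrow>
     f \<in> borel_measurable (lebesgue_on S) \<and> integrable (lebesgue_on S) (\<lambda>x. (norm (f x))\<^sup>2)"

definition locally_integrable_on ::
    "'a::euclidean_space set \<Rightarrow> ('a \<Rightarrow> 'b::euclidean_space) \<Rightarrow> bool" where
  "locally_integrable_on S f \<longleftrightarrow> (\<forall>K. compact K \<and> K \<subseteq> S \<longrightarrow> integrable (lebesgue_on K) f)"

definition partial :: "'n \<Rightarrow> (real^'n \<Rightarrow> complex) \<Rightarrow> real^'n \<Rightarrow> complex" where
  "partial j f x = frechet_derivative f (at x) (axis j 1)"

definition grad :: "(real^'n \<Rightarrow> complex) \<Rightarrow> real^'n \<Rightarrow> complex^'n" where
  "grad f x = (\<chi> j. partial j f x)"

definition laplacian :: "(real^'n \<Rightarrow> complex) \<Rightarrow> real^'n \<Rightarrow> complex" where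
  "laplacian f x = (\<Sum>j\<in>UNIV. partial j (partial j f) x)"

definition has_weak_gradient ::
    "(real^'n) set \<Rightarrow> (real^'n \<Rightarrow> complex) \<Rightarrow> (real^'n \<Rightarrow> complex^'n) \<Rightarrow> bool" where
  "has_weak_gradient S u G \<longleftrightarrow>
     locally_integrable_on S u \<and> locally_integrable_on S G \<and>
     (\<forall>\<phi> j. test_function S \<phi> \<longrightarrow>
        (\<integral>x. u x * partial j \<phi> x \<partial>lebesgue_on S) = - (\<integral>x. G x $ j * \<phi> x \<partial>lebesgue_on S))"

definition H1_on :: "(real^'n) set \<Rightarrow> (real^'n \<Rightarrow> complex) \<Rightarrow> bool" where
  "H1_on S u \<longleftrightarrow> L2_on S u \<and> (\<exists>G. L2_on S G \<and> has_weak_gradient S u G)"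

section \<open>Surface integrals on spheres\<close>

text \<open>
  Surface measure on the unit sphere is the cone measure
  \<open>\<sigma>(E) = d * |{r \<theta> : 0 < r \<le> 1, \<theta> \<in> E}|\<close>, that is \<open>d\<close> times the image of Lebesgue measure on the
  punctured unit ball under \<open>x \<mapsto> x / |x|\<close>, which is \<^const>\<open>sgn\<close>.
\<close>

definition unit_sphere_measure :: "'a::euclidean_space measure" where
  "unit_sphere_measure =
     scale_measure (of_nat DIM('a))
       (distr (restrict_space lborel (cball 0 1 - {0})) (restrict_space borel (sphere 0 1)) sgn)"

definition sphere_integral :: "real \<Rightarrow> ('a::euclidean_space \<Rightarrow> real) \<Rightarrow> real" where
  "sphere_integral R f = R ^ (DIM('a) - 1) * (\<integral>\<theta>. f (R *\<^sub>R \<theta>) \<partial>unit_sphere_measure)"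

section \<open>Incident and scattered fields\<close>

text \<open>The bilinear product on \<open>\<complex>\<^sup>d\<close>, without complex conjugation.\<close>

definition cdot :: "complex^'n \<Rightarrow> complex^'n \<Rightarrow> complex" where
  "cdot v w = (\<Sum>j\<in>UNIV. v $ j * w $ j)"

definition cmat :: "real^'n^'m \<Rightarrow> complex^'n^'m" where
  "cmat = map_matrix of_real"

definition cconj :: "complex^'n \<Rightarrow> complex^'n" where
  "cconj v = (\<chi> j. cnj (v $ j))"

definition incident_field :: "real \<Rightarrow> (real^'n) set \<Rightarrow> (real^'n) set \<Rightarrow> (real^'n \<Rightarrow> complex) \<Rightarrow> bool" where
  "incident_field k \<Omega> T u\<^sub>i \<longleftrightarrow>
     domain_set T \<and> closure \<Omega> \<subseteq> T \<and> Ck_on 2 T u\<^sub>i \<and>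
     (\<forall>x\<in>T. laplacian u\<^sub>i x + (of_real k)\<^sup>2 * u\<^sub>i x = 0)"

definition zero_extension :: "'a set \<Rightarrow> ('a \<Rightarrow> 'b::zero) \<Rightarrow> 'a \<Rightarrow> 'b" where
  "zero_extension T f x = (if x \<in> T then f x else 0)"

text \<open>
  The weak form, against test functions, of
  \<open>div (A \<nabla>u\<^sub>s) + k\<^sup>2 q u\<^sub>s = - div ((A - Id) \<nabla>u) - k\<^sup>2 (q - 1) u\<close> in the whole space, where \<open>G\<close> is the
  weak gradient of \<open>u\<^sub>s\<close>. The gradient of \<open>u\<close> is the classical one; it is only relevant where
  \<open>A \<noteq> Id\<close>.
\<close>

definition scattering_equation ::
    "real \<Rightarrow> (real^'n \<Rightarrow> real^'n^'n) \<Rightarrow> (real^'n \<Rightarrow> real) \<Rightarrow> (real^'n \<Rightarrow> complex) \<Rightarrow>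
      (real^'n \<Rightarrow> complex) \<Rightarrow> (real^'n \<Rightarrow> complex^'n) \<Rightarrow> bool" where
  "scattering_equation k A q u u\<^sub>s G \<longleftrightarrow>
     (\<forall>\<phi>. test_function UNIV \<phi> \<longrightarrow>
        - (\<integral>x. cdot (cmat (A x) *v G x) (grad \<phi> x) \<partial>lebesgue)
        + (of_real k)\<^sup>2 * (\<integral>x. of_real (q x) * u\<^sub>s x * \<phi> x \<partial>lebesgue)
      = (\<integral>x. cdot (cmat (A x - mat 1) *v grad u x) (grad \<phi> x) \<partial>lebesgue)
        - (of_real k)\<^sup>2 * (\<integral>x. of_real (q x - 1) * u x * \<phi> x \<partial>lebesgue))"

text \<open>
  An element of \<open>H\<^sup>1\<close> has no pointwise radial derivative, but a scattered field is smooth away from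
  the scatterer: the condition is imposed on the representative that is \<open>C\<^sup>1\<close> outside some ball.
\<close>

definition sommerfeld_radiating :: "real \<Rightarrow> (real^'n \<Rightarrow> complex) \<Rightarrow> bool" where
  "sommerfeld_radiating k u \<longleftrightarrow>
     (\<exists>R\<^sub>0 v. Ck_on 1 (- cball 0 R\<^sub>0) v \<and> (AE x in lebesgue_on (- cball 0 R\<^sub>0). u x = v x) \<and>
        ((\<lambda>R. sphere_integral R
            (\<lambda>x. (cmod (frechet_derivative v (at x) (sgn x) - \<i> * of_real k * v x))\<^sup>2))
          \<longlongrightarrow> 0) at_top)"

definition scattered_field ::
    "real \<Rightarrow> (real^'n \<Rightarrow> real^'n^'n) \<Rightarrow> (real^'n \<Rightarrow> real) \<Rightarrow> (real^'n) set \<Rightarrow>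
      (real^'n \<Rightarrow> complex) \<Rightarrow> (real^'n \<Rightarrow> complex) \<Rightarrow> bool" where
  "scattered_field k A q T u\<^sub>i u\<^sub>s \<longleftrightarrow>
     (\<forall>D. domain_set D \<and> bounded D \<longrightarrow> H1_on D u\<^sub>s) \<and>
     (\<exists>G. has_weak_gradient UNIV u\<^sub>s G \<and>
          scattering_equation k A q (zero_extension T u\<^sub>i) u\<^sub>s G) \<and>
     sommerfeld_radiating k u\<^sub>s"

definition non_scattering ::
    "(real^'n \<Rightarrow> real^'n^'n) \<Rightarrow> (real^'n \<Rightarrow> real) \<Rightarrow> (real^'n) set \<Rightarrow>
      real \<Rightarrow> (real^'n) set \<Rightarrow> (real^'n \<Rightarrow> complex) \<Rightarrow> bool" where
  "non_scattering A q \<Omega> k T u\<^sub>i \<longleftrightarrow>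
     (\<forall>u\<^sub>s. scattered_field k A q T u\<^sub>i u\<^sub>s \<longrightarrow> (AE x in lebesgue_on (- \<Omega>). u\<^sub>s x = 0))"

section \<open>The transformed coefficients\<close>

text \<open>On the boundary, a null set, the coefficients are given their exterior values.\<close>

definition transformed_A :: "(real^'n \<Rightarrow> real^'n) \<Rightarrow> (real^'n) set \<Rightarrow> real^'n \<Rightarrow> real^'n^'n" where
  "transformed_A \<Psi> \<Omega> x =
     (if x \<in> \<Omega> then
        (let J = jacobian \<Psi> (at (inv_into (closure \<Omega>) \<Psi> x))
         in (1 / \<bar>det J\<bar>) *\<^sub>R (J ** transpose J))
      else mat 1)"

definition transformed_q :: "(real^'n \<Rightarrow> real^'n) \<Rightarrow> (real^'n) set \<Rightarrow> real^'n \<Rightarrow> real" where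
  "transformed_q \<Psi> \<Omega> x =
     (if x \<in> \<Omega> then 1 / \<bar>det (jacobian \<Psi> (at (inv_into (closure \<Omega>) \<Psi> x)))\<bar> else 1)"

text \<open>
  The form \<open>\<xi> \<cdot> A \<xi>\<^sup>*\<close> is real because \<open>A\<close> is real and symmetric, so that taking its real part
  in order to form an infimum loses nothing.
\<close>

lemma transformed_A_symmetric:
  fixes \<Psi> :: "real^'n \<Rightarrow> real^'n"
  shows "transpose (transformed_A \<Psi> \<Omega> x) = transformed_A \<Psi> \<Omega> x"
proof -
  have "transpose (c *\<^sub>R (J ** transpose J)) = c *\<^sub>R (J ** transpose J)" for c and J :: "real^'n^'n"
    by (simp add: transpose_scalar matrix_transpose_mul)
  then show ?thesis
    by (simp add: transformed_A_def Let_def transpose_mat)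
qed

lemma transformed_A_form_real:
  fixes \<Psi> :: "real^'n \<Rightarrow> real^'n"
  shows "cdot \<xi> (cmat (transformed_A \<Psi> \<Omega> x) *v cconj \<xi>) \<in> \<real>"
proof -
  define A where "A = transformed_A \<Psi> \<Omega> x"
  have sym: "A $ i $ j = A $ j $ i" for i j
    using transformed_A_symmetric[of \<Psi> \<Omega> x]
    by (metis A_def transpose_def vec_lambda_beta)
  have form: "cdot \<xi> (cmat A *v cconj \<xi>) = (\<Sum>i\<in>UNIV. \<Sum>j\<in>UNIV. \<xi>$i * of_real (A$i$j) * cnj (\<xi>$j))"
    by (simp add: cdot_def cmat_def cconj_def matrix_vector_mult_def sum_distrib_left mult.assoc)
  have "cnj (cdot \<xi> (cmat A *v cconj \<xi>)) = (\<Sum>i\<in>UNIV. \<Sum>j\<in>UNIV. \<xi>$j * of_real (A$i$j) * cnj (\<xi>$i))"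
    by (simp add: form mult_ac)
  also have "\<dots> = (\<Sum>j\<in>UNIV. \<Sum>i\<in>UNIV. \<xi>$j * of_real (A$i$j) * cnj (\<xi>$i))"
    by (rule sum.swap)
  also have "\<dots> = cdot \<xi> (cmat A *v cconj \<xi>)"
    unfolding form using sym by (intro sum.cong refl) metis
  finally show ?thesis
    unfolding A_def[symmetric] by (simp add: Reals_cnj_iff)
qed

end

theory Submission
  imports Defs
begin

text \<open>
  Let \<open>\<theta>\<close> be the inverse of \<open>\<Psi>\<close> in \<open>\<Omega>\<close> and the identity outside. Testing the scattering equation with
  \<open>\<phi> \<circ> \<theta>\<close> shows that the functional
  \<open>l(\<psi>) = \<integral> q u\<^sub>s (\<psi> \<circ> \<theta>) + \<integral>\<^sub>\<Omega> q u\<^sub>i (\<psi> \<circ> \<theta>) - \<integral>\<^sub>\<Omega> u\<^sub>i \<psi>\<close>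
  annihilates \<open>\<Delta>\<phi> + k\<^sup>2\<phi>\<close> for all compactly supported \<open>\<phi>\<close> of class \<open>C\<^sup>2\<close>: it is an entire solution of the
  Helmholtz equation, and it coincides with \<open>u\<^sub>s\<close> off \<open>\<Omega>\<close>. Since \<open>\<phi> \<circ> \<theta>\<close> is only Lipschitz, \<open>\<theta>\<close> is
  approximated by \<open>C\<^sup>2\<close> maps of the whole space, for which the divergence of the Piola transform
  is known. The sign of \<open>det D\<Psi>\<close> is positive because \<open>\<integral> (det D\<theta> - 1) = 0\<close>.

  A radiating entire solution vanishes. Mollification shows that its energy flux through large
  spheres is zero, so the radiation condition makes the squared \<open>L\<^sup>2\<close> norm of \<open>u\<^sub>s\<close> on
  \<open>{R/2 \<le> |x| \<le> 3R}\<close> of order \<open>o(R)\<close>. For \<open>\<rho>\<close> supported in \<open>[a, b]\<close>, an ODE gives a radial \<open>\<phi>\<close> with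
  \<open>\<Delta>\<phi> + k\<^sup>2\<phi> = \<rho> + \<kappa>\<close> where \<open>\<kappa>\<close> is of order \<open>R\<close> to the power \<open>-(d+1)/2\<close> and lives on \<open>[R, 2R]\<close>. Letting \<open>R\<close>
  tend to infinity in \<open>l(\<rho> + \<kappa>) = 0\<close> yields \<open>\<integral> u\<^sub>s(x) \<rho>(|x - x\<^sub>0|) dx = 0\<close> whenever the ball of radius \<open>b\<close>
  about \<open>x\<^sub>0\<close> misses \<open>\<Omega>\<close>, and these integrals determine \<open>u\<^sub>s\<close> off \<open>\<Omega>\<close>.
\<close>

section \<open>Continuously differentiable functions\<close>

text \<open>In \<Omega> the definition of A gives A (D\<theta>)^T w = det(D\<theta>)
  (D\<theta>)^(-1) w. Hence A applied to the gradient of \<phi> o \<theta> is the Piola transform of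
  the gradient of \<phi>, and its divergence is q times (\<Delta>\<phi>) o \<theta>. This moves all
  derivatives from \<open>us\<close> to \<phi>, so that neither traces on the Lipschitz boundary nor
  a chain rule for \<open>us\<close> enter. The obstacle is that \<theta> need not have second
  derivatives across the boundary. The approximating maps are therefore the identity near it; their
  first derivatives are bounded uniformly and converge outside a null set, which is what dominated
  convergence asks for. Second derivatives of the maps occur only in the exact identity before the
  limit. The exponents in the radiation argument balance as follows: \<kappa>^2 is of order R^(-d-1)
  on a set of volume of order R^d, so its integral is O(1/R), and against an L2 mass of o(R) it
  pairs to something that tends to 0. Densities \<rho> that vanish near the centre keep the radial
  equation away from its singularity.\<close>

definition c1 :: "(real^'n) set \<Rightarrow> (real^'n \<Rightarrow> 'b::real_normed_vector) \<Rightarrow> ('n \<Rightarrow> real^'n \<Rightarrow> 'b) \<Rightarrow> bool" where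
  "c1 S f f' \<longleftrightarrow> (\<forall>x\<in>S. (f has_derivative (\<lambda>h. \<Sum>j\<in>UNIV. h$j *\<^sub>R f' j x)) (at x)) \<and>
     (\<forall>j. continuous_on S (f' j))"

text \<open>The support radius is explicit because the bounds in \<open>radon\<close> and the
  dominated convergence arguments are uniform over all functions living in a common ball.\<close>

definition cc :: "real \<Rightarrow> (real^'n \<Rightarrow> 'b::real_normed_vector) \<Rightarrow> bool" where
  "cc R f \<longleftrightarrow> continuous_on UNIV f \<and> (\<forall>x. norm x > R \<longrightarrow> f x = 0)"

lemma c1_derivative: "c1 S f f' \<Longrightarrow> x \<in> S \<Longrightarrow> (f has_derivative (\<lambda>h. \<Sum>j\<in>UNIV. h$j *\<^sub>R f' j x)) (at x)"
  by (simp add: c1_def)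

lemma c1_continuous_partial: "c1 S f f' \<Longrightarrow> continuous_on S (f' j)"
  by (simp add: c1_def)

lemma c1_subset: "c1 S f f' \<Longrightarrow> T \<subseteq> S \<Longrightarrow> c1 T f f'"
  unfolding c1_def by (meson continuous_on_subset subsetD)

lemma c1_continuous: "c1 S f f' \<Longrightarrow> continuous_on S f"
  by (meson c1_derivative continuous_at_imp_continuous_on has_derivative_continuous)

lemma sum_axis_nth: "(\<Sum>j\<in>UNIV. (axis i (1::real))$j *\<^sub>R (f j :: 'b::real_vector)) = f (i::'n::finite)"
proof -
  have "(\<Sum>j\<in>UNIV. (axis i (1::real))$j *\<^sub>R f j) = (\<Sum>j\<in>UNIV. if j = i then f j else 0)"
    by (intro sum.cong) (auto simp: axis_def)
  then show ?thesis by simp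
qed

lemma frechet_derivative_axis:
  assumes "(f has_derivative (\<lambda>h. \<Sum>j\<in>UNIV. h$j *\<^sub>R g j)) (at x)"
  shows "frechet_derivative f (at x) (axis i 1) = g i"
  using frechet_derivative_at[OF assms, symmetric] by (simp add: sum_axis_nth)

lemma c1_frechet: "c1 S f f' \<Longrightarrow> x \<in> S \<Longrightarrow> frechet_derivative f (at x) (axis i 1) = f' i x"
  by (rule frechet_derivative_axis) (rule c1_derivative)

lemma c1_partial: "c1 S f f' \<Longrightarrow> x \<in> S \<Longrightarrow> partial i f x = f' i x"
  unfolding partial_def by (rule c1_frechet)

lemma linear_axis_expansion:
  fixes h :: "real^'n"
  assumes "linear f"
  shows "f h = (\<Sum>j\<in>UNIV. h$j *\<^sub>R f (axis j 1))"
proof -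
  have "f h = f (\<Sum>j\<in>UNIV. h$j *\<^sub>R axis j 1)"
    by (metis (no_types, lifting) basis_expansion scalar_mult_eq_scaleR sum.cong)
  then show ?thesis using assms by (simp add: linear_sum linear_cmul)
qed

lemma has_derivative_axis:
  fixes f :: "real^'n \<Rightarrow> 'b::real_normed_vector"
  assumes "f differentiable (at x)"
  shows "(f has_derivative (\<lambda>h. \<Sum>j\<in>UNIV. h$j *\<^sub>R frechet_derivative f (at x) (axis j 1))) (at x)"
proof -
  have 1: "(f has_derivative frechet_derivative f (at x)) (at x)"
    using assms frechet_derivative_works by blast
  have "frechet_derivative f (at x) h = (\<Sum>j\<in>UNIV. h$j *\<^sub>R frechet_derivative f (at x) (axis j 1))" for h
    by (rule linear_axis_expansion) (rule has_derivative_linear[OF 1])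
  then have "frechet_derivative f (at x) = (\<lambda>h. \<Sum>j\<in>UNIV. h$j *\<^sub>R frechet_derivative f (at x) (axis j 1))"
    by (rule ext)
  then show ?thesis using 1 by simp
qed

lemma Basis_axis: "b \<in> (Basis :: (real^'n) set) \<longleftrightarrow> (\<exists>j. b = axis j 1)"
  unfolding Basis_vec_def by auto

lemma Ck_on_imp_continuous: "Ck_on m S f \<Longrightarrow> continuous_on S f"
  by (cases m) (auto intro: differentiable_imp_continuous_on)

lemma Ck_on_Suc_c1:
  fixes f :: "real^'n \<Rightarrow> 'b::real_normed_vector"
  assumes "Ck_on (Suc m) S f" "open S"
  shows "c1 S f (\<lambda>j x. frechet_derivative f (at x) (axis j 1))"
    and "Ck_on m S (\<lambda>x. frechet_derivative f (at x) (axis j 1))"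
proof -
  have d: "f differentiable (at x)" if "x \<in> S" for x
    using assms that by (auto simp: differentiable_on_def at_within_open[OF that])
  show *: "Ck_on m S (\<lambda>x. frechet_derivative f (at x) (axis j 1))" for j
    using assms Basis_axis[of "axis j 1"] by auto
  show "c1 S f (\<lambda>j x. frechet_derivative f (at x) (axis j 1))"
    unfolding c1_def by (intro conjI ballI allI has_derivative_axis d Ck_on_imp_continuous[OF *])
qed

text \<open>Lets smoothness be proved by induction on \<open>m\<close> with partial derivatives
  given by formulas instead of \<open>frechet_derivative\<close> terms.\<close>

lemma Ck_onI:
  fixes f :: "real^'n \<Rightarrow> 'b::real_normed_vector"
  assumes d: "\<And>x. (f has_derivative (\<lambda>h. \<Sum>j\<in>UNIV. h$j *\<^sub>R f' j x)) (at x)"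
    and "\<And>j. Ck_on m UNIV (f' j)"
  shows "Ck_on (Suc m) UNIV f"
proof -
  have eq: "(\<lambda>x. frechet_derivative f (at x) (axis j 1)) = f' j" for j
    using frechet_derivative_axis[OF d] by (intro ext)
  have "Ck_on m UNIV (\<lambda>x. frechet_derivative f (at x) b)" if b: "b \<in> Basis" for b
  proof -
    obtain j where "b = axis j 1" using b Basis_axis by blast
    then show ?thesis using eq[of j] assms(2)[of j] by simp
  qed
  moreover have "f differentiable_on UNIV"
    using d by (auto simp: differentiable_on_def differentiable_def)
  ultimately show ?thesis by simp
qed

lemma Ck_on_Suc_E:
  fixes f :: "real^'n \<Rightarrow> 'b::real_normed_vector"
  assumes "Ck_on (Suc m) UNIV f"
  obtains f' where "\<And>x. (f has_derivative (\<lambda>h. \<Sum>j\<in>UNIV. h$j *\<^sub>R f' j x)) (at x)"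
    "\<And>j. Ck_on m UNIV (f' j)"
  by (rule that[OF c1_derivative[OF Ck_on_Suc_c1(1)[OF assms open_UNIV] UNIV_I] Ck_on_Suc_c1(2)[OF assms open_UNIV]])

lemma Ck_on_Suc_imp:
  fixes f :: "real^'n \<Rightarrow> 'b::real_normed_vector"
  shows "Ck_on (Suc m) UNIV f \<Longrightarrow> Ck_on m UNIV f"
proof (induction m arbitrary: f)
  case 0
  then show ?case using Ck_on_imp_continuous by (metis Ck_on.simps(1))
next
  case (Suc m)
  obtain f' where "\<And>x. (f has_derivative (\<lambda>h. \<Sum>j\<in>UNIV. h$j *\<^sub>R f' j x)) (at x)"
    "\<And>j. Ck_on (Suc m) UNIV (f' j)" by (rule Ck_on_Suc_E[OF Suc.prems]) blast
  then show ?case using Suc.IH by (intro Ck_onI) (auto simp del: Ck_on.simps)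
qed

lemma Ck_on_const: "Ck_on m UNIV (\<lambda>x::real^'n. c :: 'b::real_normed_vector)"
  by (induction m arbitrary: c) (auto intro!: Ck_onI[where f'="\<lambda>j x. 0"])

lemma Ck_on_add:
  fixes f g :: "real^'n \<Rightarrow> 'b::real_normed_vector"
  shows "Ck_on m UNIV f \<Longrightarrow> Ck_on m UNIV g \<Longrightarrow> Ck_on m UNIV (\<lambda>x. f x + g x)"
proof (induction m arbitrary: f g)
  case 0
  then show ?case by (auto intro: continuous_intros)
next
  case (Suc m)
  obtain f' where f: "\<And>x. (f has_derivative (\<lambda>h. \<Sum>j\<in>UNIV. h$j *\<^sub>R f' j x)) (at x)"
    "\<And>j. Ck_on m UNIV (f' j)" by (rule Ck_on_Suc_E[OF Suc.prems(1)]) blast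
  obtain g' where g: "\<And>x. (g has_derivative (\<lambda>h. \<Sum>j\<in>UNIV. h$j *\<^sub>R g' j x)) (at x)"
    "\<And>j. Ck_on m UNIV (g' j)" by (rule Ck_on_Suc_E[OF Suc.prems(2)]) blast
  show ?case
  proof (rule Ck_onI)
    show "((\<lambda>x. f x + g x) has_derivative (\<lambda>h. \<Sum>j\<in>UNIV. h$j *\<^sub>R (f' j x + g' j x))) (at x)" for x
      using has_derivative_add[OF f(1) g(1)] by (simp add: sum.distrib scaleR_add_right)
  qed (use Suc.IH f g in blast)
qed

lemma Ck_on_sum:
  fixes f :: "'i \<Rightarrow> real^'n \<Rightarrow> 'b::real_normed_vector"
  assumes "\<And>i. i \<in> I \<Longrightarrow> Ck_on m UNIV (f i)"
  shows "Ck_on m UNIV (\<lambda>x. \<Sum>i\<in>I. f i x)"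
  using assms by (induction I rule: infinite_finite_induct) (auto intro: Ck_on_const Ck_on_add)

lemma Ck_on_scaleR:
  fixes f :: "real^'n \<Rightarrow> real" and g :: "real^'n \<Rightarrow> 'b::real_normed_vector"
  shows "Ck_on m UNIV f \<Longrightarrow> Ck_on m UNIV g \<Longrightarrow> Ck_on m UNIV (\<lambda>x. f x *\<^sub>R g x)"
proof (induction m arbitrary: f g)
  case 0
  then show ?case by (auto intro: continuous_intros)
next
  case (Suc m)
  obtain f' where f: "\<And>x. (f has_derivative (\<lambda>h. \<Sum>j\<in>UNIV. h$j *\<^sub>R f' j x)) (at x)"
    "\<And>j. Ck_on m UNIV (f' j)" by (rule Ck_on_Suc_E[OF Suc.prems(1)]) blast
  obtain g' where g: "\<And>x. (g has_derivative (\<lambda>h. \<Sum>j\<in>UNIV. h$j *\<^sub>R g' j x)) (at x)"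
    "\<And>j. Ck_on m UNIV (g' j)" by (rule Ck_on_Suc_E[OF Suc.prems(2)]) blast
  show ?case
  proof (rule Ck_onI)
    show "((\<lambda>x. f x *\<^sub>R g x) has_derivative (\<lambda>h. \<Sum>j\<in>UNIV. h$j *\<^sub>R (f x *\<^sub>R g' j x + f' j x *\<^sub>R g x))) (at x)" for x
      using has_derivative_scaleR[OF f(1) g(1)]
      by (simp add: sum.distrib scaleR_add_right scaleR_sum_right scaleR_sum_left mult.commute)
  next
    show "Ck_on m UNIV (\<lambda>x. f x *\<^sub>R g' j x + f' j x *\<^sub>R g x)" for j
      by (intro Ck_on_add Suc.IH f g Ck_on_Suc_imp[OF Suc.prems(1)] Ck_on_Suc_imp[OF Suc.prems(2)])
  qed
qed

lemma Ck_on_bounded_linear: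
  fixes f :: "real^'n \<Rightarrow> 'b::real_normed_vector"
  assumes "bounded_linear L"
  shows "Ck_on m UNIV f \<Longrightarrow> Ck_on m UNIV (\<lambda>x. L (f x))"
proof (induction m arbitrary: f)
  case 0
  then show ?case using assms by (auto intro: bounded_linear.continuous_on)
next
  case (Suc m)
  interpret bounded_linear L by fact
  obtain f' where f: "\<And>x. (f has_derivative (\<lambda>h. \<Sum>j\<in>UNIV. h$j *\<^sub>R f' j x)) (at x)"
    "\<And>j. Ck_on m UNIV (f' j)" by (rule Ck_on_Suc_E[OF Suc.prems(1)]) blast
  show ?case
  proof (rule Ck_onI)
    show "((\<lambda>x. L (f x)) has_derivative (\<lambda>h. \<Sum>j\<in>UNIV. h$j *\<^sub>R L (f' j x))) (at x)" for x
      using bounded_linear.has_derivative[OF assms f(1)] by (simp add: sum scaleR)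
  qed (use Suc.IH f in blast)
qed

section \<open>A smooth bump\<close>

text \<open>For varying polynomials \<open>p\<close> these functions form a class closed under
  differentiation: with y = 1/t, the polynomial \<open>p\<close> turns into y^2 (p - p'). Smoothness
  of the bump is then a single induction over all \<open>p\<close>.\<close>

definition expoly :: "real poly \<Rightarrow> real \<Rightarrow> real" where
  "expoly p t = (if t > 0 then poly p (1/t) * exp (-1/t) else 0)"

lemma poly_times_exp_tendsto_0: "((\<lambda>y. poly p y * exp (- y)) \<longlongrightarrow> (0::real)) at_top"
proof -
  have "((\<lambda>y. \<Sum>i\<le>degree p. coeff p i * (y ^ i / exp y)) \<longlongrightarrow> (\<Sum>i\<le>degree p. coeff p i * 0)) at_top"
    by (intro tendsto_intros tendsto_power_div_exp_0)
  then show ?thesis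
    by (simp add: poly_altdef sum_distrib_right exp_minus divide_inverse mult.assoc)
qed

lemma expoly_tendsto_0: "(expoly p \<longlongrightarrow> 0) (at_right 0)"
proof -
  have "((\<lambda>t. poly p (inverse t) * exp (- inverse t)) \<longlongrightarrow> (0::real)) (at_right 0)"
    using filterlim_compose[OF poly_times_exp_tendsto_0 filterlim_inverse_at_top_right] .
  moreover have "\<forall>\<^sub>F t in at_right 0. poly p (inverse t) * exp (- inverse t) = expoly p t"
    using eventually_at_right_less[of 0] by eventually_elim (simp add: expoly_def inverse_eq_divide)
  ultimately show ?thesis by (rule Lim_transform_eventually)
qed

lemma expoly_has_derivative:
  "(expoly p has_real_derivative expoly ([:0,0,1:] * (p - pderiv p)) t) (at t)"
proof -
  consider "t > 0" | "t < 0" | "t = 0" by linarith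
  then show ?thesis
  proof cases
    case 1
    have "((\<lambda>t. poly p (1/t) * exp (-1/t)) has_real_derivative expoly ([:0,0,1:] * (p - pderiv p)) t) (at t)"
      using 1 by (auto simp: expoly_def field_simps power2_eq_square intro!: derivative_eq_intros)
    moreover have "\<forall>\<^sub>F s in nhds t. expoly p s = poly p (1/s) * exp (-1/s)"
      using eventually_nhds_in_open[of "{0<..}" t] 1 by (auto elim!: eventually_mono simp: expoly_def)
    ultimately show ?thesis by (subst DERIV_cong_ev) auto
  next
    case 2
    have "\<forall>\<^sub>F s in nhds t. expoly p s = 0"
      using eventually_nhds_in_open[of "{..<0}" t] 2 by (auto elim!: eventually_mono simp: expoly_def)
    then show ?thesis by (subst DERIV_cong_ev[where g="\<lambda>_. 0"]) (use 2 in \<open>auto simp: expoly_def\<close>)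
  next
    case 3
    \<comment> \<open>Dividing by \<open>t\<close> multiplies the polynomial in 1/t by its variable,
      so the difference quotient at 0 is again of the form \<open>expoly\<close> and tends to
      0.\<close>
    have "((\<lambda>h. expoly p h / h) \<longlongrightarrow> 0) (at_right 0)"
    proof -
      have "\<forall>\<^sub>F t in at_right 0. expoly (pCons 0 p) t = expoly p t / t"
        using eventually_at_right_less[of 0] by eventually_elim (simp add: expoly_def)
      then show ?thesis by (rule Lim_transform_eventually[OF expoly_tendsto_0])
    qed
    moreover have "((\<lambda>h. expoly p h / h) \<longlongrightarrow> 0) (at_left 0)"
    proof -
      have "\<forall>\<^sub>F t in at_left 0. 0 = expoly p t / t"
        by (auto simp: eventually_at_filter expoly_def)
      then show ?thesis by (rule Lim_transform_eventually[OF tendsto_const])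
    qed
    ultimately have "((\<lambda>h. expoly p h / h) \<longlongrightarrow> 0) (at 0)" by (intro filterlim_split_at)
    then show ?thesis using 3 by (simp add: DERIV_def expoly_def)
  qed
qed

lemma Ck_on_expoly:
  fixes s :: "real^'n \<Rightarrow> real"
  assumes s: "\<And>m. Ck_on m UNIV s"
  shows "Ck_on m UNIV (\<lambda>x. expoly p (s x))"
proof (induction m arbitrary: p)
  case 0
  have "continuous_on UNIV (expoly p)"
    by (meson DERIV_isCont continuous_at_imp_continuous_on expoly_has_derivative)
  then show ?case using s[of 0] by (auto intro: continuous_on_compose2)
next
  case (Suc m)
  obtain s' where s': "\<And>x. (s has_derivative (\<lambda>h. \<Sum>j\<in>UNIV. h$j *\<^sub>R s' j x)) (at x)"
    "\<And>j. Ck_on m UNIV (s' j)" by (rule Ck_on_Suc_E[OF s[of "Suc m"]]) blast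
  show ?case
  proof (rule Ck_onI)
    show "((\<lambda>x. expoly p (s x)) has_derivative
      (\<lambda>h. \<Sum>j\<in>UNIV. h$j *\<^sub>R (expoly ([:0,0,1:] * (p - pderiv p)) (s x) *\<^sub>R s' j x))) (at x)" for x
      using has_derivative_compose[OF s'(1) expoly_has_derivative[unfolded has_field_derivative_def]]
      by (simp add: sum_distrib_left sum_distrib_right mult_ac)
  next
    show "Ck_on m UNIV (\<lambda>x. expoly ([:0,0,1:] * (p - pderiv p)) (s x) *\<^sub>R s' j x)" for j
      by (intro Ck_on_scaleR Suc.IH s')
  qed
qed

lemma Ck_on_coordinate: "Ck_on m UNIV (\<lambda>x::real^'n. x$i)"
proof (cases m)
  case (Suc k)
  have "((\<lambda>x::real^'n. x$i) has_derivative (\<lambda>h. \<Sum>j\<in>UNIV. h$j *\<^sub>R (if j = i then 1 else 0))) (at x)" for x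
    by (simp add: if_distrib cong: if_cong) (rule bounded_linear.has_derivative[OF bounded_linear_vec_nth has_derivative_ident])
  then show ?thesis unfolding Suc by (rule Ck_onI) (rule Ck_on_const)
qed (auto intro: continuous_intros)

lemma Ck_on_diff_norm2: "Ck_on m UNIV (\<lambda>x::real^'n. c - (norm x)\<^sup>2)"
proof -
  have "Ck_on m UNIV (\<lambda>x::real^'n. c + (\<Sum>i\<in>UNIV. (- (x$i)) *\<^sub>R (x$i)))"
    by (intro Ck_on_add Ck_on_sum Ck_on_const Ck_on_scaleR Ck_on_coordinate
        Ck_on_bounded_linear[OF bounded_linear_minus[OF bounded_linear_ident]])
  moreover have "(\<lambda>x::real^'n. c + (\<Sum>i\<in>UNIV. (- (x$i)) *\<^sub>R (x$i))) = (\<lambda>x. c - (norm x)\<^sup>2)"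
    by (auto simp: power2_norm_eq_inner inner_vec_def sum_negf)
  ultimately show ?thesis by simp
qed

lemma smooth_bump_exists:
  assumes "e > 0"
  shows "\<exists>\<eta>::real^'n \<Rightarrow> real. (\<forall>m. Ck_on m UNIV \<eta>) \<and> (\<forall>x. \<eta> x \<ge> 0) \<and> (\<forall>x. norm x \<ge> e \<longrightarrow> \<eta> x = 0) \<and> \<eta> 0 > 0"
proof (intro exI conjI allI)
  let ?\<eta> = "\<lambda>x::real^'n. expoly 1 (e\<^sup>2 - (norm x)\<^sup>2)"
  show "Ck_on m UNIV ?\<eta>" for m by (intro Ck_on_expoly Ck_on_diff_norm2)
  show "?\<eta> x \<ge> 0" for x by (simp add: expoly_def)
  show "norm x \<ge> e \<longrightarrow> ?\<eta> x = 0" for x :: "real^'n"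
  proof
    assume "norm x \<ge> e"
    then have "(norm x)\<^sup>2 \<ge> e\<^sup>2" using assms by (simp add: power_mono)
    then show "?\<eta> x = 0" by (simp add: expoly_def)
  qed
  show "?\<eta> 0 > 0" using assms by (simp add: expoly_def)
qed

section \<open>Calculus of maps with explicit partial derivatives\<close>

lemma c1I:
  assumes "\<And>x. x \<in> S \<Longrightarrow> (f has_derivative (\<lambda>h. \<Sum>j\<in>UNIV. h$j *\<^sub>R f' j x)) (at x)"
    "\<And>j. continuous_on S (f' j)"
  shows "c1 S f f'"
  using assms by (simp add: c1_def)

lemma c1_eqI:
  assumes "c1 S f f'" "open S" "\<And>x. x \<in> S \<Longrightarrow> f x = g x" "\<And>j x. x \<in> S \<Longrightarrow> f' j x = g' j x"
  shows "c1 S g g'"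
proof (rule c1I)
  fix x assume x: "x \<in> S"
  have "(g has_derivative (\<lambda>h. \<Sum>j\<in>UNIV. h$j *\<^sub>R f' j x)) (at x)"
    by (rule has_derivative_transform_within_open[OF c1_derivative[OF assms(1) x] assms(2) x assms(3)])
  then show "(g has_derivative (\<lambda>h. \<Sum>j\<in>UNIV. h$j *\<^sub>R g' j x)) (at x)"
    using assms(4)[OF x] by simp
next
  show "continuous_on S (g' j)" for j
    by (rule continuous_on_eq[OF c1_continuous_partial[OF assms(1)] assms(4)])
qed

lemma c1_unique:
  assumes "c1 S f f'" "c1 S f g'" "x \<in> S"
  shows "f' j x = g' j x"
  using c1_frechet[OF assms(1,3)] c1_frechet[OF assms(2,3)] by metis

lemma c1_zero_partial:
  assumes "c1 S f f'" "open T" "T \<subseteq> S" "\<And>x. x \<in> T \<Longrightarrow> f x = 0" "x \<in> T"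
  shows "f' j x = 0"
proof -
  have "c1 T (\<lambda>x. 0) (\<lambda>j x. 0 :: 'b)" by (intro c1I) auto
  then have "c1 T f (\<lambda>j x. 0)" by (rule c1_eqI) (use assms in auto)
  then show ?thesis using c1_unique[OF c1_subset[OF assms(1,3)]] assms(5) by metis
qed

lemma c1_Un:
  assumes "c1 S f f'" "c1 T f f'" "open S" "open T"
  shows "c1 (S \<union> T) f f'"
  using assms by (auto simp: c1_def intro: continuous_on_open_Un)

lemma c1_const: "c1 S (\<lambda>x. c) (\<lambda>j x. 0)"
  by (intro c1I) auto

lemma c1_add: "c1 S f f' \<Longrightarrow> c1 S g g' \<Longrightarrow> c1 S (\<lambda>x. f x + g x) (\<lambda>j x. f' j x + g' j x)"
  unfolding c1_def
  by (auto intro!: continuous_intros) (drule (1) bspec, drule (1) bspec, drule (1) has_derivative_add, simp add: scaleR_add_right sum.distrib)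

lemma c1_sum:
  assumes "\<And>i. i \<in> I \<Longrightarrow> c1 S (f i) (f' i)"
  shows "c1 S (\<lambda>x. \<Sum>i\<in>I. f i x) (\<lambda>j x. \<Sum>i\<in>I. f' i j x)"
  using assms by (induction I rule: infinite_finite_induct) (auto intro: c1_const c1_add)

lemma c1_bounded_linear:
  assumes "bounded_linear L" "c1 S f f'"
  shows "c1 S (\<lambda>x. L (f x)) (\<lambda>j x. L (f' j x))"
proof (rule c1I)
  interpret bounded_linear L by fact
  show "((\<lambda>x. L (f x)) has_derivative (\<lambda>h. \<Sum>j\<in>UNIV. h$j *\<^sub>R L (f' j x))) (at x)" if "x \<in> S" for x
    using bounded_linear.has_derivative[OF assms(1) c1_derivative[OF assms(2) that]] by (simp add: sum scaleR)
  show "continuous_on S (\<lambda>x. L (f' j x))" for j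
    by (rule bounded_linear.continuous_on[OF assms(1) c1_continuous_partial[OF assms(2)]])
qed

lemma c1_bounded_bilinear:
  assumes "bounded_bilinear pr" "c1 S f f'" "c1 S g g'"
  shows "c1 S (\<lambda>x. pr (f x) (g x)) (\<lambda>j x. pr (f x) (g' j x) + pr (f' j x) (g x))"
proof (rule c1I)
  interpret bounded_bilinear pr by fact
  show "((\<lambda>x. pr (f x) (g x)) has_derivative (\<lambda>h. \<Sum>j\<in>UNIV. h$j *\<^sub>R (pr (f x) (g' j x) + pr (f' j x) (g x)))) (at x)"
    if "x \<in> S" for x
    using FDERIV[OF c1_derivative[OF assms(2) that] c1_derivative[OF assms(3) that]]
    by (simp add: sum_left sum_right scaleR_left scaleR_right scaleR_add_right sum.distrib)
  show "continuous_on S (\<lambda>x. pr (f x) (g' j x) + pr (f' j x) (g x))" for j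
    by (intro continuous_on_add continuous_on c1_continuous_partial[OF assms(2)] c1_continuous_partial[OF assms(3)]
        c1_continuous[OF assms(2)] c1_continuous[OF assms(3)])
qed

lemmas c1_mult = c1_bounded_bilinear[OF bounded_bilinear_mult]
lemmas c1_scaleR = c1_bounded_bilinear[OF bounded_bilinear_scaleR]
lemmas c1_of_real = c1_bounded_linear[OF bounded_linear_of_real]

lemma c1_cmult: "c1 S f f' \<Longrightarrow> c1 S (\<lambda>x. c * f x) (\<lambda>j x. c * f' j x)"
  for c :: "'b::real_normed_algebra"
  by (rule c1_bounded_linear[OF bounded_linear_mult_right])

lemma c1_diff: "c1 S f f' \<Longrightarrow> c1 S g g' \<Longrightarrow> c1 S (\<lambda>x. f x - g x) (\<lambda>j x. f' j x - g' j x)"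
  using c1_add[OF _ c1_bounded_linear[OF bounded_linear_minus[OF bounded_linear_ident]]] by fastforce

lemma c1_coordinate: "c1 S (\<lambda>x. x$i) (\<lambda>j x. if j = i then 1 else 0 :: real)"
  by (rule c1I) (auto simp: if_distrib cong: if_cong
      intro!: bounded_linear.has_derivative[OF bounded_linear_vec_nth has_derivative_ident])

lemma c1_compose_real:
  assumes f: "c1 S f f'" and \<phi>: "\<And>x. x \<in> S \<Longrightarrow> (\<phi> has_real_derivative \<phi>' (f x)) (at (f x))"
    and cont: "continuous_on S (\<lambda>x. \<phi>' (f x))"
  shows "c1 S (\<lambda>x. \<phi> (f x)) (\<lambda>j x. \<phi>' (f x) * f' j x)"
proof (rule c1I)
  fix x assume x: "x \<in> S"
  show "((\<lambda>x. \<phi> (f x)) has_derivative (\<lambda>h. \<Sum>j\<in>UNIV. h$j *\<^sub>R (\<phi>' (f x) * f' j x))) (at x)"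
    using has_derivative_compose[OF c1_derivative[OF f x] \<phi>[OF x, unfolded has_field_derivative_def]]
    by (simp add: sum_distrib_left mult_ac)
next
  show "continuous_on S (\<lambda>x. \<phi>' (f x) * f' j x)" for j
    by (intro continuous_intros cont c1_continuous_partial[OF f])
qed

lemma c1_chain:
  fixes F :: "real^'n \<Rightarrow> real^'m"
  assumes F: "\<And>i. c1 S (\<lambda>x. F x $ i) (F' i)" and g: "c1 T g g'" and sub: "\<And>x. x \<in> S \<Longrightarrow> F x \<in> T"
  shows "c1 S (\<lambda>x. g (F x)) (\<lambda>j x. \<Sum>i\<in>UNIV. F' i j x *\<^sub>R g' i (F x))"
proof (rule c1I)
  fix x assume x: "x \<in> S"
  have "(F has_derivative (\<lambda>h. \<chi> i. \<Sum>j\<in>UNIV. h$j *\<^sub>R F' i j x)) (at x)"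
    unfolding has_derivative_componentwise_within[of F]
    using c1_derivative[OF F x] by (auto simp: Basis_axis inner_axis)
  from has_derivative_compose[OF this c1_derivative[OF g sub[OF x]]]
  show "((\<lambda>x. g (F x)) has_derivative (\<lambda>h. \<Sum>j\<in>UNIV. h$j *\<^sub>R (\<Sum>i\<in>UNIV. F' i j x *\<^sub>R g' i (F x)))) (at x)"
  proof (rule has_derivative_eq_rhs)
    have "(\<Sum>i\<in>UNIV. (\<Sum>j\<in>UNIV. h$j *\<^sub>R F' i j x) *\<^sub>R g' i (F x)) = (\<Sum>j\<in>UNIV. h$j *\<^sub>R (\<Sum>i\<in>UNIV. F' i j x *\<^sub>R g' i (F x)))" for h :: "real^'n"
      by (simp only: scaleR_sum_left scaleR_sum_right scaleR_scaleR real_scaleR_def) (rule sum.swap)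
    then show "(\<lambda>h. \<Sum>i\<in>UNIV. (\<chi> i. \<Sum>j\<in>UNIV. h$j *\<^sub>R F' i j x) $ i *\<^sub>R g' i (F x)) = (\<lambda>h. \<Sum>j\<in>UNIV. h$j *\<^sub>R (\<Sum>i\<in>UNIV. F' i j x *\<^sub>R g' i (F x)))"
      by simp
  qed
next
  have "continuous_on S (\<lambda>x. \<chi> i. F x $ i)"
    by (intro continuous_on_vec_lambda c1_continuous[OF F])
  then have "continuous_on S F" by simp
  then show "continuous_on S (\<lambda>x. \<Sum>i\<in>UNIV. F' i j x *\<^sub>R g' i (F x))" for j
    by (intro continuous_intros c1_continuous_partial[OF F] continuous_on_compose2[OF c1_continuous_partial[OF g]])
      (auto simp: sub)
qed

text \<open>The open sets \<open>S\<close> and \<open>- K\<close> cover the space. On the first the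
  extension is \<open>f\<close>, on the second it is identically 0, and on the overlap the partial
  derivatives of \<open>f\<close> vanish as well.\<close>

lemma c1_extend_zero:
  assumes f: "c1 S f f'" and "open S" "closed K" "K \<subseteq> S" and zero: "\<And>x. x \<in> S - K \<Longrightarrow> f x = 0"
  shows "c1 UNIV (\<lambda>x. if x \<in> S then f x else 0) (\<lambda>j x. if x \<in> S then f' j x else 0)"
proof -
  have "f' j x = 0" if "x \<in> S - K" for j x
    by (rule c1_zero_partial[OF f _ _ zero that]) (use assms in auto)
  then have "c1 (-K) (\<lambda>x. if x \<in> S then f x else 0) (\<lambda>j x. if x \<in> S then f' j x else 0)"
    using assms by (intro c1_eqI[OF c1_const[of _ 0]]) auto
  moreover have "c1 S (\<lambda>x. if x \<in> S then f x else 0) (\<lambda>j x. if x \<in> S then f' j x else 0)"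
    by (rule c1_eqI[OF f]) (use assms in auto)
  ultimately have "c1 (S \<union> -K) (\<lambda>x. if x \<in> S then f x else 0) (\<lambda>j x. if x \<in> S then f' j x else 0)"
    using assms by (intro c1_Un) auto
  moreover have "S \<union> -K = UNIV" using assms by auto
  ultimately show ?thesis by simp
qed

lemma norm_sum_coordinates_le:
  "norm (\<Sum>j\<in>UNIV. h$j *\<^sub>R a j) \<le> norm h * (\<Sum>j\<in>UNIV. norm (a j))"
  for h :: "real^'n" and a :: "'n \<Rightarrow> 'b::real_normed_vector"
proof -
  have "norm (\<Sum>j\<in>UNIV. h$j *\<^sub>R a j) \<le> (\<Sum>j\<in>UNIV. norm h * norm (a j))"
    by (intro sum_norm_le) (simp add: component_le_norm_cart mult_right_mono)
  then show ?thesis by (simp add: sum_distrib_left)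
qed

lemma onorm_coordinates_le:
  "onorm (\<lambda>h::real^'n. \<Sum>j\<in>UNIV. h$j *\<^sub>R a j) \<le> (\<Sum>j\<in>UNIV. norm (a j))"
  by (rule onorm_le) (metis norm_sum_coordinates_le mult.commute)

lemma c1_lipschitz:
  assumes f: "c1 S f f'" and "convex S" "x \<in> S" "y \<in> S" and B: "\<And>j z. z \<in> S \<Longrightarrow> norm (f' j z) \<le> B j"
  shows "norm (f x - f y) \<le> (\<Sum>j\<in>UNIV. B j) * norm (x - y)"
proof (rule differentiable_bound[OF \<open>convex S\<close> _ _ \<open>x \<in> S\<close> \<open>y \<in> S\<close>])
  show "(f has_derivative (\<lambda>h. \<Sum>j\<in>UNIV. h$j *\<^sub>R f' j z)) (at z within S)" if "z \<in> S" for z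
    by (rule has_derivative_at_withinI[OF c1_derivative[OF f that]])
  show "onorm (\<lambda>h. \<Sum>j\<in>UNIV. h$j *\<^sub>R f' j z) \<le> sum B UNIV" if "z \<in> S" for z
    by (rule order_trans[OF onorm_coordinates_le sum_mono]) (rule B[OF that])
qed

section \<open>Continuous functions of compact support\<close>

lemma cc_continuous: "cc R f \<Longrightarrow> continuous_on S f"
  unfolding cc_def using continuous_on_subset by blast

lemma cc_zero: "cc R f \<Longrightarrow> norm x > R \<Longrightarrow> f x = 0"
  by (simp add: cc_def)

lemma cc_mono: "cc R f \<Longrightarrow> R \<le> R' \<Longrightarrow> cc R' f"
  by (auto simp: cc_def)

lemma cc_integrable:
  fixes f :: "real^'n \<Rightarrow> 'b::{banach, second_countable_topology}"
  assumes "cc R f" shows "integrable lborel f"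
proof -
  have "integrable lborel (\<lambda>x. indicat_real (cball 0 R) x *\<^sub>R f x)"
    by (intro borel_integrable_compact cc_continuous[OF assms]) auto
  also have "(\<lambda>x. indicat_real (cball 0 R) x *\<^sub>R f x) = f"
    using cc_zero[OF assms] by (auto simp: indicator_def)
  finally show ?thesis .
qed

lemma cc_bounded:
  assumes "cc R f" obtains B where "B > 0" "\<And>x. norm (f x) \<le> B"
proof -
  have "compact (f ` cball 0 R)"
    by (intro compact_continuous_image cc_continuous[OF assms]) auto
  then obtain B where B: "\<And>x. x \<in> cball 0 R \<Longrightarrow> norm (f x) \<le> B"
    by (meson bounded_iff compact_imp_bounded imageI)
  show ?thesis
  proof (rule that[of "max B 1"])
    show "norm (f x) \<le> max B 1" for x
      by (cases "norm x \<le> R") (use B cc_zero[OF assms] in \<open>auto simp: le_max_iff_disj\<close>)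
  qed simp
qed

lemma cc_uniformly_continuous:
  assumes "cc R f" "e > 0"
  obtains d where "d > 0" "\<And>x y. norm (x - y) < d \<Longrightarrow> norm (f x - f y) < e"
proof -
  \<comment> \<open>The extra 1, matched by \<open>min d 1\<close> below, keeps both points in this
    ball unless both lie outside the support, where the difference is 0.\<close>
  have "uniformly_continuous_on (cball 0 (R+1)) f"
    by (intro compact_uniformly_continuous cc_continuous[OF assms(1)]) auto
  from this[unfolded uniformly_continuous_on_def, rule_format, OF assms(2)]
  obtain d where d0: "0 < d \<and>
    (\<forall>x\<in>cball 0 (R+1). \<forall>y\<in>cball 0 (R+1). dist y x < d \<longrightarrow> dist (f y) (f x) < e)"
    by (rule exE)
  note d = conjunct1[OF d0] conjunct2[OF d0]
  show ?thesis
  proof (rule that[of "min d 1"])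
    fix x y :: "real^'a" assume xy: "norm (x - y) < min d 1"
    show "norm (f x - f y) < e"
    proof (cases "norm x > R \<and> norm y > R")
      case True
      then show ?thesis using cc_zero[OF assms(1)] assms(2) by simp
    next
      case False
      have "norm x \<le> norm y + norm (x - y)" by (metis norm_triangle_sub)
      moreover have "norm y \<le> norm x + norm (x - y)" by (metis norm_triangle_sub norm_minus_commute)
      ultimately have "norm x \<le> R + 1" "norm y \<le> R + 1" using False xy by auto
      then show ?thesis using d(2)[rule_format, of y x] xy by (simp add: dist_norm)
    qed
  qed (use d in simp)
qed

lemma cc_add: "cc R f \<Longrightarrow> cc R g \<Longrightarrow> cc R (\<lambda>x. f x + g x)"
  by (auto simp: cc_def intro: continuous_intros)

lemma cc_diff: "cc R f \<Longrightarrow> cc R g \<Longrightarrow> cc R (\<lambda>x. f x - g x)"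
  by (auto simp: cc_def intro: continuous_intros)

lemma cc_cmult: "cc R f \<Longrightarrow> cc R (\<lambda>x. c * f x)" for c :: "'b::real_normed_algebra"
  by (auto simp: cc_def intro: continuous_intros)

lemma cc_sum: "(\<And>i. i \<in> I \<Longrightarrow> cc R (f i)) \<Longrightarrow> cc R (\<lambda>x. \<Sum>i\<in>I. f i x)"
  by (auto simp: cc_def intro: continuous_intros)

lemma c1_cc: "c1 UNIV f f' \<Longrightarrow> (\<And>x. norm x > R \<Longrightarrow> f x = 0) \<Longrightarrow> cc R f"
  by (auto simp: cc_def c1_continuous)

lemma c1_cc_partial:
  assumes f: "c1 UNIV f f'" and zero: "\<And>x. norm x > R \<Longrightarrow> f x = 0"
  shows "cc R (f' j)"
proof -
  have o: "open {x::real^'a. norm x > R}" by (intro open_Collect_less continuous_intros)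
  have "f' j x = 0" if "norm x > R" for x
    using c1_zero_partial[OF f o, of x j] zero that by auto
  then show ?thesis using c1_continuous_partial[OF f] by (auto simp: cc_def)
qed

section \<open>Translation of integrals and the vanishing integral of a partial derivative\<close>

lemma lborel_integral_translate:
  fixes f :: "'a::euclidean_space \<Rightarrow> 'b::{banach, second_countable_topology}"
  shows "integral\<^sup>L lborel (\<lambda>x. f (c + x)) = integral\<^sup>L lborel f"
proof (cases "f \<in> borel_measurable borel")
  case True
  then have "integral\<^sup>L (distr lborel borel ((+) c)) f = integral\<^sup>L lborel (\<lambda>x. f (c + x))"
    by (intro integral_distr) auto
  then show ?thesis by (simp add: lborel_distr_plus)
next
  case False
  have "(\<lambda>x. f (c + x)) \<notin> borel_measurable borel"
  proof
    assume "(\<lambda>x. f (c + x)) \<in> borel_measurable borel"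
    then have "(\<lambda>x. f (c + x)) \<circ> (\<lambda>x. x - c) \<in> borel_measurable borel"
      by (intro measurable_comp) auto
    with False show False by (simp add: comp_def)
  qed
  \<comment> \<open>For a non-measurable \<open>f\<close> both integrals take the default value
    0.\<close>
  then have "\<not> integrable lborel (\<lambda>x. f (c + x))" "\<not> integrable lborel f"
    using False by (auto dest!: borel_measurable_integrable)
  then show ?thesis by (simp add: not_integrable_integral_eq)
qed

lemma lborel_integral_reflect:
  fixes f :: "'a::euclidean_space \<Rightarrow> 'b::{banach, second_countable_topology}"
  assumes "f \<in> borel_measurable borel"
  shows "integral\<^sup>L lborel (\<lambda>y. f (x - y)) = integral\<^sup>L lborel f"
proof -
  have "lborel = distr lborel borel (\<lambda>y. x - y)"
    using lborel_affine[of "-1" x] by (simp add: density_1)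
  then have "integral\<^sup>L lborel f = integral\<^sup>L (distr lborel borel (\<lambda>y. x - y)) f"
    by simp
  also have "\<dots> = integral\<^sup>L lborel (\<lambda>y. f (x - y))"
    using assms by (intro integral_distr) auto
  finally show ?thesis by simp
qed

theorem integral_partial_eq_0:
  fixes F :: "real^'n \<Rightarrow> 'b::{banach, second_countable_topology}"
  assumes F: "c1 UNIV F F'" and zero: "\<And>x. norm x > R \<Longrightarrow> F x = 0"
  shows "integral\<^sup>L lborel (F' j) = 0"
proof -
  have ccF: "cc R F" by (rule c1_cc[OF F zero])
  have ccF': "cc R (F' i)" for i by (rule c1_cc_partial[OF F zero])
  have "\<exists>B. \<forall>x. norm (F' i x) \<le> B" for i
    using cc_bounded[OF ccF'[of i]] by blast
  then have "\<exists>B. \<forall>i x. norm (F' i x) \<le> B i" by metis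
  then obtain B where B: "\<And>i x. norm (F' i x) \<le> B i" by blast
  define C where "C = (\<Sum>i\<in>UNIV. B i)"
  \<comment> \<open>The increments are at most 1, so all translates are supported in the ball of
    radius \<open>R + 1\<close> and one function dominates every difference quotient.\<close>
  define s where "s n = 1 / real (Suc n)" for n
  have s: "s n > 0" "s n \<le> 1" for n by (auto simp: s_def)
  define D where "D n x = (1 / s n) *\<^sub>R (F (s n *\<^sub>R axis j 1 + x) - F x)" for n x
  have intF: "integrable lborel F" by (rule cc_integrable[OF ccF])
  have measF: "F \<in> borel_measurable borel" using intF by auto
  have ccT: "cc (R+1) (\<lambda>x. F (s n *\<^sub>R axis j 1 + x))" for n
  proof -
    have "F (s n *\<^sub>R axis j 1 + x) = 0" if "norm x > R + 1" for x
    proof -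
      have "norm x \<le> norm (s n *\<^sub>R axis j 1 + x) + norm (s n *\<^sub>R axis j (1::real))"
        by (metis add.commute norm_add_leD norm_triangle_ineq4 add_diff_cancel_left')
      then have "norm (s n *\<^sub>R axis j 1 + x) > R" using that s[of n] by simp
      then show ?thesis by (rule zero)
    qed
    then show ?thesis unfolding cc_def
      by (auto intro!: continuous_on_compose2[OF cc_continuous[OF ccF]] continuous_intros)
  qed
  have intD: "integral\<^sup>L lborel (D n) = 0" for n
    using cc_integrable[OF ccT] intF unfolding D_def
    by (simp add: lborel_integral_translate)
  have "(\<lambda>n. integral\<^sup>L lborel (D n)) \<longlonglongrightarrow> integral\<^sup>L lborel (F' j)"
  proof (rule integral_dominated_convergence[where w="\<lambda>x. C * indicator (cball 0 (R+1)) x"])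
    show "F' j \<in> borel_measurable lborel" using cc_integrable[OF ccF'] by auto
    show "D n \<in> borel_measurable lborel" for n
      unfolding D_def using measF by measurable
    show "integrable lborel (\<lambda>x. C * indicat_real (cball (0::real^'n) (R+1)) x)"
      using emeasure_bounded_finite[of "cball (0::real^'n) (R+1)"]
      by (intro integrable_mult_right integrable_real_indicator) auto
    show "AE x in lborel. (\<lambda>n. D n x) \<longlonglongrightarrow> F' j x"
    proof (intro AE_I2)
      fix x :: "real^'n"
      have "((\<lambda>t::real. F (x + t *\<^sub>R axis j 1)) has_vector_derivative F' j x) (at 0)"
      proof -
        have "((\<lambda>t::real. x + t *\<^sub>R axis j 1) has_derivative (\<lambda>t. t *\<^sub>R axis j 1)) (at 0)"
          by (auto intro!: derivative_eq_intros)
        from has_derivative_compose[OF this, of F "\<lambda>h. \<Sum>j\<in>UNIV. h$j *\<^sub>R F' j x"]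
        have "((\<lambda>t::real. F (x + t *\<^sub>R axis j 1)) has_derivative
            (\<lambda>t. \<Sum>i\<in>UNIV. (t *\<^sub>R axis j 1)$i *\<^sub>R F' i x)) (at 0)"
          using c1_derivative[OF F, of x] by simp
        moreover have "(\<Sum>i\<in>UNIV. (t *\<^sub>R axis j 1)$i *\<^sub>R F' i x) = t *\<^sub>R F' j x" for t :: real
          using sum_axis_nth[of j "\<lambda>i. F' i x"] by (simp add: scaleR_sum_right[symmetric] flip: scaleR_scaleR)
        ultimately show ?thesis by (simp add: has_vector_derivative_def)
      qed
      then have "((\<lambda>t::real. norm (F (x + t *\<^sub>R axis j 1) - F x - t *\<^sub>R F' j x) / norm t) \<longlongrightarrow> 0) (at 0)"
        by (simp add: has_vector_derivative_def has_derivative_at)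
      moreover have "\<forall>\<^sub>F t::real in at 0. norm (F (x + t *\<^sub>R axis j 1) - F x - t *\<^sub>R F' j x) / norm t =
          norm ((F (x + t *\<^sub>R axis j 1) - F x) /\<^sub>R t - F' j x)"
      proof (unfold eventually_at_filter, intro always_eventually allI impI)
        fix t :: real assume t: "t \<noteq> 0"
        have "(F (x + t *\<^sub>R axis j 1) - F x) /\<^sub>R t - F' j x = (F (x + t *\<^sub>R axis j 1) - F x - t *\<^sub>R F' j x) /\<^sub>R t"
          using t by (simp add: algebra_simps)
        then show "norm (F (x + t *\<^sub>R axis j 1) - F x - t *\<^sub>R F' j x) / norm t =
          norm ((F (x + t *\<^sub>R axis j 1) - F x) /\<^sub>R t - F' j x)"
          by (simp add: divide_inverse mult.commute)
      qed
      ultimately have "((\<lambda>t::real. norm ((F (x + t *\<^sub>R axis j 1) - F x) /\<^sub>R t - F' j x)) \<longlongrightarrow> 0) (at 0)"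
        by (rule Lim_transform_eventually)
      then have "((\<lambda>t::real. (F (x + t *\<^sub>R axis j 1) - F x) /\<^sub>R t) \<longlongrightarrow> F' j x) (at 0)"
        by (rule LIM_zero_cancel[OF tendsto_norm_zero_cancel])
      moreover have "filterlim s (at 0) sequentially"
        unfolding filterlim_at s_def using LIMSEQ_Suc[OF lim_1_over_n] by auto
      ultimately have "((\<lambda>n. (F (x + s n *\<^sub>R axis j 1) - F x) /\<^sub>R s n) \<longlonglongrightarrow> F' j x)"
        by (rule filterlim_compose)
      then show "(\<lambda>n. D n x) \<longlonglongrightarrow> F' j x"
        by (simp add: D_def inverse_eq_divide add.commute)
    qed
    show "AE x in lborel. norm (D n x) \<le> C * indicat_real (cball 0 (R+1)) x" for n
    proof (intro AE_I2)
      fix x :: "real^'n"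
      show "norm (D n x) \<le> C * indicat_real (cball 0 (R+1)) x"
      proof (cases "norm x \<le> R + 1")
        case True
        have "norm (F (s n *\<^sub>R axis j 1 + x) - F x) \<le> C * norm (s n *\<^sub>R axis j 1 + x - x)"
          unfolding C_def by (rule c1_lipschitz[OF F]) (use B in auto)
        then have "norm (F (s n *\<^sub>R axis j 1 + x) - F x) \<le> C * s n"
          using s[of n] by simp
        then have "norm (D n x) \<le> C"
          using s[of n] unfolding D_def norm_scaleR by (simp add: field_simps)
        then show ?thesis using True by simp
      next
        case False
        then show ?thesis using cc_zero[OF ccT[of n]] zero[of x] by (simp add: D_def)
      qed
    qed
  qed
  then show ?thesis using intD by (simp add: LIMSEQ_const_iff)
qed

section \<open>Radon functionals and mollification\<close>

text \<open>Linear functionals on continuous functions of compact support that are bounded in the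
  sup norm on each ball, that is, vector-valued Radon measures. The functional built from the
  scattered field can be mollified in this form without first producing a density for it.\<close>

definition radon :: "((real^'n \<Rightarrow> real) \<Rightarrow> 'b::real_normed_vector) \<Rightarrow> bool" where
  "radon l \<longleftrightarrow>
     (\<forall>R f g. cc R f \<longrightarrow> cc R g \<longrightarrow> l (\<lambda>x. f x + g x) = l f + l g) \<and>
     (\<forall>R c f. cc R f \<longrightarrow> l (\<lambda>x. c * f x) = c *\<^sub>R l f) \<and>
     (\<forall>R. \<exists>C. \<forall>f B. cc R f \<longrightarrow> (\<forall>x. \<bar>f x\<bar> \<le> B) \<longrightarrow> norm (l f) \<le> C * B)"

lemma radon_add: "radon l \<Longrightarrow> cc R f \<Longrightarrow> cc R g \<Longrightarrow> l (\<lambda>x. f x + g x) = l f + l g"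
  unfolding radon_def by blast

lemma radon_cmult: "radon l \<Longrightarrow> cc R f \<Longrightarrow> l (\<lambda>x. c * f x) = c *\<^sub>R l f"
  unfolding radon_def by blast

lemma radon_bound:
  fixes l :: "(real^'n \<Rightarrow> real) \<Rightarrow> 'b::real_normed_vector"
  assumes "radon l"
  obtains C where "C > 0" "\<And>f B. cc R f \<Longrightarrow> (\<And>x. \<bar>f x\<bar> \<le> B) \<Longrightarrow> norm (l f) \<le> C * B"
proof -
  obtain C where C: "\<forall>f B. cc R f \<longrightarrow> (\<forall>x. \<bar>f x\<bar> \<le> B) \<longrightarrow> norm (l f) \<le> C * B"
    using assms unfolding radon_def by blast
  show ?thesis
  proof (rule that[of "max C 1"])
    fix f :: "real^'n \<Rightarrow> real" and B assume f: "cc R f" "\<And>x. \<bar>f x\<bar> \<le> B"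
    have "B \<ge> 0" using f(2)[of 0] by linarith
    then have "C * B \<le> max C 1 * B" by (intro mult_right_mono) auto
    moreover have "norm (l f) \<le> C * B" using C f by blast
    ultimately show "norm (l f) \<le> max C 1 * B" by linarith
  qed simp
qed

lemma radon_diff:
  assumes "radon l" "cc R f" "cc R g"
  shows "l (\<lambda>x. f x - g x) = l f - l g"
  using radon_add[OF assms(1,2) cc_cmult[OF assms(3)], of "-1"] radon_cmult[OF assms(1,3), of "-1"]
  by simp

lemma radon_zero: "radon l \<Longrightarrow> l (\<lambda>x. 0) = 0"
  using radon_cmult[of l 0 "\<lambda>x. 0" 0] by (simp add: cc_def)

lemma radon_sum:
  assumes "radon l" "\<And>i. i \<in> I \<Longrightarrow> cc R (f i)"
  shows "l (\<lambda>x. \<Sum>i\<in>I. f i x) = (\<Sum>i\<in>I. l (f i))"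
  using assms(2)
proof (induction I rule: infinite_finite_induct)
  case (insert i I)
  then show ?case
    using radon_add[OF assms(1), of R "f i" "\<lambda>x. \<Sum>i\<in>I. f i x"] by (simp add: cc_sum)
qed (auto simp: radon_zero[OF assms(1)])

lemma cc_reflect:
  fixes f :: "real^'n \<Rightarrow> real"
  assumes "cc r f" "norm x \<le> R"
  shows "cc (R + r) (\<lambda>y. f (x - y))"
proof -
  have "f (x - y) = 0" if "norm y > R + r" for y
  proof -
    have "norm y \<le> norm x + norm (x - y)" by (metis norm_triangle_sub norm_minus_commute)
    then show ?thesis using that assms(2) by (intro cc_zero[OF assms(1)]) simp
  qed
  then show ?thesis unfolding cc_def
    by (auto intro!: continuous_on_compose2[OF cc_continuous[OF assms(1)]] continuous_intros)
qed

lemma radon_convolution_continuous: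
  fixes f :: "real^'n \<Rightarrow> real"
  assumes l: "radon l" and f: "cc r f"
  shows "continuous_on UNIV (\<lambda>x. l (\<lambda>y. f (x - y)))"
  unfolding continuous_on_iff
proof (intro ballI allI impI)
  fix x :: "real^'n" and e :: real assume "e > 0"
  define R where "R = norm x + 1"
  obtain C where C: "C > 0" "\<And>f B. cc (R + r) f \<Longrightarrow> (\<And>x. \<bar>f x\<bar> \<le> B) \<Longrightarrow> norm (l f) \<le> C * B"
    using radon_bound[OF l] by blast
  have e': "e / (2 * C) > 0" using \<open>e > 0\<close> C(1) by simp
  obtain d where d: "d > 0" "\<And>x y. norm (x - y) < d \<Longrightarrow> norm (f x - f y) < e / (2 * C)"
    using cc_uniformly_continuous[OF f e'] by blast
  show "\<exists>d>0. \<forall>x'\<in>UNIV. dist x' x < d \<longrightarrow> dist (l (\<lambda>y. f (x' - y))) (l (\<lambda>y. f (x - y))) < e"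
  proof (intro exI[of _ "min d 1"] conjI ballI impI)
    fix x' assume x': "dist x' x < min d 1"
    have R: "norm x \<le> R" "norm x' \<le> R"
      using x' norm_triangle_sub[of x' x] by (auto simp: R_def dist_norm)
    have "norm (l (\<lambda>y. f (x' - y) - f (x - y))) \<le> C * (e / (2 * C))"
    proof (rule C(2))
      show "cc (R + r) (\<lambda>y. f (x' - y) - f (x - y))" by (intro cc_diff cc_reflect f R)
      show "\<bar>f (x' - y) - f (x - y)\<bar> \<le> e / (2 * C)" for y
        using d(2)[of "x' - y" "x - y"] x' by (simp add: dist_norm)
    qed
    also have "\<dots> < e" using \<open>e > 0\<close> C(1) by simp
    finally show "dist (l (\<lambda>y. f (x' - y))) (l (\<lambda>y. f (x - y))) < e"
      using radon_diff[OF l cc_reflect[OF f R(2)] cc_reflect[OF f R(1)]] by (simp add: dist_norm)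
  qed (use d in simp)
qed

text \<open>The gradient is uniformly continuous, which makes the first-order remainder uniform in
  the base point. A remainder estimate in the sup norm is the only one to which a
  \<open>radon\<close> functional can be applied.\<close>

lemma c1_uniformly_differentiable:
  fixes f :: "real^'n \<Rightarrow> real"
  assumes f: "c1 UNIV f f'" "cc r f" and "e > 0"
  obtains d where "d > 0" "\<And>z h. norm h < d \<Longrightarrow> \<bar>f (z + h) - f z - (\<Sum>j\<in>UNIV. h$j * f' j z)\<bar> \<le> norm h * e"
proof -
  \<comment> \<open>The operator norm of the deviation is bounded by the sum of the deviations of
    the \<open>CARD('n)\<close> partial derivatives, each of which gets an equal share of
    \<open>e\<close>.\<close>
  define e' where "e' = e / of_nat CARD('n)"
  have e': "e' > 0" using \<open>e > 0\<close> by (simp add: e'_def)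
  have cc': "cc r (f' j)" for j by (rule c1_cc_partial[OF f(1)]) (rule cc_zero[OF f(2)])
  have "\<exists>d>0. \<forall>x y. norm (x - y) < d \<longrightarrow> norm (f' j x - f' j y) < e'" for j
    using cc_uniformly_continuous[OF cc' e'] by metis
  then obtain d where d: "\<And>j. d j > 0" "\<And>j x y. norm (x - y) < d j \<Longrightarrow> norm (f' j x - f' j y) < e'"
    by metis
  define D where "D = Min (range d)"
  have D: "D > 0" "\<And>j. D \<le> d j" using d(1) by (auto simp: D_def)
  show ?thesis
  proof (rule that[of D])
    show "D > 0" by (rule D)
    fix z h :: "real^'n" assume h: "norm h < D"
    have "norm (f (z + h) - f z - (\<lambda>h. \<Sum>j\<in>UNIV. h$j *\<^sub>R f' j z) ((z + h) - z)) \<le> norm ((z + h) - z) * e"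
    proof (rule differentiable_bound_linearization[where S="ball z (D)" and f'="\<lambda>x h. \<Sum>j\<in>UNIV. h$j *\<^sub>R f' j x"])
      show "z + t *\<^sub>R (z + h - z) \<in> ball z (D)" if "t \<in> {0..1}" for t
      proof -
        have "t * norm h \<le> norm h" using that by (simp add: mult_left_le_one_le)
        then show ?thesis using h that by (simp add: dist_norm)
      qed
      show "(f has_derivative (\<lambda>h. \<Sum>j\<in>UNIV. h$j *\<^sub>R f' j x)) (at x within ball z (D))" for x
        by (rule has_derivative_at_withinI[OF c1_derivative[OF f(1)]]) simp
      show "z \<in> ball z D" using D(1) by simp
      fix x assume x: "x \<in> ball z (D)"
      have "(\<lambda>h. \<Sum>j\<in>UNIV. h$j *\<^sub>R f' j x) - (\<lambda>h. \<Sum>j\<in>UNIV. h$j *\<^sub>R f' j z) =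
          (\<lambda>h. \<Sum>j\<in>UNIV. h$j *\<^sub>R (f' j x - f' j z))"
        by (auto simp: sum_subtractf right_diff_distrib)
      moreover have "onorm (\<lambda>h. \<Sum>j\<in>UNIV. h$j *\<^sub>R (f' j x - f' j z)) \<le> (\<Sum>j\<in>(UNIV::'n set). e')"
      proof (rule order_trans[OF onorm_coordinates_le sum_mono])
        fix j
        show "norm (f' j x - f' j z) \<le> e'"
          using x d(2)[of x z j] D(2)[of j] by (simp add: dist_norm norm_minus_commute)
      qed
      ultimately show "onorm ((\<lambda>h. \<Sum>j\<in>UNIV. h$j *\<^sub>R f' j x) - (\<lambda>h. \<Sum>j\<in>UNIV. h$j *\<^sub>R f' j z)) \<le> e"
        by (simp add: e'_def)
    qed
    then show "\<bar>f (z + h) - f z - (\<Sum>j\<in>UNIV. h$j * f' j z)\<bar> \<le> norm h * e"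
      by simp
  qed
qed

text \<open>Differentiation passes under \<open>l\<close>: the first-order remainder of \<eta> is
  small in the sup norm uniformly in \<open>y\<close>, and its support stays in one ball for
  increments of norm less than 1.\<close>

lemma c1_radon_convolution:
  fixes \<eta> :: "real^'n \<Rightarrow> real"
  assumes l: "radon l" and \<eta>: "c1 UNIV \<eta> \<eta>'" "cc r \<eta>"
  shows "c1 UNIV (\<lambda>x. l (\<lambda>y. \<eta> (x - y))) (\<lambda>j x. l (\<lambda>y. \<eta>' j (x - y)))"
proof (rule c1I)
  have cc': "cc r (\<eta>' j)" for j by (rule c1_cc_partial[OF \<eta>(1)]) (rule cc_zero[OF \<eta>(2)])
  show "continuous_on UNIV (\<lambda>x. l (\<lambda>y. \<eta>' j (x - y)))" for j
    by (rule radon_convolution_continuous[OF l cc'])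
  fix x :: "real^'n"
  have bl: "bounded_linear (\<lambda>h. \<Sum>j\<in>UNIV. h$j *\<^sub>R l (\<lambda>y. \<eta>' j (x - y)))"
    by (intro bounded_linear_sum bounded_linear_scaleR_const bounded_linear_vec_nth)
  show "((\<lambda>x. l (\<lambda>y. \<eta> (x - y))) has_derivative (\<lambda>h. \<Sum>j\<in>UNIV. h$j *\<^sub>R l (\<lambda>y. \<eta>' j (x - y)))) (at x)"
    unfolding has_derivative_at_alt
  proof (intro conjI bl allI impI)
    fix e :: real assume "e > 0"
    define R where "R = norm x + 1"
    obtain C where C: "C > 0" "\<And>f B. cc (R + r) f \<Longrightarrow> (\<And>x. \<bar>f x\<bar> \<le> B) \<Longrightarrow> norm (l f) \<le> C * B"
      using radon_bound[OF l] by blast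
    have e': "e / C > 0" using \<open>e > 0\<close> C(1) by simp
    obtain d where d: "d > 0"
      "\<And>z h. norm h < d \<Longrightarrow> \<bar>\<eta> (z + h) - \<eta> z - (\<Sum>j\<in>UNIV. h$j * \<eta>' j z)\<bar> \<le> norm h * (e / C)"
      using c1_uniformly_differentiable[OF \<eta> e'] by blast
    show "\<exists>d>0. \<forall>x'. norm (x' - x) < d \<longrightarrow>
      norm (l (\<lambda>y. \<eta> (x' - y)) - l (\<lambda>y. \<eta> (x - y)) - (\<Sum>j\<in>UNIV. (x' - x)$j *\<^sub>R l (\<lambda>y. \<eta>' j (x - y))))
        \<le> e * norm (x' - x)"
    proof (intro exI[of _ "min d 1"] conjI allI impI)
      fix x' assume x': "norm (x' - x) < min d 1"
      define h where "h = x' - x"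
      have R: "norm x \<le> R" "norm x' \<le> R"
        using x' norm_triangle_sub[of x' x] by (auto simp: R_def)
      have c1: "cc (R + r) (\<lambda>y. \<eta> (x' - y) - \<eta> (x - y))" by (intro cc_diff cc_reflect \<eta> R)
      have c3: "cc (R + r) (\<lambda>y. h$j * \<eta>' j (x - y))" for j by (intro cc_cmult cc_reflect cc' R)
      have c2: "cc (R + r) (\<lambda>y. \<Sum>j\<in>UNIV. h$j * \<eta>' j (x - y))" by (intro cc_sum c3)
      have "norm (l (\<lambda>y. \<eta> (x' - y) - \<eta> (x - y) - (\<Sum>j\<in>UNIV. h$j * \<eta>' j (x - y)))) \<le> C * (norm h * (e / C))"
      proof (rule C(2))
        show "cc (R + r) (\<lambda>y. \<eta> (x' - y) - \<eta> (x - y) - (\<Sum>j\<in>UNIV. h$j * \<eta>' j (x - y)))"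
          by (rule cc_diff[OF c1 c2])
        show "\<bar>\<eta> (x' - y) - \<eta> (x - y) - (\<Sum>j\<in>UNIV. h$j * \<eta>' j (x - y))\<bar> \<le> norm h * (e / C)" for y
          using d(2)[of h "x - y"] x' by (simp add: h_def algebra_simps)
      qed
      also have "\<dots> = e * norm h" using C(1) by simp
      also have "l (\<lambda>y. \<eta> (x' - y) - \<eta> (x - y) - (\<Sum>j\<in>UNIV. h$j * \<eta>' j (x - y))) =
          l (\<lambda>y. \<eta> (x' - y)) - l (\<lambda>y. \<eta> (x - y)) - (\<Sum>j\<in>UNIV. h$j *\<^sub>R l (\<lambda>y. \<eta>' j (x - y)))"
        using radon_diff[OF l c1 c2] radon_diff[OF l cc_reflect[OF \<eta>(2) R(2)] cc_reflect[OF \<eta>(2) R(1)]]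
          radon_sum[OF l c3, where I=UNIV] radon_cmult[OF l cc_reflect[OF cc' R(1)]]
        by simp
      finally show "norm (l (\<lambda>y. \<eta> (x' - y)) - l (\<lambda>y. \<eta> (x - y)) - (\<Sum>j\<in>UNIV. (x' - x)$j *\<^sub>R l (\<lambda>y. \<eta>' j (x - y))))
        \<le> e * norm (x' - x)" by (simp add: h_def)
    qed (use d in simp)
  qed
qed

lemma Ck_on_c1E:
  fixes f :: "real^'n \<Rightarrow> 'b::real_normed_vector"
  assumes "Ck_on (Suc m) UNIV f"
  obtains f' where "c1 UNIV f f'" "\<And>j. Ck_on m UNIV (f' j)"
  using Ck_on_Suc_c1[OF assms open_UNIV] by blast

lemma c1_Ck_on: "c1 UNIV f f' \<Longrightarrow> (\<And>j. Ck_on m UNIV (f' j)) \<Longrightarrow> Ck_on (Suc m) UNIV f"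
  by (rule Ck_onI[OF c1_derivative[OF _ UNIV_I]])

lemma Ck_on_radon_convolution:
  fixes \<eta> :: "real^'n \<Rightarrow> real"
  assumes l: "radon l"
  shows "Ck_on m UNIV \<eta> \<Longrightarrow> cc r \<eta> \<Longrightarrow> Ck_on m UNIV (\<lambda>x. l (\<lambda>y. \<eta> (x - y)))"
proof (induction m arbitrary: \<eta>)
  case 0
  then show ?case using radon_convolution_continuous[OF l] by simp
next
  case (Suc m)
  obtain \<eta>' where \<eta>': "c1 UNIV \<eta> \<eta>'" "\<And>j. Ck_on m UNIV (\<eta>' j)"
    by (rule Ck_on_c1E[OF Suc.prems(1)]) blast
  have cc': "cc r (\<eta>' j)" for j by (rule c1_cc_partial[OF \<eta>'(1)]) (rule cc_zero[OF Suc.prems(2)])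
  show ?case
    by (rule c1_Ck_on[OF c1_radon_convolution[OF l \<eta>'(1) Suc.prems(2)]]) (rule Suc.IH[OF \<eta>'(2) cc'])
qed

section \<open>Mollifiers and smooth approximation\<close>

definition mollifier :: "real \<Rightarrow> (real^'n \<Rightarrow> real) \<Rightarrow> bool" where
  "mollifier e \<eta> \<longleftrightarrow> (\<forall>m. Ck_on m UNIV \<eta>) \<and> (\<forall>x. \<eta> x \<ge> 0) \<and> (\<forall>x. norm x \<ge> e \<longrightarrow> \<eta> x = 0) \<and>
     integral\<^sup>L lborel \<eta> = 1"

lemma mollifier_cc: "mollifier e \<eta> \<Longrightarrow> cc e \<eta>"
  unfolding mollifier_def cc_def by (metis Ck_on.simps(1) less_imp_le)

lemma mollifier_exists:
  assumes "e > 0" shows "\<exists>\<eta>::real^'n \<Rightarrow> real. mollifier e \<eta>"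
proof -
  obtain \<eta> :: "real^'n \<Rightarrow> real" where \<eta>: "\<And>m. Ck_on m UNIV \<eta>" "\<And>x. \<eta> x \<ge> 0" "\<And>x. norm x \<ge> e \<Longrightarrow> \<eta> x = 0" "\<eta> 0 > 0"
    using smooth_bump_exists[OF assms] by blast
  have cont: "continuous_on UNIV \<eta>" using \<eta>(1)[of 0] by simp
  have cc: "cc e \<eta>" using \<eta> cont by (auto simp: cc_def)
  have int: "integrable lborel \<eta>" by (rule cc_integrable[OF cc])
  \<comment> \<open>A nonnegative function with integral 0 vanishes almost everywhere, whereas the
    set where the continuous bump is nonzero is open and contains the origin.\<close>
  have "integral\<^sup>L lborel \<eta> \<noteq> 0"
  proof
    assume "integral\<^sup>L lborel \<eta> = 0"
    then have "AE x in lborel. \<eta> x = 0"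
      using integral_nonneg_eq_0_iff_AE[OF int] \<eta>(2) by simp
    then have "negligible {x. \<eta> x \<noteq> 0}"
      by (simp add: negligible_iff_null_sets AE_completion AE_iff_null_sets[symmetric] eventually_ae_filter)
        (metis (mono_tags, lifting) Collect_mono_iff completion.complete2 null_sets_completionI UNIV_I)
    moreover have "open {x. \<eta> x \<noteq> 0}"
      by (intro open_Collect_neq cont continuous_on_const)
    ultimately show False using \<eta>(4) open_not_negligible by fastforce
  qed
  moreover have "integral\<^sup>L lborel \<eta> \<ge> 0" using \<eta>(2) by simp
  ultimately have pos: "integral\<^sup>L lborel \<eta> > 0" by simp
  define c where "c = inverse (integral\<^sup>L lborel \<eta>)"
  have c: "c > 0" "c * integral\<^sup>L lborel \<eta> = 1" using pos by (auto simp: c_def)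
  have "mollifier e (\<lambda>x. c * \<eta> x)"
    unfolding mollifier_def using \<eta> c
    by (auto intro!: Ck_on_bounded_linear[OF bounded_linear_mult_right])
  then show ?thesis by blast
qed

lemma mollifier_integral:
  assumes "mollifier e \<eta>"
  shows "integrable lborel (\<lambda>y. \<eta> (x - y))" "(LINT y|lborel. \<eta> (x - y)) = 1"
proof -
  have cc: "cc (norm x + e) (\<lambda>y. \<eta> (x - y))" by (intro cc_reflect[OF mollifier_cc[OF assms]]) simp
  show "integrable lborel (\<lambda>y. \<eta> (x - y))" by (rule cc_integrable[OF cc])
  have "\<eta> \<in> borel_measurable borel"
    using cc_integrable[OF mollifier_cc[OF assms]] by auto
  then show "(LINT y|lborel. \<eta> (x - y)) = 1"
    using assms by (simp add: lborel_integral_reflect mollifier_def)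
qed

text \<open>As a function of \<open>y\<close>, \<eta> (x - y) is a probability density carried by
  the ball of radius \<open>e\<close> about \<open>x\<close>, so the mollification is a mean of
  nearby values.\<close>

lemma mollify_close:
  fixes f :: "real^'n \<Rightarrow> 'b::{banach, second_countable_topology}"
  assumes m: "mollifier e \<eta>" and close: "\<And>y. norm (x - y) < e \<Longrightarrow> norm (f y - f x) \<le> B"
    and int: "integrable lborel (\<lambda>y. \<eta> (x - y) *\<^sub>R f y)"
  shows "norm ((LINT y|lborel. \<eta> (x - y) *\<^sub>R f y) - f x) \<le> B"
proof -
  have nn: "\<eta> z \<ge> 0" and z: "norm z \<ge> e \<Longrightarrow> \<eta> z = 0" for z using m by (auto simp: mollifier_def)
  note i = mollifier_integral[OF m, of x]
  have "(LINT y|lborel. \<eta> (x - y) *\<^sub>R f y) - f x = (LINT y|lborel. \<eta> (x - y) *\<^sub>R f y) - (LINT y|lborel. \<eta> (x - y) *\<^sub>R f x)"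
    using i by simp
  also have "\<dots> = (LINT y|lborel. \<eta> (x - y) *\<^sub>R f y - \<eta> (x - y) *\<^sub>R f x)"
    using int i by (intro Bochner_Integration.integral_diff[symmetric]) auto
  also have "norm \<dots> \<le> (LINT y|lborel. B * \<eta> (x - y))"
  proof (rule Bochner_Integration.integral_norm_bound_integral)
    show "integrable lborel (\<lambda>y. \<eta> (x - y) *\<^sub>R f y - \<eta> (x - y) *\<^sub>R f x)" using int i by auto
    show "integrable lborel (\<lambda>y. B * \<eta> (x - y))" using i by auto
    fix y :: "real^'n"
    show "norm (\<eta> (x - y) *\<^sub>R f y - \<eta> (x - y) *\<^sub>R f x) \<le> B * \<eta> (x - y)"
    proof (cases "norm (x - y) < e")
      case True
      then show ?thesis using mult_left_mono[OF close[OF True] nn[of "x - y"]] nn[of "x - y"]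
        by (simp add: scaleR_diff_right[symmetric] mult.commute)
    qed (use z[of "x - y"] in simp)
  qed
  also have "\<dots> = B" using i by simp
  finally show ?thesis .
qed

lemma cc_extend_zero:
  fixes g :: "real^'n \<Rightarrow> 'b::real_normed_vector"
  assumes "continuous_on S g" "open S" "cball x e \<subseteq> S" and zero: "\<And>y. y \<in> S \<Longrightarrow> norm (x - y) > e \<Longrightarrow> g y = 0"
  shows "cc (norm x + e) (\<lambda>y. if y \<in> S then g y else 0)"
proof -
  let ?h = "\<lambda>y. if y \<in> S then g y else 0"
  have "continuous_on S ?h" by (rule continuous_on_eq[OF assms(1)]) simp
  moreover have "continuous_on (- cball x e) ?h"
    by (rule continuous_on_eq[OF continuous_on_const[of _ 0]]) (use zero in \<open>auto simp: dist_norm\<close>)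
  ultimately have "continuous_on (S \<union> - cball x e) ?h"
    using assms(2) by (intro continuous_on_open_Un) auto
  moreover have "S \<union> - cball x e = UNIV" using assms(3) by auto
  moreover have "?h y = 0" if "norm y > norm x + e" for y
  proof -
    have "norm y \<le> norm x + norm (x - y)" by (metis norm_triangle_sub norm_minus_commute)
    then show ?thesis using that zero by simp
  qed
  ultimately show ?thesis by (auto simp: cc_def)
qed

text \<open>Integration by parts for the product of \<open>f\<close> with the reflected mollifier.
  The support of the latter lies in \<open>S\<close>, so the product extends by 0 even though
  \<open>f\<close> is controlled only in \<open>S\<close>; reflection supplies the second
  sign.\<close>

lemma mollify_partial:
  fixes f :: "real^'n \<Rightarrow> 'b::{banach, second_countable_topology}"
  assumes f: "c1 S f f'" "open S" "cball x e \<subseteq> S" and \<eta>: "c1 UNIV \<eta> \<eta>'" "cc e \<eta>"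
  shows "(LINT y|lborel. (if y \<in> S then \<eta>' j (x - y) *\<^sub>R f y else 0)) =
      (LINT y|lborel. (if y \<in> S then \<eta> (x - y) *\<^sub>R f' j y else 0))"
proof -
  have c: "c1 UNIV (\<lambda>y. \<eta> (x - y)) (\<lambda>j y. \<Sum>i\<in>UNIV. (if j = i then -1 else 0) *\<^sub>R \<eta>' i (x - y))"
  proof (rule c1_chain[OF _ \<eta>(1), of UNIV "\<lambda>y. x - y"])
    show "c1 UNIV (\<lambda>y. (x - y) $ i) (\<lambda>j y. if j = i then - 1 else 0)" for i
      by (rule c1_eqI[OF c1_diff[OF c1_const[of _ "x$i"] c1_coordinate[of _ i]]]) auto
  qed simp
  have c': "c1 UNIV (\<lambda>y. \<eta> (x - y)) (\<lambda>j y. - \<eta>' j (x - y))"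
  proof (rule c1_eqI[OF c])
    fix j :: 'n and y :: "real^'n"
    have "(\<Sum>i\<in>UNIV. (if j = i then -1 else 0) *\<^sub>R \<eta>' i (x - y)) = (\<Sum>i\<in>UNIV. if i = j then - \<eta>' i (x - y) else 0)"
      by (intro sum.cong) auto
    then show "(\<Sum>i\<in>UNIV. (if j = i then -1 else 0) *\<^sub>R \<eta>' i (x - y)) = - \<eta>' j (x - y)" by simp
  qed auto
  have cc': "cc e (\<eta>' j)" by (rule c1_cc_partial[OF \<eta>(1)]) (rule cc_zero[OF \<eta>(2)])
  have p: "c1 S (\<lambda>y. \<eta> (x - y) *\<^sub>R f y) (\<lambda>j y. \<eta> (x - y) *\<^sub>R f' j y + (- \<eta>' j (x - y)) *\<^sub>R f y)"
    by (rule c1_scaleR[OF c1_subset[OF c'] f(1)]) simp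
  have P: "c1 UNIV (\<lambda>y. if y \<in> S then \<eta> (x - y) *\<^sub>R f y else 0)
     (\<lambda>j y. if y \<in> S then \<eta> (x - y) *\<^sub>R f' j y + (- \<eta>' j (x - y)) *\<^sub>R f y else 0)"
    by (rule c1_extend_zero[OF p f(2) closed_cball f(3)]) (use cc_zero[OF \<eta>(2)] in \<open>auto simp: dist_norm\<close>)
  have 1: "cc (norm x + e) (\<lambda>y. if y \<in> S then \<eta>' j (x - y) *\<^sub>R f y else 0)"
    by (rule cc_extend_zero[OF _ f(2,3)])
      (use cc_zero[OF cc'] in \<open>auto intro!: continuous_intros c1_continuous[OF f(1)] continuous_on_compose2[OF cc_continuous[OF cc', of UNIV]]\<close>)
  have 2: "cc (norm x + e) (\<lambda>y. if y \<in> S then \<eta> (x - y) *\<^sub>R f' j y else 0)"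
    by (rule cc_extend_zero[OF _ f(2,3)])
      (use cc_zero[OF \<eta>(2)] in \<open>auto intro!: continuous_intros c1_continuous_partial[OF f(1)] continuous_on_compose2[OF cc_continuous[OF \<eta>(2), of UNIV]]\<close>)
  have "0 = (LINT y|lborel. (if y \<in> S then \<eta> (x - y) *\<^sub>R f' j y + (- \<eta>' j (x - y)) *\<^sub>R f y else 0))"
  proof (rule integral_partial_eq_0[OF P, symmetric])
    fix y :: "real^'n" assume "norm y > norm x + e"
    moreover have "norm y \<le> norm x + norm (x - y)" by (metis norm_triangle_sub norm_minus_commute)
    ultimately show "(if y \<in> S then \<eta> (x - y) *\<^sub>R f y else 0) = 0"
      using cc_zero[OF \<eta>(2), of "x - y"] by simp
  qed
  also have "\<dots> = (LINT y|lborel. (if y \<in> S then \<eta> (x - y) *\<^sub>R f' j y else 0) - (if y \<in> S then \<eta>' j (x - y) *\<^sub>R f y else 0))"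
    by (intro Bochner_Integration.integral_cong) auto
  also have "\<dots> = (LINT y|lborel. (if y \<in> S then \<eta> (x - y) *\<^sub>R f' j y else 0)) - (LINT y|lborel. (if y \<in> S then \<eta>' j (x - y) *\<^sub>R f y else 0))"
    by (rule Bochner_Integration.integral_diff[OF cc_integrable[OF 2] cc_integrable[OF 1]])
  finally show ?thesis by simp
qed

lemma cc_mult_continuous:
  fixes f g :: "real^'n \<Rightarrow> real"
  assumes "cc R f" "continuous_on UNIV g" shows "cc R (\<lambda>x. g x * f x)"
  using assms by (auto simp: cc_def intro: continuous_intros)

lemma radon_integral:
  assumes f: "cc r (f :: real^'n \<Rightarrow> real)"
  shows "radon (\<lambda>g. LINT y|lborel. g y * f y)"
  unfolding radon_def
proof (intro conjI allI impI)
  fix R and g h :: "real^'n \<Rightarrow> real" assume "cc R g" "cc R h"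
  then have "integrable lborel (\<lambda>y. g y * f y)" "integrable lborel (\<lambda>y. h y * f y)"
    using f by (auto intro!: cc_integrable cc_mult_continuous simp: cc_def)
  then show "(LINT y|lborel. (g y + h y) * f y) = (LINT y|lborel. g y * f y) + (LINT y|lborel. h y * f y)"
    by (simp add: distrib_right)
next
  show "(LINT y|lborel. c * g y * f y) = c *\<^sub>R (LINT y|lborel. g y * f y)" for c g
    by (simp add: mult.assoc)
next
  fix R
  show "\<exists>C. \<forall>g B. cc R g \<longrightarrow> (\<forall>x. \<bar>g x\<bar> \<le> B) \<longrightarrow> norm (LINT y|lborel. g y * f y) \<le> C * B"
  proof (intro exI[of _ "LINT y|lborel. \<bar>f y\<bar>"] allI impI)
    fix g :: "real^'n \<Rightarrow> real" and B assume g: "cc R g" "\<forall>x. \<bar>g x\<bar> \<le> B"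
    have "norm (LINT y|lborel. g y * f y) \<le> (LINT y|lborel. B * \<bar>f y\<bar>)"
    proof (rule Bochner_Integration.integral_norm_bound_integral)
      show "integrable lborel (\<lambda>y. g y * f y)"
        using f g by (auto intro!: cc_integrable cc_mult_continuous simp: cc_def)
      show "integrable lborel (\<lambda>y. B * \<bar>f y\<bar>)" using cc_integrable[OF f] by auto
      show "norm (g y * f y) \<le> B * \<bar>f y\<bar>" for y using g(2) by (simp add: abs_mult mult_right_mono)
    qed
    then show "norm (LINT y|lborel. g y * f y) \<le> (LINT y|lborel. \<bar>f y\<bar>) * B" by (simp add: mult.commute)
  qed
qed

text \<open>Mollification commutes with the partial derivatives, so values and first derivatives are
  approximated uniformly at once. The weak equations are stated for infinitely differentiable test
  functions, while the maps composed with \<phi> have only finite regularity; this closes the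
  gap.\<close>

proposition smooth_approximation:
  fixes f :: "real^'n \<Rightarrow> real"
  assumes f: "c1 UNIV f f'" "cc R f" and "e > 0"
  obtains t where "\<And>m. Ck_on m UNIV t" "cc (R + 1) t" "\<And>x. \<bar>t x - f x\<bar> \<le> e"
    "\<And>j x. \<bar>frechet_derivative t (at x) (axis j 1) - f' j x\<bar> \<le> e"
proof -
  have cc': "cc R (f' j)" for j by (rule c1_cc_partial[OF f(1)]) (rule cc_zero[OF f(2)])
  have "\<exists>d>0. \<forall>x y. norm (x - y :: real^'n) < d \<longrightarrow> norm (f' j x - f' j y) < e" for j
    using cc_uniformly_continuous[OF cc' \<open>e > 0\<close>] by metis
  then obtain d where d: "\<And>j. d j > 0" "\<And>j x y. norm (x - y) < d j \<Longrightarrow> norm (f' j x - f' j y) < e"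
    by metis
  obtain d0 where d0: "d0 > 0" "\<And>x y. norm (x - y) < d0 \<Longrightarrow> norm (f x - f y) < e"
    using cc_uniformly_continuous[OF f(2) \<open>e > 0\<close>] by blast
  \<comment> \<open>Small enough for the moduli of continuity of \<open>f\<close> and of all its
    partial derivatives, and at most 1 so that the support grows by at most 1.\<close>
  define \<delta> where "\<delta> = min (min d0 1) (Min (range d))"
  have \<delta>: "\<delta> > 0" "\<delta> \<le> 1" "\<delta> \<le> d0" using d(1) d0(1) by (auto simp: \<delta>_def)
  have \<delta>d: "\<delta> \<le> d j" for j unfolding \<delta>_def by (meson Min_le finite finite_imageI min.coboundedI2 rangeI)
  obtain \<eta> :: "real^'n \<Rightarrow> real" where \<eta>: "mollifier \<delta> \<eta>" using mollifier_exists[OF \<delta>(1)] by blast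
  note cc\<eta> = mollifier_cc[OF \<eta>]
  have sm: "Ck_on m UNIV \<eta>" for m using \<eta> by (simp add: mollifier_def)
  obtain \<eta>' where \<eta>': "c1 UNIV \<eta> \<eta>'" by (rule Ck_on_c1E[OF sm[of "Suc 0"]]) blast
  have int: "integrable lborel (\<lambda>y. \<eta> (x - y) *\<^sub>R g y)" if "cc R g" for g :: "real^'n \<Rightarrow> real" and x
    using cc_integrable[OF cc_mult_continuous[OF that, of "\<lambda>y. \<eta> (x - y)"]] cc_continuous[OF cc_reflect[OF cc\<eta> order_refl, of x]]
    by simp
  define t where "t x = (LINT y|lborel. \<eta> (x - y) * f y)" for x
  note l = radon_integral[OF f(2)]
  have t': "c1 UNIV t (\<lambda>j x. LINT y|lborel. \<eta>' j (x - y) * f y)"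
    unfolding t_def by (rule c1_radon_convolution[OF l \<eta>' cc\<eta>])
  show ?thesis
  proof (rule that[of t])
    show "Ck_on m UNIV t" for m
      unfolding t_def by (rule Ck_on_radon_convolution[OF l sm cc\<eta>])
    show "cc (R + 1) t"
    proof (rule c1_cc[OF t'])
      fix x :: "real^'n" assume x: "norm x > R + 1"
      have "\<eta> (x - y) * f y = 0" for y
      proof (cases "norm y > R")
        case True then show ?thesis using cc_zero[OF f(2)] by simp
      next
        case False
        have "norm x \<le> norm y + norm (x - y)" by (metis norm_triangle_sub)
        then have "norm (x - y) > \<delta>" using False x \<delta>(2) by simp
        then show ?thesis using cc_zero[OF cc\<eta>] by simp
      qed
      then have "(\<lambda>y. \<eta> (x - y) * f y) = (\<lambda>y. 0)" by (rule ext)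
      then show "t x = 0" unfolding t_def by (simp only: integral_zero)
    qed
    show "\<bar>t x - f x\<bar> \<le> e" for x
    proof -
      have "norm ((LINT y|lborel. \<eta> (x - y) *\<^sub>R f y) - f x) \<le> e"
      proof (rule mollify_close[OF \<eta> _ int[OF f(2)]])
        fix y assume "norm (x - y) < \<delta>"
        then show "norm (f y - f x) \<le> e" using d0(2)[of y x] \<delta>(3) by (simp add: norm_minus_commute)
      qed
      then show ?thesis by (simp add: t_def)
    qed
    show "\<bar>frechet_derivative t (at x) (axis j 1) - f' j x\<bar> \<le> e" for j x
    proof -
      have "norm ((LINT y|lborel. \<eta> (x - y) *\<^sub>R f' j y) - f' j x) \<le> e"
      proof (rule mollify_close[OF \<eta> _ int[OF cc']])
        fix y assume "norm (x - y) < \<delta>"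
        then show "norm (f' j y - f' j x) \<le> e" using d(2)[of y x j] \<delta>d[of j] by (simp add: norm_minus_commute)
      qed
      moreover have "frechet_derivative t (at x) (axis j 1) = (LINT y|lborel. \<eta> (x - y) *\<^sub>R f' j y)"
        using c1_frechet[OF t'] mollify_partial[OF f(1) open_UNIV subset_UNIV \<eta>' cc\<eta>, where x=x and j=j] by simp
      ultimately show ?thesis by simp
    qed
  qed
qed

section \<open>The divergence of a Piola transform\<close>

lemma c1_line:
  assumes f: "c1 S f f'" and "p + s *\<^sub>R axis i 1 \<in> S"
  shows "((\<lambda>s. f (p + s *\<^sub>R axis i 1)) has_vector_derivative f' i (p + s *\<^sub>R axis i 1)) (at s)"
proof -
  have "((\<lambda>t::real. p + t *\<^sub>R axis i 1) has_derivative (\<lambda>t. t *\<^sub>R axis i 1)) (at s)"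
    by (auto intro!: derivative_eq_intros)
  from has_derivative_compose[OF this c1_derivative[OF f assms(2)]]
  have "((\<lambda>t::real. f (p + t *\<^sub>R axis i 1)) has_derivative
      (\<lambda>t. \<Sum>j\<in>UNIV. (t *\<^sub>R axis i 1)$j *\<^sub>R f' j (p + s *\<^sub>R axis i 1))) (at s)" .
  moreover have "(\<Sum>j\<in>UNIV. (t *\<^sub>R axis i 1)$j *\<^sub>R f' j (p + s *\<^sub>R axis i 1)) = t *\<^sub>R f' i (p + s *\<^sub>R axis i 1)" for t :: real
    using sum_axis_nth[of i "\<lambda>j. f' j (p + s *\<^sub>R axis i 1)"] by (simp add: scaleR_sum_right[symmetric] flip: scaleR_scaleR)
  ultimately show ?thesis by (simp add: has_vector_derivative_def)
qed

text \<open>The mean value theorem is applied first in direction \<open>i\<close> to the increment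
  in direction \<open>j\<close>, then in direction \<open>j\<close> to the partial derivative that
  results. Both intermediate points stay within distance \<open>2 * t\<close> of
  \<open>x\<close>.\<close>

lemma second_difference:
  fixes f :: "real^'n \<Rightarrow> real"
  assumes f: "c1 S f f'" "c1 S (f' i) f''" and S: "cball x (2 * t) \<subseteq> S" "t > 0"
  shows "\<exists>p\<in>cball x (2 * t). f (x + t *\<^sub>R axis i 1 + t *\<^sub>R axis j 1) - f (x + t *\<^sub>R axis i 1)
     - f (x + t *\<^sub>R axis j 1) + f x = t * (t * f'' j p)"
proof -
  have mem: "x + s *\<^sub>R axis i 1 + r *\<^sub>R axis j 1 \<in> cball x (2 * t)" if "0 \<le> s" "s \<le> t" "0 \<le> r" "r \<le> t" for r s
  proof -
    have "norm (s *\<^sub>R axis i (1::real) + r *\<^sub>R axis j 1) \<le> s + r"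
      using norm_triangle_ineq[of "s *\<^sub>R axis i (1::real)" "r *\<^sub>R axis j 1"] that by simp
    then show ?thesis using that by (simp add: dist_norm algebra_simps norm_minus_commute)
  qed
  define g where "g s = f ((x + t *\<^sub>R axis j 1) + s *\<^sub>R axis i 1) - f (x + s *\<^sub>R axis i 1)" for s
  have "\<exists>z>0. z < t \<and> g t - g 0 = (t - 0) * (f' i ((x + t *\<^sub>R axis j 1) + z *\<^sub>R axis i 1) - f' i (x + z *\<^sub>R axis i 1))"
  proof (rule MVT2[OF S(2)])
    fix s assume s: "0 \<le> s" "s \<le> t"
    show "(g has_real_derivative f' i ((x + t *\<^sub>R axis j 1) + s *\<^sub>R axis i 1) - f' i (x + s *\<^sub>R axis i 1)) (at s)"
      unfolding g_def
      by (intro DERIV_diff c1_line[OF f(1), folded has_real_derivative_iff_has_vector_derivative])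
        (use mem[OF s, of t] mem[OF s, of 0] S s in \<open>auto simp: algebra_simps\<close>)
  qed
  then obtain z where z: "0 < z" "z < t"
    "g t - g 0 = t * (f' i ((x + t *\<^sub>R axis j 1) + z *\<^sub>R axis i 1) - f' i (x + z *\<^sub>R axis i 1))" by auto
  have "\<exists>w>0. w < t \<and> f' i ((x + z *\<^sub>R axis i 1) + t *\<^sub>R axis j 1) - f' i ((x + z *\<^sub>R axis i 1) + 0 *\<^sub>R axis j 1) =
     (t - 0) * f'' j ((x + z *\<^sub>R axis i 1) + w *\<^sub>R axis j 1)"
  proof (rule MVT2[OF S(2)])
    fix w assume w: "0 \<le> w" "w \<le> t"
    show "((\<lambda>w. f' i ((x + z *\<^sub>R axis i 1) + w *\<^sub>R axis j 1)) has_real_derivative f'' j ((x + z *\<^sub>R axis i 1) + w *\<^sub>R axis j 1)) (at w)"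
      by (rule c1_line[OF f(2), folded has_real_derivative_iff_has_vector_derivative])
        (use mem[of z w] z w S in auto)
  qed
  then obtain w where w: "0 < w" "w < t" "f' i ((x + z *\<^sub>R axis i 1) + t *\<^sub>R axis j 1) - f' i (x + z *\<^sub>R axis i 1) =
     t * f'' j ((x + z *\<^sub>R axis i 1) + w *\<^sub>R axis j 1)" by auto
  show ?thesis
  proof (intro bexI)
    show "(x + z *\<^sub>R axis i 1) + w *\<^sub>R axis j 1 \<in> cball x (2 * t)" using mem[of z w] z w by auto
    show "f (x + t *\<^sub>R axis i 1 + t *\<^sub>R axis j 1) - f (x + t *\<^sub>R axis i 1) - f (x + t *\<^sub>R axis j 1) + f x
       = t * (t * f'' j ((x + z *\<^sub>R axis i 1) + w *\<^sub>R axis j 1))"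
      using z(3) w(3) by (simp add: g_def algebra_simps)
  qed
qed

text \<open>The second difference is symmetric in the two directions. Evaluated in either order it
  is \<open>t * t\<close> times a mixed derivative at a point near \<open>x\<close>, and continuity
  brings both points back to \<open>x\<close>.\<close>

lemma mixed_partials_commute:
  fixes f :: "real^'n \<Rightarrow> real"
  assumes f: "c1 S f f'" "\<And>i. c1 S (f' i) (f'' i)" and S: "open S" "x \<in> S"
  shows "f'' i j x = f'' j i x"
proof (rule ccontr)
  assume ne: "f'' i j x \<noteq> f'' j i x"
  define e where "e = \<bar>f'' i j x - f'' j i x\<bar> / 2"
  have e: "e > 0" using ne by (simp add: e_def)
  have cont: "isCont (f'' i j) x" "isCont (f'' j i) x"
    using c1_continuous_partial[OF f(2)] S by (auto simp: continuous_on_eq_continuous_at)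
  then obtain d1 d2 where d: "d1 > 0" "\<And>y. dist y x < d1 \<Longrightarrow> dist (f'' i j y) (f'' i j x) < e"
    "d2 > 0" "\<And>y. dist y x < d2 \<Longrightarrow> dist (f'' j i y) (f'' j i x) < e"
    using e unfolding continuous_at_eps_delta by metis
  obtain d3 where d3: "d3 > 0" "cball x d3 \<subseteq> S" using S open_contains_cball by blast
  define t where "t = min d3 (min d1 d2) / 4"
  have t: "t > 0" "2 * t < d1" "2 * t < d2" "cball x (2 * t) \<subseteq> S"
    using d d3 subset_cball[of "2*t" d3 x] by (auto simp: t_def)
  obtain p where p: "p \<in> cball x (2 * t)" "f (x + t *\<^sub>R axis i 1 + t *\<^sub>R axis j 1) - f (x + t *\<^sub>R axis i 1)
     - f (x + t *\<^sub>R axis j 1) + f x = t * (t * f'' i j p)"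
    using second_difference[OF f(1) f(2) t(4,1), of i j] by blast
  obtain q where q: "q \<in> cball x (2 * t)" "f (x + t *\<^sub>R axis j 1 + t *\<^sub>R axis i 1) - f (x + t *\<^sub>R axis j 1)
     - f (x + t *\<^sub>R axis i 1) + f x = t * (t * f'' j i q)"
    using second_difference[OF f(1) f(2) t(4,1), of j i] by blast
  have "x + t *\<^sub>R axis j 1 + t *\<^sub>R axis i 1 = x + t *\<^sub>R axis i 1 + t *\<^sub>R axis j 1"
    by (simp add: add_ac)
  then have "t * (t * f'' i j p) = t * (t * f'' j i q)" using p(2) q(2)
    by (metis (no_types, lifting) diff_diff_eq add.commute)
  then have "f'' i j p = f'' j i q" using t(1) by simp
  moreover have "dist (f'' i j p) (f'' i j x) < e" "dist (f'' j i q) (f'' j i x) < e"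
    using d(2)[of p] d(4)[of q] p(1) q(1) t by (auto simp: dist_commute)
  ultimately show False by (simp add: e_def dist_real_def abs_if split: if_splits)
qed

lemma c1_prod:
  fixes f :: "'i \<Rightarrow> real^'n \<Rightarrow> real"
  assumes "finite I" "open S" "\<And>i. i \<in> I \<Longrightarrow> c1 S (f i) (f' i)"
  shows "c1 S (\<lambda>x. \<Prod>i\<in>I. f i x) (\<lambda>j x. \<Sum>i\<in>I. f' i j x * (\<Prod>k\<in>I-{i}. f k x))"
  using assms(1,3)
proof (induction I rule: finite_induct)
  case (insert i I)
  have "c1 S (\<lambda>x. f i x * (\<Prod>i\<in>I. f i x))
    (\<lambda>j x. f i x * (\<Sum>i\<in>I. f' i j x * (\<Prod>k\<in>I-{i}. f k x)) + f' i j x * (\<Prod>i\<in>I. f i x))"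
    using insert by (intro c1_mult) auto
  then show ?case
  proof (rule c1_eqI[OF _ assms(2)])
    fix j x
    have "(\<Sum>k\<in>I. f' k j x * (\<Prod>l\<in>insert i I - {k}. f l x)) = (\<Sum>k\<in>I. f i x * (f' k j x * (\<Prod>l\<in>I-{k}. f l x)))"
    proof (rule sum.cong[OF refl])
      fix k assume "k \<in> I"
      then have "insert i I - {k} = insert i (I - {k})" using insert by auto
      then show "f' k j x * (\<Prod>l\<in>insert i I - {k}. f l x) = f i x * (f' k j x * (\<Prod>l\<in>I-{k}. f l x))"
        using insert by simp
    qed
    moreover have "insert i I - {i} = I" using insert by auto
    ultimately show "f i x * (\<Sum>i\<in>I. f' i j x * (\<Prod>k\<in>I-{i}. f k x)) + f' i j x * (\<Prod>i\<in>I. f i x)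
      = (\<Sum>k\<in>insert i I. f' k j x * (\<Prod>l\<in>insert i I - {k}. f l x))"
      using insert by (simp add: sum_distrib_left)
  qed (use insert in auto)
qed (auto intro: c1_const)

text \<open>The product rule on the permutation expansion, regrouped according to the row that
  carries the derivative.\<close>

lemma c1_det:
  fixes m :: "'m::finite \<Rightarrow> 'm \<Rightarrow> real^'n \<Rightarrow> real"
  assumes "open S" and m: "\<And>a b. c1 S (m a b) (m' a b)"
  shows "c1 S (\<lambda>x. det (\<chi> a b. m a b x)) (\<lambda>j x. \<Sum>i\<in>UNIV. det (\<chi> a b. if a = i then m' a b j x else m a b x))"
proof -
  have "c1 S (\<lambda>x. \<Sum>p\<in>{p. p permutes (UNIV::'m set)}. of_int (sign p) * (\<Prod>a\<in>UNIV. m a (p a) x))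
     (\<lambda>j x. \<Sum>p\<in>{p. p permutes (UNIV::'m set)}. of_int (sign p) * (\<Sum>i\<in>UNIV. m' i (p i) j x * (\<Prod>a\<in>UNIV-{i}. m a (p a) x)))"
    by (intro c1_sum c1_cmult c1_prod assms) auto
  then show ?thesis
  proof (rule c1_eqI[OF _ assms(1)])
    fix j x
    have "(\<Prod>a\<in>UNIV. (if a = i then m' a (p a) j x else m a (p a) x)) = m' i (p i) j x * (\<Prod>a\<in>UNIV-{i}. m a (p a) x)" for p i
      by (subst prod.remove[of _ i]) auto
    then show "(\<Sum>p\<in>{p. p permutes (UNIV::'m set)}. of_int (sign p) * (\<Sum>i\<in>UNIV. m' i (p i) j x * (\<Prod>a\<in>UNIV-{i}. m a (p a) x)))
      = (\<Sum>i\<in>UNIV. det (\<chi> a b. if a = i then m' a b j x else m a b x))"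
      by (simp add: det_def sum_distrib_left) (rule sum.swap)
  qed (simp add: det_def)
qed

text \<open>Cramer's rule for the identity matrix; it shows in particular that the Piola transform
  along the identity map changes nothing.\<close>

lemma det_replace_row_identity:
  fixes v :: "'m::finite \<Rightarrow> real"
  shows "det (\<chi> a b. if a = i then v b else (if a = b then 1 else 0)) = v i"
proof -
  have "det ((\<chi> k. if k = i then (\<Sum>j\<in>UNIV. (vec_lambda v)$j *s row j (mat 1 :: real^'m^'m)) else row k (mat 1 :: real^'m^'m)) :: real^'m^'m) = v i"
    by (simp add: cramer_lemma_transpose)
  moreover have "((\<chi> k. if k = i then (\<Sum>j\<in>UNIV. (vec_lambda v)$j *s row j (mat 1 :: real^'m^'m)) else row k (mat 1 :: real^'m^'m)) :: real^'m^'m)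
     = (\<chi> a b. if a = i then v b else (if a = b then 1 else 0))"
    by (auto simp: vec_eq_iff row_def mat_def if_distrib cong: if_cong)
  ultimately show ?thesis by simp
qed

text \<open>Jacobi's formula: both sides are the derivative at t = 0 of det (A (1 + t D)^T),
  computed row by row on the left, and through det A * det (1 + t D) on the right.\<close>

lemma sum_det_replace_row:
  fixes A D :: "real^'n^'n"
  shows "(\<Sum>i\<in>UNIV. det (\<chi> a b. if a = i then (D *v A$a)$b else A$a$b)) = trace D * det A"
proof -
  \<comment> \<open>The parameter t is played by one arbitrarily chosen coordinate of
    \<open>x\<close>, since \<open>c1\<close> is formulated for functions on the whole space and not
    on the line.\<close>
  obtain k :: 'n where True by simp
  define M where "M x = (\<chi> a b. (if a = b then 1 else 0) + x$k * D$a$b)" for x :: "real^'n"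
  have e: "c1 UNIV (\<lambda>x::real^'n. c + x$k * d) (\<lambda>j x. if j = k then d else 0)" for c d
    by (rule c1_eqI[OF c1_add[OF c1_const c1_mult[OF c1_coordinate c1_const]]]) auto
  have "c1 UNIV (\<lambda>x::real^'n. det (\<chi> a b. A$a$b + x$k * (D *v A$a)$b))
     (\<lambda>j x. \<Sum>i\<in>UNIV. det (\<chi> a b. if a = i then (if j = k then (D *v A$a)$b else 0) else A$a$b + x$k * (D *v A$a)$b))"
    by (rule c1_det[OF open_UNIV e])
  moreover have "c1 UNIV (\<lambda>x. det (\<chi> a b. A$a$b + x$k * (D *v A$a)$b)) (\<lambda>j x. det A * (\<Sum>i\<in>UNIV. det (\<chi> a b. if a = i then (if j = k then D$a$b else 0) else (if a = b then 1 else 0) + x$k * D$a$b)))"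
  proof (rule c1_eqI[OF c1_cmult[OF c1_det[OF open_UNIV e]]])
    fix x :: "real^'n"
    have "(\<chi> a b. A$a$b + x$k * (D *v A$a)$b) = A ** transpose (M x)"
      by (auto simp: vec_eq_iff matrix_matrix_mult_def transpose_def M_def matrix_vector_mult_def
          distrib_left sum.distrib sum_distrib_left mult_delta_right mult_ac)
    then show "det A * det (\<chi> a b. (if a = b then 1 else 0) + x$k * D$a$b) = det (\<chi> a b. A$a$b + x$k * (D *v A$a)$b)"
      by (simp add: det_mul M_def)
  qed auto
  ultimately have "(\<Sum>i\<in>UNIV. det (\<chi> a b. if a = i then (if k = k then (D *v A$a)$b else 0) else A$a$b + (0::real^'n)$k * (D *v A$a)$b))
     = det A * (\<Sum>i\<in>UNIV. det (\<chi> a b. if a = i then (if k = k then D$a$b else 0) else (if a = b then 1 else 0) + (0::real^'n)$k * D$a$b))"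
    by (rule c1_unique) simp
  moreover have "det (\<chi> a b. if a = i then D$a$b else (if a = b then 1 else 0)) = D$i$i" for i
  proof -
    have "(\<chi> a b. if a = i then D$a$b else (if a = b then 1 else 0)) = (\<chi> a b. if a = i then D$i$b else (if a = b then 1 else (0::real)))"
      by (auto simp: vec_eq_iff)
    then show ?thesis using det_replace_row_identity[of i "\<lambda>b. D$i$b"] by simp
  qed
  ultimately show ?thesis by (simp add: trace_def cong: if_cong)
qed

lemma det_swap_rows:
  fixes A :: "real^'n^'n"
  assumes "i \<noteq> j"
  shows "det (\<chi> a. A $ (Transposition.transpose i j a)) = - det A"
  using det_permute_rows[of "Transposition.transpose i j" A] assms
  by (simp add: permutes_swap_id sign_swap_id)

text \<open>By Cramer's rule, this is the \<open>i\<close>-th component of \<open>det(DF) (DF)\<^sup>-\<^sup>1 v\<close>, where \<open>F' b a\<close> is the \<open>a\<close>-th partial derivative of \<open>F\<^sub>b\<close>.\<close>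

definition piola :: "('n \<Rightarrow> 'n \<Rightarrow> real^'n \<Rightarrow> real) \<Rightarrow> ('n \<Rightarrow> real) \<Rightarrow> 'n \<Rightarrow> real^'n \<Rightarrow> real" where
  "piola F' v i x = det (\<chi> a b. if a = i then v b else F' b a x)"

text \<open>The derivative of row \<open>i\<close> itself contributes, after summation, the trace of
  the derivative of \<open>g\<close> times the determinant. The terms with another row
  differentiated contain mixed second derivatives of \<open>F\<close> and cancel in pairs, which
  expresses that the cofactor matrix is divergence-free.\<close>

theorem divergence_piola:
  fixes F :: "real^'n \<Rightarrow> real^'n"
  assumes F: "\<And>a. c1 UNIV (\<lambda>x. F x $ a) (F' a)" "\<And>a b. c1 UNIV (F' a b) (F'' a b)"
    and g: "\<And>a. c1 UNIV (g a) (g' a)"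
  shows "\<exists>V'. (\<forall>i. c1 UNIV (\<lambda>x. piola F' (\<lambda>a. g a (F x)) i x) (V' i)) \<and>
     (\<forall>x. (\<Sum>i\<in>UNIV. V' i i x) = det (\<chi> a b. F' b a x) * (\<Sum>a\<in>UNIV. g' a a (F x)))"
proof -
  define m where "m i a b x = (if a = i then g b (F x) else F' b a x)" for i a b x
  define m' where "m' i a b j x = (if a = i then (\<Sum>c\<in>UNIV. F' c j x * g' b c (F x)) else F'' b a j x)" for i a b j x
  have "c1 UNIV (\<lambda>x. g b (F x)) (\<lambda>j x. \<Sum>c\<in>UNIV. F' c j x *\<^sub>R g' b c (F x))" for b
    by (rule c1_chain[OF F(1) g]) simp
  then have m: "c1 UNIV (m i a b) (m' i a b)" for i a b
    by (cases "a = i") (auto simp: m_def[abs_def] m'_def[abs_def] F(2))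
  define V' where "V' i j x = (\<Sum>l\<in>UNIV. det (\<chi> a b. if a = l then m' i a b j x else m i a b x))" for i j x
  have sym: "F'' b i l x = F'' b l i x" for b i l x
    by (rule mixed_partials_commute[OF F(1) F(2)]) auto
  show ?thesis
  proof (intro exI[of _ V'] conjI allI)
    have "(\<lambda>x. piola F' (\<lambda>a. g a (F x)) i x) = (\<lambda>x. det (\<chi> a b. m i a b x))" for i
      by (simp add: piola_def m_def)
    then show "c1 UNIV (\<lambda>x. piola F' (\<lambda>a. g a (F x)) i x) (V' i)" for i
      using c1_det[OF open_UNIV, of "m i" "m' i"] m V'_def[abs_def, of ] by (simp add: V'_def[abs_def])
    fix x
    \<comment> \<open>\<open>T i l\<close> is the part of the i-th derivative of the i-th component
      in which row \<open>l\<close> is differentiated. Its rows \<open>i\<close> and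
      \<open>l\<close> hold \<open>g\<close> and a mixed second derivative in the directions
      \<open>i\<close> and \<open>l\<close>, so exchanging \<open>i\<close> and \<open>l\<close>
      swaps two rows and changes the sign.\<close>
    define T where "T i l = (if l = i then 0 else det (\<chi> a b. if a = l then F'' b l i x else if a = i then g b (F x) else F' b a x))" for i l
    have T: "T i l = - T l i" for i l
    proof (cases "l = i")
      case False
      define X where "X = (\<chi> a b. if a = i then F'' b l i x else if a = l then g b (F x) else F' b a x)"
      have "(\<chi> a b. if a = l then F'' b l i x else if a = i then g b (F x) else F' b a x) =
         (\<chi> a. X $ (Transposition.transpose i l a))"
        using False by (auto simp: vec_eq_iff X_def Transposition.transpose_def)
      moreover have "X = (\<chi> a b. if a = i then F'' b i l x else if a = l then g b (F x) else F' b a x)"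
        using sym by (auto simp: vec_eq_iff X_def)
      ultimately show ?thesis using False det_swap_rows[of i l X] by (simp add: T_def)
    qed (simp add: T_def)
    have "(\<Sum>i\<in>UNIV. \<Sum>l\<in>UNIV. T i l) = (\<Sum>i\<in>UNIV. \<Sum>l\<in>UNIV. T l i)" by (rule sum.swap)
    also have "\<dots> = - (\<Sum>i\<in>UNIV. \<Sum>l\<in>UNIV. T i l)"
      unfolding sum_negf[symmetric] by (intro sum.cong refl T)
    finally have T0: "(\<Sum>i\<in>UNIV. \<Sum>l\<in>UNIV. T i l) = 0" by simp
    define A where "A = (\<chi> a b. F' b a x)"
    define D where "D = (\<chi> b c. g' b c (F x))"
    have V: "V' i i x = det (\<chi> a b. if a = i then (D *v A$a)$b else A$a$b) + (\<Sum>l\<in>UNIV. T i l)" for i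
    proof -
      have 1: "(\<chi> a b. if a = i then m' i a b i x else m i a b x) = (\<chi> a b. if a = i then (D *v A$a)$b else A$a$b)"
        by (auto simp: vec_eq_iff m'_def m_def A_def D_def matrix_vector_mult_def mult.commute)
      have 2: "det (\<chi> a b. if a = l then m' i a b i x else m i a b x) = T i l" if "l \<noteq> i" for l
      proof -
        have "(\<chi> a b. if a = l then m' i a b i x else m i a b x) = (\<chi> a b. if a = l then F'' b l i x else if a = i then g b (F x) else F' b a x)"
          using that by (auto simp: vec_eq_iff m'_def m_def)
        then show ?thesis using that by (simp add: T_def)
      qed
      have "V' i i x = det (\<chi> a b. if a = i then m' i a b i x else m i a b x) + (\<Sum>l\<in>UNIV-{i}. T i l)"
        unfolding V'_def by (subst sum.remove[of _ i]) (use 2 in auto)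
      also have "(\<Sum>l\<in>UNIV-{i}. T i l) = (\<Sum>l\<in>UNIV. T i l)"
        by (rule sum.mono_neutral_left) (auto simp: T_def)
      finally show ?thesis using 1 by simp
    qed
    have "(\<Sum>i\<in>UNIV. V' i i x) = trace D * det A"
      unfolding V sum.distrib T0 sum_det_replace_row by simp
    then show "(\<Sum>i\<in>UNIV. V' i i x) = det (\<chi> a b. F' b a x) * (\<Sum>a\<in>UNIV. g' a a (F x))"
      by (simp add: trace_def A_def D_def mult.commute)
  qed
qed

section \<open>Test functions of class C1\<close>

lemma locally_integrable_ball:
  "locally_integrable_on UNIV a \<Longrightarrow> integrable lebesgue (\<lambda>x. indicat_real (cball 0 R) x *\<^sub>R a x)"
  unfolding locally_integrable_on_def using integrable_restrict_space[of "cball 0 R" lebesgue a]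
  by (auto simp: lmeasurable_cball fmeasurableD)

lemma locally_integrable_cc:
  fixes a :: "real^'n \<Rightarrow> complex"
  assumes a: "locally_integrable_on UNIV a" and f: "cc R (f :: real^'n \<Rightarrow> real)" and B: "\<And>x. \<bar>f x\<bar> \<le> B"
  shows "integrable lebesgue (\<lambda>x. a x * of_real (f x))"
    and "norm (LINT x|lebesgue. a x * of_real (f x)) \<le> B * (LINT x|lebesgue. norm (indicat_real (cball 0 R) x *\<^sub>R a x))"
proof -
  note i = locally_integrable_ball[OF a, of R]
  have fm: "f \<in> borel_measurable lebesgue"
    using cc_integrable[OF f] by (intro measurable_completion) auto
  have eq: "a x * of_real (f x) = (indicat_real (cball 0 R) x *\<^sub>R a x) * of_real (f x)" for x
    using cc_zero[OF f, of x] by (auto simp: indicator_def)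
  have bd: "norm (a x * of_real (f x)) \<le> B * norm (indicat_real (cball 0 R) x *\<^sub>R a x)" for x
    unfolding eq norm_mult using mult_left_mono[OF B[of x] norm_ge_zero[of "indicat_real (cball 0 R) x *\<^sub>R a x"]]
    by (simp add: mult.commute)
  have m: "(\<lambda>x. a x * of_real (f x)) \<in> borel_measurable lebesgue"
    unfolding eq by (intro borel_measurable_times borel_measurable_integrable[OF i] measurable_compose[OF fm]) simp
  show I: "integrable lebesgue (\<lambda>x. a x * of_real (f x))"
  proof (rule Bochner_Integration.integrable_bound[OF _ m])
    show "integrable lebesgue (\<lambda>x. B * norm (indicat_real (cball 0 R) x *\<^sub>R a x))"
      by (rule integrable_mult_right[OF integrable_norm[OF i]])
    show "AE x in lebesgue. norm (a x * of_real (f x)) \<le> norm (B * norm (indicat_real (cball 0 R) x *\<^sub>R a x))"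
      using order_trans[OF bd abs_ge_self] by simp
  qed
  have "norm (LINT x|lebesgue. a x * of_real (f x)) \<le> (LINT x|lebesgue. B * norm (indicat_real (cball 0 R) x *\<^sub>R a x))"
    by (rule Bochner_Integration.integral_norm_bound_integral[OF I]) (rule integrable_mult_right[OF integrable_norm[OF i]], rule bd)
  then show "norm (LINT x|lebesgue. a x * of_real (f x)) \<le> B * (LINT x|lebesgue. norm (indicat_real (cball 0 R) x *\<^sub>R a x))"
    by simp
qed

lemma test_function_of_real:
  fixes t :: "real^'n \<Rightarrow> real"
  assumes "\<And>m. Ck_on m UNIV t" "cc R t"
  shows "test_function UNIV (\<lambda>x. complex_of_real (t x))"
  unfolding test_function_def
proof (intro conjI allI exI[of _ "cball 0 R"])
  show "Ck_on m UNIV (\<lambda>x. complex_of_real (t x))" for m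
    by (rule Ck_on_bounded_linear[OF bounded_linear_of_real assms(1)])
  show "x \<notin> cball 0 R \<longrightarrow> complex_of_real (t x) = 0" for x using cc_zero[OF assms(2), of x] by simp
qed auto

text \<open>Both sides are continuous in \<open>W\<close> for the C1 sup norm on a fixed ball,
  because the coefficients are integrable there; smooth approximations of \<open>W\<close> therefore
  suffice.\<close>

proposition weak_identity_c1:
  fixes a :: "'n \<Rightarrow> real^'n \<Rightarrow> complex"
  assumes a: "\<And>j. locally_integrable_on UNIV (a j)" and b: "locally_integrable_on UNIV b"
    and H: "\<And>\<phi>. test_function UNIV \<phi> \<Longrightarrow> (\<Sum>j\<in>UNIV. LINT x|lebesgue. a j x * partial j \<phi> x) + (LINT x|lebesgue. b x * \<phi> x) = 0"
    and W: "c1 UNIV W W'" "cc R W"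
  shows "(\<Sum>j\<in>UNIV. LINT x|lebesgue. a j x * of_real (W' j x)) + (LINT x|lebesgue. b x * of_real (W x)) = 0" (is "?L = 0")
proof -
  have ccW': "cc R (W' j)" for j by (rule c1_cc_partial[OF W(1)]) (rule cc_zero[OF W(2)])
  \<comment> \<open>The L1 norms of the coefficients over the ball of radius \<open>R + 1\<close>,
    which contains the supports of \<open>W\<close> and of all its approximations.\<close>
  define C where "C = (\<Sum>j\<in>UNIV. LINT x|lebesgue. norm (indicat_real (cball 0 (R+1)) x *\<^sub>R a j x))
     + (LINT x|lebesgue. norm (indicat_real (cball 0 (R+1)) x *\<^sub>R b x))"
  have "C \<ge> 0" unfolding C_def by (intro add_nonneg_nonneg sum_nonneg Bochner_Integration.integral_nonneg) auto
  have bound: "norm ?L \<le> e * C" if e: "e > 0" for e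
  proof -
    obtain t where t: "\<And>m. Ck_on m UNIV t" "cc (R + 1) t" "\<And>x. \<bar>t x - W x\<bar> \<le> e"
      "\<And>j x. \<bar>frechet_derivative t (at x) (axis j 1) - W' j x\<bar> \<le> e"
      using smooth_approximation[OF W e] by blast
    obtain t' where t': "c1 UNIV t t'" by (rule Ck_on_c1E[OF t(1)[of "Suc 0"]]) blast
    have cct': "cc (R+1) (t' j)" for j by (rule c1_cc_partial[OF t']) (rule cc_zero[OF t(2)])
    have pt: "partial j (\<lambda>x. complex_of_real (t x)) x = of_real (t' j x)" for j x
      using c1_partial[OF c1_of_real[OF t']] by simp
    have d1: "cc (R+1) (\<lambda>x. W x - t x)" "\<bar>W x - t x\<bar> \<le> e" for x
      using t(2,3) cc_mono[OF W(2), of "R+1"] by (auto intro: cc_diff simp: abs_minus_commute)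
    have d2: "cc (R+1) (\<lambda>x. W' j x - t' j x)" "\<bar>W' j x - t' j x\<bar> \<le> e" for j x
      using cct' t(4)[of x j] cc_mono[OF ccW', of "R+1"] by (auto intro: cc_diff simp: abs_minus_commute c1_frechet[OF t'])
    have bdd: "\<exists>B. \<forall>x. \<bar>f x\<bar> \<le> B" if "cc r f" for r and f :: "real^'n \<Rightarrow> real"
      using cc_bounded[OF that] by (metis real_norm_def)
    have int: "integrable lebesgue (\<lambda>x. c x * of_real (f x))" if "locally_integrable_on UNIV c" "cc r f" for r and c :: "real^'n \<Rightarrow> complex" and f :: "real^'n \<Rightarrow> real"
      using bdd[OF that(2)] locally_integrable_cc(1)[OF that] by blast
    have "(\<Sum>j\<in>UNIV. LINT x|lebesgue. a j x * of_real (t' j x)) + (LINT x|lebesgue. b x * of_real (t x)) = 0"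
      using H[OF test_function_of_real[OF t(1,2)]] by (simp add: pt)
    then have "?L = (\<Sum>j\<in>UNIV. (LINT x|lebesgue. a j x * of_real (W' j x)) - (LINT x|lebesgue. a j x * of_real (t' j x)))
       + ((LINT x|lebesgue. b x * of_real (W x)) - (LINT x|lebesgue. b x * of_real (t x)))"
      by (simp add: sum_subtractf algebra_simps)
    also have "\<dots> = (\<Sum>j\<in>UNIV. LINT x|lebesgue. a j x * of_real (W' j x - t' j x)) + (LINT x|lebesgue. b x * of_real (W x - t x))"
      using int[OF a ccW'] int[OF a cct'] int[OF b W(2)] int[OF b t(2)]
      by (simp add: right_diff_distrib)
    also have "norm \<dots> \<le> (\<Sum>j\<in>UNIV. e * (LINT x|lebesgue. norm (indicat_real (cball 0 (R+1)) x *\<^sub>R a j x)))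
        + e * (LINT x|lebesgue. norm (indicat_real (cball 0 (R+1)) x *\<^sub>R b x))"
      by (intro order_trans[OF norm_triangle_ineq] add_mono sum_norm_le
          locally_integrable_cc(2)[OF a d2] locally_integrable_cc(2)[OF b d1])
    also have "\<dots> = e * C" by (simp add: C_def sum_distrib_left distrib_left)
    finally show ?thesis .
  qed
  have "norm ?L \<le> 0"
  proof (rule field_le_epsilon)
    fix e :: real assume "e > 0"
    have "norm ?L \<le> e / (C + 1) * C" using \<open>e > 0\<close> \<open>C \<ge> 0\<close> by (intro bound) simp
    also have "\<dots> \<le> e" using \<open>e > 0\<close> \<open>C \<ge> 0\<close> by (simp add: field_simps)
    finally show "norm ?L \<le> 0 + e" by simp
  qed
  then show ?thesis by simp
qed

section \<open>Cut-off functions\<close>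

text \<open>Truncated powers: the derivative of \<open>mp n\<close> is \<open>n\<close> times
  \<open>mp (n - 1)\<close> for n >= 2. They give piecewise polynomial cut-offs of class C2 whose
  derivatives have explicit numerical bounds, needed for the constants below.\<close>

definition mp :: "nat \<Rightarrow> real \<Rightarrow> real" where "mp n t = max 0 t ^ n"

lemma mp_nonneg: "mp n t \<ge> 0" by (simp add: mp_def)

lemma mp_nonpos: "t \<le> 0 \<Longrightarrow> n > 0 \<Longrightarrow> mp n t = 0" by (simp add: mp_def)

lemma continuous_mp [continuous_intros]: "continuous_on S f \<Longrightarrow> continuous_on S (\<lambda>x. mp n (f x))"
  unfolding mp_def by (intro continuous_intros)

lemma mp_derivative: "(mp (Suc (Suc n)) has_real_derivative real (n + 2) * mp (Suc n) t) (at t)"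
proof -
  consider "t > 0" | "t < 0" | "t = 0" by linarith
  then show ?thesis
  proof cases
    case 1
    have "\<forall>\<^sub>F s in nhds t. mp (Suc (Suc n)) s = s ^ (Suc (Suc n))"
      using eventually_nhds_in_open[of "{0<..}" t] 1 by (auto elim!: eventually_mono simp: mp_def)
    moreover have "((\<lambda>s. s ^ (Suc (Suc n))) has_real_derivative real (n + 2) * mp (Suc n) t) (at t)"
      using DERIV_pow[of "Suc (Suc n)" t] 1 by (simp add: mp_def)
    ultimately show ?thesis by (subst DERIV_cong_ev[OF refl _ refl])
  next
    case 2
    have "\<forall>\<^sub>F s in nhds t. mp (Suc (Suc n)) s = 0"
      using eventually_nhds_in_open[of "{..<0}" t] 2 by (auto elim!: eventually_mono simp: mp_def)
    then show ?thesis
      by (subst DERIV_cong_ev[OF refl _ refl, where g="\<lambda>s. 0"]) (use 2 in \<open>auto simp: mp_def\<close>)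
  next
    case 3
    have "(\<lambda>h. mp (Suc n) h * (max 0 h / h)) \<midarrow>0\<rightarrow> 0"
    proof (rule Lim_null_comparison)
      show "\<forall>\<^sub>F h in at 0. norm (mp (Suc n) h * (max 0 h / h)) \<le> \<bar>h\<bar> ^ Suc n"
        by (intro always_eventually allI) (auto simp: mp_def max_def intro!: mult_nonpos_nonneg)
      have "isCont (\<lambda>h::real. \<bar>h\<bar> ^ Suc n) 0" by (intro continuous_intros)
      then show "(\<lambda>h::real. \<bar>h\<bar> ^ Suc n) \<midarrow>0\<rightarrow> 0" by (simp add: isCont_def)
    qed
    then show ?thesis using 3 by (simp add: DERIV_def mp_def mult_ac)
  qed
qed

lemma mp_has_derivative [derivative_intros]:
  assumes "(f has_real_derivative f') (at x within S)" "D = real (n + 2) * mp (Suc n) (f x) * f'"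
  shows "((\<lambda>x. mp (Suc (Suc n)) (f x)) has_real_derivative D) (at x within S)"
  using DERIV_chain2[OF mp_derivative assms(1)] assms(2) by simp

text \<open>A decreasing step of class C2 from 1 on u <= 1 to 0 on u >= 2: the inner cube makes the
  junction at 1 smooth to second order, the outer cube the junction at 2.\<close>

definition plateau :: "real \<Rightarrow> real" where "plateau u = mp 3 (1 - mp 3 (u - 1))"
definition plateau' :: "real \<Rightarrow> real" where "plateau' u = - 9 * mp 2 (1 - mp 3 (u - 1)) * mp 2 (u - 1)"
definition plateau'' :: "real \<Rightarrow> real" where
  "plateau'' u = 54 * mp 1 (1 - mp 3 (u - 1)) * mp 2 (u - 1) * mp 2 (u - 1) - 18 * mp 2 (1 - mp 3 (u - 1)) * mp 1 (u - 1)"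

lemma plateau_derivative: "(plateau has_real_derivative plateau' u) (at u)"
  unfolding plateau_def[abs_def] plateau'_def numeral_3_eq_3 numeral_2_eq_2
  by (rule derivative_eq_intros refl | simp)+

lemma plateau'_derivative: "(plateau' has_real_derivative plateau'' u) (at u)"
  unfolding plateau'_def[abs_def] plateau''_def numeral_3_eq_3 numeral_2_eq_2 One_nat_def
  by (rule derivative_eq_intros refl | simp add: algebra_simps)+

lemma continuous_plateau [continuous_intros]:
  "continuous_on S f \<Longrightarrow> continuous_on S (\<lambda>x. plateau (f x))"
  "continuous_on S f \<Longrightarrow> continuous_on S (\<lambda>x. plateau' (f x))"
  "continuous_on S f \<Longrightarrow> continuous_on S (\<lambda>x. plateau'' (f x))"
  unfolding plateau_def plateau'_def plateau''_def by (intro continuous_intros; assumption)+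

lemma plateau_low: "u \<le> 1 \<Longrightarrow> plateau u = 1" "u \<le> 1 \<Longrightarrow> plateau' u = 0" "u \<le> 1 \<Longrightarrow> plateau'' u = 0"
  by (auto simp: plateau_def plateau'_def plateau''_def mp_def)

lemma mp3_ge_1: "u \<ge> 2 \<Longrightarrow> 1 - mp 3 (u - 1) \<le> 0"
  by (simp add: mp_def one_le_power)

lemma plateau_high: "u \<ge> 2 \<Longrightarrow> plateau u = 0" "u \<ge> 2 \<Longrightarrow> plateau' u = 0" "u \<ge> 2 \<Longrightarrow> plateau'' u = 0"
  using mp3_ge_1[of u] by (auto simp: plateau_def plateau'_def plateau''_def mp_nonpos)

lemma plateau_bounds: "0 \<le> plateau u" "plateau u \<le> 1" "\<bar>plateau' u\<bar> \<le> 9" "plateau' u \<le> 0"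
proof -
  show "0 \<le> plateau u" by (simp add: plateau_def mp_nonneg)
  have *: "1 - mp 3 (u - 1) \<le> 1" by (simp add: mp_nonneg)
  then have m: "max 0 (1 - mp 3 (u - 1)) \<le> 1" by simp
  show "plateau u \<le> 1" unfolding plateau_def mp_def[of 3 "1 - _"] using m by (simp add: power_le_one)
  show "plateau' u \<le> 0" by (simp add: plateau'_def mp_nonneg)
  show "\<bar>plateau' u\<bar> \<le> 9"
  proof (cases "u \<le> 2")
    case True
    have "mp 2 (1 - mp 3 (u - 1)) \<le> 1" unfolding mp_def[of 2] using m by (simp add: power_le_one)
    moreover have "mp 2 (u - 1) \<le> 1" unfolding mp_def using True by (simp add: power_le_one)
    ultimately have "mp 2 (1 - mp 3 (u - 1)) * mp 2 (u - 1) \<le> 1" by (intro mult_le_one mp_nonneg)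
    then show ?thesis by (simp add: plateau'_def abs_mult mp_nonneg)
  qed (simp add: plateau_high)
qed

text \<open>Equal to 0 for |s| <= d and to s for |s| >= 2 d. Passing through the square of s/d
  avoids the absolute value, so no regularity is lost at 0.\<close>

definition trunc :: "real \<Rightarrow> real \<Rightarrow> real" where "trunc d s = s * (1 - plateau ((s/d)\<^sup>2))"
definition trunc' :: "real \<Rightarrow> real \<Rightarrow> real" where
  "trunc' d s = 1 - plateau ((s/d)\<^sup>2) - 2 * (s/d)\<^sup>2 * plateau' ((s/d)\<^sup>2)"
definition trunc'' :: "real \<Rightarrow> real \<Rightarrow> real" where
  "trunc'' d s = - (6 * s / d\<^sup>2) * plateau' ((s/d)\<^sup>2) - 4 * (s/d)\<^sup>2 * (s / d\<^sup>2) * plateau'' ((s/d)\<^sup>2)"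

lemma trunc_derivative:
  assumes "d > 0"
  shows "(trunc d has_real_derivative trunc' d s) (at s)" "(trunc' d has_real_derivative trunc'' d s) (at s)"
proof -
  note p = DERIV_chain2[OF plateau_derivative] DERIV_chain2[OF plateau'_derivative]
  show "(trunc d has_real_derivative trunc' d s) (at s)"
    unfolding trunc_def[abs_def] trunc'_def using assms
    by (auto intro!: derivative_eq_intros p simp: power2_eq_square field_simps)
  show "(trunc' d has_real_derivative trunc'' d s) (at s)"
    unfolding trunc'_def[abs_def] trunc''_def using assms
    by (auto intro!: derivative_eq_intros p simp: power2_eq_square field_simps)
qed

lemma continuous_trunc [continuous_intros]:
  "d > 0 \<Longrightarrow> continuous_on S f \<Longrightarrow> continuous_on S (\<lambda>x. trunc d (f x))"
  "d > 0 \<Longrightarrow> continuous_on S f \<Longrightarrow> continuous_on S (\<lambda>x. trunc' d (f x))"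
  "d > 0 \<Longrightarrow> continuous_on S f \<Longrightarrow> continuous_on S (\<lambda>x. trunc'' d (f x))"
  unfolding trunc_def trunc'_def trunc''_def by (intro continuous_intros; simp)+

lemma trunc_small:
  assumes "\<bar>s\<bar> \<le> d" "d > 0" shows "trunc d s = 0" "trunc' d s = 0"
proof -
  have "(s/d)\<^sup>2 \<le> 1" using assms by (simp add: power_divide abs_le_square_iff[symmetric])
  then show "trunc d s = 0" "trunc' d s = 0" by (auto simp: trunc_def trunc'_def plateau_low)
qed

lemma trunc_large:
  assumes "2 * d \<le> \<bar>s\<bar>" "d > 0" shows "trunc d s = s" "trunc' d s = 1"
proof -
  have "(2 * d)\<^sup>2 \<le> s\<^sup>2" using power_mono[OF assms(1), of 2] assms(2) by simp
  then have "4 * d\<^sup>2 \<le> s\<^sup>2" by (simp add: power_mult_distrib)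
  then have "2 * d\<^sup>2 \<le> s\<^sup>2" using zero_le_power2[of d] by linarith
  then have "(s/d)\<^sup>2 \<ge> 2" using assms by (simp add: power_divide field_simps)
  then show "trunc d s = s" "trunc' d s = 1" by (auto simp: trunc_def trunc'_def plateau_high)
qed

text \<open>The bound is free of \<open>d\<close> because \<open>trunc' d s\<close> depends on s/d
  only. The number is 1 + 2 * 2 * 9: where \<open>plateau'\<close> does not vanish the square of s/d
  is at most 2, and |\<open>plateau'\<close>| is at most 9.\<close>

lemma trunc'_bound: "\<bar>trunc' d s\<bar> \<le> 37"
proof -
  have "\<bar>2 * (s/d)\<^sup>2 * plateau' ((s/d)\<^sup>2)\<bar> \<le> 36"
  proof (cases "(s/d)\<^sup>2 \<le> 2")
    case True
    have "(s/d)\<^sup>2 * \<bar>plateau' ((s/d)\<^sup>2)\<bar> \<le> 2 * 9"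
      using True plateau_bounds(3) by (intro mult_mono) auto
    then show ?thesis by (simp add: abs_mult)
  qed (simp add: plateau_high)
  then show ?thesis using plateau_bounds[of "(s/d)\<^sup>2"] unfolding trunc'_def by linarith
qed

lemma trunc_close:
  assumes "d > 0" shows "\<bar>trunc d s - s\<bar> \<le> 2 * d"
proof (cases "2 * d \<le> \<bar>s\<bar>")
  case True
  then show ?thesis using trunc_large assms by simp
next
  case False
  have "\<bar>trunc d s - s\<bar> = \<bar>s\<bar> * plateau ((s/d)\<^sup>2)"
    using plateau_bounds(1)[of "(s/d)\<^sup>2"] by (simp add: trunc_def algebra_simps abs_mult)
  also have "\<dots> \<le> \<bar>s\<bar> * 1" using plateau_bounds(2) by (intro mult_left_mono) auto
  finally show ?thesis using False by simp
qed

section \<open>Lipschitz graphs are null sets\<close>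

text \<open>The orthogonal projection maps \<open>Z\<close> injectively into a hyperplane, which is
  a null set, and the hypothesis makes the inverse Lipschitz; Lipschitz maps preserve null
  sets.\<close>

lemma negligible_lipschitz_graph:
  fixes Z :: "(real^'n) set"
  assumes e: "norm e = 1" and C: "\<And>x y. x \<in> Z \<Longrightarrow> y \<in> Z \<Longrightarrow> norm (x - y) \<le> C * norm ((x - (x \<bullet> e) *\<^sub>R e) - (y - (y \<bullet> e) *\<^sub>R e))"
  shows "negligible Z"
proof -
  define \<pi> where "\<pi> x = x - (x \<bullet> e) *\<^sub>R e" for x :: "real^'n"
  have inj: "inj_on \<pi> Z"
    using C by (auto simp: inj_on_def \<pi>_def) fastforce
  have ee: "e \<bullet> e = 1" using e by (simp add: dot_square_norm)
  have "\<pi> ` Z \<subseteq> {y. e \<bullet> y = 0}"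
    using ee by (auto simp: \<pi>_def inner_diff_right inner_commute)
  moreover have "negligible {y. e \<bullet> y = 0}" by (rule negligible_hyperplane) (use e in auto)
  ultimately have neg: "negligible (\<pi> ` Z)" using negligible_subset by blast
  have "negligible (inv_into Z \<pi> ` (\<pi> ` Z))"
  proof (rule negligible_locally_Lipschitz_image[OF order_refl neg])
    fix y assume "y \<in> \<pi> ` Z"
    show "\<exists>T B. open T \<and> y \<in> T \<and> (\<forall>z\<in>\<pi> ` Z \<inter> T. norm (inv_into Z \<pi> z - inv_into Z \<pi> y) \<le> B * norm (z - y))"
    proof (intro exI[of _ UNIV] exI[of _ C] conjI ballI)
      fix z assume "z \<in> \<pi> ` Z \<inter> UNIV"
      then obtain a where a: "a \<in> Z" "z = \<pi> a" by auto
      obtain b where b: "b \<in> Z" "y = \<pi> b" using \<open>y \<in> \<pi> ` Z\<close> by auto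
      show "norm (inv_into Z \<pi> z - inv_into Z \<pi> y) \<le> C * norm (z - y)"
        using C[OF a(1) b(1)] a b inv_into_f_f[OF inj] by (simp add: \<pi>_def[symmetric])
    qed auto
  qed
  moreover have "inv_into Z \<pi> ` (\<pi> ` Z) = Z"
    using inv_into_f_f[OF inj] by force
  ultimately show ?thesis by simp
qed

text \<open>The quantitative core of the implicit function theorem. Near a zero with nonvanishing
  b-th partial derivative, two zeros cannot differ mainly in coordinate \<open>b\<close>, so the
  zeros form a Lipschitz graph over the other coordinates.\<close>

lemma negligible_c1_zero_set:
  fixes v :: "real^'n \<Rightarrow> real"
  assumes v: "c1 S v v'" and "open S"
  shows "negligible {x\<in>S. v x = 0 \<and> v' b x \<noteq> 0}" (is "negligible ?N")
proof (subst locally_negligible_alt, intro ballI)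
  fix x0 assume x0: "x0 \<in> ?N"
  define c where "c = \<bar>v' b x0\<bar>"
  have c: "c > 0" using x0 by (simp add: c_def)
  \<comment> \<open>Summed over the \<open>CARD('n)\<close> coordinates this becomes a Lipschitz
    constant of c/2, half the size of the derivative in direction \<open>b\<close>, so that it can
    be absorbed below.\<close>
  define \<epsilon> where "\<epsilon> = c / (2 * real CARD('n))"
  have \<epsilon>: "\<epsilon> > 0" using c by (simp add: \<epsilon>_def)
  have "\<exists>d>0. \<forall>y. dist y x0 < d \<longrightarrow> dist (v' j y) (v' j x0) < \<epsilon>" for j
    using c1_continuous_partial[OF v, of j] x0 \<open>open S\<close> \<epsilon>
    by (auto simp: continuous_on_eq_continuous_at continuous_at_eps_delta)
  then obtain d where d: "\<And>j. d j > 0" "\<And>j y. dist y x0 < d j \<Longrightarrow> dist (v' j y) (v' j x0) < \<epsilon>" by metis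
  obtain d0 where d0: "d0 > 0" "ball x0 d0 \<subseteq> S" using x0 \<open>open S\<close> open_contains_ball by blast
  define r where "r = min d0 (Min (range d))"
  have r: "r > 0" "r \<le> d0" "r \<le> d j" for j using d(1) d0(1) by (auto simp: r_def min.coboundedI2)
  define B where "B = ball x0 r"
  have BS: "B \<subseteq> S" using d0 r by (auto simp: B_def)
  \<comment> \<open>\<open>v\<close> minus its linear part at \<open>x0\<close>: its partial
    derivatives are small near \<open>x0\<close>, and between two zeros of \<open>v\<close> its
    increment is minus the linear part.\<close>
  define w where "w x = v x - (\<Sum>j\<in>UNIV. x$j * v' j x0)" for x
  have w: "c1 B w (\<lambda>j x. v' j x - v' j x0)"
  proof -
    have "c1 B w (\<lambda>j x. v' j x - (\<Sum>i\<in>UNIV. (x$i * 0 + (if j = i then 1 else 0) * v' i x0)))"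
      unfolding w_def by (intro c1_diff c1_subset[OF v BS] c1_sum c1_mult c1_coordinate c1_const)
    then show ?thesis by (simp add: if_distribR if_distrib cong: if_cong)
  qed
  define M where "M = (\<Sum>j\<in>UNIV. \<bar>v' j x0\<bar>)"
  have "negligible (?N \<inter> B)"
  proof (rule negligible_lipschitz_graph)
    show "norm (axis b (1::real)) = 1" by simp
    fix x y assume xy: "x \<in> ?N \<inter> B" "y \<in> ?N \<inter> B"
    define h where "h = x - y"
    define p where "p = h - h$b *\<^sub>R axis b 1"
    have p_eq: "(x - (x \<bullet> axis b 1) *\<^sub>R axis b 1) - (y - (y \<bullet> axis b 1) *\<^sub>R axis b 1) = p"
      by (simp add: p_def h_def inner_axis algebra_simps)
    have "norm (w x - w y) \<le> (\<Sum>j\<in>(UNIV::'n set). \<epsilon>) * norm (x - y)"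
    proof (rule c1_lipschitz[OF w])
      show "convex B" "x \<in> B" "y \<in> B" using xy by (auto simp: B_def)
      show "norm (v' j z - v' j x0) \<le> \<epsilon>" if "z \<in> B" for j z
        using d(2)[of z j] r(3)[of j] that by (simp add: B_def dist_norm norm_minus_commute)
    qed
    also have "(\<Sum>j\<in>(UNIV::'n set). \<epsilon>) = c / 2" by (simp add: \<epsilon>_def)
    also have "w x - w y = - (\<Sum>j\<in>UNIV. h$j * v' j x0)"
      using xy by (simp add: w_def h_def sum_subtractf left_diff_distrib)
    finally have 1: "\<bar>\<Sum>j\<in>UNIV. h$j * v' j x0\<bar> \<le> c / 2 * norm h" by (simp add: h_def)
    have "(\<Sum>j\<in>UNIV. p$j * v' j x0) = (\<Sum>j\<in>UNIV. h$j * v' j x0 - (axis b 1)$j * (h$b * v' j x0))"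
      by (intro sum.cong refl) (simp add: p_def algebra_simps)
    also have "\<dots> = (\<Sum>j\<in>UNIV. h$j * v' j x0) - h$b * v' b x0"
      using sum_axis_nth[of b "\<lambda>j. h$b * v' j x0"] by (simp add: sum_subtractf)
    finally have 2: "h$b * v' b x0 = (\<Sum>j\<in>UNIV. h$j * v' j x0) - (\<Sum>j\<in>UNIV. p$j * v' j x0)" by simp
    have 3: "\<bar>\<Sum>j\<in>UNIV. p$j * v' j x0\<bar> \<le> norm p * M"
      using norm_sum_coordinates_le[of p "\<lambda>j. v' j x0"] by (simp add: M_def)
    have "\<bar>h$b\<bar> * c = \<bar>h$b * v' b x0\<bar>" by (simp add: c_def abs_mult)
    \<comment> \<open>The term c/2 * norm h is absorbed into c * norm h on the left once norm h is
      bounded by norm p plus the b-th component, which leaves norm h controlled by the projection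
      \<open>p\<close>.\<close>
    then have 4: "\<bar>h$b\<bar> * c \<le> c / 2 * norm h + norm p * M" using 1 2 3 by linarith
    have "h = p + h$b *\<^sub>R axis b 1" by (simp add: p_def)
    then have 5: "norm h \<le> norm p + \<bar>h$b\<bar>" using norm_triangle_ineq[of p "h$b *\<^sub>R axis b 1"] by simp
    then have "c * norm h \<le> c * norm p + \<bar>h$b\<bar> * c" using c by (metis distrib_left mult.commute mult_left_mono less_imp_le)
    then have "c / 2 * norm h \<le> (c + M) * norm p" using 4 by (simp add: algebra_simps)
    then have "norm h \<le> (c + M) / (c / 2) * norm p" using c by (simp add: field_simps)
    then show "norm (x - y) \<le> (c + M) / (c / 2) * norm ((x - (x \<bullet> axis b 1) *\<^sub>R axis b 1) - (y - (y \<bullet> axis b 1) *\<^sub>R axis b 1))"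
      unfolding p_eq h_def .
  qed
  moreover have "openin (top_of_set ?N) (?N \<inter> B)" unfolding B_def by (rule openin_open_Int) simp
  moreover have "x0 \<in> ?N \<inter> B" using x0 r by (simp add: B_def)
  ultimately show "\<exists>U. openin (top_of_set ?N) U \<and> x0 \<in> U \<and> negligible U" by blast
qed

text \<open>Near \<open>p\<close> the frontier lies on the graph of \<open>g\<close>: its points are
  not above the graph because \<open>S\<close> is open and does not meet its frontier, and not below
  because the points strictly below form an open set disjoint from \<open>S\<close>.\<close>

lemma negligible_lipschitz_boundary:
  fixes S :: "(real^'n) set"
  assumes "open S" "lipschitz_boundary S"
  shows "negligible (frontier S)"
proof (subst locally_negligible_alt, intro ballI)
  fix p assume p: "p \<in> frontier S"
  obtain e r L g where e: "norm e = 1" "r > 0" "L-lipschitz_on {y. y \<bullet> e = 0} g"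
    and S: "\<And>x. x \<in> ball p r \<Longrightarrow> x \<in> S \<longleftrightarrow> g (x - (x \<bullet> e) *\<^sub>R e) < x \<bullet> e"
    using assms(2) p unfolding lipschitz_boundary_def by blast
  have ee: "e \<bullet> e = 1" using e by (simp add: dot_square_norm)
  define \<pi> where "\<pi> x = x - (x \<bullet> e) *\<^sub>R e" for x
  have \<pi>: "\<pi> x \<in> {y. y \<bullet> e = 0}" for x using ee by (simp add: \<pi>_def inner_diff_left)
  have lip: "\<bar>g (\<pi> x) - g (\<pi> y)\<bar> \<le> L * norm (\<pi> x - \<pi> y)" for x y
    using lipschitz_onD[OF e(3) \<pi> \<pi>, of x y] by (simp add: dist_norm)
  have cont: "continuous_on UNIV (\<lambda>x. g (\<pi> x))"
    by (rule continuous_on_compose2[OF lipschitz_on_continuous_on[OF e(3)]])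
      (use \<pi> in \<open>auto simp: \<pi>_def intro!: continuous_intros\<close>)
  have graph: "g (\<pi> x) = x \<bullet> e" if x: "x \<in> frontier S \<inter> ball p r" for x
  proof (rule antisym)
    show "x \<bullet> e \<le> g (\<pi> x)"
      using x S[of x] \<open>open S\<close> by (auto simp: frontier_def interior_open \<pi>_def)
    show "g (\<pi> x) \<le> x \<bullet> e"
    proof (rule ccontr)
      assume "\<not> g (\<pi> x) \<le> x \<bullet> e"
      define U where "U = ball p r \<inter> {x. x \<bullet> e < g (\<pi> x)}"
      have "open U" unfolding U_def
        by (intro open_Int open_ball open_Collect_less cont continuous_intros)
      moreover have "x \<in> U" using x \<open>\<not> _\<close> by (simp add: U_def)
      moreover have "U \<inter> S = {}" using S by (auto simp: U_def \<pi>_def)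
      ultimately show False using x open_Int_closure_eq_empty[of U S] by (auto simp: frontier_def)
    qed
  qed
  have "negligible (frontier S \<inter> ball p r)"
  proof (rule negligible_lipschitz_graph[OF e(1)])
    fix x y assume xy: "x \<in> frontier S \<inter> ball p r" "y \<in> frontier S \<inter> ball p r"
    have "x - y = (\<pi> x - \<pi> y) + (x \<bullet> e - y \<bullet> e) *\<^sub>R e" by (simp add: \<pi>_def algebra_simps)
    then have "norm (x - y) \<le> norm (\<pi> x - \<pi> y) + \<bar>x \<bullet> e - y \<bullet> e\<bar>"
      using norm_triangle_ineq[of "\<pi> x - \<pi> y" "(x \<bullet> e - y \<bullet> e) *\<^sub>R e"] e by simp
    also have "\<bar>x \<bullet> e - y \<bullet> e\<bar> \<le> L * norm (\<pi> x - \<pi> y)" using lip[of x y] graph xy by simp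
    finally show "norm (x - y) \<le> (1 + L) * norm ((x - (x \<bullet> e) *\<^sub>R e) - (y - (y \<bullet> e) *\<^sub>R e))"
      by (simp add: \<pi>_def[symmetric] algebra_simps)
  qed
  moreover have "openin (top_of_set (frontier S)) (frontier S \<inter> ball p r)" by (rule openin_open_Int) simp
  moreover have "p \<in> frontier S \<inter> ball p r" using p e by simp
  ultimately show "\<exists>U. openin (top_of_set (frontier S)) U \<and> p \<in> U \<and> negligible U" by blast
qed

section \<open>Locally integrable functions\<close>

lemma locally_integrableI:
  fixes f :: "real^'n \<Rightarrow> 'b::euclidean_space"
  assumes "\<And>R. integrable lebesgue (\<lambda>x. indicat_real (cball 0 R) x *\<^sub>R f x)"
  shows "locally_integrable_on UNIV f"
  unfolding locally_integrable_on_def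
proof (intro allI impI)
  fix K :: "(real^'n) set" assume K: "compact K \<and> K \<subseteq> UNIV"
  have "bounded K" using K compact_imp_bounded by blast
  then obtain R where "\<forall>x\<in>K. norm x \<le> R" unfolding bounded_iff by blast
  then have R: "K \<subseteq> cball 0 R" by auto
  have Km: "K \<in> sets lebesgue" using K by (simp add: borel_compact)
  have "integrable lebesgue (\<lambda>x. indicat_real K x *\<^sub>R (indicat_real (cball 0 R) x *\<^sub>R f x))"
    by (rule integrable_mult_indicator[OF Km assms])
  also have "(\<lambda>x. indicat_real K x *\<^sub>R (indicat_real (cball 0 R) x *\<^sub>R f x)) = (\<lambda>x. indicat_real K x *\<^sub>R f x)"
    using R by (auto simp: indicator_def fun_eq_iff)
  finally show "integrable (lebesgue_on K) f"
    using integrable_restrict_space[of K lebesgue f] Km by simp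
qed

lemma integrable_indicator_cball: "integrable lebesgue (\<lambda>x. indicat_real (cball (a::real^'n) R) x)"
  using lmeasurable_iff_integrable[of "cball a R"] lmeasurable_cball by simp

lemma integrable_imp_locally_integrable:
  fixes f :: "real^'n \<Rightarrow> 'b::euclidean_space"
  assumes "integrable lebesgue f" shows "locally_integrable_on UNIV f"
  by (intro locally_integrableI integrable_mult_indicator assms) auto

lemma loc_int_cc:
  fixes a :: "real^'n \<Rightarrow> complex" and f :: "real^'n \<Rightarrow> real"
  assumes a: "locally_integrable_on UNIV a" and f: "cc R f"
  shows "integrable lebesgue (\<lambda>x. a x * of_real (f x))"
proof -
  obtain B where "\<And>x. norm (f x) \<le> B" using cc_bounded[OF f] by blast
  then have "\<And>x. \<bar>f x\<bar> \<le> B" by simp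
  then show ?thesis by (rule locally_integrable_cc(1)[OF a f])
qed

lemma loc_int_bounded:
  fixes c :: "real^'n \<Rightarrow> complex" and f :: "real^'n \<Rightarrow> complex"
  assumes c: "locally_integrable_on UNIV c" and f: "f \<in> borel_measurable lebesgue"
    and B: "\<And>x. norm (f x) \<le> B" and R: "\<And>x. norm x > R \<Longrightarrow> f x = 0"
  shows "integrable lebesgue (\<lambda>x. c x * f x)"
proof -
  note i = locally_integrable_ball[OF c, of R]
  have eq: "c x * f x = (indicat_real (cball 0 R) x *\<^sub>R c x) * f x" for x
    using R[of x] by (auto simp: indicator_def)
  show ?thesis unfolding eq
  proof (rule Bochner_Integration.integrable_bound)
    show "integrable lebesgue (\<lambda>x. B * norm (indicat_real (cball 0 R) x *\<^sub>R c x))"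
      by (rule integrable_mult_right[OF integrable_norm[OF i]])
    show "(\<lambda>x. (indicat_real (cball 0 R) x *\<^sub>R c x) * f x) \<in> borel_measurable lebesgue"
      by (intro borel_measurable_times borel_measurable_integrable[OF i] f)
    have "norm ((indicat_real (cball 0 R) x *\<^sub>R c x) * f x) \<le> B * norm (indicat_real (cball 0 R) x *\<^sub>R c x)" for x
      unfolding norm_mult using mult_left_mono[OF B[of x] norm_ge_zero[of "indicat_real (cball 0 R) x *\<^sub>R c x"]]
      by (simp add: mult.commute)
    then show "AE x in lebesgue. norm ((indicat_real (cball 0 R) x *\<^sub>R c x) * f x) \<le> norm (B * norm (indicat_real (cball 0 R) x *\<^sub>R c x))"
      using order_trans[OF _ abs_ge_self] unfolding real_norm_def by (intro AE_I2) blast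
  qed
qed

lemma loc_int_cc_complex:
  fixes a :: "real^'n \<Rightarrow> complex" and f :: "real^'n \<Rightarrow> complex"
  assumes a: "locally_integrable_on UNIV a" and f: "cc R f"
  shows "integrable lebesgue (\<lambda>x. a x * f x)"
proof -
  obtain B where B: "\<And>x. norm (f x) \<le> B" using cc_bounded[OF f] by blast
  have "f \<in> borel_measurable lebesgue"
    using cc_integrable[OF f] by (intro measurable_completion) auto
  then show ?thesis by (rule loc_int_bounded[OF a _ B]) (use cc_zero[OF f] in auto)
qed

lemma loc_int_mult_bounded:
  fixes c :: "real^'n \<Rightarrow> complex" and f :: "real^'n \<Rightarrow> complex"
  assumes c: "locally_integrable_on UNIV c" and f: "f \<in> borel_measurable lebesgue"
    and B: "\<And>x. norm (f x) \<le> B"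
  shows "locally_integrable_on UNIV (\<lambda>x. f x * c x)"
proof (rule locally_integrableI)
  fix R
  have "B \<ge> 0" using B[of 0] norm_ge_zero order_trans by blast
  have "integrable lebesgue (\<lambda>x. c x * (indicat_real (cball 0 R) x *\<^sub>R f x))"
  proof (rule loc_int_bounded[OF c, where B=B and R=R])
    show "(\<lambda>x. indicat_real (cball 0 R) x *\<^sub>R f x) \<in> borel_measurable lebesgue"
      by (intro borel_measurable_scaleR borel_measurable_indicator f) auto
  qed (use B \<open>B \<ge> 0\<close> in \<open>auto simp: indicator_def\<close>)
  then show "integrable lebesgue (\<lambda>x. indicat_real (cball 0 R) x *\<^sub>R (f x * c x))"
    by (simp add: mult_ac scaleR_conv_of_real)
qed

lemma loc_int_add:
  fixes c d :: "real^'n \<Rightarrow> complex"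
  assumes "locally_integrable_on UNIV c" "locally_integrable_on UNIV d"
  shows "locally_integrable_on UNIV (\<lambda>x. c x + d x)"
  using assms unfolding locally_integrable_on_def by auto

lemma loc_int_minus:
  fixes c :: "real^'n \<Rightarrow> complex"
  assumes "locally_integrable_on UNIV c"
  shows "locally_integrable_on UNIV (\<lambda>x. - c x)"
  using assms unfolding locally_integrable_on_def by auto

lemma loc_int_sum:
  fixes c :: "'i \<Rightarrow> real^'n \<Rightarrow> complex"
  assumes "\<And>i. i \<in> I \<Longrightarrow> locally_integrable_on UNIV (c i)"
  shows "locally_integrable_on UNIV (\<lambda>x. \<Sum>i\<in>I. c i x)"
  using assms unfolding locally_integrable_on_def by auto

lemma loc_int_component:
  fixes G :: "real^'n \<Rightarrow> complex^'n"
  assumes "locally_integrable_on UNIV G"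
  shows "locally_integrable_on UNIV (\<lambda>x. G x $ i)"
  using assms unfolding locally_integrable_on_def
  by (auto intro: integrable_bounded_linear[OF bounded_linear_vec_nth])

text \<open>Dominated convergence against a weight that is only locally integrable; the common
  support supplies the integrable bound. It is the device for replacing the smooth maps
  \<open>F d\<close> by \<theta>, hence the null set \<open>N\<close> on which nothing is
  known.\<close>

lemma weak_dct:
  fixes c :: "real^'n \<Rightarrow> complex"
  assumes c: "locally_integrable_on UNIV c"
    and f: "\<And>l. f l \<in> borel_measurable borel" and g: "g \<in> borel_measurable borel"
    and B: "\<And>l x. \<bar>f l x\<bar> \<le> B" and R: "\<And>l x. norm x > R \<Longrightarrow> f l x = 0"
    and N: "negligible N" and lim: "\<And>x. x \<notin> N \<Longrightarrow> (\<lambda>l. f l x) \<longlonglongrightarrow> g x"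
  shows "(\<lambda>l. LINT x|lebesgue. c x * of_real (f l x)) \<longlonglongrightarrow> (LINT x|lebesgue. c x * of_real (g x))"
proof -
  note i = locally_integrable_ball[OF c, of R]
  have AEN: "AE x in lebesgue. x \<notin> N"
    using N by (simp add: negligible_iff_null_sets AE_not_in)
  have eq: "c x * of_real (f l x) = (indicat_real (cball 0 R) x *\<^sub>R c x) * of_real (f l x)" for l x
    using R[of x l] by (auto simp: indicator_def)
  \<comment> \<open>On \<open>N\<close> the function \<open>g\<close> is arbitrary and may be
    nonzero outside the ball, so the localised formula for it holds only almost everywhere.\<close>
  have g0: "g x = 0" if "x \<notin> N" "norm x > R" for x
    using LIMSEQ_unique[OF lim[OF that(1)], of 0] R[OF that(2)] by simp
  have eqg: "AE x in lebesgue. c x * of_real (g x) = (indicat_real (cball 0 R) x *\<^sub>R c x) * of_real (g x)"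
    using AEN by eventually_elim (use g0 in \<open>auto simp: indicator_def\<close>)
  have mf: "(\<lambda>x. complex_of_real (f l x)) \<in> borel_measurable lebesgue" for l
    using f[of l] by (intro measurable_completion) (simp add: measurable_lborel1)
  have mg: "(\<lambda>x. complex_of_real (g x)) \<in> borel_measurable lebesgue"
    using g by (intro measurable_completion) (simp add: measurable_lborel1)
  have mgi: "(\<lambda>x. (indicat_real (cball 0 R) x *\<^sub>R c x) * of_real (g x)) \<in> borel_measurable lebesgue"
    by (intro borel_measurable_times borel_measurable_integrable[OF i] mg)
  have "(\<lambda>l. LINT x|lebesgue. (indicat_real (cball 0 R) x *\<^sub>R c x) * of_real (f l x))
      \<longlonglongrightarrow> (LINT x|lebesgue. (indicat_real (cball 0 R) x *\<^sub>R c x) * of_real (g x))"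
  proof (rule integral_dominated_convergence[where w="\<lambda>x. B * norm (indicat_real (cball 0 R) x *\<^sub>R c x)"])
    show "integrable lebesgue (\<lambda>x. B * norm (indicat_real (cball 0 R) x *\<^sub>R c x))"
      by (rule integrable_mult_right[OF integrable_norm[OF i]])
    show "(\<lambda>x. (indicat_real (cball 0 R) x *\<^sub>R c x) * of_real (f l x)) \<in> borel_measurable lebesgue" for l
      by (intro borel_measurable_times borel_measurable_integrable[OF i] mf)
    show "AE x in lebesgue. (\<lambda>l. (indicat_real (cball 0 R) x *\<^sub>R c x) * of_real (f l x)) \<longlonglongrightarrow>
       (indicat_real (cball 0 R) x *\<^sub>R c x) * of_real (g x)"
      using AEN by eventually_elim (intro tendsto_intros lim)
    show "AE x in lebesgue. norm ((indicat_real (cball 0 R) x *\<^sub>R c x) * of_real (f l x)) \<le> B * norm (indicat_real (cball 0 R) x *\<^sub>R c x)" for l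
    proof (intro AE_I2)
      fix x
      show "norm ((indicat_real (cball 0 R) x *\<^sub>R c x) * of_real (f l x)) \<le> B * norm (indicat_real (cball 0 R) x *\<^sub>R c x)"
        unfolding norm_mult using mult_left_mono[OF B[of l x] norm_ge_zero[of "indicat_real (cball 0 R) x *\<^sub>R c x"]]
        by (simp add: mult.commute)
    qed
  qed (fact mgi)
  moreover have "(LINT x|lebesgue. c x * of_real (g x)) = (LINT x|lebesgue. (indicat_real (cball 0 R) x *\<^sub>R c x) * of_real (g x))"
  proof (rule integral_cong_AE[OF _ mgi eqg])
    show "(\<lambda>x. c x * of_real (g x)) \<in> borel_measurable lebesgue"
      by (rule borel_measurable_AE[OF mgi]) (use eqg in \<open>auto elim: eventually_mono\<close>)
  qed
  ultimately show ?thesis by (simp only: eq)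
qed


lemma borel_measurable_det:
  assumes "\<And>a b. m a b \<in> borel_measurable M"
  shows "(\<lambda>x. det (\<chi> a b. m a b x) :: real) \<in> borel_measurable M"
  unfolding det_def using assms by simp

lemma det_bound:
  fixes M :: real
  obtains C where "C \<ge> 0" "\<And>A::real^'n^'n. (\<And>a b. \<bar>A$a$b\<bar> \<le> M) \<Longrightarrow> \<bar>det A\<bar> \<le> C"
proof (rule that)
  let ?C = "\<Sum>p\<in>{p. p permutes (UNIV::'n set)}. \<Prod>i\<in>(UNIV::'n set). \<bar>M\<bar>"
  show "?C \<ge> 0" by (intro sum_nonneg prod_nonneg) auto
  fix A :: "real^'n^'n" assume A: "\<And>a b. \<bar>A$a$b\<bar> \<le> M"
  show "\<bar>det A\<bar> \<le> ?C"
    unfolding det_def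
  proof (rule order_trans[OF sum_abs sum_mono])
    fix p :: "'n \<Rightarrow> 'n"
    have "\<bar>of_int (sign p) * (\<Prod>i\<in>UNIV. A$i$p i)\<bar> = (\<Prod>i\<in>UNIV. \<bar>A$i$p i\<bar>)"
      by (auto simp: abs_mult abs_prod sign_def)
    also have "\<dots> \<le> (\<Prod>i\<in>(UNIV::'n set). \<bar>M\<bar>)"
      by (intro prod_mono) (use A in \<open>auto intro: order_trans[OF _ abs_ge_self]\<close>)
    finally show "\<bar>of_int (sign p) * (\<Prod>i\<in>UNIV. A$i$p i)\<bar> \<le> (\<Prod>i\<in>(UNIV::'n set). \<bar>M\<bar>)" .
  qed
qed

lemma piola_identity: "piola (\<lambda>a b x. if b = a then 1 else 0) v i x = v i"
  unfolding piola_def using det_replace_row_identity[of i v] by (simp cong: if_cong)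

lemma det_delta: "det ((\<chi> a b. if a = b then 1 else 0) :: real^'n^'n) = 1"
  using det_I[where 'a=real and 'n='n] by (simp add: mat_def)

section \<open>Approximation of a change of variables that is the identity outside a domain\<close>

text \<open>\<theta> is continuous everywhere, but its derivatives may jump across the boundary.
  \<open>D a b\<close> is the b-th partial derivative of component \<open>a\<close> inside \<Omega>,
  with a uniform bound; the second derivatives \<open>D2\<close> carry no bound. Determinants are
  written with the differentiation index as row index, to match \<open>piola\<close>.\<close>

locale inner_change =
  fixes \<Omega> :: "(real^'n) set" and \<theta> :: "real^'n \<Rightarrow> real^'n" and D :: "'n \<Rightarrow> 'n \<Rightarrow> real^'n \<Rightarrow> real"
    and D2 :: "'n \<Rightarrow> 'n \<Rightarrow> 'n \<Rightarrow> real^'n \<Rightarrow> real" and L R\<^sub>0 :: real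
  assumes open_dom: "open \<Omega>" and dom_ball: "\<Omega> \<subseteq> cball 0 R\<^sub>0" and R0: "R\<^sub>0 > 0" and connected_dom: "connected \<Omega>" and dom_nonempty: "\<Omega> \<noteq> {}"
    and cont: "continuous_on UNIV \<theta>" and out: "\<And>x. x \<notin> \<Omega> \<Longrightarrow> \<theta> x = x"
    and D: "\<And>a. c1 \<Omega> (\<lambda>x. \<theta> x $ a) (D a)" and D2: "\<And>a b. c1 \<Omega> (D a b) (D2 a b)"
    and L: "\<And>a b x. x \<in> \<Omega> \<Longrightarrow> \<bar>D a b x\<bar> \<le> L"
    and det_nonzero: "\<And>x. x \<in> \<Omega> \<Longrightarrow> det (\<chi> a b. D b a x) \<noteq> 0"
begin

definition v :: "'n \<Rightarrow> real^'n \<Rightarrow> real" where "v a x = \<theta> x $ a - x $ a"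
text \<open>Zero by convention off \<Omega>, frontier included, where \<open>v a\<close> may fail to
  be differentiable. This agrees with \<open>F d\<close>, which is the identity there for every
  positive \<open>d\<close>, so frontier points need no separate treatment.\<close>

definition v' :: "'n \<Rightarrow> 'n \<Rightarrow> real^'n \<Rightarrow> real" where
  "v' a b x = (if x \<in> \<Omega> then D a b x - (if b = a then 1 else 0) else 0)"
definition v'' :: "'n \<Rightarrow> 'n \<Rightarrow> 'n \<Rightarrow> real^'n \<Rightarrow> real" where "v'' a b c x = (if x \<in> \<Omega> then D2 a b c x else 0)"
text \<open>
  \<open>F d\<close> undoes the displacement \<open>\<theta> - id\<close> where it is small, so it is the identity near the boundary
  and, unlike \<open>\<theta>\<close>, of class \<open>C\<^sup>2\<close> everywhere.
\<close>

definition F :: "real \<Rightarrow> real^'n \<Rightarrow> real^'n" where "F d x = (\<chi> a. x $ a + trunc d (v a x))"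
definition F' :: "real \<Rightarrow> 'n \<Rightarrow> 'n \<Rightarrow> real^'n \<Rightarrow> real" where
  "F' d a b x = (if b = a then 1 else 0) + trunc' d (v a x) * v' a b x"
definition F'' :: "real \<Rightarrow> 'n \<Rightarrow> 'n \<Rightarrow> 'n \<Rightarrow> real^'n \<Rightarrow> real" where
  "F'' d a b c x = trunc' d (v a x) * v'' a b c x + trunc'' d (v a x) * v' a c x * v' a b x"
definition \<theta>' :: "'n \<Rightarrow> 'n \<Rightarrow> real^'n \<Rightarrow> real" where
  "\<theta>' a b x = (if b = a then 1 else 0) + v' a b x"
text \<open>The signed determinant, since that is what the Piola identity produces;
  \<open>q_pos\<close> shows that it coincides with its absolute value.\<close>

definition q :: "real^'n \<Rightarrow> real" where "q x = det (\<chi> a b. \<theta>' b a x)"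
text \<open>For positive \<open>d\<close> a closed set inside \<Omega>, because the displacement is
  continuous on the whole space and vanishes off \<Omega>. Off this set \<open>F d\<close> is the
  identity.\<close>

definition K :: "real \<Rightarrow> (real^'n) set" where "K d = (\<Union>a. {x. d \<le> \<bar>v a x\<bar>})"
text \<open>The exceptional null set where the derivatives of \<open>F d\<close> do not converge to those of \<open>\<theta>\<close> as \<open>d\<close> tends to 0.\<close>

definition N :: "(real^'n) set" where "N = (\<Union>a. \<Union>b. {x\<in>\<Omega>. v a x = 0 \<and> D a b x - (if b = a then 1 else 0) \<noteq> 0})"

lemma v_out: "x \<notin> \<Omega> \<Longrightarrow> v a x = 0" by (simp add: v_def out)
lemma v'_out: "x \<notin> \<Omega> \<Longrightarrow> v' a b x = 0" by (simp add: v'_def)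
lemma \<theta>'_in: "x \<in> \<Omega> \<Longrightarrow> \<theta>' a b x = D a b x" by (simp add: \<theta>'_def v'_def)
lemma \<theta>'_out: "x \<notin> \<Omega> \<Longrightarrow> \<theta>' a b x = (if b = a then 1 else 0)" by (simp add: \<theta>'_def v'_def)
lemma norm_out: "norm x > R\<^sub>0 \<Longrightarrow> x \<notin> \<Omega>" using dom_ball by auto

lemma v_cont: "continuous_on S (v a)"
  unfolding v_def by (intro continuous_intros continuous_on_subset[OF cont]) auto

lemma K_component: assumes "d > 0" shows "closed {x. d \<le> \<bar>v a x\<bar>}" "{x. d \<le> \<bar>v a x\<bar>} \<subseteq> \<Omega>"
proof -
  show "closed {x. d \<le> \<bar>v a x\<bar>}" by (intro closed_Collect_le continuous_intros v_cont)
  show "{x. d \<le> \<bar>v a x\<bar>} \<subseteq> \<Omega>" using v_out assms by fastforce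
qed

lemma K_closed: "d > 0 \<Longrightarrow> closed (K d)" and K_subset: "d > 0 \<Longrightarrow> K d \<subseteq> \<Omega>"
proof -
  assume d: "d > 0"
  show "closed (K d)" unfolding K_def by (rule closed_UN) (auto intro: K_component(1)[OF d])
  show "K d \<subseteq> \<Omega>" unfolding K_def by (intro UN_least K_component(2)[OF d])
qed

lemma F_offK: assumes "x \<notin> K d" "d > 0" shows "F d x = x" "F' d a b x = (if b = a then 1 else 0)"
proof -
  have "\<bar>v a x\<bar> \<le> d" for a using assms by (auto simp: K_def not_le less_imp_le)
  then show "F d x = x" "F' d a b x = (if b = a then 1 else 0)"
    using trunc_small assms(2) by (auto simp: F_def F'_def vec_eq_iff)
qed

lemma F_out: "x \<notin> \<Omega> \<Longrightarrow> d > 0 \<Longrightarrow> F d x = x" using F_offK(1)[of x d] K_subset by blast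

lemma v_c1: "c1 \<Omega> (v a) (\<lambda>b x. D a b x - (if b = a then 1 else 0))"
  unfolding v_def by (intro c1_diff D c1_coordinate)

text \<open>Truncation removes displacements of size at most \<open>d\<close>, so the truncated
  displacement vanishes off a closed subset of \<Omega> and extends by 0 as a C1 function, which the
  displacement itself need not do.\<close>

lemma F_c1: assumes d: "d > 0" shows "c1 UNIV (\<lambda>x. F d x $ a) (F' d a)"
proof -
  have "c1 \<Omega> (\<lambda>x. trunc d (v a x)) (\<lambda>b x. trunc' d (v a x) * (D a b x - (if b = a then 1 else 0)))"
    by (rule c1_compose_real[OF v_c1 trunc_derivative(1)[OF d]]) (intro continuous_intros v_cont d)
  then have "c1 UNIV (\<lambda>x. if x \<in> \<Omega> then trunc d (v a x) else 0)
     (\<lambda>b x. if x \<in> \<Omega> then trunc' d (v a x) * (D a b x - (if b = a then 1 else 0)) else 0)"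
    by (rule c1_extend_zero[OF _ open_dom K_component[OF d, of a]]) (use trunc_small d in auto)
  from c1_add[OF c1_coordinate[of _ a] this]
  show ?thesis
    by (rule c1_eqI) (use v_out trunc_small[of 0] d in \<open>auto simp: F_def F'_def v'_def\<close>)
qed

lemma F'_c1: assumes d: "d > 0" shows "c1 UNIV (F' d a b) (F'' d a b)"
proof -
  have 1: "c1 \<Omega> (\<lambda>x. trunc' d (v a x)) (\<lambda>c x. trunc'' d (v a x) * (D a c x - (if c = a then 1 else 0)))"
    by (rule c1_compose_real[OF v_c1 trunc_derivative(2)[OF d]]) (intro continuous_intros v_cont d)
  have 2: "c1 \<Omega> (\<lambda>x. D a b x - (if b = a then 1 else 0)) (\<lambda>c x. D2 a b c x - 0)"
    by (intro c1_diff D2 c1_const)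
  have "c1 UNIV (\<lambda>x. if x \<in> \<Omega> then trunc' d (v a x) * (D a b x - (if b = a then 1 else 0)) else 0)
     (\<lambda>c x. if x \<in> \<Omega> then trunc' d (v a x) * (D2 a b c x - 0) + trunc'' d (v a x) * (D a c x - (if c = a then 1 else 0)) * (D a b x - (if b = a then 1 else 0)) else 0)"
    by (rule c1_extend_zero[OF c1_mult[OF 1 2] open_dom K_component[OF d, of a]]) (use trunc_small d in auto)
  from c1_add[OF c1_const[of _ "if b = a then 1 else 0"] this]
  show ?thesis
    by (rule c1_eqI) (auto simp: F'_def F''_def v'_def v''_def)
qed

definition \<epsilon> :: "nat \<Rightarrow> real" where "\<epsilon> l = 1 / real (Suc l)"

lemma \<epsilon>_pos: "\<epsilon> l > 0" by (simp add: \<epsilon>_def)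

lemma \<epsilon>_lim: "\<epsilon> \<longlonglongrightarrow> 0" unfolding \<epsilon>_def using LIMSEQ_Suc[OF lim_1_over_n] by simp

lemma F_lim: "(\<lambda>l. F (\<epsilon> l) x) \<longlonglongrightarrow> \<theta> x"
proof (rule vec_tendstoI)
  fix a
  have "(\<lambda>l. trunc (\<epsilon> l) (v a x) - v a x) \<longlonglongrightarrow> 0"
  proof (rule Lim_null_comparison)
    show "\<forall>\<^sub>F l in sequentially. norm (trunc (\<epsilon> l) (v a x) - v a x) \<le> 2 * \<epsilon> l"
      using trunc_close[OF \<epsilon>_pos] by simp
    show "(\<lambda>l. 2 * \<epsilon> l) \<longlonglongrightarrow> 0" using tendsto_mult_right_zero[OF \<epsilon>_lim] by simp
  qed
  then have "(\<lambda>l. \<theta> x $ a + (trunc (\<epsilon> l) (v a x) - v a x)) \<longlonglongrightarrow> \<theta> x $ a + 0"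
    by (intro tendsto_add tendsto_const)
  then show "(\<lambda>l. F (\<epsilon> l) x $ a) \<longlonglongrightarrow> \<theta> x $ a" by (simp add: F_def v_def algebra_simps)
qed

lemma N_negligible: "negligible N"
proof -
  have "negligible (\<Union>b. {x\<in>\<Omega>. v a x = 0 \<and> D a b x - (if b = a then 1 else 0) \<noteq> 0})" for a
  proof (rule negligible_Union)
    fix t assume "t \<in> range (\<lambda>b. {x\<in>\<Omega>. v a x = 0 \<and> D a b x - (if b = a then 1 else 0) \<noteq> 0})"
    then show "negligible t" using negligible_c1_zero_set[OF v_c1 open_dom] by blast
  qed simp
  then show ?thesis unfolding N_def by (intro negligible_Union) auto
qed

text \<open>Off \<open>N\<close> one of two things happens: the derivative of the displacement is 0
  and truncation has no effect on it, or the displacement itself is nonzero and truncation is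
  eventually inactive.\<close>

lemma F'_lim: assumes "x \<notin> N" shows "(\<lambda>l. F' (\<epsilon> l) a b x) \<longlonglongrightarrow> \<theta>' a b x"
proof (cases "v' a b x = 0")
  case True
  then show ?thesis by (simp add: F'_def \<theta>'_def)
next
  case False
  then have "x \<in> \<Omega>" using v'_out by blast
  then have "v a x \<noteq> 0" using False assms by (auto simp: N_def v'_def)
  have "\<forall>\<^sub>F l in sequentially. \<epsilon> l < \<bar>v a x\<bar> / 2"
    using order_tendstoD(2)[OF \<epsilon>_lim, of "\<bar>v a x\<bar> / 2"] \<open>v a x \<noteq> 0\<close> by simp
  then have "\<forall>\<^sub>F l in sequentially. \<theta>' a b x = F' (\<epsilon> l) a b x"
    by eventually_elim (simp add: F'_def \<theta>'_def trunc_large(2) \<epsilon>_pos)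
  then show ?thesis by (rule Lim_transform_eventually[OF tendsto_const])
qed

text \<open>37 is the bound of \<open>trunc'_bound\<close>, and the factor in parentheses bounds the
  derivatives of the displacement. Independence of \<open>d\<close> is what dominated convergence
  needs.\<close>

definition M :: real where "M = 1 + 37 * (\<bar>L\<bar> + 1)"

lemma v'_bound: "\<bar>v' a b x\<bar> \<le> \<bar>L\<bar> + 1"
  using L[of x a b] by (auto simp: v'_def)

lemma F'_bound: "\<bar>F' d a b x\<bar> \<le> M"
proof -
  have "\<bar>trunc' d (v a x) * v' a b x\<bar> \<le> 37 * (\<bar>L\<bar> + 1)"
    unfolding abs_mult using trunc'_bound v'_bound by (intro mult_mono) auto
  then show ?thesis by (auto simp: F'_def M_def)
qed

lemma \<theta>'_bound: "\<bar>\<theta>' a b x\<bar> \<le> M"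
  using v'_bound[of a b x] by (auto simp: \<theta>'_def M_def)

lemma \<theta>'_measurable: "\<theta>' a b \<in> borel_measurable borel"
proof -
  have "(\<lambda>x. if x \<in> \<Omega> then D a b x else (if b = a then 1 else 0)) \<in> borel_measurable borel"
    by (rule borel_measurable_continuous_on_if) (use open_dom c1_continuous_partial[OF D] in auto)
  moreover have "(\<lambda>x. if x \<in> \<Omega> then D a b x else (if b = a then 1 else 0)) = \<theta>' a b"
    by (auto simp: \<theta>'_def v'_def)
  ultimately show ?thesis by simp
qed

lemma q_measurable: "q \<in> borel_measurable borel"
  unfolding q_def by (intro borel_measurable_det \<theta>'_measurable)

lemma q_out: "x \<notin> \<Omega> \<Longrightarrow> q x = 1"
  by (simp add: q_def \<theta>'_out det_delta)

lemma F_compose_measurable: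
  assumes "d > 0" "continuous_on UNIV (g :: real^'n \<Rightarrow> real)"
  shows "(\<lambda>x. g (F d x)) \<in> borel_measurable borel" "(\<lambda>x. g (\<theta> x)) \<in> borel_measurable borel"
proof -
  have "continuous_on UNIV (\<lambda>x. \<chi> a. F d x $ a)"
    by (intro continuous_on_vec_lambda c1_continuous[OF F_c1[OF assms(1)]])
  then have "continuous_on UNIV (F d)" by simp
  then show "(\<lambda>x. g (F d x)) \<in> borel_measurable borel"
    by (intro borel_measurable_continuous_onI continuous_on_compose2[OF assms(2)]) auto
  show "(\<lambda>x. g (\<theta> x)) \<in> borel_measurable borel"
    by (intro borel_measurable_continuous_onI continuous_on_compose2[OF assms(2) cont]) auto
qed

lemma g_F_lim: "continuous_on UNIV (g :: real^'n \<Rightarrow> real) \<Longrightarrow> (\<lambda>l. g (F (\<epsilon> l) x)) \<longlonglongrightarrow> g (\<theta> x)"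
  using continuous_on_tendsto_compose[OF _ F_lim, of UNIV g x] by simp

lemma det_F'_lim: "x \<notin> N \<Longrightarrow> (\<lambda>l. det (\<chi> a b. F' (\<epsilon> l) b a x)) \<longlonglongrightarrow> q x"
  unfolding det_def q_def by simp (intro tendsto_intros F'_lim)

lemma piola_lim:
  assumes "x \<notin> N" "\<And>a. continuous_on UNIV (g a)"
  shows "(\<lambda>l. piola (F' (\<epsilon> l)) (\<lambda>a. g a (F (\<epsilon> l) x)) i x) \<longlonglongrightarrow> piola \<theta>' (\<lambda>a. g a (\<theta> x)) i x"
proof -
  have "(\<lambda>l. if a = i then g b (F (\<epsilon> l) x) else F' (\<epsilon> l) b a x) \<longlonglongrightarrow> (if a = i then g b (\<theta> x) else \<theta>' b a x)" for a b
    using g_F_lim[OF assms(2)] F'_lim[OF assms(1)] by auto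
  then show ?thesis unfolding piola_def det_def by simp (intro tendsto_intros)
qed

lemma \<theta>_norm_out: "norm x > R\<^sub>0 \<Longrightarrow> \<theta> x = x" using norm_out out by blast
lemma F_norm_out: "norm x > R\<^sub>0 \<Longrightarrow> d > 0 \<Longrightarrow> F d x = x" using norm_out F_out by blast

lemma piola_zero: "(\<And>a. w a = 0) \<Longrightarrow> piola m w i (x :: real^'n) = 0"
  unfolding piola_def by (rule det_zero_row(1)[where i=i]) (simp add: row_def vec_eq_iff)

text \<open>Integrates the Piola divergence identity for \<open>F d\<close> against \<open>u\<close>
  and lets \<open>d\<close> tend to 0. The case \<open>s = 0\<close> serves a function
  \<open>u\<close> with weak gradient \<open>G\<close> on the whole space. The case
  \<open>s = 1\<close> serves a function cut off to \<Omega>, for which integration by parts is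
  available only for fields vanishing off \<open>K d\<close>; subtracting \<open>g\<close> from its
  Piola transform produces such a field.\<close>

lemma piola_limit_pair:
  fixes g :: "'n \<Rightarrow> real^'n \<Rightarrow> real" and s :: real and u :: "real^'n \<Rightarrow> complex" and G :: "'n \<Rightarrow> real^'n \<Rightarrow> complex"
  assumes u: "locally_integrable_on UNIV u" and G: "\<And>i. locally_integrable_on UNIV (G i)"
    and g: "\<And>a. c1 UNIV (g a) (g' a)" "\<And>a. cc R (g a)"
    and IBP: "\<And>d i W W'. d > 0 \<Longrightarrow> c1 UNIV W W' \<Longrightarrow> cc (max R R\<^sub>0) W \<Longrightarrow> (s = 1 \<Longrightarrow> (\<And>x. x \<notin> K d \<Longrightarrow> W x = 0)) \<Longrightarrow>
      (LINT x|lebesgue. u x * of_real (W' i x)) = - (LINT x|lebesgue. G i x * of_real (W x))"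
  shows "(\<Sum>i\<in>UNIV. LINT x|lebesgue. G i x * of_real (piola \<theta>' (\<lambda>a. g a (\<theta> x)) i x - s * g i x)) =
    - (LINT x|lebesgue. u x * of_real (q x * (\<Sum>a\<in>UNIV. g' a a (\<theta> x)) - s * (\<Sum>a\<in>UNIV. g' a a x)))"
proof -
  let ?V = "\<lambda>l i x. piola (F' (\<epsilon> l)) (\<lambda>a. g a (F (\<epsilon> l) x)) i x - s * g i x"
  let ?E = "\<lambda>l x. det (\<chi> a b. F' (\<epsilon> l) b a x) * (\<Sum>a\<in>UNIV. g' a a (F (\<epsilon> l) x)) - s * (\<Sum>a\<in>UNIV. g' a a x)"
  have gc: "continuous_on UNIV (g a)" for a by (rule cc_continuous[OF g(2)])
  have ccg': "cc R (g' a b)" for a b by (rule c1_cc_partial[OF g(1)]) (rule cc_zero[OF g(2)])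
  have g'c: "continuous_on UNIV (g' a b)" for a b by (rule cc_continuous[OF ccg'])
  obtain Bg where Bg: "\<And>a x. \<bar>g a x\<bar> \<le> Bg"
  proof -
    have "\<exists>B. \<forall>x. \<bar>g a x\<bar> \<le> B" for a using cc_bounded[OF g(2)[of a]] by (metis real_norm_def)
    then obtain B where B: "\<And>a x. \<bar>g a x\<bar> \<le> B a" by metis
    have "B a \<ge> 0" for a using order_trans[OF abs_ge_zero B] .
    then have "B a \<le> (\<Sum>a\<in>UNIV. B a)" for a by (intro member_le_sum) auto
    then have "\<bar>g a x\<bar> \<le> (\<Sum>a\<in>UNIV. B a)" for a x using B order_trans by blast
    then show ?thesis using that by blast
  qed
  have sc: "cc R (\<lambda>x. \<Sum>a\<in>UNIV. g' a a x)" by (intro cc_sum ccg')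
  obtain Bs where Bs0: "Bs > 0" "\<And>x. norm (\<Sum>a\<in>UNIV. g' a a x) \<le> Bs"
    using cc_bounded[OF sc] by blast
  have Bs: "Bs > 0" "\<And>x. \<bar>\<Sum>a\<in>UNIV. g' a a x\<bar> \<le> Bs" using Bs0 by auto
  obtain C1 where C1: "C1 \<ge> 0" "\<And>A::real^'n^'n. (\<And>a b. \<bar>A$a$b\<bar> \<le> max M Bg) \<Longrightarrow> \<bar>det A\<bar> \<le> C1"
    by (rule det_bound[of "max M Bg"]) blast
  have V0: "?V l i x = 0" if "norm x > max R R\<^sub>0" for l i x
    using that F_norm_out[OF _ \<epsilon>_pos, of x l] cc_zero[OF g(2), of x] by (simp add: piola_zero)
  have step: "(\<Sum>i\<in>UNIV. LINT x|lebesgue. G i x * of_real (?V l i x)) = - (LINT x|lebesgue. u x * of_real (?E l x))" for l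
  proof -
    obtain V' where V': "\<And>i. c1 UNIV (\<lambda>x. piola (F' (\<epsilon> l)) (\<lambda>a. g a (F (\<epsilon> l) x)) i x) (V' i)"
      "\<And>x. (\<Sum>i\<in>UNIV. V' i i x) = det (\<chi> a b. F' (\<epsilon> l) b a x) * (\<Sum>a\<in>UNIV. g' a a (F (\<epsilon> l) x))"
      using divergence_piola[where F="F (\<epsilon> l)" and F'="F' (\<epsilon> l)" and F''="F'' (\<epsilon> l)" and g=g and g'=g', OF F_c1[OF \<epsilon>_pos] F'_c1[OF \<epsilon>_pos] g(1)] by blast
    have W: "c1 UNIV (?V l i) (\<lambda>j x. V' i j x - s * g' i j x)" for i
      by (rule c1_diff[OF V'(1) c1_cmult[OF g(1)]])
    have ccW: "cc (max R R\<^sub>0) (?V l i)" for i by (rule c1_cc[OF W V0])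
    have ccW': "cc (max R R\<^sub>0) (\<lambda>x. V' i i x - s * g' i i x)" for i by (rule c1_cc_partial[OF W V0])
    \<comment> \<open>Off \<open>K\<close> the map is the identity with identity Jacobian, and the
      Piola transform then returns \<open>g\<close> unchanged.\<close>
    have VK: "?V l i x = 0" if "s = 1" "x \<notin> K (\<epsilon> l)" for i x
      using that F_offK[OF that(2) \<epsilon>_pos] piola_identity[of "\<lambda>a. g a x" i x]
      by (simp add: piola_def cong: if_cong)
    have int: "integrable lebesgue (\<lambda>x. u x * of_real (V' i i x - s * g' i i x))" for i
      by (rule loc_int_cc[OF u ccW'])
    have "(\<Sum>i\<in>UNIV. LINT x|lebesgue. G i x * of_real (?V l i x)) = - (\<Sum>i\<in>UNIV. LINT x|lebesgue. u x * of_real (V' i i x - s * g' i i x))"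
      using IBP[OF \<epsilon>_pos W ccW VK] by (simp add: sum_negf)
    also have "(\<Sum>i\<in>UNIV. LINT x|lebesgue. u x * of_real (V' i i x - s * g' i i x)) =
       (LINT x|lebesgue. (\<Sum>i\<in>UNIV. u x * of_real (V' i i x - s * g' i i x)))"
      by (rule Bochner_Integration.integral_sum[symmetric]) (rule int)
    also have "(\<lambda>x. \<Sum>i\<in>UNIV. u x * of_real (V' i i x - s * g' i i x)) = (\<lambda>x. u x * of_real (?E l x))"
    proof
      fix x
      have "(\<Sum>i\<in>UNIV. V' i i x - s * g' i i x) = ?E l x"
        using V'(2)[of x] by (simp add: sum_subtractf sum_distrib_left)
      then show "(\<Sum>i\<in>UNIV. u x * of_real (V' i i x - s * g' i i x)) = u x * of_real (?E l x)"
        by (metis (mono_tags, lifting) of_real_sum sum.cong sum_distrib_left)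
    qed
    finally show ?thesis .
  qed
  have lim1: "(\<lambda>l. LINT x|lebesgue. G i x * of_real (?V l i x)) \<longlonglongrightarrow>
     (LINT x|lebesgue. G i x * of_real (piola \<theta>' (\<lambda>a. g a (\<theta> x)) i x - s * g i x))" for i
  proof (rule weak_dct[OF G])
    have m1: "(\<lambda>x. piola m (\<lambda>a. h a x) i x) \<in> borel_measurable borel"
      if "\<And>a. h a \<in> borel_measurable borel" "\<And>a b. m a b \<in> borel_measurable borel" for h m
      unfolding piola_def
      by (rule borel_measurable_det) (use that in \<open>auto intro!: measurable_If\<close>)
    have F'm: "F' d a b \<in> borel_measurable borel" if "d > 0" for d a b
      by (rule borel_measurable_continuous_onI[OF c1_continuous[OF F'_c1[OF that]]])
    have gm: "g i \<in> borel_measurable borel" by (rule borel_measurable_continuous_onI[OF gc])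
    show "?V l i \<in> borel_measurable borel" for l
      by (intro borel_measurable_diff borel_measurable_times borel_measurable_const gm m1 F_compose_measurable gc \<epsilon>_pos F'm)
    show "(\<lambda>x. piola \<theta>' (\<lambda>a. g a (\<theta> x)) i x - s * g i x) \<in> borel_measurable borel"
      by (intro borel_measurable_diff borel_measurable_times borel_measurable_const gm m1 F_compose_measurable(2)[OF \<epsilon>_pos[of 0]] gc \<theta>'_measurable)
    show "\<bar>?V l i x\<bar> \<le> C1 + \<bar>s\<bar> * Bg" for l x
    proof -
      have "\<bar>piola (F' (\<epsilon> l)) (\<lambda>a. g a (F (\<epsilon> l) x)) i x\<bar> \<le> C1"
        unfolding piola_def using F'_bound Bg by (intro C1(2)) (auto simp: le_max_iff_disj)
      moreover have "\<bar>s * g i x\<bar> \<le> \<bar>s\<bar> * Bg" unfolding abs_mult by (intro mult_left_mono Bg) simp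
      ultimately show ?thesis by linarith
    qed
    show "?V l i x = 0" if "norm x > max R R\<^sub>0" for l x using V0[OF that] .
    show "(\<lambda>l. ?V l i x) \<longlonglongrightarrow> piola \<theta>' (\<lambda>a. g a (\<theta> x)) i x - s * g i x" if "x \<notin> N" for x
      by (intro tendsto_diff tendsto_const piola_lim that gc)
  qed (rule N_negligible)
  have lim2: "(\<lambda>l. LINT x|lebesgue. u x * of_real (?E l x)) \<longlonglongrightarrow>
     (LINT x|lebesgue. u x * of_real (q x * (\<Sum>a\<in>UNIV. g' a a (\<theta> x)) - s * (\<Sum>a\<in>UNIV. g' a a x)))"
  proof (rule weak_dct[OF u])
    have F'm: "F' d a b \<in> borel_measurable borel" if "d > 0" for d a b
      by (rule borel_measurable_continuous_onI[OF c1_continuous[OF F'_c1[OF that]]])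
    have sm: "(\<lambda>x. \<Sum>a\<in>UNIV. g' a a x) \<in> borel_measurable borel"
      by (rule borel_measurable_continuous_onI[OF cc_continuous[OF sc]])
    note sc' = cc_continuous[OF sc, of UNIV]
    show "?E l \<in> borel_measurable borel" for l
      by (intro borel_measurable_diff borel_measurable_times borel_measurable_const sm borel_measurable_det F'm \<epsilon>_pos F_compose_measurable(1)[OF \<epsilon>_pos sc'])
    show "(\<lambda>x. q x * (\<Sum>a\<in>UNIV. g' a a (\<theta> x)) - s * (\<Sum>a\<in>UNIV. g' a a x)) \<in> borel_measurable borel"
      by (intro borel_measurable_diff borel_measurable_times borel_measurable_const sm q_measurable F_compose_measurable(2)[OF \<epsilon>_pos[of 0] sc'])
    show "\<bar>?E l x\<bar> \<le> C1 * Bs + \<bar>s\<bar> * Bs" for l x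
    proof -
      have "\<bar>det (\<chi> a b. F' (\<epsilon> l) b a x)\<bar> \<le> C1"
        using F'_bound by (intro C1(2)) (auto simp: le_max_iff_disj)
      then have "\<bar>det (\<chi> a b. F' (\<epsilon> l) b a x) * (\<Sum>a\<in>UNIV. g' a a (F (\<epsilon> l) x))\<bar> \<le> C1 * Bs"
        unfolding abs_mult using Bs C1(1) by (intro mult_mono) auto
      moreover have "\<bar>s * (\<Sum>a\<in>UNIV. g' a a x)\<bar> \<le> \<bar>s\<bar> * Bs" unfolding abs_mult by (intro mult_left_mono Bs) simp
      ultimately show ?thesis by linarith
    qed
    show "?E l x = 0" if "norm x > max R R\<^sub>0" for l x
      using that F_norm_out[OF _ \<epsilon>_pos, of x l] cc_zero[OF sc, of x] by simp
    show "(\<lambda>l. ?E l x) \<longlonglongrightarrow> q x * (\<Sum>a\<in>UNIV. g' a a (\<theta> x)) - s * (\<Sum>a\<in>UNIV. g' a a x)" if "x \<notin> N" for x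
      by (intro tendsto_diff tendsto_mult tendsto_const det_F'_lim that g_F_lim[OF sc'])
  qed (rule N_negligible)
  show ?thesis
    by (rule LIMSEQ_unique[OF tendsto_sum[OF lim1] ]) (use tendsto_minus[OF lim2] step in simp)
qed

lemma cc_extend:
  assumes "d > 0" "continuous_on \<Omega> h" "\<And>x. x \<in> \<Omega> \<Longrightarrow> x \<notin> K d \<Longrightarrow> h x = 0"
  shows "cc R\<^sub>0 (\<lambda>x. if x \<in> \<Omega> then h x else 0)"
proof -
  let ?h = "\<lambda>x. if x \<in> \<Omega> then h x else 0"
  have "continuous_on \<Omega> ?h" by (rule continuous_on_eq[OF assms(2)]) simp
  moreover have "continuous_on (- K d) ?h"
    by (rule continuous_on_eq[OF continuous_on_const[of _ 0]]) (use assms(3) in auto)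
  ultimately have "continuous_on (\<Omega> \<union> - K d) ?h"
    using open_dom K_closed[OF assms(1)] by (intro continuous_on_open_Un) auto
  moreover have "\<Omega> \<union> - K d = UNIV" using K_subset[OF assms(1)] by auto
  ultimately show ?thesis using norm_out by (auto simp: cc_def)
qed

text \<open>\<open>W\<close> vanishes off a closed subset of \<Omega>, so the product with
  \<open>u\<close> extended by 0 is C1 on the whole space and its partial derivative has integral 0.
  No boundary term arises although \<open>u\<close> is unrestricted near the boundary.\<close>

lemma classical_ibp:
  fixes u :: "real^'n \<Rightarrow> complex" and W :: "real^'n \<Rightarrow> real"
  assumes u: "c1 \<Omega> u u'" and W: "c1 UNIV W W'" and d: "d > 0" and WK: "\<And>x. x \<notin> K d \<Longrightarrow> W x = 0"
  shows "(LINT x|lebesgue. (if x \<in> \<Omega> then u x else 0) * of_real (W' j x)) =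
    - (LINT x|lebesgue. (if x \<in> \<Omega> then u' j x else 0) * of_real (W x))"
proof -
  have W'K: "W' j x = 0" if "x \<notin> K d" for x
    by (rule c1_zero_partial[OF W, of "- K d"]) (use K_closed[OF d] WK that in auto)
  note p = c1_mult[OF u c1_of_real[OF c1_subset[OF W subset_UNIV]]]
  have P: "c1 UNIV (\<lambda>x. if x \<in> \<Omega> then u x * of_real (W x) else 0)
     (\<lambda>j x. if x \<in> \<Omega> then u x * of_real (W' j x) + u' j x * of_real (W x) else 0)"
    by (rule c1_extend_zero[OF p open_dom K_closed[OF d] K_subset[OF d]]) (use WK in auto)
  have 0: "(LINT x|lborel. (if x \<in> \<Omega> then u x * of_real (W' j x) + u' j x * of_real (W x) else 0)) = 0"
    by (rule integral_partial_eq_0[OF P, of R\<^sub>0]) (use norm_out in auto)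
  have 1: "cc R\<^sub>0 (\<lambda>x. if x \<in> \<Omega> then u x * of_real (W' j x) else 0)"
    by (rule cc_extend[OF d]) (use W'K in \<open>auto intro!: continuous_intros c1_continuous[OF u] continuous_on_subset[OF c1_continuous_partial[OF W]]\<close>)
  have 2: "cc R\<^sub>0 (\<lambda>x. if x \<in> \<Omega> then u' j x * of_real (W x) else 0)"
    by (rule cc_extend[OF d]) (use WK in \<open>auto intro!: continuous_intros c1_continuous_partial[OF u] continuous_on_subset[OF c1_continuous[OF W]]\<close>)
  have e: "(LINT x|lebesgue. h x) = (LINT x|lborel. h x)" if "cc R\<^sub>0 h" for h :: "real^'n \<Rightarrow> complex"
    by (rule integral_completion) (use cc_integrable[OF that] in auto)
  have "(LINT x|lborel. (if x \<in> \<Omega> then u x * of_real (W' j x) else 0)) + (LINT x|lborel. (if x \<in> \<Omega> then u' j x * of_real (W x) else 0))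
    = (LINT x|lborel. (if x \<in> \<Omega> then u x * of_real (W' j x) else 0) + (if x \<in> \<Omega> then u' j x * of_real (W x) else 0))"
    by (rule Bochner_Integration.integral_add[symmetric, OF cc_integrable[OF 1] cc_integrable[OF 2]])
  also have "\<dots> = (LINT x|lborel. (if x \<in> \<Omega> then u x * of_real (W' j x) + u' j x * of_real (W x) else 0))"
    by (intro Bochner_Integration.integral_cong) auto
  finally have "(LINT x|lborel. (if x \<in> \<Omega> then u x * of_real (W' j x) else 0)) = - (LINT x|lborel. (if x \<in> \<Omega> then u' j x * of_real (W x) else 0))"
    using 0 by (simp add: eq_neg_iff_add_eq_0)
  moreover have r: "(if P then a else 0) * c = (if P then a * c else 0)" for P and a c :: complex by simp
  ultimately show ?thesis using e[OF 1] e[OF 2] unfolding r by simp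
qed

lemma q_continuous: "continuous_on \<Omega> q"
proof -
  have "continuous_on \<Omega> (\<lambda>x. det (\<chi> a b. D b a x))"
    unfolding det_def by (simp, intro continuous_intros c1_continuous_partial[OF D])
  then show ?thesis by (rule continuous_on_eq) (simp add: q_def \<theta>'_in)
qed

lemma q_nonzero: "x \<in> \<Omega> \<Longrightarrow> q x \<noteq> 0"
  using det_nonzero by (simp add: q_def \<theta>'_in)

lemma q_bound: obtains C where "\<And>x. \<bar>q x\<bar> \<le> C"
proof -
  obtain C where "C \<ge> 0" "\<And>A::real^'n^'n. (\<And>a b. \<bar>A$a$b\<bar> \<le> M) \<Longrightarrow> \<bar>det A\<bar> \<le> C"
    by (rule det_bound[of M]) blast
  then show ?thesis using \<theta>'_bound by (intro that[of C]) (simp add: q_def)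
qed

text \<open>The Piola identity applied to the identity field, whose divergence is
  \<open>CARD('n)\<close>, exhibits \<open>CARD('n)\<close> times (det DF - 1) as the divergence of
  a compactly supported field, for every approximating map \<open>F\<close>. The integral 0 survives
  the limit.\<close>

lemma integral_q: "(LINT x|lebesgue. of_real (real CARD('n) * q x - real CARD('n))) = (0::complex)"
proof -
  let ?n = "real CARD('n)"
  let ?E = "\<lambda>l x. ?n * det (\<chi> a b. F' (\<epsilon> l) b a x) - ?n"
  obtain C1 where C1: "C1 \<ge> 0" "\<And>A::real^'n^'n. (\<And>a b. \<bar>A$a$b\<bar> \<le> M) \<Longrightarrow> \<bar>det A\<bar> \<le> C1"
    by (rule det_bound[of M]) blast
  have one: "locally_integrable_on UNIV (\<lambda>x::real^'n. 1 :: complex)"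
    by (intro locally_integrableI integrable_scaleR_left integrable_indicator_cball)
  have E0: "(LINT x|lebesgue. 1 * of_real (?E l x)) = (0::complex)" for l
  proof -
    have idc: "c1 UNIV (\<lambda>y::real^'n. y $ a) (\<lambda>b y. if b = a then 1 else 0 :: real)" for a
      by (rule c1_coordinate)
    obtain V' where V': "\<And>i. c1 UNIV (\<lambda>x. piola (F' (\<epsilon> l)) (\<lambda>a. F (\<epsilon> l) x $ a) i x) (V' i)"
      "\<And>x. (\<Sum>i\<in>UNIV. V' i i x) = det (\<chi> a b. F' (\<epsilon> l) b a x) * ?n"
      using divergence_piola[where F="F (\<epsilon> l)" and F'="F' (\<epsilon> l)" and F''="F'' (\<epsilon> l)" and g="\<lambda>a y. y $ a" and g'="\<lambda>a b y. if b = a then 1 else 0",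
          OF F_c1[OF \<epsilon>_pos] F'_c1[OF \<epsilon>_pos] idc] by auto
    have W: "c1 UNIV (\<lambda>x. piola (F' (\<epsilon> l)) (\<lambda>a. F (\<epsilon> l) x $ a) i x - x $ i) (\<lambda>j x. V' i j x - (if j = i then 1 else 0))" for i
      by (rule c1_diff[OF V'(1) c1_coordinate])
    have W0: "piola (F' (\<epsilon> l)) (\<lambda>a. F (\<epsilon> l) x $ a) i x - x $ i = 0" if "norm x > R\<^sub>0" for i x
    proof -
      have "x \<notin> K (\<epsilon> l)" using norm_out[OF that] K_subset[OF \<epsilon>_pos] by blast
      from F_offK[OF this \<epsilon>_pos] show ?thesis
        using piola_identity[of "\<lambda>a. x $ a" i x] by (simp add: piola_def cong: if_cong)
    qed
    have cc: "cc R\<^sub>0 (\<lambda>x. V' i i x - (if i = i then 1 else 0))" for i by (rule c1_cc_partial[OF W W0])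
    have "(LINT x|lborel. (\<Sum>i\<in>UNIV. V' i i x - (if i = i then 1 else 0))) = (\<Sum>i\<in>UNIV. LINT x|lborel. V' i i x - (if i = i then 1 else 0))"
      by (rule Bochner_Integration.integral_sum) (rule cc_integrable[OF cc])
    also have "(LINT x|lborel. V' i i x - (if i = i then 1 else 0)) = 0" for i
      by (rule integral_partial_eq_0[OF W W0])
    then have "(\<Sum>i\<in>UNIV. LINT x|lborel. V' i i x - (if i = i then 1 else 0)) = 0" by simp
    also have "(\<lambda>x. \<Sum>i\<in>UNIV. V' i i x - (if i = i then 1 else 0)) = ?E l"
      by (simp add: sum_subtractf V'(2) mult.commute)
    finally have "(LINT x|lborel. ?E l x) = 0" .
    moreover have "cc R\<^sub>0 (?E l)"
      using cc_sum[of UNIV R\<^sub>0 "\<lambda>i x. V' i i x - (if i = i then 1 else 0)", OF cc]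
      by (simp add: sum_subtractf V'(2) mult.commute)
    then have "?E l \<in> borel_measurable lborel" using cc_integrable by blast
    then have "(LINT x|lebesgue. ?E l x) = (LINT x|lborel. ?E l x)" by (rule integral_completion)
    ultimately have z: "(LINT x|lebesgue. ?E l x) = 0" by simp
    show ?thesis unfolding mult_1 integral_complex_of_real z by simp
  qed
  have "(\<lambda>l. LINT x|lebesgue. 1 * of_real (?E l x)) \<longlonglongrightarrow> (LINT x|lebesgue. 1 * complex_of_real (?n * q x - ?n))"
  proof (rule weak_dct[OF one])
    have F'm: "F' d a b \<in> borel_measurable borel" if "d > 0" for d a b
      by (rule borel_measurable_continuous_onI[OF c1_continuous[OF F'_c1[OF that]]])
    show "?E l \<in> borel_measurable borel" for l
      by (intro borel_measurable_diff borel_measurable_times borel_measurable_const borel_measurable_det F'm \<epsilon>_pos)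
    show "(\<lambda>x. ?n * q x - ?n) \<in> borel_measurable borel"
      by (intro borel_measurable_diff borel_measurable_times borel_measurable_const q_measurable)
    show "\<bar>?E l x\<bar> \<le> ?n * C1 + ?n" for l x
    proof -
      have "\<bar>det (\<chi> a b. F' (\<epsilon> l) b a x)\<bar> \<le> C1" using F'_bound by (intro C1(2)) auto
      then have "\<bar>?n * det (\<chi> a b. F' (\<epsilon> l) b a x)\<bar> \<le> ?n * C1" by (simp add: abs_mult)
      then show ?thesis by linarith
    qed
    show "?E l x = 0" if "norm x > R\<^sub>0" for l x
    proof -
      have "x \<notin> K (\<epsilon> l)" using norm_out[OF that] K_subset[OF \<epsilon>_pos] by blast
      from F_offK(2)[OF this \<epsilon>_pos] show ?thesis by (simp add: det_delta)
    qed
    show "(\<lambda>l. ?E l x) \<longlonglongrightarrow> ?n * q x - ?n" if "x \<notin> N" for x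
      by (intro tendsto_intros det_F'_lim that)
  qed (rule N_negligible)
  then show ?thesis using E0 LIMSEQ_unique[OF tendsto_const] by fastforce
qed

text \<open>If \<open>q\<close> were negative somewhere it would be negative throughout \<open>\<Omega>\<close>, contradicting \<open>\<integral> (q - 1) = 0\<close>.\<close>

lemma q_pos: assumes "x \<in> \<Omega>" shows "q x > 0"
proof (rule ccontr)
  assume "\<not> q x > 0"
  then have qx: "q x < 0" using q_nonzero[OF assms] by simp
  have neg: "q y < 0" if "y \<in> \<Omega>" for y
  proof (rule ccontr)
    assume "\<not> q y < 0"
    then have "0 \<in> q ` \<Omega>"
      using connected_continuous_image[OF q_continuous connected_dom] qx assms that
        connectedD_interval[of "q ` \<Omega>" "q x" "q y" 0] by auto
    then show False using q_nonzero by force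
  qed
  let ?h = "\<lambda>x. real CARD('n) - real CARD('n) * q x"
  obtain C where C: "\<And>x. \<bar>q x\<bar> \<le> C" by (rule q_bound) blast
  have one: "integrable lebesgue (\<lambda>x::real^'n. indicat_real (cball 0 R\<^sub>0) x)"
    by (rule integrable_indicator_cball)
  have int: "integrable lebesgue ?h"
  proof (rule Bochner_Integration.integrable_bound)
    show "integrable lebesgue (\<lambda>x::real^'n. (real CARD('n) + real CARD('n) * C) * indicat_real (cball 0 R\<^sub>0) x)"
      by (intro integrable_mult_right one)
    show "?h \<in> borel_measurable lebesgue"
      using q_measurable by (intro measurable_completion borel_measurable_diff borel_measurable_times borel_measurable_const) (simp add: measurable_lborel1)
    show "AE x in lebesgue. norm (?h x) \<le> norm ((real CARD('n) + real CARD('n) * C) * indicat_real (cball 0 R\<^sub>0) x)"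
    proof (intro AE_I2)
      fix x
      show "norm (?h x) \<le> norm ((real CARD('n) + real CARD('n) * C) * indicat_real (cball 0 R\<^sub>0) x)"
      proof (cases "norm x \<le> R\<^sub>0")
        case True
        have "\<bar>real CARD('n) * q x\<bar> \<le> real CARD('n) * C" using C by (simp add: abs_mult)
        then show ?thesis using True by (simp add: indicator_def)
      next
        case False
        then show ?thesis using q_out[OF norm_out[of x]] by simp
      qed
    qed
  qed
  have nn: "?h x \<ge> 0" for x
  proof (cases "x \<in> \<Omega>")
    case True
    then show ?thesis using neg[OF True] by simp
  qed (simp add: q_out)
  have "(LINT x|lebesgue. real CARD('n) * q x - real CARD('n)) = 0"
    using integral_q by (simp only: integral_complex_of_real of_real_eq_0_iff)
  then have "(LINT x|lebesgue. - (real CARD('n) * q x - real CARD('n))) = 0"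
    by (simp only: Bochner_Integration.integral_minus neg_equal_0_iff_equal)
  then have "(LINT x|lebesgue. ?h x) = 0" by (simp only: minus_diff_eq)
  then have "AE x in lebesgue. ?h x = 0"
    using integral_nonneg_eq_0_iff_AE[OF int] nn by simp
  then have "AE x in lebesgue. x \<notin> \<Omega>"
    by eventually_elim (use neg in force)
  then have "negligible \<Omega>"
    using open_dom by (simp add: negligible_iff_null_sets AE_iff_null_sets[symmetric] borel_open)
  then show False using open_not_negligible open_dom dom_nonempty by blast
qed

lemma inner_field:
  fixes h :: "real^'n \<Rightarrow> complex"
  assumes h: "continuous_on \<Omega> h" and B: "\<And>x. x \<in> \<Omega> \<Longrightarrow> norm (h x) \<le> B"
  shows "locally_integrable_on UNIV (\<lambda>x. if x \<in> \<Omega> then h x else 0)"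
    and "(\<lambda>x. if x \<in> \<Omega> then h x else 0) \<in> borel_measurable lebesgue"
proof -
  have "(\<lambda>x. if x \<in> \<Omega> then h x else 0) \<in> borel_measurable borel"
    by (rule borel_measurable_continuous_on_if) (use open_dom h in auto)
  then show m: "(\<lambda>x. if x \<in> \<Omega> then h x else 0) \<in> borel_measurable lebesgue"
    by (intro measurable_completion) (simp add: measurable_lborel1)
  show "locally_integrable_on UNIV (\<lambda>x. if x \<in> \<Omega> then h x else 0)"
  proof (rule integrable_imp_locally_integrable, rule Bochner_Integration.integrable_bound[OF _ m])
    show "integrable lebesgue (\<lambda>x::real^'n. B * indicat_real (cball 0 R\<^sub>0) x)"
      by (intro integrable_mult_right integrable_indicator_cball)
    show "AE x in lebesgue. norm (if x \<in> \<Omega> then h x else 0) \<le> norm (B * indicat_real (cball 0 R\<^sub>0) x)"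
      using B dom_ball by (intro AE_I2) (auto simp: indicator_def intro: order_trans[OF _ abs_ge_self])
  qed
qed

lemma test_function_cc:
  fixes \<phi> :: "real^'n \<Rightarrow> complex"
  assumes "test_function UNIV \<phi>"
  obtains R where "cc R \<phi>" "\<And>j. cc R (partial j \<phi>)"
proof -
  obtain K where K: "compact K" "\<And>x. x \<notin> K \<Longrightarrow> \<phi> x = 0" and sm: "\<And>m. Ck_on m UNIV \<phi>"
    using assms unfolding test_function_def by blast
  obtain R where R: "\<forall>x\<in>K. norm x \<le> R" using compact_imp_bounded[OF K(1)] bounded_iff by blast
  have c: "c1 UNIV \<phi> (\<lambda>j. partial j \<phi>)"
    unfolding partial_def by (rule Ck_on_Suc_c1[OF sm[of "Suc 0"] open_UNIV])
  have z: "\<phi> x = 0" if "norm x > R" for x using K(2) R that by force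
  show ?thesis by (rule that[OF c1_cc[OF c z] c1_cc_partial[OF c z]])
qed

text \<open>The weak equation is tested with \<phi> o \<theta>. The hypothesis linking
  \<open>A\<close> and \<open>piola\<close> turns the principal part into the Piola transform of the
  gradient of \<phi>, and \<open>piola_limit_pair\<close> moves the derivatives of \<open>us\<close>
  and \<open>u\<close> to \<phi>. The Helmholtz equation for \<open>u\<close> enters when \<phi> o
  \<theta> is compared with \<phi> inside \<Omega>. Second derivatives of \<open>u\<close> need no
  bound up to the boundary, since they only meet functions supported in some
  \<open>K d\<close>.\<close>

theorem pulled_back_equation:
  fixes u us ue :: "real^'n \<Rightarrow> complex" and A :: "real^'n \<Rightarrow> real^'n^'n" and k :: real
  assumes u: "c1 \<Omega> u u'" "\<And>j. c1 \<Omega> (u' j) (u'' j)"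
    and helmholtz: "\<And>x. x \<in> \<Omega> \<Longrightarrow> (\<Sum>j\<in>UNIV. u'' j j x) + (of_real k)\<^sup>2 * u x = 0"
    and Bu: "\<And>x. x \<in> \<Omega> \<Longrightarrow> norm (u x) \<le> B" "\<And>j x. x \<in> \<Omega> \<Longrightarrow> norm (u' j x) \<le> B"
    and ue: "\<And>x. x \<in> \<Omega> \<Longrightarrow> ue x = u x" "\<And>x. x \<in> \<Omega> \<Longrightarrow> grad ue x = (\<chi> j. u' j x)"
    and G: "has_weak_gradient UNIV us G" and eq: "scattering_equation k A q ue us G"
    and A: "\<And>i j. (\<lambda>x. A x $ i $ j) \<in> borel_measurable borel" "\<And>i j x. \<bar>A x $ i $ j\<bar> \<le> BA"
      "\<And>i j x. A x $ i $ j = A x $ j $ i" "\<And>x. x \<notin> \<Omega> \<Longrightarrow> A x = mat 1"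
      "\<And>x w i. (\<Sum>j\<in>UNIV. A x $ i $ j * (\<Sum>a\<in>UNIV. \<theta>' a j x * w a)) = piola \<theta>' w i x"
    and \<phi>: "c1 UNIV \<phi> \<phi>'" "\<And>a. c1 UNIV (\<phi>' a) (\<phi>'' a)" "cc R \<phi>"
  defines "L\<phi> \<equiv> \<lambda>x. (\<Sum>a\<in>UNIV. \<phi>'' a a x) + k\<^sup>2 * \<phi> x"
  shows "(LINT x|lebesgue. us x * of_real (q x * L\<phi> (\<theta> x)))
    + (LINT x|lebesgue. (if x \<in> \<Omega> then u x else 0) * of_real (q x * L\<phi> (\<theta> x)))
    - (LINT x|lebesgue. (if x \<in> \<Omega> then u x else 0) * of_real (L\<phi> x)) = 0"
proof -
  define U where "U x = (if x \<in> \<Omega> then u x else 0)" for x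
  define U' where "U' j x = (if x \<in> \<Omega> then u' j x else 0)" for j x
  have us: "locally_integrable_on UNIV us" and Gl: "locally_integrable_on UNIV G"
    and wg: "\<And>\<psi> j. test_function UNIV \<psi> \<Longrightarrow> (LINT x|lebesgue. us x * partial j \<psi> x) = - (LINT x|lebesgue. G x $ j * \<psi> x)"
    using G by (auto simp: has_weak_gradient_def lebesgue_on_UNIV_eq)
  have Gi: "locally_integrable_on UNIV (\<lambda>x. G x $ i)" for i by (rule loc_int_component[OF Gl])
  have U: "locally_integrable_on UNIV U" unfolding U_def[abs_def] by (rule inner_field[OF c1_continuous[OF u(1)] Bu(1)])
  have U': "locally_integrable_on UNIV (U' j)" for j
    unfolding U'_def[abs_def] by (rule inner_field[OF c1_continuous_partial[OF u(1)] Bu(2)])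
  have Am: "(\<lambda>x. complex_of_real (A x $ i $ j)) \<in> borel_measurable lebesgue" for i j
    using A(1)[of i j] by (intro measurable_completion) (simp add: measurable_lborel1)
  obtain Cq where Cq: "\<And>x. \<bar>q x\<bar> \<le> Cq" by (rule q_bound) blast
  have qm: "(\<lambda>x. complex_of_real (q x)) \<in> borel_measurable lebesgue"
    using q_measurable by (intro measurable_completion) (simp add: measurable_lborel1)
  \<comment> \<open>The flux A \<nabla>us of the scattered field; \<open>AU\<close> is the flux (A -
    Id) \<nabla>u of the incident field, cut off to \<Omega>, outside of which A - Id
    vanishes.\<close>
  define AG where "AG j x = (\<Sum>i\<in>UNIV. of_real (A x $ j $ i) * G x $ i)" for j x
  define AU where "AU j x = (\<Sum>i\<in>UNIV. of_real (A x $ j $ i) * U' i x) - U' j x" for j x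
  have AG: "locally_integrable_on UNIV (AG j)" for j
    unfolding AG_def[abs_def] using A(2) by (intro loc_int_sum loc_int_mult_bounded[OF Gi Am]) auto
  have AU: "locally_integrable_on UNIV (AU j)" for j
  proof -
    have "locally_integrable_on UNIV (\<lambda>x. (\<Sum>i\<in>UNIV. of_real (A x $ j $ i) * U' i x) + - U' j x)"
      using A(2) by (intro loc_int_add loc_int_minus loc_int_sum loc_int_mult_bounded[OF U' Am] U') auto
    then show ?thesis by (simp add: AU_def[abs_def])
  qed
  define b1 where "b1 x = of_real (q x) * us x" for x
  define b2 where "b2 x = of_real (q x) * U x - U x" for x
  have b1: "locally_integrable_on UNIV b1"
    unfolding b1_def[abs_def] using Cq by (intro loc_int_mult_bounded[OF us qm]) auto
  have qU: "locally_integrable_on UNIV (\<lambda>x. of_real (q x) * U x)"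
    using Cq by (intro loc_int_mult_bounded[OF U qm]) auto
  have b2: "locally_integrable_on UNIV b2"
    using loc_int_add[OF qU loc_int_minus[OF U]] by (simp add: b2_def[abs_def])
  define aa where "aa j x = - (AG j x + AU j x)" for j x
  define bb where "bb x = (of_real k)\<^sup>2 * (b1 x + b2 x)" for x
  have aa: "locally_integrable_on UNIV (aa j)" for j
    unfolding aa_def[abs_def] by (intro loc_int_minus loc_int_add AG AU)
  have bb: "locally_integrable_on UNIV bb"
    unfolding bb_def[abs_def] by (intro loc_int_mult_bounded[where B="norm ((complex_of_real k)\<^sup>2)"] loc_int_add b1 b2) auto
  have H: "(\<Sum>j\<in>UNIV. LINT x|lebesgue. aa j x * partial j \<psi> x) + (LINT x|lebesgue. bb x * \<psi> x) = 0"
    if test: "test_function UNIV \<psi>" for \<psi>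
  proof -
    obtain R' where cc: "cc R' \<psi>" "\<And>j. cc R' (partial j \<psi>)" using test_function_cc[OF test] by blast
    note int = loc_int_cc_complex[OF AG cc(2)] loc_int_cc_complex[OF AU cc(2)]
      loc_int_cc_complex[OF b1 cc(1)] loc_int_cc_complex[OF b2 cc(1)]
    have 1: "(LINT x|lebesgue. cdot (cmat (A x) *v G x) (grad \<psi> x)) = (\<Sum>j\<in>UNIV. LINT x|lebesgue. AG j x * partial j \<psi> x)"
    proof -
      have "cdot (cmat (A x) *v G x) (grad \<psi> x) = (\<Sum>j\<in>UNIV. AG j x * partial j \<psi> x)" for x
        by (simp add: cdot_def cmat_def grad_def matrix_vector_mult_def AG_def)
      then show ?thesis by (simp add: Bochner_Integration.integral_sum[OF int(1)])
    qed
    have 2: "(LINT x|lebesgue. cdot (cmat (A x - mat 1) *v grad ue x) (grad \<psi> x)) = (\<Sum>j\<in>UNIV. LINT x|lebesgue. AU j x * partial j \<psi> x)"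
    proof -
      have "cdot (cmat (A x - mat 1) *v grad ue x) (grad \<psi> x) = (\<Sum>j\<in>UNIV. AU j x * partial j \<psi> x)" for x
      proof (cases "x \<in> \<Omega>")
        case True
        have "(\<Sum>i\<in>UNIV. (complex_of_real (A x $ j $ i) - complex_of_real (mat 1 $ j $ i)) * u' i x) = AU j x" for j
        proof -
          have "(\<Sum>i\<in>UNIV. complex_of_real (mat 1 $ j $ i) * u' i x) = (\<Sum>i\<in>UNIV. if i = j then u' i x else 0)"
            by (intro sum.cong) (auto simp: mat_def)
          then show ?thesis using True by (simp add: AU_def U'_def left_diff_distrib sum_subtractf)
        qed
        then show ?thesis
          by (simp add: cdot_def cmat_def grad_def[of \<psi>] matrix_vector_mult_def ue(2)[OF True])
      next
        case False
        then show ?thesis by (simp add: cdot_def cmat_def matrix_vector_mult_def A(4) AU_def U'_def)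
      qed
      then show ?thesis by (simp add: Bochner_Integration.integral_sum[OF int(2)])
    qed
    have 3: "(LINT x|lebesgue. of_real (q x) * us x * \<psi> x) = (LINT x|lebesgue. b1 x * \<psi> x)"
      by (simp add: b1_def)
    have 4: "(LINT x|lebesgue. of_real (q x - 1) * ue x * \<psi> x) = (LINT x|lebesgue. b2 x * \<psi> x)"
      by (intro Bochner_Integration.integral_cong refl) (auto simp: b2_def U_def ue(1) q_out algebra_simps)
    have e0: "- (\<Sum>j\<in>UNIV. LINT x|lebesgue. AG j x * partial j \<psi> x) + (of_real k)\<^sup>2 * (LINT x|lebesgue. b1 x * \<psi> x)
      = (\<Sum>j\<in>UNIV. LINT x|lebesgue. AU j x * partial j \<psi> x) - (of_real k)\<^sup>2 * (LINT x|lebesgue. b2 x * \<psi> x)"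
      using eq test unfolding scattering_equation_def 1[symmetric] 2[symmetric] 3[symmetric] 4[symmetric] by blast
    have e1: "(LINT x|lebesgue. aa j x * partial j \<psi> x) = - (LINT x|lebesgue. AG j x * partial j \<psi> x) - (LINT x|lebesgue. AU j x * partial j \<psi> x)" for j
    proof -
      have "(\<lambda>x. aa j x * partial j \<psi> x) = (\<lambda>x. - (AG j x * partial j \<psi> x) - AU j x * partial j \<psi> x)"
        by (simp add: aa_def algebra_simps fun_eq_iff)
      then show ?thesis using int(1,2)[of j j] by simp
    qed
    have e2: "(LINT x|lebesgue. bb x * \<psi> x) = (of_real k)\<^sup>2 * ((LINT x|lebesgue. b1 x * \<psi> x) + (LINT x|lebesgue. b2 x * \<psi> x))"
      using int(3,4) by (simp add: bb_def distrib_right mult.assoc)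
    show ?thesis unfolding e1 e2 sum_subtractf sum_negf using e0 by (simp add: algebra_simps)
  qed
  note weak = weak_identity_c1[OF aa bb]
  have cc\<phi>': "cc R (\<phi>' a)" for a by (rule c1_cc_partial[OF \<phi>(1)]) (rule cc_zero[OF \<phi>(3)])
  have cc\<phi>'': "cc R (\<phi>'' a b)" for a b by (rule c1_cc_partial[OF \<phi>(2)]) (rule cc_zero[OF cc\<phi>'])
  have \<phi>c: "continuous_on UNIV \<phi>" "continuous_on UNIV (\<phi>' a)" for a
    using cc_continuous[OF \<phi>(3)] cc_continuous[OF cc\<phi>'] by auto
  obtain B\<phi> where B\<phi>: "\<And>x. \<bar>\<phi> x\<bar> \<le> B\<phi>" "\<And>a x. \<bar>\<phi>' a x\<bar> \<le> B\<phi>"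
  proof -
    have "\<exists>B. \<forall>x. norm (\<phi>' a x) \<le> B" for a using cc_bounded[OF cc\<phi>'[of a]] by blast
    then obtain B where B: "\<And>a x. norm (\<phi>' a x) \<le> B a" by metis
    obtain B0 where B0: "\<And>x. norm (\<phi> x) \<le> B0" using cc_bounded[OF \<phi>(3)] by blast
    have Bn: "B a \<ge> 0" for a using order_trans[OF norm_ge_zero B] .
    have B0n: "B0 \<ge> 0" using order_trans[OF norm_ge_zero B0] .
    have "B a \<le> (\<Sum>a\<in>UNIV. B a)" for a using Bn by (intro member_le_sum) auto
    then have "\<bar>\<phi>' a x\<bar> \<le> B0 + (\<Sum>a\<in>UNIV. B a)" for a x using B[of a x] B0n
      by (smt (verit, best) real_norm_def)
    moreover have "\<bar>\<phi> x\<bar> \<le> B0 + (\<Sum>a\<in>UNIV. B a)" for x using B0[of x] sum_nonneg[of UNIV B] Bn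
      by (smt (verit, best) real_norm_def)
    ultimately show ?thesis using that by blast
  qed
  \<comment> \<open>The gradient of \<phi> o \<theta> as given by the chain rule. \<open>P\<close>
    is the Piola transform of the gradient of \<phi>, and \<open>A(5)\<close> says that A maps
    \<open>w\<close> to \<open>P\<close>.\<close>
  define w where "w j x = (\<Sum>a\<in>UNIV. \<theta>' a j x * \<phi>' a (\<theta> x))" for j x
  define P where "P i x = piola \<theta>' (\<lambda>a. \<phi>' a (\<theta> x)) i x" for i x
  let ?W = "\<lambda>l x. \<phi> (F (\<epsilon> l) x)" and ?W' = "\<lambda>l j x. \<Sum>a\<in>UNIV. F' (\<epsilon> l) a j x * \<phi>' a (F (\<epsilon> l) x)"
  have W: "c1 UNIV (?W l) (?W' l)" for l
    using c1_chain[OF F_c1[OF \<epsilon>_pos] \<phi>(1)] by simp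
  have W0: "?W l x = 0" if "norm x > max R R\<^sub>0" for l x
    using that F_norm_out[OF _ \<epsilon>_pos, of x l] cc_zero[OF \<phi>(3)] by simp
  have ccW: "cc (max R R\<^sub>0) (?W l)" for l by (rule c1_cc[OF W W0])
  have ccW': "cc (max R R\<^sub>0) (?W' l j)" for l j by (rule c1_cc_partial[OF W W0])
  have W'bd: "\<bar>?W' l j x\<bar> \<le> real CARD('n) * (M * B\<phi>)" for l j x
  proof -
    have "\<bar>?W' l j x\<bar> \<le> (\<Sum>a\<in>(UNIV::'n set). M * B\<phi>)"
      by (intro order_trans[OF sum_abs] sum_mono, unfold abs_mult)
        (intro mult_mono F'_bound B\<phi> abs_ge_zero order_trans[OF abs_ge_zero F'_bound])
    then show ?thesis by simp
  qed
  have wm: "w j \<in> borel_measurable borel" for j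
    unfolding w_def[abs_def] by (intro borel_measurable_sum borel_measurable_times \<theta>'_measurable F_compose_measurable(2)[OF \<epsilon>_pos[of 0]] \<phi>c)
  have W'lim: "(\<lambda>l. ?W' l j x) \<longlonglongrightarrow> w j x" if "x \<notin> N" for j x
    unfolding w_def by (intro tendsto_intros F'_lim that g_F_lim \<phi>c)
  have \<phi>\<theta>m: "(\<lambda>x. \<phi> (\<theta> x)) \<in> borel_measurable borel" by (rule F_compose_measurable(2)[OF \<epsilon>_pos[of 0] \<phi>c(1)])
  have \<phi>m: "\<phi> \<in> borel_measurable borel" "\<phi>' j \<in> borel_measurable borel" for j
    by (rule borel_measurable_continuous_onI[OF \<phi>c(1)], rule borel_measurable_continuous_onI[OF \<phi>c(2)])
  have limW': "(\<lambda>l. LINT x|lebesgue. c x * of_real (?W' l j x)) \<longlonglongrightarrow> (LINT x|lebesgue. c x * of_real (w j x))"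
    if "locally_integrable_on UNIV c" for c :: "real^'n \<Rightarrow> complex" and j
    by (rule weak_dct[where R="max R R\<^sub>0", OF that _ wm W'bd cc_zero[OF ccW'] N_negligible W'lim])
      (auto intro: borel_measurable_continuous_onI cc_continuous[OF ccW'])
  have limW: "(\<lambda>l. LINT x|lebesgue. c x * of_real (?W l x)) \<longlonglongrightarrow> (LINT x|lebesgue. c x * of_real (\<phi> (\<theta> x)))"
    if "locally_integrable_on UNIV c" for c :: "real^'n \<Rightarrow> complex"
    by (rule weak_dct[where R="max R R\<^sub>0", OF that _ \<phi>\<theta>m B\<phi>(1) cc_zero[OF ccW] N_negligible g_F_lim[OF \<phi>c(1)]])
      (auto intro: borel_measurable_continuous_onI cc_continuous[OF ccW])
  \<comment> \<open>\<phi> o \<theta> is not of class C1 in general, so the equation is applied to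
    the functions \<phi> o F and each integral is taken to the limit.\<close>
  have S2: "(\<Sum>j\<in>UNIV. LINT x|lebesgue. aa j x * of_real (w j x)) + (LINT x|lebesgue. bb x * of_real (\<phi> (\<theta> x))) = 0"
    by (rule LIMSEQ_unique[OF tendsto_add[OF tendsto_sum[OF limW'[OF aa]] limW[OF bb]]])
      (simp only: weak[OF H W ccW] tendsto_const)
  have I: "integrable lebesgue (\<lambda>x. c x * complex_of_real (f x))"
    if "locally_integrable_on UNIV c" "f \<in> borel_measurable borel" "\<And>x. \<bar>f x\<bar> \<le> B'" "\<And>x. norm x > R' \<Longrightarrow> f x = 0"
    for c :: "real^'n \<Rightarrow> complex" and f :: "real^'n \<Rightarrow> real" and B' R'
  proof (rule loc_int_bounded[OF that(1), where B=B' and R=R'])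
    show "(\<lambda>x. complex_of_real (f x)) \<in> borel_measurable lebesgue"
      using that(2) by (intro measurable_completion) (simp add: measurable_lborel1)
  qed (use that in auto)
  define \<rho> where "\<rho> = max R R\<^sub>0"
  have \<theta>0: "\<theta> x = x" "x \<notin> \<Omega>" if "norm x > \<rho>" for x using that \<theta>_norm_out norm_out by (auto simp: \<rho>_def)
  have w0: "w j x = 0" and P0: "P j x = 0" if "norm x > \<rho>" for j x
    using \<theta>0(1)[OF that] that cc_zero[OF cc\<phi>', of x] by (auto simp: w_def P_def \<rho>_def piola_zero)
  have wbd: "\<bar>w j x\<bar> \<le> real CARD('n) * (M * B\<phi>)" for j x
  proof -
    have "\<bar>w j x\<bar> \<le> (\<Sum>a\<in>(UNIV::'n set). M * B\<phi>)"
      unfolding w_def by (intro order_trans[OF sum_abs] sum_mono, unfold abs_mult)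
        (intro mult_mono \<theta>'_bound B\<phi> abs_ge_zero order_trans[OF abs_ge_zero \<theta>'_bound])
    then show ?thesis by simp
  qed
  obtain C1 where C1: "C1 \<ge> 0" "\<And>A::real^'n^'n. (\<And>a b. \<bar>A$a$b\<bar> \<le> max M B\<phi>) \<Longrightarrow> \<bar>det A\<bar> \<le> C1"
    by (rule det_bound[of "max M B\<phi>"]) blast
  have Pbd: "\<bar>P i x\<bar> \<le> C1" for i x
    unfolding P_def piola_def using \<theta>'_bound B\<phi> by (intro C1(2)) (auto simp: le_max_iff_disj)
  have Pm: "P i \<in> borel_measurable borel" for i
    unfolding P_def[abs_def] piola_def
  proof (rule borel_measurable_det)
    show "(\<lambda>x. if a = i then \<phi>' b (\<theta> x) else \<theta>' b a x) \<in> borel_measurable borel" for a b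
      by (cases "a = i") (simp_all add: F_compose_measurable(2)[OF \<epsilon>_pos[of 0] \<phi>c(2)] \<theta>'_measurable)
  qed
  have Iw: "integrable lebesgue (\<lambda>x. c x * complex_of_real (w j x))" if "locally_integrable_on UNIV c" for c j
    by (rule I[OF that wm wbd w0])
  have IP: "integrable lebesgue (\<lambda>x. c x * complex_of_real (P j x))" if "locally_integrable_on UNIV c" for c j
    by (rule I[OF that Pm Pbd P0])
  have I\<phi>\<theta>: "integrable lebesgue (\<lambda>x. c x * complex_of_real (\<phi> (\<theta> x)))" if "locally_integrable_on UNIV c" for c
    by (rule I[OF that \<phi>\<theta>m B\<phi>(1), of \<rho>]) (use \<theta>0(1) cc_zero[OF \<phi>(3)] in \<open>auto simp: \<rho>_def\<close>)
  have I\<phi>: "integrable lebesgue (\<lambda>x. c x * complex_of_real (\<phi> x))" if "locally_integrable_on UNIV c" for c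
    by (rule loc_int_cc[OF that \<phi>(3)])
  have I\<phi>': "integrable lebesgue (\<lambda>x. c x * complex_of_real (\<phi>' a x))" if "locally_integrable_on UNIV c" for c a
    by (rule loc_int_cc[OF that cc\<phi>'])
  have Aw: "(\<Sum>j\<in>UNIV. A x $ i $ j * w j x) = P i x" for i x
    unfolding w_def P_def by (rule A(5))
  \<comment> \<open>Symmetry of \<open>A\<close> transfers it from the gradient of the field to the
    gradient of the test function, where it produces \<open>P\<close>.\<close>
  have swap: "(\<Sum>j\<in>UNIV. (\<Sum>i\<in>UNIV. of_real (A x $ j $ i) * c i) * complex_of_real (w j x)) = (\<Sum>i\<in>UNIV. c i * of_real (P i x))"
    for x and c :: "'n \<Rightarrow> complex"
  proof -
    have "(\<Sum>j\<in>UNIV. (\<Sum>i\<in>UNIV. of_real (A x $ j $ i) * c i) * complex_of_real (w j x))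
      = (\<Sum>j\<in>UNIV. \<Sum>i\<in>UNIV. c i * of_real (A x $ i $ j * w j x))"
      unfolding sum_distrib_right by (intro sum.cong refl) (simp add: A(3)[of x] mult_ac)
    also have "\<dots> = (\<Sum>i\<in>UNIV. \<Sum>j\<in>UNIV. c i * of_real (A x $ i $ j * w j x))" by (rule sum.swap)
    also have "\<dots> = (\<Sum>i\<in>UNIV. c i * of_real (P i x))"
      unfolding Aw[symmetric] of_real_sum sum_distrib_left ..
    finally show ?thesis .
  qed
  have S3a: "(\<Sum>j\<in>UNIV. LINT x|lebesgue. AG j x * of_real (w j x)) = (\<Sum>i\<in>UNIV. LINT x|lebesgue. G x $ i * of_real (P i x))"
  proof -
    have "(\<Sum>j\<in>UNIV. LINT x|lebesgue. AG j x * of_real (w j x)) = (LINT x|lebesgue. (\<Sum>j\<in>UNIV. AG j x * of_real (w j x)))"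
      by (rule Bochner_Integration.integral_sum[symmetric]) (rule Iw[OF AG])
    also have "\<dots> = (LINT x|lebesgue. (\<Sum>i\<in>UNIV. G x $ i * of_real (P i x)))"
      unfolding AG_def swap ..
    also have "\<dots> = (\<Sum>i\<in>UNIV. LINT x|lebesgue. G x $ i * of_real (P i x))"
      by (rule Bochner_Integration.integral_sum) (rule IP[OF Gi])
    finally show ?thesis .
  qed
  have S3b: "(\<Sum>j\<in>UNIV. LINT x|lebesgue. AU j x * of_real (w j x)) =
     (\<Sum>i\<in>UNIV. LINT x|lebesgue. U' i x * of_real (P i x)) - (\<Sum>i\<in>UNIV. LINT x|lebesgue. U' i x * of_real (w i x))"
  proof -
    have "(\<Sum>j\<in>UNIV. LINT x|lebesgue. AU j x * of_real (w j x)) = (LINT x|lebesgue. (\<Sum>j\<in>UNIV. AU j x * of_real (w j x)))"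
      by (rule Bochner_Integration.integral_sum[symmetric]) (rule Iw[OF AU])
    also have "\<dots> = (LINT x|lebesgue. (\<Sum>i\<in>UNIV. U' i x * of_real (P i x)) - (\<Sum>i\<in>UNIV. U' i x * of_real (w i x)))"
      unfolding AU_def left_diff_distrib sum_subtractf swap ..
    also have "\<dots> = (\<Sum>i\<in>UNIV. LINT x|lebesgue. U' i x * of_real (P i x)) - (\<Sum>i\<in>UNIV. LINT x|lebesgue. U' i x * of_real (w i x))"
      using IP[OF U'] Iw[OF U'] by (simp add: Bochner_Integration.integral_diff Bochner_Integration.integral_sum)
    finally show ?thesis .
  qed
  define \<Delta> where "\<Delta> x = (\<Sum>a\<in>UNIV. \<phi>'' a a x)" for x
  \<comment> \<open>The case \<open>s = 0\<close>: \<open>G\<close> is the weak gradient of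
    \<open>us\<close> on the whole space, so the test fields need not vanish near the
    boundary.\<close>
  have S4: "(\<Sum>i\<in>UNIV. LINT x|lebesgue. G x $ i * of_real (P i x)) = - (LINT x|lebesgue. us x * of_real (q x * \<Delta> (\<theta> x)))"
  proof -
    have "(\<Sum>i\<in>UNIV. LINT x|lebesgue. G x $ i * of_real (piola \<theta>' (\<lambda>a. \<phi>' a (\<theta> x)) i x - 0 * \<phi>' i x)) =
      - (LINT x|lebesgue. us x * of_real (q x * (\<Sum>a\<in>UNIV. \<phi>'' a a (\<theta> x)) - 0 * (\<Sum>a\<in>UNIV. \<phi>'' a a x)))"
    proof (rule piola_limit_pair[OF us Gi \<phi>(2) cc\<phi>'])
      fix d :: real and i and V :: "real^'n \<Rightarrow> real" and V' assume V: "c1 UNIV V V'" "cc (max R R\<^sub>0) V"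
      have z: "locally_integrable_on UNIV (\<lambda>x::real^'n. 0 :: complex)" by (simp add: locally_integrable_on_def)
      \<comment> \<open>\<open>weak_identity_c1\<close> sums over all directions; a single component
        is isolated by taking the other coefficients to be 0.\<close>
      have "(\<Sum>j\<in>UNIV. LINT x|lebesgue. (if j = i then us x else 0) * of_real (V' j x)) + (LINT x|lebesgue. G x $ i * of_real (V x)) = 0"
      proof (rule weak_identity_c1[OF _ Gi _ V])
        show "locally_integrable_on UNIV (\<lambda>x. if j = i then us x else 0)" for j
          by (cases "j = i") (simp_all add: us z)
        fix \<psi> :: "real^'n \<Rightarrow> complex" assume t: "test_function UNIV \<psi>"
        have "(\<Sum>j\<in>UNIV. LINT x|lebesgue. (if j = i then us x else 0) * partial j \<psi> x) = (\<Sum>j\<in>UNIV. if j = i then LINT x|lebesgue. us x * partial j \<psi> x else 0)"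
          by (intro sum.cong) auto
        then show "(\<Sum>j\<in>UNIV. LINT x|lebesgue. (if j = i then us x else 0) * partial j \<psi> x) + (LINT x|lebesgue. G x $ i * \<psi> x) = 0"
          using wg[OF t, of i] by simp
      qed
      moreover have "(\<Sum>j\<in>UNIV. LINT x|lebesgue. (if j = i then us x else 0) * of_real (V' j x)) = (\<Sum>j\<in>UNIV. if j = i then LINT x|lebesgue. us x * of_real (V' j x) else 0)"
        by (intro sum.cong) auto
      ultimately show "(LINT x|lebesgue. us x * of_real (V' i x)) = - (LINT x|lebesgue. G x $ i * of_real (V x))"
        by (simp add: eq_neg_iff_add_eq_0)
    qed
    then show ?thesis by (simp add: P_def \<Delta>_def)
  qed
  have \<Delta>cc: "cc R \<Delta>" unfolding \<Delta>_def[abs_def] by (intro cc_sum cc\<phi>'')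
  note \<Delta>c = cc_continuous[OF \<Delta>cc, of UNIV]
  obtain B\<Delta> where "\<And>x. norm (\<Delta> x) \<le> B\<Delta>" using cc_bounded[OF \<Delta>cc] by blast
  then have B\<Delta>: "\<And>x. \<bar>\<Delta> x\<bar> \<le> B\<Delta>" by simp
  have Iq: "integrable lebesgue (\<lambda>x. c x * complex_of_real (q x * f (\<theta> x)))"
    if "locally_integrable_on UNIV c" "continuous_on UNIV f" "\<And>x. \<bar>f x\<bar> \<le> Bf" "\<And>x. norm x > R \<Longrightarrow> f x = 0"
    for c :: "real^'n \<Rightarrow> complex" and f :: "real^'n \<Rightarrow> real" and Bf
  proof (rule I[OF that(1), of _ "Cq * Bf" \<rho>])
    show "(\<lambda>x. q x * f (\<theta> x)) \<in> borel_measurable borel"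
      by (intro borel_measurable_times q_measurable F_compose_measurable(2)[OF \<epsilon>_pos[of 0] that(2)])
    show "\<bar>q x * f (\<theta> x)\<bar> \<le> Cq * Bf" for x
      unfolding abs_mult by (intro mult_mono Cq that abs_ge_zero order_trans[OF abs_ge_zero Cq])
    show "q x * f (\<theta> x) = 0" if "norm x > \<rho>" for x
      using \<theta>0(1)[OF that] that \<open>\<And>x. norm x > R \<Longrightarrow> f x = 0\<close> by (simp add: \<rho>_def)
  qed
  note Iq\<Delta> = Iq[OF _ \<Delta>c B\<Delta> cc_zero[OF \<Delta>cc]] and Iq\<phi> = Iq[OF _ \<phi>c(1) B\<phi>(1) cc_zero[OF \<phi>(3)]]
  note I\<Delta> = loc_int_cc[OF _ \<Delta>cc]
  \<comment> \<open>The case \<open>s = 1\<close>: \<open>U\<close> may jump at the boundary, so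
    \<open>U'\<close> need not be its weak gradient, and only differences supported inside \<Omega>
    are admissible.\<close>
  have S5: "(\<Sum>i\<in>UNIV. LINT x|lebesgue. U' i x * of_real (P i x)) - (\<Sum>i\<in>UNIV. LINT x|lebesgue. U' i x * of_real (\<phi>' i x)) =
     (LINT x|lebesgue. U x * of_real (\<Delta> x)) - (LINT x|lebesgue. U x * of_real (q x * \<Delta> (\<theta> x)))"
  proof -
    have "(\<Sum>i\<in>UNIV. LINT x|lebesgue. U' i x * of_real (piola \<theta>' (\<lambda>a. \<phi>' a (\<theta> x)) i x - 1 * \<phi>' i x)) =
      - (LINT x|lebesgue. U x * of_real (q x * (\<Sum>a\<in>UNIV. \<phi>'' a a (\<theta> x)) - 1 * (\<Sum>a\<in>UNIV. \<phi>'' a a x)))"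
    proof (rule piola_limit_pair[OF U U' \<phi>(2) cc\<phi>'])
      fix d :: real and i and V :: "real^'n \<Rightarrow> real" and V'
      assume V: "d > 0" "c1 UNIV V V'" "(1::real) = 1 \<Longrightarrow> (\<And>x. x \<notin> K d \<Longrightarrow> V x = 0)"
      show "(LINT x|lebesgue. U x * of_real (V' i x)) = - (LINT x|lebesgue. U' i x * of_real (V x))"
        unfolding U_def U'_def by (rule classical_ibp[OF u(1) V(2,1) V(3)[OF refl]])
    qed
    then show ?thesis using IP[OF U'] I\<phi>'[OF U'] Iq\<Delta>[OF U] I\<Delta>[OF U]
      by (simp add: P_def[symmetric] \<Delta>_def[symmetric] right_diff_distrib sum_subtractf)
  qed
  \<comment> \<open>Integration by parts for \<open>u\<close> in \<Omega> against \<phi> o F -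
    \<phi>, which vanishes near the boundary; the Helmholtz equation then removes the second
    derivatives of \<open>u\<close>, and the approximations converge.\<close>
  have S6: "(\<Sum>i\<in>UNIV. LINT x|lebesgue. U' i x * of_real (w i x)) - (\<Sum>i\<in>UNIV. LINT x|lebesgue. U' i x * of_real (\<phi>' i x)) =
     (of_real k)\<^sup>2 * ((LINT x|lebesgue. U x * of_real (\<phi> (\<theta> x))) - (LINT x|lebesgue. U x * of_real (\<phi> x)))" (is "?l = ?r")
  proof (rule LIMSEQ_unique)
    have step: "(\<Sum>i\<in>UNIV. LINT x|lebesgue. U' i x * of_real (?W' l i x)) - (\<Sum>i\<in>UNIV. LINT x|lebesgue. U' i x * of_real (\<phi>' i x)) =
       (of_real k)\<^sup>2 * ((LINT x|lebesgue. U x * of_real (?W l x)) - (LINT x|lebesgue. U x * of_real (\<phi> x)))" for l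
    proof -
      have V: "c1 UNIV (\<lambda>x. ?W l x - \<phi> x) (\<lambda>j x. ?W' l j x - \<phi>' j x)" by (rule c1_diff[OF W \<phi>(1)])
      have VK: "?W l x - \<phi> x = 0" if "x \<notin> K (\<epsilon> l)" for x using F_offK(1)[OF that \<epsilon>_pos] by simp
      have c: "cc R\<^sub>0 (\<lambda>x. if x \<in> \<Omega> then u'' j j x * of_real (?W l x - \<phi> x) else 0)" for j
        by (rule cc_extend[OF \<epsilon>_pos]) (use VK in \<open>auto intro!: continuous_intros c1_continuous_partial[OF u(2)] continuous_on_subset[OF c1_continuous[OF W]] continuous_on_subset[OF \<phi>c(1)]\<close>)
      have ic: "integrable lebesgue (\<lambda>x. (if x \<in> \<Omega> then u'' j j x else 0) * of_real (?W l x - \<phi> x))" for j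
      proof -
        have "(\<lambda>x. (if x \<in> \<Omega> then u'' j j x else 0) * of_real (?W l x - \<phi> x)) = (\<lambda>x. if x \<in> \<Omega> then u'' j j x * of_real (?W l x - \<phi> x) else 0)"
          by (auto simp: fun_eq_iff)
        then show ?thesis using integrable_completion[OF borel_measurable_integrable[OF cc_integrable[OF c[of j]]]] cc_integrable[OF c[of j]] by simp
      qed
      have "(\<Sum>i\<in>UNIV. LINT x|lebesgue. U' i x * of_real (?W' l i x)) - (\<Sum>i\<in>UNIV. LINT x|lebesgue. U' i x * of_real (\<phi>' i x)) =
        (\<Sum>i\<in>UNIV. LINT x|lebesgue. U' i x * of_real (?W' l i x - \<phi>' i x))"
        using loc_int_cc[OF U' ccW'] I\<phi>'[OF U'] unfolding of_real_diff right_diff_distrib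
        by (simp only: Bochner_Integration.integral_diff sum_subtractf)
      also have "\<dots> = - (\<Sum>i\<in>UNIV. LINT x|lebesgue. (if x \<in> \<Omega> then u'' i i x else 0) * of_real (?W l x - \<phi> x))"
        unfolding U'_def using classical_ibp[OF u(2) V \<epsilon>_pos VK] by (simp only: sum_negf)
      also have "(\<Sum>i\<in>UNIV. LINT x|lebesgue. (if x \<in> \<Omega> then u'' i i x else 0) * of_real (?W l x - \<phi> x)) =
        (LINT x|lebesgue. (\<Sum>i\<in>UNIV. (if x \<in> \<Omega> then u'' i i x else 0) * of_real (?W l x - \<phi> x)))"
        by (rule Bochner_Integration.integral_sum[symmetric]) (rule ic)
      also have "(\<lambda>x. \<Sum>i\<in>UNIV. (if x \<in> \<Omega> then u'' i i x else 0) * complex_of_real (?W l x - \<phi> x)) = (\<lambda>x. - (of_real k)\<^sup>2 * (U x * of_real (?W l x - \<phi> x)))"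
      proof
        fix x
        show "(\<Sum>i\<in>UNIV. (if x \<in> \<Omega> then u'' i i x else 0) * complex_of_real (?W l x - \<phi> x)) = - (of_real k)\<^sup>2 * (U x * of_real (?W l x - \<phi> x))"
        proof (cases "x \<in> \<Omega>")
          case True
          then have "(\<Sum>i\<in>UNIV. u'' i i x) = - (of_real k)\<^sup>2 * u x"
            using helmholtz[OF True] by (simp add: eq_neg_iff_add_eq_0)
          then show ?thesis using True by (simp add: U_def sum_distrib_right[symmetric] mult.assoc)
        qed (simp add: U_def)
      qed
      also have "- (LINT x|lebesgue. - (of_real k)\<^sup>2 * (U x * complex_of_real (?W l x - \<phi> x))) = (of_real k)\<^sup>2 * (LINT x|lebesgue. U x * complex_of_real (?W l x - \<phi> x))"
        by simp
      also have "(LINT x|lebesgue. U x * complex_of_real (?W l x - \<phi> x)) = (LINT x|lebesgue. U x * of_real (?W l x)) - (LINT x|lebesgue. U x * of_real (\<phi> x))"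
        using loc_int_cc[OF U ccW] I\<phi>[OF U] by (simp add: right_diff_distrib)
      finally show ?thesis .
    qed
    show "(\<lambda>l. (\<Sum>i\<in>UNIV. LINT x|lebesgue. U' i x * of_real (?W' l i x)) - (\<Sum>i\<in>UNIV. LINT x|lebesgue. U' i x * of_real (\<phi>' i x))) \<longlonglongrightarrow> ?l"
      by (intro tendsto_diff tendsto_sum limW'[OF U'] tendsto_const)
    show "(\<lambda>l. (\<Sum>i\<in>UNIV. LINT x|lebesgue. U' i x * of_real (?W' l i x)) - (\<Sum>i\<in>UNIV. LINT x|lebesgue. U' i x * of_real (\<phi>' i x))) \<longlonglongrightarrow> ?r"
      unfolding step by (intro tendsto_diff tendsto_mult limW[OF U] tendsto_const)
  qed
  have S2': "- ((\<Sum>j\<in>UNIV. LINT x|lebesgue. AG j x * of_real (w j x)) + (\<Sum>j\<in>UNIV. LINT x|lebesgue. AU j x * of_real (w j x)))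
    + (of_real k)\<^sup>2 * ((LINT x|lebesgue. us x * of_real (q x * \<phi> (\<theta> x))) + (LINT x|lebesgue. U x * of_real (q x * \<phi> (\<theta> x))) - (LINT x|lebesgue. U x * of_real (\<phi> (\<theta> x)))) = 0"
  proof -
    have "(LINT x|lebesgue. aa j x * of_real (w j x)) = - ((LINT x|lebesgue. AG j x * of_real (w j x)) + (LINT x|lebesgue. AU j x * of_real (w j x)))" for j
    proof -
      have "(\<lambda>x. aa j x * complex_of_real (w j x)) = (\<lambda>x. - (AG j x * of_real (w j x) + AU j x * of_real (w j x)))"
        by (simp add: aa_def algebra_simps fun_eq_iff)
      then show ?thesis using Iw[OF AG, of j j] Iw[OF AU, of j j] by simp
    qed
    moreover have "(LINT x|lebesgue. bb x * of_real (\<phi> (\<theta> x))) = (of_real k)\<^sup>2 * ((LINT x|lebesgue. us x * of_real (q x * \<phi> (\<theta> x))) + (LINT x|lebesgue. U x * of_real (q x * \<phi> (\<theta> x))) - (LINT x|lebesgue. U x * of_real (\<phi> (\<theta> x))))"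
    proof -
      have "(\<lambda>x. bb x * complex_of_real (\<phi> (\<theta> x))) = (\<lambda>x. (of_real k)\<^sup>2 * (us x * of_real (q x * \<phi> (\<theta> x)) + U x * of_real (q x * \<phi> (\<theta> x)) - U x * of_real (\<phi> (\<theta> x))))"
        by (simp add: bb_def b1_def b2_def algebra_simps fun_eq_iff)
      then show ?thesis using Iq\<phi>[OF us] Iq\<phi>[OF U] I\<phi>\<theta>[OF U] by (simp del: of_real_mult)
    qed
    ultimately show ?thesis using S2 by (simp add: sum_negf sum.distrib sum_subtractf del: of_real_mult)
  qed
  have L1: "(LINT x|lebesgue. c x * of_real (q x * L\<phi> (\<theta> x))) = (LINT x|lebesgue. c x * of_real (q x * \<Delta> (\<theta> x))) + (of_real k)\<^sup>2 * (LINT x|lebesgue. c x * of_real (q x * \<phi> (\<theta> x)))"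
    if "locally_integrable_on UNIV c" for c :: "real^'n \<Rightarrow> complex"
  proof -
    have "(\<lambda>x. c x * complex_of_real (q x * L\<phi> (\<theta> x))) = (\<lambda>x. c x * of_real (q x * \<Delta> (\<theta> x)) + (of_real k)\<^sup>2 * (c x * of_real (q x * \<phi> (\<theta> x))))"
      by (simp add: L\<phi>_def \<Delta>_def[symmetric] algebra_simps fun_eq_iff)
    then show ?thesis using Iq\<phi>[OF that] Iq\<Delta>[OF that] by (simp del: of_real_mult)
  qed
  have L2: "(LINT x|lebesgue. U x * of_real (L\<phi> x)) = (LINT x|lebesgue. U x * of_real (\<Delta> x)) + (of_real k)\<^sup>2 * (LINT x|lebesgue. U x * of_real (\<phi> x))"
  proof -
    have "(\<lambda>x. U x * complex_of_real (L\<phi> x)) = (\<lambda>x. U x * of_real (\<Delta> x) + (of_real k)\<^sup>2 * (U x * of_real (\<phi> x)))"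
      by (simp add: L\<phi>_def \<Delta>_def[symmetric] algebra_simps fun_eq_iff)
    then show ?thesis using I\<phi>[OF U] I\<Delta>[OF U] by simp
  qed
  \<comment> \<open>Two quantities drop out: the pairing of \<open>U'\<close> with the gradient of
    \<phi>, common to \<open>S5\<close> and \<open>S6\<close>, and the integral of \<open>U\<close>
    against \<phi> o \<theta> without the factor \<open>q\<close>.\<close>
  have lin: "x + \<kappa> * a + (y + \<kappa> * b) - (d + \<kappa> * e) = 0"
    if "- (ag + au) + \<kappa> * (a + b - c) = 0" "ag = ig" "au = p - w'" "ig = - x" "p - f = d - y" "w' - f = \<kappa> * (c - e)"
    for a b c d e f x y p w' ag au ig \<kappa> :: complex
    using that by algebra
  show ?thesis
    unfolding U_def[symmetric] L1[OF us] L1[OF U] L2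
    by (rule lin[OF S2' S3a S3b S4 S5 S6])
qed

end

section \<open>A bounded solution of a radial equation\<close>

lemma primitive_derivative:
  fixes h :: "real \<Rightarrow> real"
  assumes "continuous_on UNIV h" "a < r"
  shows "((\<lambda>r. integral {a..r} h) has_real_derivative h r) (at r)"
proof -
  have "((\<lambda>r. integral {a..r} h) has_real_derivative h r) (at r within {a..r+1})"
    by (rule integral_has_real_derivative) (use assms continuous_on_subset in auto)
  then show ?thesis using assms(2) by (simp add: at_within_Icc_at)
qed

lemma primitive_continuous:
  fixes h :: "real \<Rightarrow> real"
  assumes "continuous_on UNIV h"
  shows "continuous_on UNIV (\<lambda>r. integral {a..max a r} h)"
proof (intro continuous_at_imp_continuous_on ballI)
  fix r :: real
  define b where "b = max a r + 1"
  have "continuous_on {a..b} (\<lambda>x. integral {a..x} h)"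
    by (intro indefinite_integral_continuous_1 integrable_continuous_real continuous_on_subset[OF assms]) auto
  then have "continuous_on {..<b} (\<lambda>r. integral {a..max a r} h)"
    by (rule continuous_on_compose2) (auto intro!: continuous_intros simp: b_def)
  then show "isCont (\<lambda>r. integral {a..max a r} h) r"
    by (rule continuous_on_interior) (auto simp: b_def interior_open)
qed

lemma integral_inverse_square_bound:
  fixes h :: "real \<Rightarrow> real"
  assumes "continuous_on UNIV h" "a > 0" "a \<le> r" and D: "D \<ge> 0" "\<And>s. a \<le> s \<Longrightarrow> \<bar>h s\<bar> \<le> D / s\<^sup>2"
  shows "\<bar>integral {a..r} h\<bar> \<le> D / a"
proof -
  have i: "((\<lambda>s. D / s\<^sup>2) has_integral (- D / r) - (- D / a)) {a..r}"
    by (rule fundamental_theorem_of_calculus)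
      (use assms(2,3) in \<open>auto intro!: derivative_eq_intros simp: has_real_derivative_iff_has_vector_derivative[symmetric] power2_eq_square\<close>)
  have "norm (integral {a..r} h) \<le> integral {a..r} (\<lambda>s. D / s\<^sup>2)"
    by (rule Henstock_Kurzweil_Integration.integral_norm_bound_integral)
      (use i D continuous_on_subset[OF assms(1)] in \<open>auto intro!: integrable_continuous_real simp: has_integral_integrable\<close>)
  also have "\<dots> = D / a - D / r" using i by (simp add: integral_unique)
  also have "\<dots> \<le> D / a" using assms(2,3) D(1) by simp
  finally show ?thesis by simp
qed

text \<open>The equation is g'' = (c / r^2 - k^2) g + f with zero data up to \<open>a\<close>. Since
  c / r^2 is integrable at infinity, it perturbs g'' + k^2 g = f so mildly that solutions stay
  bounded.\<close>

locale radial_ode =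
  fixes k c a b :: real and f :: "real \<Rightarrow> real"
  assumes k: "k > 0" and a: "a > 0" and f_cont: "continuous_on UNIV f"
    and f_low: "\<And>r. r \<le> a \<Longrightarrow> f r = 0" and f_high: "\<And>r. r \<ge> b \<Longrightarrow> f r = 0"
begin

text \<open>In the norm weighted by \<open>E\<close> the Volterra operator below is a contraction.\<close>

definition E :: "real \<Rightarrow> real" where "E r = exp (2 * \<bar>c\<bar> / k * (1 / a - 1 / max a r))"

lemma E_cont: "continuous_on UNIV E"
  unfolding E_def using a by (intro continuous_intros) auto

lemma E_bounds: "1 \<le> E r" "E r \<le> exp (2 * \<bar>c\<bar> / k / a)"
proof -
  have m: "1 / max a r \<le> 1 / a" "1 / max a r \<ge> 0" using a by (auto simp: frac_le)
  then show "1 \<le> E r" using k by (simp add: E_def)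
  have "2 * \<bar>c\<bar> / k * (1 / a - 1 / max a r) \<le> 2 * \<bar>c\<bar> / k * (1 / a)"
    using m k by (intro mult_left_mono) auto
  then show "E r \<le> exp (2 * \<bar>c\<bar> / k / a)" by (simp add: E_def)
qed

text \<open>E/2 is a primitive of |c| / (k s^2) * E on s >= a. The factor 2 in the exponent of
  \<open>E\<close> is what makes the contraction constant 1/2.\<close>

lemma E_integral: "a \<le> r \<Longrightarrow> ((\<lambda>s. \<bar>c\<bar> / (k * s\<^sup>2) * E s) has_integral (E r - 1) / 2) {a..r}"
proof -
  assume r: "a \<le> r"
  define e where "e s = exp (2 * \<bar>c\<bar> / k * (1 / a - 1 / s)) / 2" for s
  have "((\<lambda>s. \<bar>c\<bar> / (k * s\<^sup>2) * (2 * e s)) has_integral e r - e a) {a..r}"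
    by (rule fundamental_theorem_of_calculus[OF r], unfold has_real_derivative_iff_has_vector_derivative[symmetric] e_def)
      (rule derivative_eq_intros refl | use a k in \<open>simp add: power2_eq_square field_simps\<close>)+
  moreover have "e r - e a = (E r - 1) / 2" using r a by (simp add: e_def E_def max_def field_simps)
  ultimately have 1: "((\<lambda>s. \<bar>c\<bar> / (k * s\<^sup>2) * (2 * e s)) has_integral (E r - 1) / 2) {a..r}" by simp
  show ?thesis by (rule has_integral_eq[OF _ 1]) (auto simp: e_def E_def max_def)
qed

text \<open>\<open>max a s\<close> removes the singularity at 0 and changes nothing for s >= a,
  where the integrals are taken.\<close>

definition Q :: "(real \<Rightarrow> real) \<Rightarrow> real \<Rightarrow> real" where "Q g s = c / (max a s)\<^sup>2 * g s + f s"

text \<open>Variation of constants for y'' + k^2 y = h with zero data at \<open>a\<close>. The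
  kernel sin (k (r - s)) / k is expanded so that \<open>r\<close> leaves the integrals and
  differentiation reduces to the product rule; \<open>volterra_kernel\<close> restores the compact
  form for estimates.\<close>

definition volterra :: "(real \<Rightarrow> real) \<Rightarrow> real \<Rightarrow> real" where
  "volterra h r = (sin (k * r) * integral {a..max a r} (\<lambda>s. cos (k * s) * h s) -
     cos (k * r) * integral {a..max a r} (\<lambda>s. sin (k * s) * h s)) / k"

lemma Q_cont: "continuous_on UNIV g \<Longrightarrow> continuous_on UNIV (Q g)"
  unfolding Q_def using a by (intro continuous_intros f_cont) auto

lemma volterra_cont: "continuous_on UNIV h \<Longrightarrow> continuous_on UNIV (volterra h)"
  unfolding volterra_def using k by (intro continuous_intros primitive_continuous) auto

lemma volterra_low: "r \<le> a \<Longrightarrow> volterra h r = 0"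
  by (simp add: volterra_def max_def)

lemma volterra_kernel:
  assumes h: "continuous_on UNIV h"
  shows "volterra h r = integral {a..max a r} (\<lambda>s. sin (k * (r - s)) / k * h s)"
proof -
  have i: "(\<lambda>s. g s * h s) integrable_on {a..max a r}" if "continuous_on UNIV g" for g
    using continuous_on_subset[OF continuous_on_mult[OF that h]] by (intro integrable_continuous_real) auto
  have ic: "(\<lambda>s. cos (k * s) * h s) integrable_on {a..max a r}" "(\<lambda>s. sin (k * s) * h s) integrable_on {a..max a r}"
    by (intro i continuous_intros)+
  have "(\<lambda>s. sin (k * (r - s)) / k * h s) =
     (\<lambda>s. (sin (k * r) * (cos (k * s) * h s) - cos (k * r) * (sin (k * s) * h s)) / k)"
    by (auto simp: right_diff_distrib sin_diff field_simps)
  moreover have "((\<lambda>s. (sin (k * r) * (cos (k * s) * h s) - cos (k * r) * (sin (k * s) * h s)) / k) has_integral volterra h r) {a..max a r}"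
    unfolding volterra_def
    by (intro has_integral_divide has_integral_diff has_integral_mult_right integrable_integral ic)
  ultimately show ?thesis by (simp only: integral_unique)
qed

lemma f_bound: obtains Df where "Df \<ge> 0" "\<And>s. a \<le> s \<Longrightarrow> \<bar>f s\<bar> \<le> Df / s\<^sup>2"
proof -
  have "bounded (f ` {a..b})" by (intro compact_imp_bounded compact_continuous_image continuous_on_subset[OF f_cont]) auto
  then obtain B where "\<forall>x\<in>f ` {a..b}. norm x \<le> B" unfolding bounded_iff by blast
  then have B: "\<And>s. s \<in> {a..b} \<Longrightarrow> \<bar>f s\<bar> \<le> B" by auto
  show ?thesis
  proof (rule that[of "max B 0 * b\<^sup>2"])
    show "\<bar>f s\<bar> \<le> max B 0 * b\<^sup>2 / s\<^sup>2" if "a \<le> s" for s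
    proof (cases "s \<le> b")
      case True
      have "s\<^sup>2 \<le> b\<^sup>2" using True that a by (intro power_mono) auto
      then have "\<bar>f s\<bar> * s\<^sup>2 \<le> max B 0 * b\<^sup>2" using B[of s] True that by (intro mult_mono) auto
      then show ?thesis using that a by (simp add: field_simps)
    qed (use f_high in simp)
  qed simp
qed

lemma volterra_bound:
  assumes h: "continuous_on UNIV h" and D: "D \<ge> 0" "\<And>s. a \<le> s \<Longrightarrow> \<bar>h s\<bar> \<le> D / s\<^sup>2"
  shows "\<bar>volterra h r\<bar> \<le> 2 * D / (a * k)"
proof -
  have i: "\<bar>integral {a..max a r} (\<lambda>s. g s * h s)\<bar> \<le> D / a" if "continuous_on UNIV g" "\<And>s. \<bar>g s\<bar> \<le> 1" for g
  proof (rule integral_inverse_square_bound[OF continuous_on_mult[OF that(1) h] a _ D(1)])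
    show "\<bar>g s * h s\<bar> \<le> D / s\<^sup>2" if "a \<le> s" for s
      using mult_mono[OF \<open>\<And>s. \<bar>g s\<bar> \<le> 1\<close>[of s] D(2)[OF that]] by (simp add: abs_mult)
  qed simp
  have 1: "\<bar>sin (k * r) * integral {a..max a r} (\<lambda>s. cos (k * s) * h s)\<bar> \<le> 1 * (D / a)"
    unfolding abs_mult by (intro mult_mono i continuous_intros) auto
  have 2: "\<bar>cos (k * r) * integral {a..max a r} (\<lambda>s. sin (k * s) * h s)\<bar> \<le> 1 * (D / a)"
    unfolding abs_mult by (intro mult_mono i continuous_intros) auto
  have "\<bar>volterra h r\<bar> \<le> (D / a + D / a) / k"
    unfolding volterra_def abs_divide using 1 2 k by (intro frac_le) auto
  then show ?thesis by (simp add: field_simps)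
qed

text \<open>The kernel is at most 1/k and the forcing \<open>f\<close> cancels in the difference, so
  what remains is the integral evaluated in \<open>E_integral\<close>.\<close>

lemma volterra_contraction:
  assumes g: "continuous_on UNIV g1" "continuous_on UNIV g2" and d: "\<And>s. \<bar>g1 s - g2 s\<bar> \<le> d * E s"
  shows "\<bar>volterra (Q g1) r - volterra (Q g2) r\<bar> \<le> d / 2 * E r"
proof -
  have d0: "d \<ge> 0" using order_trans[OF abs_ge_zero d[of a]] E_bounds(1)[of a] by (simp add: zero_le_mult_iff)
  have int: "(\<lambda>s. sin (k * (r - s)) / k * Q g s) integrable_on {a..max a r}" if "continuous_on UNIV g" for g
    using continuous_on_subset[OF Q_cont[OF that]] k by (intro integrable_continuous_real continuous_intros) auto
  note E = E_integral[OF max.cobounded1[of a r]]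
  have eq: "volterra (Q g1) r - volterra (Q g2) r = integral {a..max a r} (\<lambda>s. sin (k * (r - s)) / k * Q g1 s - sin (k * (r - s)) / k * Q g2 s)"
    unfolding volterra_kernel[OF Q_cont[OF g(1)]] volterra_kernel[OF Q_cont[OF g(2)]]
    by (rule Henstock_Kurzweil_Integration.integral_diff[symmetric]) (rule int[OF g(1)], rule int[OF g(2)])
  have le: "norm (integral {a..max a r} (\<lambda>s. sin (k * (r - s)) / k * Q g1 s - sin (k * (r - s)) / k * Q g2 s)) \<le> integral {a..max a r} (\<lambda>s. d * (\<bar>c\<bar> / (k * s\<^sup>2) * E s))"
  proof (rule Henstock_Kurzweil_Integration.integral_norm_bound_integral)
    show "(\<lambda>s. sin (k * (r - s)) / k * Q g1 s - sin (k * (r - s)) / k * Q g2 s) integrable_on {a..max a r}"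
      by (intro integrable_diff int g)
    show "(\<lambda>s. d * (\<bar>c\<bar> / (k * s\<^sup>2) * E s)) integrable_on {a..max a r}"
      by (rule has_integral_integrable[OF has_integral_mult_right[OF E]])
    fix s assume s: "s \<in> {a..max a r}"
    have "sin (k * (r - s)) / k * Q g1 s - sin (k * (r - s)) / k * Q g2 s = sin (k * (r - s)) * (c / (k * s\<^sup>2) * (g1 s - g2 s))"
      using s a k by (simp add: Q_def field_simps max_def)
    also have "norm \<dots> \<le> 1 * (\<bar>c\<bar> / (k * s\<^sup>2) * (d * E s))"
      unfolding real_norm_def abs_mult using k d[of s] by (intro mult_mono) (auto simp: abs_mult)
    finally show "norm (sin (k * (r - s)) / k * Q g1 s - sin (k * (r - s)) / k * Q g2 s) \<le> d * (\<bar>c\<bar> / (k * s\<^sup>2) * E s)"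
      by (simp add: mult_ac)
  qed
  have val: "integral {a..max a r} (\<lambda>s. d * (\<bar>c\<bar> / (k * s\<^sup>2) * E s)) = d * ((E r - 1) / 2)"
  proof -
    have "E (max a r) = E r" by (simp add: E_def)
    then show ?thesis using integral_unique[OF has_integral_mult_right[OF E, of d]] by simp
  qed
  have "d * ((E r - 1) / 2) \<le> d / 2 * E r" using d0 by (simp add: field_simps)
  then show ?thesis using le unfolding eq[symmetric] val real_norm_def by linarith
qed

text \<open>Banach's theorem for the conjugated operator \<open>T\<close>: the substitution g = E y
  turns the weighted norm into the sup norm on bounded continuous functions.\<close>

lemma fixed_point_exists:
  obtains g C where "continuous_on UNIV g" "\<And>r. \<bar>g r\<bar> \<le> C" "\<And>r. g r = volterra (Q g) r"
proof -
  define T where "T y r = volterra (Q (\<lambda>s. E s * y s)) r / E r" for y r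
  have Epos: "E r > 0" for r using E_bounds(1)[of r] by linarith
  have cont_Ey: "continuous_on UNIV (\<lambda>s. E s * apply_bcontfun y s)" for y :: "real \<Rightarrow>\<^sub>C real"
    by (intro continuous_intros E_cont) simp
  obtain Df where Df: "Df \<ge> 0" "\<And>s. a \<le> s \<Longrightarrow> \<bar>f s\<bar> \<le> Df / s\<^sup>2" by (rule f_bound) blast
  have T_in: "T (apply_bcontfun y) \<in> bcontfun" for y :: "real \<Rightarrow>\<^sub>C real"
  proof -
    have cT: "continuous_on UNIV (T (apply_bcontfun y))"
      unfolding T_def using Epos by (intro continuous_intros volterra_cont Q_cont cont_Ey E_cont) (metis less_irrefl)
    obtain By where By: "\<And>s. \<bar>apply_bcontfun y s\<bar> \<le> By"
      using norm_bounded[of y] by auto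
    have By0: "By \<ge> 0" using order_trans[OF abs_ge_zero By] .
    define D where "D = \<bar>c\<bar> * (exp (2 * \<bar>c\<bar> / k / a) * By) + Df"
    have D0: "D \<ge> 0" using Df(1) By0 by (simp add: D_def)
    have "\<bar>volterra (Q (\<lambda>s. E s * apply_bcontfun y s)) r\<bar> \<le> 2 * D / (a * k)" for r
    proof (rule volterra_bound[OF Q_cont[OF cont_Ey] D0])
      fix s assume s: "a \<le> s"
      have "\<bar>E s * apply_bcontfun y s\<bar> \<le> exp (2 * \<bar>c\<bar> / k / a) * By"
        unfolding abs_mult using E_bounds[of s] By by (intro mult_mono) auto
      then have "\<bar>c / s\<^sup>2 * (E s * apply_bcontfun y s)\<bar> \<le> \<bar>c\<bar> / s\<^sup>2 * (exp (2 * \<bar>c\<bar> / k / a) * By)"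
        unfolding abs_mult[of "c / s\<^sup>2"] by (intro mult_mono) (auto simp: abs_mult)
      moreover have "\<bar>Q (\<lambda>s. E s * apply_bcontfun y s) s\<bar> \<le> \<bar>c / s\<^sup>2 * (E s * apply_bcontfun y s)\<bar> + \<bar>f s\<bar>"
      proof -
        have "Q (\<lambda>s. E s * apply_bcontfun y s) s = c / s\<^sup>2 * (E s * apply_bcontfun y s) + f s"
          using s by (simp add: Q_def max_def)
        then show ?thesis by (simp only: abs_triangle_ineq)
      qed
      ultimately have "\<bar>Q (\<lambda>s. E s * apply_bcontfun y s) s\<bar> \<le> \<bar>c\<bar> / s\<^sup>2 * (exp (2 * \<bar>c\<bar> / k / a) * By) + Df / s\<^sup>2"
        using Df(2)[OF s] by linarith
      then show "\<bar>Q (\<lambda>s. E s * apply_bcontfun y s) s\<bar> \<le> D / s\<^sup>2" by (simp add: D_def add_divide_distrib)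
    qed
    then have "norm (T (apply_bcontfun y) r) \<le> 2 * D / (a * k)" for r
    proof -
      assume *: "\<And>r. \<bar>volterra (Q (\<lambda>s. E s * apply_bcontfun y s)) r\<bar> \<le> 2 * D / (a * k)"
      have "norm (T (apply_bcontfun y) r) \<le> \<bar>volterra (Q (\<lambda>s. E s * apply_bcontfun y s)) r\<bar> / 1"
        unfolding T_def real_norm_def abs_divide using E_bounds(1)[of r] by (intro divide_left_mono) auto
      then show ?thesis using *[of r] by simp
    qed
    then show ?thesis by (rule bcontfun_normI[OF cT])
  qed
  define S :: "(real \<Rightarrow>\<^sub>C real) \<Rightarrow> (real \<Rightarrow>\<^sub>C real)" where "S y = Bcontfun (T (apply_bcontfun y))" for y
  have S: "apply_bcontfun (S y) = T (apply_bcontfun y)" for y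
    unfolding S_def by (rule Bcontfun_inverse[OF T_in])
  have "\<exists>!y. S y = y"
  proof (rule banach_fix_type[of "1/2"])
    show "\<forall>y z. dist (S y) (S z) \<le> 1/2 * dist y z"
    proof (intro allI dist_bound)
      fix y z :: "real \<Rightarrow>\<^sub>C real" and r
      have "\<bar>E s * apply_bcontfun y s - E s * apply_bcontfun z s\<bar> \<le> dist y z * E s" for s
      proof -
        have "\<bar>E s * apply_bcontfun y s - E s * apply_bcontfun z s\<bar> = E s * \<bar>apply_bcontfun y s - apply_bcontfun z s\<bar>"
          using Epos[of s] by (simp add: abs_mult right_diff_distrib[symmetric])
        also have "\<dots> \<le> E s * dist y z"
          using dist_bounded[of y s z] Epos[of s] by (intro mult_left_mono) (auto simp: dist_real_def)
        finally show ?thesis by (simp add: mult.commute)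
      qed
      from volterra_contraction[OF cont_Ey cont_Ey this, of r]
      have "\<bar>T (apply_bcontfun y) r - T (apply_bcontfun z) r\<bar> \<le> 1/2 * dist y z"
        using Epos[of r] unfolding T_def diff_divide_distrib[symmetric] abs_divide by (simp add: field_simps)
      then show "dist (apply_bcontfun (S y) r) (apply_bcontfun (S z) r) \<le> 1/2 * dist y z"
        by (simp add: S dist_real_def)
    qed
  qed auto
  then obtain y where y: "S y = y" by blast
  define g where "g r = E r * apply_bcontfun y r" for r
  obtain By where By: "\<And>s. \<bar>apply_bcontfun y s\<bar> \<le> By"
    using norm_bounded[of y] by auto
  show ?thesis
  proof (rule that[of g "exp (2 * \<bar>c\<bar> / k / a) * By"])
    show "continuous_on UNIV g" unfolding g_def by (rule cont_Ey)
    show "\<bar>g r\<bar> \<le> exp (2 * \<bar>c\<bar> / k / a) * By" for r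
      unfolding g_def abs_mult using E_bounds[of r] By by (intro mult_mono) auto
    have "apply_bcontfun y r = T (apply_bcontfun y) r" for r using S[of y] y by simp
    then have "apply_bcontfun y r = volterra (Q g) r / E r" for r unfolding T_def g_def .
    then show "g r = volterra (Q g) r" for r
      using Epos[of r] by (simp only: g_def[of r]) (simp add: less_imp_neq[symmetric])
  qed
qed

theorem solution_exists:
  obtains g g' C where "\<And>r. (g has_real_derivative g' r) (at r)"
    "\<And>r. r > 0 \<Longrightarrow> (g' has_real_derivative (c / r\<^sup>2 - k\<^sup>2) * g r + f r) (at r)"
    "\<And>r. r \<le> a \<Longrightarrow> g r = 0" "\<And>r. r \<le> a \<Longrightarrow> g' r = 0"
    "\<And>r. \<bar>g r\<bar> \<le> C" "\<And>r. \<bar>g' r\<bar> \<le> C" "continuous_on UNIV g'"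
proof -
  obtain g C where g: "continuous_on UNIV g" "\<And>r. \<bar>g r\<bar> \<le> C" "\<And>r. g r = volterra (Q g) r"
    by (rule fixed_point_exists) blast
  define h where "h = Q g"
  have g_low: "g r = 0" if "r \<le> a" for r using g(3) volterra_low[OF that] by simp
  have h_low: "h r = 0" if "r \<le> a" for r using g_low[OF that] f_low[OF that] by (simp add: h_def Q_def)
  have h_cont: "continuous_on UNIV h" unfolding h_def by (rule Q_cont[OF g(1)])
  define I1 where "I1 r = integral {a..max a r} (\<lambda>s. cos (k * s) * h s)" for r
  define I2 where "I2 r = integral {a..max a r} (\<lambda>s. sin (k * s) * h s)" for r
  \<comment> \<open>\<open>h\<close> vanishes up to \<open>a\<close>, so the lower limit can be
    moved to \<open>a - 1\<close>. This yields differentiability at the junction r = a as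
    well.\<close>
  have prim: "((\<lambda>r. integral {a..max a r} (\<lambda>s. m s * h s)) has_real_derivative m r * h r) (at r)"
    if m: "continuous_on UNIV m" for m r
  proof (cases "r < a")
    case True
    have "\<forall>\<^sub>F s in nhds r. integral {a..max a s} (\<lambda>s. m s * h s) = 0"
      using eventually_nhds_in_open[of "{..<a}" r] True by (auto elim!: eventually_mono simp: max_def)
    then show ?thesis
      by (subst DERIV_cong_ev[OF refl _ refl, where g="\<lambda>_. 0"]) (use h_low[of r] True in auto)
  next
    case False
    have c: "continuous_on UNIV (\<lambda>s. m s * h s)" by (intro continuous_intros m h_cont)
    have eq: "integral {a..max a s} (\<lambda>s. m s * h s) = integral {a-1..s} (\<lambda>s. m s * h s)" if "s > a - 1" for s
    proof (cases "s \<le> a")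
      case True
      have "integral {a-1..s} (\<lambda>s. m s * h s) = integral {a-1..s} (\<lambda>s. 0)"
        by (rule Henstock_Kurzweil_Integration.integral_cong) (use True h_low in auto)
      then show ?thesis using True by (simp add: max_def)
    next
      case F: False
      have "integral {a-1..a} (\<lambda>s. m s * h s) + integral {a..s} (\<lambda>s. m s * h s) = integral {a-1..s} (\<lambda>s. m s * h s)"
        by (rule Henstock_Kurzweil_Integration.integral_combine)
          (use F continuous_on_subset[OF c] in \<open>auto intro!: integrable_continuous_real\<close>)
      moreover have "integral {a-1..a} (\<lambda>s. m s * h s) = integral {a-1..a} (\<lambda>s. 0)"
        by (rule Henstock_Kurzweil_Integration.integral_cong) (use h_low in auto)
      ultimately show ?thesis using F by (simp add: max_def)
    qed
    have "\<forall>\<^sub>F s in nhds r. integral {a..max a s} (\<lambda>s. m s * h s) = integral {a-1..s} (\<lambda>s. m s * h s)"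
      using eventually_nhds_in_open[of "{a-1<..}" r] False eq by (auto elim!: eventually_mono)
    then show ?thesis
      using primitive_derivative[OF c, of "a - 1" r] False by (subst DERIV_cong_ev[OF refl _ refl]) auto
  qed
  have I1: "(I1 has_real_derivative cos (k * r) * h r) (at r)" and I2: "(I2 has_real_derivative sin (k * r) * h r) (at r)" for r
    unfolding I1_def[abs_def] I2_def[abs_def] by (intro prim continuous_intros)+
  \<comment> \<open>In the derivative of \<open>g\<close> the two terms containing \<open>h\<close>
    cancel, so \<open>g'\<close> again involves only the integrals and can be differentiated once
    more; there cos^2 + sin^2 = 1 brings \<open>h\<close> back.\<close>
  define g' where "g' r = cos (k * r) * I1 r + sin (k * r) * I2 r" for r
  have g_eq: "g = (\<lambda>r. (sin (k * r) * I1 r - cos (k * r) * I2 r) / k)"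
    using g(3) by (auto simp: volterra_def h_def[symmetric] I1_def I2_def)
  have dg: "(g has_real_derivative g' r) (at r)" for r
  proof -
    have "((\<lambda>r. (sin (k * r) * I1 r - cos (k * r) * I2 r) / k) has_real_derivative
       ((cos (k * r) * k * I1 r + sin (k * r) * (cos (k * r) * h r)) - (- sin (k * r) * k * I2 r + cos (k * r) * (sin (k * r) * h r))) / k) (at r)"
      by (rule DERIV_cdivide) (rule derivative_eq_intros I1 I2 refl | simp add: mult_ac)+
    moreover have "((cos (k * r) * k * I1 r + sin (k * r) * (cos (k * r) * h r)) - (- sin (k * r) * k * I2 r + cos (k * r) * (sin (k * r) * h r))) / k = g' r"
      using k by (simp add: g'_def field_simps)
    ultimately show ?thesis unfolding g_eq by simp
  qed
  have dg': "(g' has_real_derivative h r - k\<^sup>2 * g r) (at r)" for r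
  proof -
    have "((\<lambda>r. cos (k * r) * I1 r + sin (k * r) * I2 r) has_real_derivative
       (- sin (k * r) * k * I1 r + cos (k * r) * (cos (k * r) * h r)) + (cos (k * r) * k * I2 r + sin (k * r) * (sin (k * r) * h r))) (at r)"
      by (rule derivative_eq_intros I1 I2 refl | simp add: mult_ac)+
    moreover have "(- sin (k * r) * k * I1 r + cos (k * r) * (cos (k * r) * h r)) + (cos (k * r) * k * I2 r + sin (k * r) * (sin (k * r) * h r)) = h r - k\<^sup>2 * g r"
    proof -
      have cs: "sin (k * r) * sin (k * r) + cos (k * r) * cos (k * r) = 1"
        using sin_cos_squared_add[of "k * r"] by (simp add: power2_eq_square)
      have "cos (k * r) * (cos (k * r) * h r) + sin (k * r) * (sin (k * r) * h r) = (sin (k * r) * sin (k * r) + cos (k * r) * cos (k * r)) * h r"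
        by (simp only: distrib_right mult.assoc add.commute)
      then have "cos (k * r) * (cos (k * r) * h r) + sin (k * r) * (sin (k * r) * h r) = h r"
        unfolding cs by simp
      moreover have "k\<^sup>2 * g r = k * (sin (k * r) * I1 r - cos (k * r) * I2 r)"
        unfolding g_eq using k by (simp add: power2_eq_square)
      ultimately show ?thesis by (simp add: algebra_simps)
    qed
    ultimately show ?thesis unfolding g'_def[abs_def] by simp
  qed
  obtain Df where Df: "Df \<ge> 0" "\<And>s. a \<le> s \<Longrightarrow> \<bar>f s\<bar> \<le> Df / s\<^sup>2" by (rule f_bound) blast
  have C0: "C \<ge> 0" using order_trans[OF abs_ge_zero g(2)] .
  define D where "D = \<bar>c\<bar> * C + Df"
  have D0: "D \<ge> 0" using C0 Df by (simp add: D_def)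
  have hD: "\<bar>h s\<bar> \<le> D / s\<^sup>2" if s: "a \<le> s" for s
  proof -
    have "\<bar>c / s\<^sup>2 * g s\<bar> \<le> \<bar>c\<bar> / s\<^sup>2 * C" unfolding abs_mult using g(2) by (intro mult_mono) auto
    moreover have "\<bar>h s\<bar> \<le> \<bar>c / s\<^sup>2 * g s\<bar> + \<bar>f s\<bar>"
    proof -
      have "h s = c / s\<^sup>2 * g s + f s" using s by (simp add: h_def Q_def max_def)
      then show ?thesis by (simp only: abs_triangle_ineq)
    qed
    ultimately have "\<bar>h s\<bar> \<le> \<bar>c\<bar> / s\<^sup>2 * C + Df / s\<^sup>2" using Df(2)[OF s] by linarith
    then show ?thesis by (simp add: D_def add_divide_distrib)
  qed
  have Ib: "\<bar>integral {a..max a r} (\<lambda>s. m s * h s)\<bar> \<le> D / a" if "continuous_on UNIV m" "\<And>s. \<bar>m s\<bar> \<le> 1" for m r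
  proof (rule integral_inverse_square_bound[OF continuous_on_mult[OF that(1) h_cont] a _ D0])
    show "\<bar>m s * h s\<bar> \<le> D / s\<^sup>2" if "a \<le> s" for s
      using mult_mono[OF \<open>\<And>s. \<bar>m s\<bar> \<le> 1\<close>[of s] hD[OF that]] by (simp add: abs_mult)
  qed simp
  have "\<bar>I1 r\<bar> \<le> D / a" "\<bar>I2 r\<bar> \<le> D / a" for r
    unfolding I1_def I2_def by (intro Ib continuous_intros; simp)+
  then have "\<bar>cos (k * r) * I1 r\<bar> \<le> 1 * (D / a)" "\<bar>sin (k * r) * I2 r\<bar> \<le> 1 * (D / a)" for r
    unfolding abs_mult by (intro mult_mono; simp)+
  then have g'b: "\<bar>g' r\<bar> \<le> D / a + D / a" for r unfolding g'_def by (metis abs_triangle_ineq add_mono mult_1 order_trans)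
  show ?thesis
  proof (rule that[of g g' "max C (D / a + D / a)"])
    show "(g has_real_derivative g' r) (at r)" for r by (rule dg)
    show "(g' has_real_derivative (c / r\<^sup>2 - k\<^sup>2) * g r + f r) (at r)" if "r > 0" for r
    proof -
      have "h r - k\<^sup>2 * g r = (c / r\<^sup>2 - k\<^sup>2) * g r + f r"
        using g_low[of r] by (cases "r \<le> a") (auto simp: h_def Q_def max_def algebra_simps)
      then show ?thesis using dg'[of r] by simp
    qed
    show "g r = 0" "g' r = 0" if "r \<le> a" for r
      using that g_low by (auto simp: g'_def I1_def I2_def max_def)
    show "\<bar>g r\<bar> \<le> max C (D / a + D / a)" "\<bar>g' r\<bar> \<le> max C (D / a + D / a)" for r
      using g(2)[of r] g'b[of r] by auto
    show "continuous_on UNIV g'" by (meson DERIV_isCont continuous_at_imp_continuous_on dg')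
  qed
qed

end

section \<open>Radial test functions\<close>

lemma c1_norm:
  fixes x0 :: "real^'n"
  shows "c1 (- {x0}) (\<lambda>x. norm (x - x0)) (\<lambda>j x. (x - x0)$j / norm (x - x0))"
proof -
  have sh: "c1 (- {x0}) (\<lambda>x. (x - x0)$i) (\<lambda>j x. if j = i then 1 else 0)" for i
    by (rule c1_eqI[OF c1_diff[OF c1_coordinate[of _ i] c1_const[of _ "x0$i"]]]) auto
  have "c1 (- {x0}) (\<lambda>x. \<Sum>i\<in>UNIV. (x - x0)$i * (x - x0)$i) (\<lambda>j x. \<Sum>i\<in>UNIV. (x - x0)$i * (if j = i then 1 else 0) + (if j = i then 1 else 0) * (x - x0)$i)"
    by (intro c1_sum c1_mult sh)
  then have sq: "c1 (- {x0}) (\<lambda>x. (norm (x - x0))\<^sup>2) (\<lambda>j x. 2 * (x - x0)$j)"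
  proof (rule c1_eqI)
    fix j x
    have "(\<Sum>i\<in>UNIV. (x - x0)$i * (if j = i then 1 else 0) + (if j = i then 1 else 0) * (x - x0)$i) = (\<Sum>i\<in>UNIV. if i = j then 2 * (x - x0)$i else 0)"
      by (intro sum.cong) auto
    then show "(\<Sum>i\<in>UNIV. (x - x0)$i * (if j = i then 1 else 0) + (if j = i then 1 else 0) * (x - x0)$i) = 2 * (x - x0)$j" by simp
  qed (auto simp: power2_norm_eq_inner inner_vec_def)
  have "c1 (- {x0}) (\<lambda>x. sqrt ((norm (x - x0))\<^sup>2)) (\<lambda>j x. inverse (sqrt ((norm (x - x0))\<^sup>2)) / 2 * (2 * (x - x0)$j))"
  proof (rule c1_compose_real[OF sq, where \<phi>'="\<lambda>t. inverse (sqrt t) / 2"])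
    show "(sqrt has_real_derivative inverse (sqrt ((norm (x - x0))\<^sup>2)) / 2) (at ((norm (x - x0))\<^sup>2))" if "x \<in> - {x0}" for x
      using that by (intro DERIV_real_sqrt) auto
  qed (auto intro!: continuous_intros)
  then show ?thesis
  proof (rule c1_eqI)
    show "open (- {x0})" by (simp add: open_Compl)
    show "inverse (sqrt ((norm (x - x0))\<^sup>2)) / 2 * (2 * (x - x0)$j) = (x - x0)$j / norm (x - x0)" for j x
      unfolding real_sqrt_abs abs_norm_cancel by (simp only: divide_inverse mult_ac) simp
  qed simp
qed

text \<open>The norm is not differentiable at the centre, but the function vanishes in a ball around
  it. This ball and the punctured space are open sets that cover everything.\<close>

lemma c1_radial:
  fixes x0 :: "real^'n" and P P' :: "real \<Rightarrow> real"
  assumes a: "a > 0" and low: "\<And>r. r \<le> a \<Longrightarrow> P r = 0" "\<And>r. r \<le> a \<Longrightarrow> P' r = 0"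
    and P: "\<And>r. r > 0 \<Longrightarrow> (P has_real_derivative P' r) (at r)" and cont: "continuous_on {0<..} P'"
  shows "c1 UNIV (\<lambda>x. P (norm (x - x0))) (\<lambda>j x. P' (norm (x - x0)) / norm (x - x0) * (x - x0)$j)"
proof -
  have 1: "c1 (- {x0}) (\<lambda>x. P (norm (x - x0))) (\<lambda>j x. P' (norm (x - x0)) * ((x - x0)$j / norm (x - x0)))"
    by (rule c1_compose_real[OF c1_norm P]) (auto intro!: continuous_on_compose2[OF cont] continuous_intros)
  have 1: "c1 (- {x0}) (\<lambda>x. P (norm (x - x0))) (\<lambda>j x. P' (norm (x - x0)) / norm (x - x0) * (x - x0)$j)"
    by (rule c1_eqI[OF 1]) auto
  have 2: "c1 (ball x0 a) (\<lambda>x. P (norm (x - x0))) (\<lambda>j x. P' (norm (x - x0)) / norm (x - x0) * (x - x0)$j)"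
    by (rule c1_eqI[OF c1_const[of _ 0]]) (use low in \<open>auto simp: dist_norm norm_minus_commute\<close>)
  have "- {x0} \<union> ball x0 a = UNIV" using a by auto
  moreover have "open (- {x0})" by (simp add: open_Compl)
  ultimately show ?thesis using c1_Un[OF 1 2 _ open_ball] by simp
qed

text \<open>With Q r = P' r / r every first partial derivative is Q of the radius times a
  coordinate, so \<open>c1_radial\<close> applies to \<open>Q\<close> in turn and second derivatives
  of the norm never appear.\<close>

lemma radial_laplacian:
  fixes x0 :: "real^'n" and P P' P'' :: "real \<Rightarrow> real"
  assumes a: "a > 0" and low: "\<And>r. r \<le> a \<Longrightarrow> P r = 0" "\<And>r. r \<le> a \<Longrightarrow> P' r = 0" "\<And>r. r \<le> a \<Longrightarrow> P'' r = 0"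
    and P: "\<And>r. r > 0 \<Longrightarrow> (P has_real_derivative P' r) (at r)" "\<And>r. r > 0 \<Longrightarrow> (P' has_real_derivative P'' r) (at r)"
    and cont: "continuous_on {0<..} P''"
  obtains \<phi>' \<phi>'' where "c1 UNIV (\<lambda>x. P (norm (x - x0))) \<phi>'" "\<And>i. c1 UNIV (\<phi>' i) (\<phi>'' i)"
    "\<And>x. (\<Sum>i\<in>UNIV. \<phi>'' i i x) = P'' (norm (x - x0)) + (real CARD('n) - 1) * P' (norm (x - x0)) / norm (x - x0)"
proof -
  have contP': "continuous_on {0<..} P'"
    by (rule continuous_at_imp_continuous_on) (use P(2) DERIV_isCont in auto)
  define Q where "Q r = P' r / r" for r
  define Q' where "Q' r = (P'' r * r - P' r) / (r * r)" for r
  have Qd: "(Q has_real_derivative Q' r) (at r)" if "r > 0" for r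
    unfolding Q_def[abs_def] Q'_def using that by (auto intro!: derivative_eq_intros P)
  have contQ': "continuous_on {0<..} Q'" unfolding Q'_def by (intro continuous_intros cont contP') auto
  have Ql: "Q r = 0" "Q' r = 0" if "r \<le> a" for r using low that by (auto simp: Q_def Q'_def)
  have sh: "c1 UNIV (\<lambda>x. (x - x0)$i) (\<lambda>j x. if j = i then 1 else 0)" for i
    by (rule c1_eqI[OF c1_diff[OF c1_coordinate[of _ i] c1_const[of _ "x0$i"]]]) auto
  let ?r = "\<lambda>x. norm (x - x0)"
  show ?thesis
  proof (rule that)
    show "c1 UNIV (\<lambda>x. P (?r x)) (\<lambda>j x. Q (?r x) * (x - x0)$j)"
      unfolding Q_def by (rule c1_radial[OF a low(1,2) P(1) contP'])
    show "c1 UNIV (\<lambda>x. Q (?r x) * (x - x0)$i) (\<lambda>j x. Q (?r x) * (if j = i then 1 else 0) + (Q' (?r x) / ?r x * (x - x0)$j) * (x - x0)$i)" for i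
      by (rule c1_mult[OF c1_radial[OF a Ql Qd contQ'] sh])
    fix x
    have "(\<Sum>i\<in>UNIV. Q (?r x) * (if i = i then 1 else 0) + (Q' (?r x) / ?r x * (x - x0)$i) * (x - x0)$i) =
       real CARD('n) * Q (?r x) + Q' (?r x) / ?r x * (\<Sum>i\<in>UNIV. (x - x0)$i * (x - x0)$i)"
      by (simp add: sum.distrib sum_distrib_left mult_ac)
    also have "(\<Sum>i\<in>UNIV. (x - x0)$i * (x - x0)$i) = ?r x * ?r x"
    proof -
      have "(\<Sum>i\<in>UNIV. (x - x0)$i * (x - x0)$i) = (x - x0) \<bullet> (x - x0)" by (simp add: inner_vec_def)
      then show ?thesis by (simp only: dot_square_norm power2_eq_square)
    qed
    also have "real CARD('n) * Q (?r x) + Q' (?r x) / ?r x * (?r x * ?r x) = P'' (?r x) + (real CARD('n) - 1) * P' (?r x) / ?r x"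
    proof (cases "?r x = 0")
      case True
      then show ?thesis using low[of 0] a by (simp add: Q_def)
    next
      case False
      then show ?thesis by (simp add: Q_def Q'_def field_simps)
    qed
    finally show "(\<Sum>i\<in>UNIV. Q (?r x) * (if i = i then 1 else 0) + (Q' (?r x) / ?r x * (x - x0)$i) * (x - x0)$i) =
       P'' (?r x) + (real CARD('n) - 1) * P' (?r x) / ?r x" .
  qed
qed

lemma plateau''_bound: obtains B where "\<And>u. \<bar>plateau'' u\<bar> \<le> B"
proof -
  have "bounded (plateau'' ` {1..2})"
    by (intro compact_imp_bounded compact_continuous_image continuous_intros) auto
  then obtain B where B: "\<forall>x\<in>plateau'' ` {1..2}. norm x \<le> B" unfolding bounded_iff by blast
  show ?thesis
  proof (rule that[of "max B 0"])
    show "\<bar>plateau'' u\<bar> \<le> max B 0" for u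
      by (cases "1 \<le> u \<and> u \<le> 2") (use B plateau_low(3)[of u] plateau_high(3)[of u] in \<open>auto simp: le_max_iff_disj\<close>)
  qed
qed

text \<open>
  The substitution \<open>\<phi>(x) = r powr (-m) g(r)\<close> with \<open>m = (d - 1)/2\<close> removes the first-order term of the
  radial Helmholtz operator; cutting \<open>g\<close> off between \<open>R\<close> and \<open>2R\<close> produces the error \<open>\<kappa>\<close>.
\<close>

lemma radial_test_family:
  fixes x0 :: "real^'n" and \<rho> :: "real \<Rightarrow> real" and k :: real
  assumes k: "k > 0" and a: "a > 0" and \<rho>: "continuous_on UNIV \<rho>" "\<And>r. r \<le> a \<Longrightarrow> \<rho> r = 0" "\<And>r. r \<ge> b \<Longrightarrow> \<rho> r = 0"
  obtains C \<kappa> where "C \<ge> 0"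
    "\<And>R r. R \<ge> max 1 b \<Longrightarrow> \<bar>\<kappa> R r\<bar> \<le> C * R powr (- (real CARD('n) + 1) / 2)"
    "\<And>R r. R \<ge> max 1 b \<Longrightarrow> r < R \<or> 2 * R < r \<Longrightarrow> \<kappa> R r = 0"
    "\<And>R. R \<ge> max 1 b \<Longrightarrow> \<exists>\<phi> \<phi>' \<phi>''. c1 UNIV \<phi> \<phi>' \<and> (\<forall>i. c1 UNIV (\<phi>' i) (\<phi>'' i)) \<and> cc (norm x0 + 2 * R) \<phi> \<and>
       (\<forall>x::real^'n. (\<Sum>i\<in>UNIV. \<phi>'' i i x) + k\<^sup>2 * \<phi> x = \<rho> (norm (x - x0)) + \<kappa> R (norm (x - x0)))"
proof -
  define m where "m = (real CARD('n) - 1) / 2"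
  have m0: "m \<ge> 0" by (simp add: m_def Suc_leI)
  \<comment> \<open>For r > 0 this is r powr m times \<rho> r, since \<rho> vanishes up to
    \<open>a\<close>; \<open>max a r\<close> keeps the power continuous on the whole line.\<close>
  define f where "f r = max a r powr m * \<rho> r" for r
  interpret radial_ode k "m * (m - 1)" a b f
  proof
    show "continuous_on UNIV f" unfolding f_def using a by (intro continuous_intros \<rho>) auto
  qed (use k a \<rho> in \<open>auto simp: f_def\<close>)
  obtain g g' C where g: "\<And>r. (g has_real_derivative g' r) (at r)"
    "\<And>r. r > 0 \<Longrightarrow> (g' has_real_derivative (m * (m - 1) / r\<^sup>2 - k\<^sup>2) * g r + f r) (at r)"
    "\<And>r. r \<le> a \<Longrightarrow> g r = 0" "\<And>r. r \<le> a \<Longrightarrow> g' r = 0"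
    "\<And>r. \<bar>g r\<bar> \<le> C" "\<And>r. \<bar>g' r\<bar> \<le> C" "continuous_on UNIV g'"
    by (rule solution_exists) blast
  have gc: "continuous_on S g" for S by (meson DERIV_isCont continuous_at_imp_continuous_on g(1))
  have g'c: "continuous_on S g'" for S using g(7) continuous_on_subset by blast
  have C0: "C \<ge> 0" using order_trans[OF abs_ge_zero g(5)] .
  obtain B where B: "\<And>u. \<bar>plateau'' u\<bar> \<le> B" by (rule plateau''_bound) blast
  have B0: "B \<ge> 0" using order_trans[OF abs_ge_zero B] .
  \<comment> \<open>The commutator of the cut-off with the radial operator: with \<beta> = plateau
    (r / R) it consists of the terms 2 \<beta>' g' + \<beta>'' g, multiplied by the power from the
    substitution.\<close>
  define \<kappa> where "\<kappa> R r = r powr (- m) * (2 * (plateau' (r/R) / R) * g' r + plateau'' (r/R) / R\<^sup>2 * g r)" for R r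
  have \<kappa>0: "\<kappa> R r = 0" if "R \<ge> max 1 b" "r < R \<or> 2 * R < r" for R r
  proof -
    have "r / R \<le> 1 \<or> r / R \<ge> 2" using that by (auto simp: field_simps)
    then show ?thesis by (auto simp: \<kappa>_def plateau_low plateau_high)
  qed
  show ?thesis
  \<comment> \<open>18 = 2 * 9 with 9 the bound for \<open>plateau'\<close>, while \<open>B\<close>
    bounds \<open>plateau''\<close>; for R >= 1 the factor 1 / R^2 is weakened to 1 / R. The power
    of r contributes R to the exponent -m, and -m - 1 = -(d + 1) / 2 with d =
    \<open>CARD('n)\<close>.\<close>
  proof (rule that[of "(18 + B) * C" \<kappa>])
    show "(18 + B) * C \<ge> 0" using B0 C0 by simp
    show "\<kappa> R r = 0" if "R \<ge> max 1 b" "r < R \<or> 2 * R < r" for R r using \<kappa>0[OF that] .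
    show "\<bar>\<kappa> R r\<bar> \<le> (18 + B) * C * R powr (- (real CARD('n) + 1) / 2)" if R: "R \<ge> max 1 b" for R r
    proof (cases "R \<le> r")
      case False
      then show ?thesis using \<kappa>0[OF R, of r] B0 C0 by simp
    next
      case True
      have R1: "R \<ge> 1" using R by simp
      have p: "r powr (- m) \<le> R powr (- m)" using True R1 m0 by (intro powr_mono2') auto
      have "\<bar>2 * (plateau' (r/R) / R) * g' r\<bar> \<le> 2 * (9 / R) * C"
        unfolding abs_mult abs_divide using R1 plateau_bounds(3) g(6) by (intro mult_mono frac_le) auto
      moreover have "\<bar>plateau'' (r/R) / R\<^sup>2 * g r\<bar> \<le> B / R * C"
      proof -
        have "\<bar>plateau'' (r/R) / R\<^sup>2\<bar> \<le> B / R"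
          unfolding abs_divide using R1 B B0 by (intro frac_le) (auto simp: power2_eq_square)
        then show ?thesis unfolding abs_mult using g(5) R1 B0 by (intro mult_mono) auto
      qed
      ultimately have "\<bar>2 * (plateau' (r/R) / R) * g' r + plateau'' (r/R) / R\<^sup>2 * g r\<bar> \<le> 2 * (9 / R) * C + B / R * C"
        using abs_triangle_ineq[of "2 * (plateau' (r/R) / R) * g' r" "plateau'' (r/R) / R\<^sup>2 * g r"] by linarith
      also have "\<dots> = (18 + B) * C / R" using R1 by (simp add: field_simps)
      finally have "\<bar>2 * (plateau' (r/R) / R) * g' r + plateau'' (r/R) / R\<^sup>2 * g r\<bar> \<le> (18 + B) * C / R" .
      then have "\<bar>\<kappa> R r\<bar> \<le> R powr (- m) * ((18 + B) * C / R)"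
        unfolding \<kappa>_def abs_mult using p B0 C0 R1 by (intro mult_mono) auto
      also have "\<dots> = (18 + B) * C * (R powr (- m) * R powr (- 1))" using R1 by (simp add: powr_minus_divide)
      also have "R powr (- m) * R powr (- 1) = R powr (- (real CARD('n) + 1) / 2)"
        unfolding powr_add[symmetric] by (simp add: m_def field_simps)
      finally show ?thesis .
    qed
    fix R assume R: "R \<ge> max 1 b"
    then have R1: "R \<ge> 1" "R \<ge> b" by auto
    define \<beta> where "\<beta> r = plateau (r/R)" for r
    define \<beta>' where "\<beta>' r = plateau' (r/R) / R" for r
    define \<beta>'' where "\<beta>'' r = plateau'' (r/R) / R\<^sup>2" for r
    have \<beta>d: "(\<beta> has_real_derivative \<beta>' r) (at r)" "(\<beta>' has_real_derivative \<beta>'' r) (at r)" for r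
    proof -
      have d: "((\<lambda>r. r / R) has_real_derivative 1 / R) (at r)"
        by (rule DERIV_cdivide) simp
      show "(\<beta> has_real_derivative \<beta>' r) (at r)"
        unfolding \<beta>_def[abs_def] \<beta>'_def using DERIV_chain2[OF plateau_derivative d] by simp
      show "(\<beta>' has_real_derivative \<beta>'' r) (at r)"
        unfolding \<beta>'_def[abs_def] \<beta>''_def using DERIV_cdivide[OF DERIV_chain2[OF plateau'_derivative d], of R]
        by (simp add: power2_eq_square)
    qed
    define g'' where "g'' r = (m * (m - 1) / r\<^sup>2 - k\<^sup>2) * g r + f r" for r
    define G where "G r = \<beta> r * g r" for r
    define G' where "G' r = \<beta>' r * g r + \<beta> r * g' r" for r
    define G'' where "G'' r = \<beta>'' r * g r + 2 * \<beta>' r * g' r + \<beta> r * g'' r" for r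
    have Gd: "(G has_real_derivative G' r) (at r)" "r > 0 \<Longrightarrow> (G' has_real_derivative G'' r) (at r)" for r
      unfolding G_def[abs_def] G'_def[abs_def] G''_def g''_def
      by (auto intro!: derivative_eq_intros \<beta>d g(1,2) simp: algebra_simps)
    define P where "P r = r powr (- m) * G r" for r
    define P' where "P' r = r powr (- m) * (G' r - m * G r / r)" for r
    define P'' where "P'' r = r powr (- m) * (G'' r - 2 * m * G' r / r + m * (m + 1) * G r / r\<^sup>2)" for r
    have pd: "((\<lambda>r. r powr (- m)) has_real_derivative r powr (- m) * (- m / r)) (at r)" if "r > 0" for r
      using that by (auto intro!: derivative_eq_intros simp: powr_diff)
    have Pd: "(P has_real_derivative P' r) (at r)" if "r > 0" for r
    proof -
      have "((\<lambda>r. r powr (- m) * G r) has_real_derivative (r powr (- m) * (- m / r) * G r + G' r * r powr (- m))) (at r)"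
        by (rule DERIV_mult[OF pd[OF that] Gd(1)])
      then show ?thesis unfolding P_def[abs_def] P'_def by (simp add: algebra_simps)
    qed
    have P'd: "(P' has_real_derivative P'' r) (at r)" if r: "r > 0" for r
    proof -
      have i: "((\<lambda>r. G' r - m * G r / r) has_real_derivative G'' r - (m * G' r * r - m * G r) / (r * r)) (at r)"
        using r by (auto intro!: derivative_eq_intros Gd)
      have "((\<lambda>r. r powr (- m) * (G' r - m * G r / r)) has_real_derivative (r powr (- m) * (- m / r) * (G' r - m * G r / r) + (G'' r - (m * G' r * r - m * G r) / (r * r)) * r powr (- m))) (at r)"
        by (rule DERIV_mult[OF pd[OF r] i])
      moreover have "r powr (- m) * (- m / r) * (G' r - m * G r / r) + (G'' r - (m * G' r * r - m * G r) / (r * r)) * r powr (- m) = P'' r"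
        using r unfolding P''_def by (simp add: field_simps power2_eq_square)
      ultimately show ?thesis unfolding P'_def[abs_def] by simp
    qed
    have f_low': "f r = 0" if "r \<le> a" for r using that \<rho>(2) by (simp add: f_def)
    have Gl: "G r = 0" "G' r = 0" "G'' r = 0" if "r \<le> a" for r
      using g(3,4)[OF that] f_low'[OF that] by (auto simp: G_def G'_def G''_def g''_def)
    have Pl: "P r = 0" "P' r = 0" "P'' r = 0" if "r \<le> a" for r
      using Gl[OF that] by (auto simp: P_def P'_def P''_def)
    have fc: "continuous_on S f" for S using f_cont continuous_on_subset by blast
    have \<beta>c: "continuous_on S \<beta>" "continuous_on S \<beta>'" "continuous_on S \<beta>''" for S
      unfolding \<beta>_def \<beta>'_def \<beta>''_def using R1 by (auto intro!: continuous_intros)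
    have contP'': "continuous_on {0<..} P''"
      unfolding P''_def G''_def G'_def G_def g''_def
      by (intro continuous_intros gc g'c fc \<beta>c) auto
    obtain \<phi>' \<phi>'' where \<phi>: "c1 UNIV (\<lambda>x. P (norm (x - x0))) \<phi>'" "\<And>i. c1 UNIV (\<phi>' i) (\<phi>'' i)"
      "\<And>x. (\<Sum>i\<in>UNIV. \<phi>'' i i x) = P'' (norm (x - x0)) + (real CARD('n) - 1) * P' (norm (x - x0)) / norm (x - x0)"
      using radial_laplacian[OF a Pl Pd P'd contP'', of x0] by blast
    have key: "P'' r + (real CARD('n) - 1) * P' r / r + k\<^sup>2 * P r = \<rho> r + \<kappa> R r" for r
    proof (cases "r \<le> a")
      case True
      then show ?thesis using Pl[OF True] g(3,4)[OF True] \<rho>(2)[OF True] by (simp add: \<kappa>_def)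
    next
      case False
      then have r: "r > 0" using a by simp
      have n: "real CARD('n) - 1 = 2 * m" by (simp add: m_def)
      have "P'' r + (real CARD('n) - 1) * P' r / r + k\<^sup>2 * P r = r powr (- m) * (G'' r - m * (m - 1) * G r / r\<^sup>2 + k\<^sup>2 * G r)"
        unfolding n P''_def P'_def P_def using r by (simp add: field_simps power2_eq_square)
      also have "G'' r - m * (m - 1) * G r / r\<^sup>2 + k\<^sup>2 * G r = \<beta> r * f r + (2 * \<beta>' r * g' r + \<beta>'' r * g r)"
        unfolding G''_def G_def g''_def by (simp add: algebra_simps)
      \<comment> \<open>\<open>f\<close> vanishes from \<open>b\<close> on and b <= R, while the
        cut-off equals 1 up to \<open>R\<close>.\<close>
      also have "\<beta> r * f r = f r"
        using \<rho>(3)[of r] R1 by (cases "r \<le> R") (auto simp: \<beta>_def f_def plateau_low)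
      also have "r powr (- m) * (f r + (2 * \<beta>' r * g' r + \<beta>'' r * g r)) = r powr (- m) * f r + \<kappa> R r"
        by (simp add: \<kappa>_def \<beta>'_def \<beta>''_def distrib_left)
      also have "r powr (- m) * f r = \<rho> r"
        using r False by (simp add: f_def max_def powr_minus field_simps)
      finally show ?thesis .
    qed
    have "P (norm (x - x0)) = 0" if "norm x > norm x0 + 2 * R" for x
    proof -
      have "norm x \<le> norm x0 + norm (x - x0)" using norm_triangle_sub[of x x0] by simp
      then have "norm (x - x0) / R \<ge> 2" using that R1 by (simp add: field_simps)
      then show ?thesis by (simp add: P_def G_def \<beta>_def plateau_high)
    qed
    then have "cc (norm x0 + 2 * R) (\<lambda>x. P (norm (x - x0)))" by (rule c1_cc[OF \<phi>(1)])
    moreover have "(\<Sum>i\<in>UNIV. \<phi>'' i i x) + k\<^sup>2 * P (norm (x - x0)) = \<rho> (norm (x - x0)) + \<kappa> R (norm (x - x0))" for x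
      unfolding \<phi>(3) by (rule key)
    ultimately show "\<exists>\<phi> \<phi>' \<phi>''. c1 UNIV \<phi> \<phi>' \<and> (\<forall>i. c1 UNIV (\<phi>' i) (\<phi>'' i)) \<and> cc (norm x0 + 2 * R) \<phi> \<and>
       (\<forall>x::real^'n. (\<Sum>i\<in>UNIV. \<phi>'' i i x) + k\<^sup>2 * \<phi> x = \<rho> (norm (x - x0)) + \<kappa> R (norm (x - x0)))"
      using \<phi>(1,2) by blast
  qed
qed

section \<open>Polar coordinates\<close>

lemma nn_integral_lborel_scale:
  fixes h :: "'a::euclidean_space \<Rightarrow> ennreal"
  assumes h: "h \<in> borel_measurable borel" and t: "t > 0"
  shows "(\<integral>\<^sup>+x. h x \<partial>lborel) = ennreal (t ^ DIM('a)) * (\<integral>\<^sup>+x. h (t *\<^sub>R x) \<partial>lborel)"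
proof -
  have "(lborel :: 'a measure) = density (distr lborel borel (\<lambda>x. 0 + t *\<^sub>R x)) (\<lambda>_. \<bar>t\<bar> ^ DIM('a))"
    by (rule lborel_affine) (use t in simp)
  then have "(\<integral>\<^sup>+x. h x \<partial>lborel) = (\<integral>\<^sup>+x. h x \<partial>density (distr lborel borel (\<lambda>x. 0 + t *\<^sub>R x)) (\<lambda>_. \<bar>t\<bar> ^ DIM('a)))"
    by simp
  also have "\<dots> = (\<integral>\<^sup>+x. ennreal (\<bar>t\<bar> ^ DIM('a)) * h x \<partial>distr lborel borel (\<lambda>x. 0 + t *\<^sub>R x))"
    using h by (subst nn_integral_density) (auto simp: ennreal_power)
  also have "\<dots> = (\<integral>\<^sup>+x. ennreal (\<bar>t\<bar> ^ DIM('a)) * h (0 + t *\<^sub>R x) \<partial>lborel)"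
    using h by (subst nn_integral_distr) auto
  also have "\<dots> = ennreal (t ^ DIM('a)) * (\<integral>\<^sup>+x. h (t *\<^sub>R x) \<partial>lborel)"
    using t h by (subst nn_integral_cmult[symmetric]) auto
  finally show ?thesis .
qed

text \<open>For n = d this value cancels the factor d |y|^d left over by the two substitutions in
  \<open>polar_coordinates\<close>.\<close>

lemma nn_integral_power_tail:
  fixes y :: real
  assumes "y > 0" "n > 0"
  shows "(\<integral>\<^sup>+t. ennreal (1 / t ^ (n + 1)) * indicator {y..} t \<partial>lborel) = ennreal (1 / (real n * y ^ n))"
proof -
  have "(\<integral>\<^sup>+t. ennreal (1 / t ^ (n + 1)) * indicator {y..} t \<partial>lborel) = ennreal (0 - (- 1 / (real n * y ^ n)))"
  proof (rule nn_integral_FTC_atLeast)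
    show "((\<lambda>t. - 1 / (real n * t ^ n)) has_real_derivative 1 / t ^ (n + 1)) (at t)" if "y \<le> t" for t
    proof -
      have t: "t > 0" using that assms by simp
      obtain m where n: "n = Suc m" using assms(2) gr0_implies_Suc by blast
      have "((\<lambda>t. - 1 / (real n * t ^ n)) has_real_derivative (0 * (real n * t ^ n) - (-1) * (real n * (real n * t ^ (n - 1)))) / ((real n * t ^ n) * (real n * t ^ n))) (at t)"
        using t assms(2) by (intro DERIV_divide DERIV_const DERIV_cmult) (auto intro!: derivative_eq_intros)
      moreover have "(0 * (real n * t ^ n) - (-1) * (real n * (real n * t ^ (n - 1)))) / ((real n * t ^ n) * (real n * t ^ n)) = 1 / t ^ (n + 1)"
      proof -
        define N where "N = real n"
        have N: "N > 0" using assms(2) by (simp add: N_def)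
        have p: "t ^ n = t * t ^ m" "t ^ (n - 1) = t ^ m" "t ^ (n + 1) = t * t * t ^ m" by (simp_all add: n)
        show ?thesis unfolding N_def[symmetric] p using t N by (simp add: field_simps)
      qed
      ultimately show ?thesis by simp
    qed
    show "0 \<le> 1 / t ^ (n + 1)" if "y \<le> t" for t using that assms by simp
    have "((\<lambda>t. 1 / (real n * t ^ n)) \<longlongrightarrow> 0) at_top"
      using assms(2) by (intro tendsto_divide_0[OF tendsto_const] filterlim_at_top_imp_at_infinity filterlim_tendsto_pos_mult_at_top[OF tendsto_const _ filterlim_pow_at_top] filterlim_ident) auto
    then show "((\<lambda>t. - 1 / (real n * t ^ n)) \<longlongrightarrow> 0) at_top"
      using tendsto_minus by fastforce
  qed simp
  then show ?thesis by simp
qed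

lemma measurable_sgn_punctured_ball:
  "sgn \<in> restrict_space lborel (cball 0 1 - {0}) \<rightarrow>\<^sub>M restrict_space borel (sphere (0::'a::euclidean_space) 1)"
proof (rule measurable_restrict_space2)
  show "sgn \<in> space (restrict_space lborel (cball 0 1 - {0::'a})) \<rightarrow> sphere 0 1"
    by (auto simp: space_restrict_space norm_sgn)
  have "(sgn :: 'a \<Rightarrow> 'a) \<in> borel_measurable borel"
    unfolding sgn_div_norm[abs_def] by measurable
  then show "sgn \<in> borel_measurable (restrict_space lborel (cball 0 1 - {0::'a}))"
    by (intro measurable_restrict_space1) simp
qed

text \<open>By the cone description of the surface measure the right-hand side is a double integral
  over r > 0 and x in the punctured unit ball. Substituting r = |x| t and then y = t x turns it into
  the integral of h(y) d |y|^d times the integral of t^(-d-1) over t >= |y|, and the last integral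
  is 1 / (d |y|^d).\<close>

theorem polar_coordinates:
  fixes h :: "'a::euclidean_space \<Rightarrow> ennreal"
  assumes h[measurable]: "h \<in> borel_measurable borel" and h0: "h 0 = 0"
  shows "(\<integral>\<^sup>+x. h x \<partial>lborel) =
    (\<integral>\<^sup>+r. indicator {0<..} r * ennreal (r ^ (DIM('a) - 1)) * (\<integral>\<^sup>+\<theta>. h (r *\<^sub>R \<theta>) \<partial>unit_sphere_measure) \<partial>lborel)"
proof -
  let ?d = "DIM('a)"
  define B where "B = cball 0 1 - {0::'a}"
  have B_m[measurable]: "B \<in> sets borel" by (simp add: B_def)
  have d: "?d > 0" by simp
  have dS: "Suc (?d - 1) = ?d" using d by simp
  note sgn_m = measurable_sgn_punctured_ball[where 'a='a, folded B_def]
  have sphere: "(\<integral>\<^sup>+\<theta>. h (r *\<^sub>R \<theta>) \<partial>unit_sphere_measure) = of_nat ?d * (\<integral>\<^sup>+x. h (r *\<^sub>R sgn x) * indicator B x \<partial>lborel)" for r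
  proof -
    have m: "(\<lambda>\<theta>. h (r *\<^sub>R \<theta>)) \<in> borel_measurable (restrict_space borel (sphere 0 1))"
      by (intro measurable_restrict_space1) measurable
    show ?thesis
      unfolding unit_sphere_measure_def B_def[symmetric]
    proof -
      let ?N = "distr (restrict_space lborel B) (restrict_space borel (sphere 0 1)) sgn"
      have m': "(\<lambda>\<theta>. h (r *\<^sub>R \<theta>)) \<in> borel_measurable ?N" using m by simp
      have "(\<integral>\<^sup>+\<theta>. h (r *\<^sub>R \<theta>) \<partial>scale_measure (of_nat ?d) ?N) = of_nat ?d * (\<integral>\<^sup>+\<theta>. h (r *\<^sub>R \<theta>) \<partial>?N)"
        by (rule nn_integral_scale_measure[OF m'])
      also have "(\<integral>\<^sup>+\<theta>. h (r *\<^sub>R \<theta>) \<partial>?N) = (\<integral>\<^sup>+x. h (r *\<^sub>R sgn x) \<partial>restrict_space lborel B)"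
        by (rule nn_integral_distr[OF sgn_m m'])
      also have "\<dots> = (\<integral>\<^sup>+x. h (r *\<^sub>R sgn x) * indicator B x \<partial>lborel)"
        by (rule nn_integral_restrict_space) simp
      finally show "(\<integral>\<^sup>+\<theta>. h (r *\<^sub>R \<theta>) \<partial>scale_measure (of_nat ?d) ?N) = of_nat ?d * (\<integral>\<^sup>+x. h (r *\<^sub>R sgn x) * indicator B x \<partial>lborel)" .
    qed
  qed
  let ?pos = "indicator {0<..} :: real \<Rightarrow> ennreal"
  let ?p = "\<lambda>r::real. ennreal (r ^ (?d - 1))"
  have "(\<integral>\<^sup>+r. ?pos r * ?p r * (\<integral>\<^sup>+\<theta>. h (r *\<^sub>R \<theta>) \<partial>unit_sphere_measure) \<partial>lborel)
    = (\<integral>\<^sup>+r. (\<integral>\<^sup>+x. of_nat ?d * (?pos r * ?p r * h (r *\<^sub>R sgn x) * indicator B x) \<partial>lborel) \<partial>lborel)"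
    unfolding sphere
  proof (rule nn_integral_cong)
    fix r :: real
    have m: "(\<lambda>x::'a. h (r *\<^sub>R sgn x) * indicator B x) \<in> borel_measurable lborel"
      unfolding sgn_div_norm by measurable
    have "(\<integral>\<^sup>+x. of_nat ?d * (?pos r * ?p r * h (r *\<^sub>R sgn x) * indicator B x) \<partial>lborel)
      = (\<integral>\<^sup>+x. (of_nat ?d * (?pos r * ?p r)) * (h (r *\<^sub>R sgn x) * indicator B x) \<partial>lborel)"
      by (simp only: mult.assoc)
    then show "?pos r * ?p r * (of_nat ?d * (\<integral>\<^sup>+x. h (r *\<^sub>R sgn x) * indicator B x \<partial>lborel))
      = (\<integral>\<^sup>+x. of_nat ?d * (?pos r * ?p r * h (r *\<^sub>R sgn x) * indicator B x) \<partial>lborel)"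
      unfolding nn_integral_cmult[OF m] by (simp only: mult_ac)
  qed
  also have "\<dots> = (\<integral>\<^sup>+x. (\<integral>\<^sup>+r. of_nat ?d * (?pos r * ?p r * h (r *\<^sub>R sgn x) * indicator B x) \<partial>lborel) \<partial>lborel)"
    by (rule lborel_pair.Fubini') (unfold sgn_div_norm, measurable)
  \<comment> \<open>The substitution r = |x| t for fixed \<open>x\<close>, after which
    \<open>h\<close> is evaluated at \<open>t\<close> times \<open>x\<close> and no longer at a
    multiple of \<open>sgn x\<close>.\<close>
  also have "\<dots> = (\<integral>\<^sup>+x. (\<integral>\<^sup>+t. of_nat ?d * (?pos t * ?p t * (ennreal (norm x ^ ?d) * indicator B x * h (t *\<^sub>R x))) \<partial>lborel) \<partial>lborel)"
  proof (rule nn_integral_cong)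
    fix x :: 'a
    show "(\<integral>\<^sup>+r. of_nat ?d * (?pos r * ?p r * h (r *\<^sub>R sgn x) * indicator B x) \<partial>lborel)
      = (\<integral>\<^sup>+t. of_nat ?d * (?pos t * ?p t * (ennreal (norm x ^ ?d) * indicator B x * h (t *\<^sub>R x))) \<partial>lborel)"
    proof (cases "x \<in> B")
      case True
      then have nx: "norm x > 0" by (simp add: B_def)
      have "(\<integral>\<^sup>+r. of_nat ?d * (?pos r * ?p r * h (r *\<^sub>R sgn x) * indicator B x) \<partial>lborel)
        = ennreal \<bar>norm x\<bar> * (\<integral>\<^sup>+t. of_nat ?d * (?pos (0 + norm x * t) * ?p (0 + norm x * t) * h ((0 + norm x * t) *\<^sub>R sgn x) * indicator B x) \<partial>lborel)"
        using nx by (intro nn_integral_real_affine) auto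
      also have "\<dots> = (\<integral>\<^sup>+t. ennreal (norm x) * (of_nat ?d * (?pos (norm x * t) * ?p (norm x * t) * h ((norm x * t) *\<^sub>R sgn x) * indicator B x)) \<partial>lborel)"
        using nx by (subst nn_integral_cmult) auto
      also have "\<dots> = (\<integral>\<^sup>+t. of_nat ?d * (?pos t * ?p t * (ennreal (norm x ^ ?d) * indicator B x * h (t *\<^sub>R x))) \<partial>lborel)"
      proof (rule nn_integral_cong)
        fix t :: real
        have 1: "(norm x * t) *\<^sub>R sgn x = t *\<^sub>R x" using nx by (simp add: sgn_div_norm)
        have 2: "?pos (norm x * t) = ?pos t" using nx by (simp add: indicator_def zero_less_mult_iff)
        have 3: "?pos t * (ennreal (norm x) * ?p (norm x * t)) = ?pos t * (?p t * ennreal (norm x ^ ?d))"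
        proof (cases "t > 0")
          case True
          have "norm x * (norm x * t) ^ (?d - 1) = t ^ (?d - 1) * norm x ^ ?d"
            using power_Suc[of "norm x" "?d - 1"] unfolding dS by (simp add: power_mult_distrib)
          then show ?thesis using True nx by (simp add: ennreal_mult[symmetric])
        qed simp
        have "ennreal (norm x) * (of_nat ?d * (?pos (norm x * t) * ?p (norm x * t) * h ((norm x * t) *\<^sub>R sgn x) * indicator B x))
           = of_nat ?d * ((?pos t * (ennreal (norm x) * ?p (norm x * t))) * (h (t *\<^sub>R x) * indicator B x))"
          unfolding 1 2 by (simp only: mult_ac)
        also have "\<dots> = of_nat ?d * (?pos t * ?p t * (ennreal (norm x ^ ?d) * indicator B x * h (t *\<^sub>R x)))"
          unfolding 3 by (simp only: mult_ac)
        finally show "ennreal (norm x) * (of_nat ?d * (?pos (norm x * t) * ?p (norm x * t) * h ((norm x * t) *\<^sub>R sgn x) * indicator B x))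
           = of_nat ?d * (?pos t * ?p t * (ennreal (norm x ^ ?d) * indicator B x * h (t *\<^sub>R x)))" .
      qed
      finally show ?thesis .
    qed simp
  qed
  also have "\<dots> = (\<integral>\<^sup>+t. (\<integral>\<^sup>+x. of_nat ?d * (?pos t * ?p t * (ennreal (norm x ^ ?d) * indicator B x * h (t *\<^sub>R x))) \<partial>lborel) \<partial>lborel)"
    by (rule lborel_pair.Fubini') measurable
  \<comment> \<open>The substitution y = t x for fixed \<open>t\<close>: membership of
    \<open>x\<close> in the punctured ball becomes |y| <= t together with y distinct from 0.\<close>
  also have "\<dots> = (\<integral>\<^sup>+t. (\<integral>\<^sup>+y. of_nat ?d * h y * (ennreal (norm y ^ ?d) * (ennreal (1 / t ^ (?d + 1)) * (if norm y \<le> t then 1 else 0))) * (if y = 0 then 0 else 1) \<partial>lborel) \<partial>lborel)"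
  proof (rule nn_integral_cong)
    fix t :: real
    show "(\<integral>\<^sup>+x. of_nat ?d * (?pos t * ?p t * (ennreal (norm x ^ ?d) * indicator B x * h (t *\<^sub>R x))) \<partial>lborel)
      = (\<integral>\<^sup>+y. of_nat ?d * h y * (ennreal (norm y ^ ?d) * (ennreal (1 / t ^ (?d + 1)) * (if norm y \<le> t then 1 else 0))) * (if y = 0 then 0 else 1) \<partial>lborel)"
    proof (cases "t > 0")
      case True
      have "(\<integral>\<^sup>+y. of_nat ?d * h y * (ennreal (norm y ^ ?d) * (ennreal (1 / t ^ (?d + 1)) * (if norm y \<le> t then 1 else 0))) * (if y = 0 then 0 else 1) \<partial>lborel)
        = ennreal (t ^ ?d) * (\<integral>\<^sup>+x. of_nat ?d * h (t *\<^sub>R x) * (ennreal (norm (t *\<^sub>R x) ^ ?d) * (ennreal (1 / t ^ (?d + 1)) * (if norm (t *\<^sub>R x) \<le> t then 1 else 0))) * (if t *\<^sub>R x = 0 then 0 else 1) \<partial>lborel)"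
        by (rule nn_integral_lborel_scale[OF _ True]) measurable
      also have "\<dots> = (\<integral>\<^sup>+x. ennreal (t ^ ?d) * (of_nat ?d * h (t *\<^sub>R x) * (ennreal (norm (t *\<^sub>R x) ^ ?d) * (ennreal (1 / t ^ (?d + 1)) * (if norm (t *\<^sub>R x) \<le> t then 1 else 0))) * (if t *\<^sub>R x = 0 then 0 else 1)) \<partial>lborel)"
        by (rule nn_integral_cmult[symmetric]) measurable
      also have "\<dots> = (\<integral>\<^sup>+x. of_nat ?d * (?pos t * ?p t * (ennreal (norm x ^ ?d) * indicator B x * h (t *\<^sub>R x))) \<partial>lborel)"
      proof (rule nn_integral_cong)
        fix x :: 'a
        have 1: "(if norm (t *\<^sub>R x) \<le> t then 1 else 0) * (if t *\<^sub>R x = 0 then 0 else 1) = (indicator B x :: ennreal)"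
          using True by (auto simp: indicator_def B_def)
        have 2: "ennreal (t ^ ?d) * (ennreal (norm (t *\<^sub>R x) ^ ?d) * ennreal (1 / t ^ (?d + 1))) = ?p t * ennreal (norm x ^ ?d)"
        proof -
          have "t ^ ?d * (norm (t *\<^sub>R x) ^ ?d * (1 / t ^ (?d + 1))) = t ^ (?d - 1) * norm x ^ ?d"
          proof -
            have "t ^ ?d = t * t ^ (?d - 1)" using power_Suc[of t "?d - 1"] unfolding dS .
            then show ?thesis using True by (simp add: power_mult_distrib field_simps)
          qed
          then show ?thesis using True by (simp add: ennreal_mult[symmetric])
        qed
        have "ennreal (t ^ ?d) * (of_nat ?d * h (t *\<^sub>R x) * (ennreal (norm (t *\<^sub>R x) ^ ?d) * (ennreal (1 / t ^ (?d + 1)) * (if norm (t *\<^sub>R x) \<le> t then 1 else 0))) * (if t *\<^sub>R x = 0 then 0 else 1))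
          = of_nat ?d * h (t *\<^sub>R x) * (ennreal (t ^ ?d) * (ennreal (norm (t *\<^sub>R x) ^ ?d) * ennreal (1 / t ^ (?d + 1)))) * ((if norm (t *\<^sub>R x) \<le> t then 1 else 0) * (if t *\<^sub>R x = 0 then 0 else 1))"
          by (simp only: mult_ac)
        also have "\<dots> = of_nat ?d * (?pos t * ?p t * (ennreal (norm x ^ ?d) * indicator B x * h (t *\<^sub>R x)))"
          unfolding 1 2 using True by (simp add: mult_ac)
        finally show "ennreal (t ^ ?d) * (of_nat ?d * h (t *\<^sub>R x) * (ennreal (norm (t *\<^sub>R x) ^ ?d) * (ennreal (1 / t ^ (?d + 1)) * (if norm (t *\<^sub>R x) \<le> t then 1 else 0))) * (if t *\<^sub>R x = 0 then 0 else 1))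
          = of_nat ?d * (?pos t * ?p t * (ennreal (norm x ^ ?d) * indicator B x * h (t *\<^sub>R x)))" .
      qed
      finally show ?thesis by simp
    next
      case False
      have "y = 0" if "norm y \<le> t" for y :: 'a using that False norm_le_zero_iff[of y] by linarith
      then have "(if norm y \<le> t then 1 else 0) * (if y = 0 then 0 else 1) = (0::ennreal)" for y :: 'a by auto
      then have z: "of_nat ?d * h y * (ennreal (norm y ^ ?d) * (ennreal (1 / t ^ (?d + 1)) * (if norm y \<le> t then 1 else 0))) * (if y = 0 then 0 else 1) = 0" for y :: 'a
        by (simp add: mult.assoc)
      show ?thesis unfolding z using False by simp
    qed
  qed
  also have "\<dots> = (\<integral>\<^sup>+y. (\<integral>\<^sup>+t. of_nat ?d * h y * (ennreal (norm y ^ ?d) * (ennreal (1 / t ^ (?d + 1)) * (if norm y \<le> t then 1 else 0))) * (if y = 0 then 0 else 1) \<partial>lborel) \<partial>lborel)"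
    by (rule lborel_pair.Fubini') measurable
  also have "\<dots> = (\<integral>\<^sup>+y. h y \<partial>lborel)"
  proof (rule nn_integral_cong)
    fix y :: 'a
    show "(\<integral>\<^sup>+t. of_nat ?d * h y * (ennreal (norm y ^ ?d) * (ennreal (1 / t ^ (?d + 1)) * (if norm y \<le> t then 1 else 0))) * (if y = 0 then 0 else 1) \<partial>lborel) = h y"
    proof (cases "y = 0")
      case True
      then show ?thesis by (simp add: h0)
    next
      case False
      then have ny: "norm y > 0" by simp
      have "(\<integral>\<^sup>+t. of_nat ?d * h y * (ennreal (norm y ^ ?d) * (ennreal (1 / t ^ (?d + 1)) * (if norm y \<le> t then 1 else 0))) * (if y = 0 then 0 else 1) \<partial>lborel)
        = (\<integral>\<^sup>+t. of_nat ?d * h y * ennreal (norm y ^ ?d) * (ennreal (1 / t ^ (?d + 1)) * (if norm y \<le> t then 1 else 0)) \<partial>lborel)"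
        using False by (simp add: mult.assoc)
      also have "\<dots> = of_nat ?d * h y * ennreal (norm y ^ ?d) * (\<integral>\<^sup>+t. ennreal (1 / t ^ (?d + 1)) * (if norm y \<le> t then 1 else 0) \<partial>lborel)"
        by (rule nn_integral_cmult) measurable
      also have "\<dots> = h y * (ennreal (real ?d) * (ennreal (norm y ^ ?d) * ennreal (1 / (real ?d * norm y ^ ?d))))"
      proof -
        have "(\<integral>\<^sup>+t. ennreal (1 / t ^ (?d + 1)) * (if norm y \<le> t then 1 else 0) \<partial>lborel) = (\<integral>\<^sup>+t. ennreal (1 / t ^ (?d + 1)) * indicator {norm y..} t \<partial>lborel)"
          by (intro nn_integral_cong) (auto simp: indicator_def)
        then show ?thesis unfolding nn_integral_power_tail[OF ny d] ennreal_of_nat_eq_real_of_nat by (simp only: mult_ac)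
      qed
      also have "ennreal (real ?d) * (ennreal (norm y ^ ?d) * ennreal (1 / (real ?d * norm y ^ ?d))) = 1"
        using ny by (simp add: ennreal_mult[symmetric])
      finally show ?thesis by simp
    qed
  qed
  finally show ?thesis by simp
qed

section \<open>Fields radiating at infinity\<close>

text \<open>From here on the medium is visible only through \<open>l\<close>: a solution of the
  Helmholtz equation on the whole space in the sense of distributions that is given by
  \<open>us\<close> on functions vanishing in \<Omega>. \<open>v\<close> is the C1 representative of
  \<open>us\<close> far away, on which the radiation condition is imposed.\<close>

locale radiating =
  fixes l :: "(real^'n \<Rightarrow> real) \<Rightarrow> complex" and \<Omega> :: "(real^'n) set" and k R\<^sub>0 :: real
    and us v :: "real^'n \<Rightarrow> complex" and v' :: "'n \<Rightarrow> real^'n \<Rightarrow> complex"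
  assumes l: "radon l" and k: "k > 0" and R0: "R\<^sub>0 > 0" and dom: "\<Omega> \<subseteq> cball 0 R\<^sub>0"
    and annihilates: "\<And>\<phi> \<phi>' \<phi>'' R. c1 UNIV \<phi> \<phi>' \<Longrightarrow> (\<And>i. c1 UNIV (\<phi>' i) (\<phi>'' i)) \<Longrightarrow> cc R \<phi> \<Longrightarrow>
      l (\<lambda>x. (\<Sum>i\<in>UNIV. \<phi>'' i i x) + k\<^sup>2 * \<phi> x) = 0"
    and represents: "\<And>\<psi> R. cc R \<psi> \<Longrightarrow> (\<And>x. x \<in> \<Omega> \<Longrightarrow> \<psi> x = 0) \<Longrightarrow> l \<psi> = (LINT x|lebesgue. us x * of_real (\<psi> x))"
    and us: "locally_integrable_on UNIV us"
    and v: "c1 (- cball 0 R\<^sub>0) v v'" and us_v: "AE x in lebesgue. norm x > R\<^sub>0 \<longrightarrow> us x = v x"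
begin

abbreviation (input) S where "S \<equiv> - cball 0 R\<^sub>0"

text \<open>The margin 1 accommodates mollifiers of radius at most 1: a function supported within
  distance 1 of \<open>x\<close> does not reach the ball that contains \<Omega>.\<close>

lemma represents_far:
  assumes \<psi>: "cc R \<psi>" and x: "norm x > R\<^sub>0 + 1" and z: "\<And>y. norm (x - y) > 1 \<Longrightarrow> \<psi> y = 0"
  shows "l \<psi> = (LINT y|lborel. (if y \<in> S then \<psi> y *\<^sub>R v y else 0))"
proof -
  have far: "\<psi> y = 0" if "norm y \<le> R\<^sub>0" for y
  proof -
    have "norm x \<le> norm y + norm (x - y)" by (rule norm_triangle_sub)
    then show ?thesis using that x by (intro z) simp
  qed
  have c: "cc (norm x + 1) (\<lambda>y. if y \<in> S then \<psi> y *\<^sub>R v y else 0)"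
  proof (rule cc_extend_zero)
    show "continuous_on S (\<lambda>y. \<psi> y *\<^sub>R v y)"
      by (intro continuous_intros c1_continuous[OF v] continuous_on_subset[OF cc_continuous[OF \<psi>, of UNIV]]) auto
    show "cball x 1 \<subseteq> S"
    proof
      fix y assume "y \<in> cball x 1"
      moreover have "norm x \<le> norm y + norm (x - y)" by (rule norm_triangle_sub)
      ultimately show "y \<in> S" using x by (auto simp: dist_norm)
    qed
  qed (use z in auto)
  have m: "(\<lambda>y. if y \<in> S then \<psi> y *\<^sub>R v y else 0) \<in> borel_measurable lborel" using cc_integrable[OF c] by auto
  have "l \<psi> = (LINT y|lebesgue. us y * of_real (\<psi> y))"
    by (rule represents[OF \<psi>]) (use far dom in auto)
  also have "\<dots> = (LINT y|lebesgue. (if y \<in> S then \<psi> y *\<^sub>R v y else 0))"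
  proof (rule integral_cong_AE)
    show "(\<lambda>y. us y * of_real (\<psi> y)) \<in> borel_measurable lebesgue"
      by (rule borel_measurable_integrable[OF loc_int_cc[OF us \<psi>]])
    show "(\<lambda>y. if y \<in> S then \<psi> y *\<^sub>R v y else 0) \<in> borel_measurable lebesgue"
      by (rule measurable_completion[OF m])
    show "AE y in lebesgue. us y * of_real (\<psi> y) = (if y \<in> S then \<psi> y *\<^sub>R v y else 0)"
      using us_v by eventually_elim (use far in \<open>auto simp: scaleR_conv_of_real\<close>)
  qed
  also have "\<dots> = (LINT y|lborel. (if y \<in> S then \<psi> y *\<^sub>R v y else 0))"
    by (rule integral_completion[OF m])
  finally show ?thesis .
qed

lemma reflected_c1:
  fixes \<eta> :: "real^'n \<Rightarrow> real"
  assumes "c1 UNIV \<eta> \<eta>'"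
  shows "c1 UNIV (\<lambda>y. \<eta> (x - y)) (\<lambda>j y. - \<eta>' j (x - y))"
proof -
  have c: "c1 UNIV (\<lambda>y. \<eta> (x - y)) (\<lambda>j y. \<Sum>i\<in>UNIV. (if j = i then -1 else 0) *\<^sub>R \<eta>' i (x - y))"
  proof (rule c1_chain[OF _ assms, of UNIV "\<lambda>y. x - y"])
    show "c1 UNIV (\<lambda>y. (x - y) $ i) (\<lambda>j y. if j = i then - 1 else 0)" for i
      by (rule c1_eqI[OF c1_diff[OF c1_const[of _ "x$i"] c1_coordinate[of _ i]]]) auto
  qed simp
  show ?thesis
  proof (rule c1_eqI[OF c])
    fix j :: 'n and y :: "real^'n"
    have "(\<Sum>i\<in>UNIV. (if j = i then -1 else 0) *\<^sub>R \<eta>' i (x - y)) = (\<Sum>i\<in>UNIV. if i = j then - \<eta>' i (x - y) else 0)"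
      by (intro sum.cong) auto
    then show "(\<Sum>i\<in>UNIV. (if j = i then -1 else 0) *\<^sub>R \<eta>' i (x - y)) = - \<eta>' j (x - y)" by simp
  qed auto
qed

text \<open>Convolution with a mollifier makes \<open>l\<close> a classical solution on the whole
  space, because translates of the reflected mollifier are admissible test functions. Far away
  \<open>l\<close> is integration against \<open>v\<close>, so the convolution and its gradient are
  local averages of \<open>v\<close> and \<open>v'\<close>.\<close>

lemma mollified_field:
  fixes w :: "real^'n \<Rightarrow> complex" and w' :: "'n \<Rightarrow> real^'n \<Rightarrow> complex"
  assumes m: "mollifier e \<eta>" and e: "e > 0" "e \<le> 1" and \<eta>: "c1 UNIV \<eta> \<eta>'"
  defines "w \<equiv> \<lambda>x. l (\<lambda>y. \<eta> (x - y))" and "w' \<equiv> \<lambda>j x. l (\<lambda>y. \<eta>' j (x - y))"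
  shows "c1 UNIV w w'"
    and "\<exists>w''. (\<forall>i. c1 UNIV (w' i) (w'' i)) \<and> (\<forall>x. (\<Sum>i\<in>UNIV. w'' i i x) + of_real (k\<^sup>2) * w x = 0)"
    and "norm x > R\<^sub>0 + 1 \<Longrightarrow> (\<And>y. norm (x - y) < e \<Longrightarrow> norm (v y - v x) \<le> B) \<Longrightarrow> norm (w x - v x) \<le> B"
    and "norm x > R\<^sub>0 + 1 \<Longrightarrow> (\<And>y. norm (x - y) < e \<Longrightarrow> norm (v' j y - v' j x) \<le> B) \<Longrightarrow> norm (w' j x - v' j x) \<le> B"
proof -
  have cc: "cc e \<eta>" by (rule mollifier_cc[OF m])
  have cc': "cc e (\<eta>' j)" for j by (rule c1_cc_partial[OF \<eta>]) (rule cc_zero[OF cc])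
  show c1w: "c1 UNIV w w'" unfolding w_def w'_def by (rule c1_radon_convolution[OF l \<eta> cc])
  have "Ck_on 2 UNIV \<eta>" using m by (simp add: mollifier_def)
  then have "Ck_on (Suc (Suc 0)) UNIV \<eta>" by (simp only: numeral_2_eq_2)
  then obtain \<zeta> where \<zeta>: "c1 UNIV \<eta> \<zeta>" "\<And>j. Ck_on (Suc 0) UNIV (\<zeta> j)" by (rule Ck_on_c1E) blast
  have "\<zeta> j = \<eta>' j" for j using c1_unique[OF \<zeta>(1) \<eta>] by auto
  moreover have "\<exists>z. c1 UNIV (\<zeta> j) z" for j by (rule Ck_on_c1E[OF \<zeta>(2)[of j]]) blast
  ultimately have "\<exists>z. c1 UNIV (\<eta>' j) z" for j by metis
  then obtain \<eta>'' where \<eta>'': "\<And>j. c1 UNIV (\<eta>' j) (\<eta>'' j)" by metis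
  have cc'': "cc e (\<eta>'' i j)" for i j by (rule c1_cc_partial[OF \<eta>'']) (rule cc_zero[OF cc'])
  show "\<exists>w''. (\<forall>i. c1 UNIV (w' i) (w'' i)) \<and> (\<forall>x. (\<Sum>i\<in>UNIV. w'' i i x) + of_real (k\<^sup>2) * w x = 0)"
  proof (intro exI[of _ "\<lambda>i j x. l (\<lambda>y. \<eta>'' i j (x - y))"] conjI allI)
    show "c1 UNIV (w' i) (\<lambda>j x. l (\<lambda>y. \<eta>'' i j (x - y)))" for i
      unfolding w'_def by (rule c1_radon_convolution[OF l \<eta>'' cc'])
    fix x :: "real^'n"
    define \<rho> where "\<rho> = norm x + e"
    have c: "cc \<rho> (\<lambda>y. \<eta> (x - y))" "cc \<rho> (\<lambda>y. \<eta>'' i i (x - y))" for i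
      unfolding \<rho>_def by (rule cc_reflect[OF cc order_refl], rule cc_reflect[OF cc'' order_refl])
    \<comment> \<open>As a function of \<open>y\<close>, \<eta> (x - y) is an admissible test
      function; two differentiations in \<open>y\<close> restore the sign, so its Laplacian is that
      of \<eta> at x - y.\<close>
    have "l (\<lambda>y. (\<Sum>i\<in>UNIV. \<eta>'' i i (x - y)) + k\<^sup>2 * \<eta> (x - y)) = 0"
    proof (rule annihilates[OF reflected_c1[OF \<eta>] _ c(1), where \<phi>''="\<lambda>i j y. \<eta>'' i j (x - y)"])
      show "c1 UNIV (\<lambda>y. - \<eta>' i (x - y)) (\<lambda>j y. \<eta>'' i j (x - y))" for i
        by (rule c1_eqI[OF c1_cmult[OF reflected_c1[OF \<eta>''], where c="-1::real"]]) auto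
    qed
    also have "l (\<lambda>y. (\<Sum>i\<in>UNIV. \<eta>'' i i (x - y)) + k\<^sup>2 * \<eta> (x - y)) = (\<Sum>i\<in>UNIV. l (\<lambda>y. \<eta>'' i i (x - y))) + k\<^sup>2 *\<^sub>R w x"
    proof -
      have "l (\<lambda>y. (\<Sum>i\<in>UNIV. \<eta>'' i i (x - y)) + k\<^sup>2 * \<eta> (x - y)) = l (\<lambda>y. \<Sum>i\<in>UNIV. \<eta>'' i i (x - y)) + l (\<lambda>y. k\<^sup>2 * \<eta> (x - y))"
        by (rule radon_add[OF l cc_sum[OF c(2)] cc_cmult[OF c(1)]])
      then show ?thesis using radon_sum[OF l c(2), where I=UNIV] radon_cmult[OF l c(1)] by (simp add: w_def)
    qed
    finally show "(\<Sum>i\<in>UNIV. l (\<lambda>y. \<eta>'' i i (x - y))) + of_real (k\<^sup>2) * w x = 0"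
      by (simp add: scaleR_conv_of_real)
  qed
  assume x: "norm x > R\<^sub>0 + 1"
  have zero: "\<psi> (x - y) = 0" if "cc e \<psi>" "norm (x - y) > 1" for \<psi> :: "real^'n \<Rightarrow> real" and y
    using cc_zero[OF that(1)] that(2) e by simp
  have sub: "cball x e \<subseteq> S"
  proof
    fix y assume "y \<in> cball x e"
    moreover have "norm x \<le> norm y + norm (x - y)" by (rule norm_triangle_sub)
    ultimately show "y \<in> S" using x e by (auto simp: dist_norm)
  qed
  have op: "open S" by (simp add: open_Compl)
  have rep: "l (\<lambda>y. \<psi> (x - y)) = (LINT y|lborel. (if y \<in> S then \<psi> (x - y) *\<^sub>R v y else 0))" if "cc e \<psi>" for \<psi>
    by (rule represents_far[OF cc_reflect[OF that order_refl] x]) (rule zero[OF that])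
  have ext: "(LINT y|lborel. (if y \<in> S then \<eta> (x - y) *\<^sub>R f y else 0)) = (LINT y|lborel. \<eta> (x - y) *\<^sub>R (if y \<in> S then f y else 0))" for f :: "real^'n \<Rightarrow> complex"
    by (intro Bochner_Integration.integral_cong) auto
  have inS: "y \<in> S" if "norm (x - y) < e" for y
  proof -
    have "y \<in> cball x e" using that by (simp add: dist_norm)
    then show ?thesis using sub by blast
  qed
  have xS: "x \<in> S" using inS[of x] e by simp
  have int: "integrable lborel (\<lambda>y. \<eta> (x - y) *\<^sub>R (if y \<in> S then f y else 0))" if "continuous_on S f" for f :: "real^'n \<Rightarrow> complex"
  proof -
    have c: "cc (norm x + e) (\<lambda>y. if y \<in> S then \<eta> (x - y) *\<^sub>R f y else 0)"
      by (rule cc_extend_zero[OF _ op sub])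
        (use cc_zero[OF cc] in \<open>auto intro!: continuous_intros that continuous_on_compose2[OF cc_continuous[OF cc, of UNIV]]\<close>)
    have eq: "(\<lambda>y. \<eta> (x - y) *\<^sub>R (if y \<in> S then f y else 0)) = (\<lambda>y. if y \<in> S then \<eta> (x - y) *\<^sub>R f y else 0)" by auto
    show ?thesis unfolding eq by (rule cc_integrable[OF c])
  qed
  show "norm (w x - v x) \<le> B" if "\<And>y. norm (x - y) < e \<Longrightarrow> norm (v y - v x) \<le> B"
    using mollify_close[OF m _ int[OF c1_continuous[OF v]], of B] that inS xS
    unfolding w_def rep[OF cc] ext by simp
  show "norm (w' j x - v' j x) \<le> B" if "\<And>y. norm (x - y) < e \<Longrightarrow> norm (v' j y - v' j x) \<le> B"
    using mollify_close[OF m _ int[OF c1_continuous_partial[OF v]], of j B] that inS xS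
    unfolding w'_def rep[OF cc'] mollify_partial[OF v op sub \<eta> cc] ext by simp
qed

text \<open>For a classical solution w on the whole space the field Im (conj w \<nabla>w) is
  divergence-free because k^2 is real, so its pairing with the gradient of a compactly supported
  \<xi> is 0. The mollifications of \<open>l\<close> are such solutions, and where \<nabla>\<xi> can
  be nonzero they converge boundedly, with their gradients, to \<open>v\<close> and
  \<open>v'\<close>.\<close>

theorem flux_vanishes:
  assumes \<chi>: "c1 UNIV \<xi> \<xi>'" "cc R \<xi>" and flat: "\<And>j x. norm x \<le> R\<^sub>0 + 2 \<Longrightarrow> \<xi>' j x = 0"
  shows "(LINT x|lborel. (\<Sum>j\<in>UNIV. \<xi>' j x * Im (cnj (v x) * v' j x))) = 0"
proof -
  have cc': "cc R (\<xi>' j)" for j by (rule c1_cc_partial[OF \<chi>(1)]) (rule cc_zero[OF \<chi>(2)])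
  have "\<forall>n. \<exists>\<eta>::real^'n \<Rightarrow> real. mollifier (1 / real (Suc n)) \<eta>" by (intro allI mollifier_exists) simp
  then obtain \<eta> :: "nat \<Rightarrow> real^'n \<Rightarrow> real" where \<eta>: "\<And>n. mollifier (1 / real (Suc n)) (\<eta> n)" by metis
  have "\<exists>z. c1 UNIV (\<eta> n) z" for n
  proof -
    have "Ck_on (Suc 0) UNIV (\<eta> n)" using \<eta>[of n] unfolding mollifier_def by blast
    then show ?thesis by (rule Ck_on_c1E) blast
  qed
  then obtain \<eta>' where \<eta>': "\<And>n. c1 UNIV (\<eta> n) (\<eta>' n)" by metis
  define w where "w n x = l (\<lambda>y. \<eta> n (x - y))" for n x
  define w' where "w' n j x = l (\<lambda>y. \<eta>' n j (x - y))" for n j x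
  have e: "1 / real (Suc n) > 0" "1 / real (Suc n) \<le> 1" for n by auto
  note mf = mollified_field[OF \<eta> e \<eta>', folded w_def w'_def]
  have zero: "(LINT x|lborel. (\<Sum>j\<in>UNIV. \<xi>' j x * Im (cnj (w n x) * w' n j x))) = 0" for n
  proof -
    obtain w'' where w'': "\<And>i. c1 UNIV (w' n i) (w'' i)" "\<And>x. (\<Sum>i\<in>UNIV. w'' i i x) + of_real (k\<^sup>2) * w n x = 0"
      using mf(2)[of n] by blast
    have "c1 UNIV (\<lambda>x. \<xi> x * Im (cnj (w n x) * w' n i x)) (\<lambda>j x. \<xi> x * Im (cnj (w n x) * w'' i j x + cnj (w' n j x) * w' n i x) + \<xi>' j x * Im (cnj (w n x) * w' n i x))" for i
      by (rule c1_mult[OF \<chi>(1) c1_bounded_linear[OF bounded_linear_Im c1_mult[OF c1_bounded_linear[OF bounded_linear_cnj mf(1)] w''(1)]]])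
    note X = this
    have X0: "\<xi> x * Im (cnj (w n x) * w' n i x) = 0" if "norm x > R" for i x using cc_zero[OF \<chi>(2) that] by simp
    have "(LINT x|lborel. (\<Sum>i\<in>UNIV. \<xi> x * Im (cnj (w n x) * w'' i i x + cnj (w' n i x) * w' n i x) + \<xi>' i x * Im (cnj (w n x) * w' n i x)))
      = (\<Sum>i\<in>UNIV. LINT x|lborel. \<xi> x * Im (cnj (w n x) * w'' i i x + cnj (w' n i x) * w' n i x) + \<xi>' i x * Im (cnj (w n x) * w' n i x))"
      by (rule Bochner_Integration.integral_sum) (rule cc_integrable[OF c1_cc_partial[OF X X0]])
    also have "\<dots> = (\<Sum>i\<in>(UNIV::'n set). 0)"
      by (intro sum.cong refl) (rule integral_partial_eq_0[OF X X0])
    also have "(\<lambda>x. \<Sum>i\<in>UNIV. \<xi> x * Im (cnj (w n x) * w'' i i x + cnj (w' n i x) * w' n i x) + \<xi>' i x * Im (cnj (w n x) * w' n i x))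
      = (\<lambda>x. \<Sum>j\<in>UNIV. \<xi>' j x * Im (cnj (w n x) * w' n j x))"
    proof
      fix x
      have r: "Im (cnj z * z) = 0" for z by (simp add: mult.commute)
      have "(\<Sum>i\<in>UNIV. \<xi> x * Im (cnj (w n x) * w'' i i x + cnj (w' n i x) * w' n i x)) = \<xi> x * Im (cnj (w n x) * (\<Sum>i\<in>UNIV. w'' i i x))"
        by (simp only: plus_complex.sel r add_0_right sum_distrib_left Im_sum)
      also have "(\<Sum>i\<in>UNIV. w'' i i x) = - (of_real (k\<^sup>2) * w n x)" using w''(2)[of x] by (simp only: eq_neg_iff_add_eq_0)
      also have "Im (cnj (w n x) * - (of_real (k\<^sup>2) * w n x)) = 0"
      proof -
        have "cnj (w n x) * - (of_real (k\<^sup>2) * w n x) = - of_real (k\<^sup>2) * (cnj (w n x) * w n x)" by simp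
        moreover have "Im (- of_real c * z) = - c * Im z" for c z by simp
        ultimately show ?thesis using r[of "w n x"] by (simp only: mult_zero_right)
      qed
      finally show "(\<Sum>i\<in>UNIV. \<xi> x * Im (cnj (w n x) * w'' i i x + cnj (w' n i x) * w' n i x) + \<xi>' i x * Im (cnj (w n x) * w' n i x))
        = (\<Sum>j\<in>UNIV. \<xi>' j x * Im (cnj (w n x) * w' n j x))"
        by (simp only: sum.distrib mult_zero_right add_0_left)
    qed
    finally show ?thesis by simp
  qed
  \<comment> \<open>A compact shell inside the region where \<open>v\<close> is defined that
    contains the unit neighbourhood of every point at which the gradient of \<xi> can be
    nonzero.\<close>
  define Q where "Q = {x::real^'n. R\<^sub>0 + 1 \<le> norm x \<and> norm x \<le> \<bar>R\<bar> + 1}"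
  have "Q = cball 0 (\<bar>R\<bar> + 1) - ball 0 (R\<^sub>0 + 1)" by (auto simp: Q_def)
  then have Qc: "compact Q" by (simp add: compact_diff)
  have QS: "Q \<subseteq> S" by (auto simp: Q_def)
  have op: "open S" by (simp add: open_Compl)
  have "\<exists>B\<ge>0. \<forall>x\<in>Q. norm (f x) \<le> B" if "continuous_on S f" for f :: "real^'n \<Rightarrow> complex"
  proof -
    have "bounded (f ` Q)"
      by (rule compact_imp_bounded[OF compact_continuous_image[OF continuous_on_subset[OF that QS] Qc]])
    then obtain B where "\<forall>y\<in>f ` Q. norm y \<le> B" unfolding bounded_iff by blast
    then show ?thesis by (intro exI[of _ "max B 0"]) (auto simp: le_max_iff_disj)
  qed
  note bdd = this
  obtain B0 where B0: "B0 \<ge> 0" "\<forall>x\<in>Q. norm (v x) \<le> B0" using bdd[OF c1_continuous[OF v]] by blast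
  have "\<forall>j. \<exists>B\<ge>0. \<forall>x\<in>Q. norm (v' j x) \<le> B" using bdd[OF c1_continuous_partial[OF v]] by blast
  then obtain B1 where B1: "\<And>j. B1 j \<ge> 0" "\<And>j. \<forall>x\<in>Q. norm (v' j x) \<le> B1 j" by metis
  have near: "y \<in> Q" if "norm x > R\<^sub>0 + 2" "norm x \<le> R" "norm (x - y) < 1" for x y
  proof -
    have "norm x \<le> norm y + norm (x - y)" by (rule norm_triangle_sub)
    moreover have "norm y \<le> norm x + norm (x - y)" using norm_triangle_sub[of y x] by (simp add: norm_minus_commute)
    ultimately show ?thesis using that by (auto simp: Q_def)
  qed
  \<comment> \<open>3 = 1 + 2: the bound for \<open>v\<close> on \<open>Q\<close> plus an
    oscillation of at most twice that bound.\<close>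
  have wb: "norm (w n x) \<le> 3 * B0" and w'b: "norm (w' n j x) \<le> 3 * B1 j" if x: "norm x > R\<^sub>0 + 2" "norm x \<le> R" for n j x
  proof -
    have xQ: "x \<in> Q" using near[OF x, of x] by simp
    have nq: "y \<in> Q" if "norm (x - y) < 1 / real (Suc n)" for y using near[OF x, of y] that e(2)[of n] by linarith
    have x1: "norm x > R\<^sub>0 + 1" using x by simp
    have "norm (w n x - v x) \<le> 2 * B0"
    proof (rule mf(3)[OF x1])
      fix y assume "norm (x - y) < 1 / real (Suc n)"
      then have "norm (v y) \<le> B0" "norm (v x) \<le> B0" using B0(2) nq xQ by blast+
      then show "norm (v y - v x) \<le> 2 * B0" using norm_triangle_ineq4[of "v y" "v x"] by linarith
    qed
    then show "norm (w n x) \<le> 3 * B0" using bspec[OF B0(2) xQ] norm_triangle_sub[of "w n x" "v x"] by linarith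
    have "norm (w' n j x - v' j x) \<le> 2 * B1 j"
    proof (rule mf(4)[OF x1])
      fix y assume "norm (x - y) < 1 / real (Suc n)"
      then have "norm (v' j y) \<le> B1 j" "norm (v' j x) \<le> B1 j" using B1(2) nq xQ by blast+
      then show "norm (v' j y - v' j x) \<le> 2 * B1 j" using norm_triangle_ineq4[of "v' j y" "v' j x"] by linarith
    qed
    then show "norm (w' n j x) \<le> 3 * B1 j" using bspec[OF B1(2)[of j] xQ] norm_triangle_sub[of "w' n j x" "v' j x"] by linarith
  qed
  have conv: "(\<lambda>n. a n) \<longlonglongrightarrow> f x"
    if x: "norm x > R\<^sub>0 + 2" and f: "continuous_on S f" and a: "\<And>n B. (\<And>y. norm (x - y) < 1 / real (Suc n) \<Longrightarrow> norm (f y - f x) \<le> B) \<Longrightarrow> norm (a n - f x) \<le> B"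
    for x and f :: "real^'n \<Rightarrow> complex" and a :: "nat \<Rightarrow> complex"
  proof (rule LIMSEQ_I)
    fix r :: real assume r: "r > 0"
    have "x \<in> S" using x by simp
    then have "isCont f x" using f continuous_on_eq_continuous_at[OF op] by blast
    then obtain d where d: "d > 0" "\<And>y. dist y x < d \<Longrightarrow> dist (f y) (f x) < r / 2"
      unfolding continuous_at_eps_delta using half_gt_zero[OF r] by blast
    obtain N where N: "1 / real (Suc N) < d" using nat_approx_posE[OF d(1)] by blast
    show "\<exists>no. \<forall>n\<ge>no. norm (a n - f x) < r"
    proof (intro exI allI impI)
      fix n assume n: "n \<ge> N"
      have "1 / real (Suc n) \<le> 1 / real (Suc N)" using n by (intro divide_left_mono) auto
      then have le: "1 / real (Suc n) < d" using N by linarith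
      have "norm (a n - f x) \<le> r / 2"
      proof (rule a)
        fix y assume "norm (x - y) < 1 / real (Suc n)"
        then have "dist y x < d" using le by (simp add: dist_norm norm_minus_commute)
        from d(2)[OF this] show "norm (f y - f x) \<le> r / 2" by (simp add: dist_norm)
      qed
      then show "norm (a n - f x) < r" using r by simp
    qed
  qed
  let ?T = "\<lambda>n x. \<Sum>j\<in>UNIV. \<xi>' j x * Im (cnj (w n x) * w' n j x)"
  let ?L = "\<lambda>x. \<Sum>j\<in>UNIV. \<xi>' j x * Im (cnj (v x) * v' j x)"
  have Lc: "continuous_on UNIV ?L"
  proof -
    have "continuous_on S ?L"
      by (intro continuous_intros c1_continuous[OF v] c1_continuous_partial[OF v] continuous_on_subset[OF cc_continuous[OF cc', of UNIV]]) auto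
    moreover have "continuous_on (ball 0 (R\<^sub>0 + 2)) ?L"
      by (rule continuous_on_eq[OF continuous_on_const[of _ 0]]) (use flat in auto)
    ultimately have L: "continuous_on (S \<union> ball 0 (R\<^sub>0 + 2)) ?L" by (intro continuous_on_open_Un op open_ball)
    have U: "S \<union> ball 0 (R\<^sub>0 + 2) = UNIV" by auto
    show ?thesis using L unfolding U .
  qed
  have "\<exists>B. \<forall>x. \<bar>\<xi>' j x\<bar> \<le> B" for j using cc_bounded[OF cc'[of j]] by (metis real_norm_def)
  then obtain B2 where B2: "\<And>j x. \<bar>\<xi>' j x\<bar> \<le> B2 j" by metis
  define C where "C = (\<Sum>j\<in>UNIV. B2 j * (3 * B0 * (3 * B1 j)))"
  have "(\<lambda>n. LINT x|lborel. ?T n x) \<longlonglongrightarrow> (LINT x|lborel. ?L x)"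
  proof (rule integral_dominated_convergence[where w="\<lambda>x. C * indicator (cball 0 R) x"])
    show "?L \<in> borel_measurable lborel" using borel_measurable_continuous_onI[OF Lc] by simp
    have "continuous_on UNIV (?T n)" for n
    proof -
      obtain w'' where w'': "\<And>i. c1 UNIV (w' n i) (w'' i)" using mf(2)[of n] by blast
      show ?thesis by (intro continuous_intros c1_continuous[OF mf(1)] c1_continuous[OF w''] cc_continuous[OF cc'])
    qed
    then show "?T n \<in> borel_measurable lborel" for n
      unfolding measurable_lborel2 by (rule borel_measurable_continuous_onI)
    show "integrable lborel (\<lambda>x::real^'n. C * indicat_real (cball 0 R) x)"
      using emeasure_bounded_finite[of "cball (0::real^'n) R"]
      by (intro integrable_mult_right integrable_real_indicator) auto
    show "AE x in lborel. (\<lambda>n. ?T n x) \<longlonglongrightarrow> ?L x"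
    proof (intro AE_I2)
      fix x :: "real^'n"
      show "(\<lambda>n. ?T n x) \<longlonglongrightarrow> ?L x"
      proof (cases "norm x \<le> R\<^sub>0 + 2")
        case True
        then show ?thesis by (simp add: flat)
      next
        case False
        then have x: "norm x > R\<^sub>0 + 2" "norm x > R\<^sub>0 + 1" by auto
        have 1: "(\<lambda>n. w n x) \<longlonglongrightarrow> v x"
          by (rule conv[OF x(1) c1_continuous[OF v]]) (rule mf(3)[OF x(2)])
        have 2: "(\<lambda>n. w' n j x) \<longlonglongrightarrow> v' j x" for j
          by (rule conv[OF x(1) c1_continuous_partial[OF v]]) (rule mf(4)[OF x(2)])
        show ?thesis by (intro tendsto_intros 1 2)
      qed
    qed
    show "AE x in lborel. norm (?T n x) \<le> C * indicat_real (cball 0 R) x" for n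
    proof (intro AE_I2)
      fix x :: "real^'n"
      show "norm (?T n x) \<le> C * indicat_real (cball 0 R) x"
      proof (cases "norm x \<le> R")
        case False
        then show ?thesis using cc_zero[OF cc', of x] by simp
      next
        case True
        have "\<bar>\<xi>' j x * Im (cnj (w n x) * w' n j x)\<bar> \<le> B2 j * (3 * B0 * (3 * B1 j))" if "norm x > R\<^sub>0 + 2" for j
        proof -
          have "\<bar>Im (cnj (w n x) * w' n j x)\<bar> \<le> norm (w n x) * norm (w' n j x)"
            using abs_Im_le_cmod[of "cnj (w n x) * w' n j x"] by (simp add: norm_mult)
          also have "\<dots> \<le> 3 * B0 * (3 * B1 j)"
            by (intro mult_mono wb[OF that True] w'b[OF that True] norm_ge_zero order_trans[OF norm_ge_zero wb[OF that True]])
          finally show ?thesis unfolding abs_mult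
            by (intro mult_mono B2 abs_ge_zero order_trans[OF abs_ge_zero B2])
        qed
        then have "norm (?T n x) \<le> C" if "norm x > R\<^sub>0 + 2"
          unfolding C_def real_norm_def using that by (intro order_trans[OF sum_abs] sum_mono) blast
        moreover have "norm (?T n x) = 0" if "norm x \<le> R\<^sub>0 + 2" using that flat by simp
        moreover have "C \<ge> 0"
          unfolding C_def using B0(1) B1(1) order_trans[OF abs_ge_zero B2] by (intro sum_nonneg mult_nonneg_nonneg) auto
        ultimately show ?thesis using True by (cases "norm x \<le> R\<^sub>0 + 2") auto
      qed
    qed
  qed
  then show ?thesis using zero by (simp add: LIMSEQ_const_iff)
qed

end

section \<open>From the radiation condition to decay of the field in shells\<close>

lemma space_unit_sphere_measure: "space unit_sphere_measure = sphere 0 1"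
  by (simp add: unit_sphere_measure_def space_scale_measure space_restrict_space)

lemma borel_measurable_unit_sphere:
  fixes g :: "'a::euclidean_space \<Rightarrow> real"
  assumes "continuous_on (sphere 0 1) g" shows "g \<in> borel_measurable unit_sphere_measure"
  using borel_measurable_continuous_on_restrict[OF assms]
  by (simp add: unit_sphere_measure_def measurable_def space_scale_measure space_restrict_space)

text \<open>Connects the Bochner integral in \<open>sphere_integral\<close> with the nonnegative
  integrals of \<open>polar_coordinates\<close>. The cone measure is finite, so a continuous
  function is integrable on the sphere and no default value intervenes.\<close>

lemma nn_integral_sphere:
  fixes g :: "'a::euclidean_space \<Rightarrow> real"
  assumes r: "r > 0" and g: "continuous_on (sphere 0 r) g" "\<And>x. g x \<ge> 0"
  shows "ennreal (r ^ (DIM('a) - 1)) * (\<integral>\<^sup>+\<theta>. ennreal (g (r *\<^sub>R \<theta>)) \<partial>unit_sphere_measure) = ennreal (sphere_integral r g)"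
proof -
  let ?N = "unit_sphere_measure :: 'a measure"
  have c: "continuous_on (sphere 0 1) (\<lambda>\<theta>. g (r *\<^sub>R \<theta>))"
    by (rule continuous_on_compose2[OF g(1)]) (use r in \<open>auto intro!: continuous_intros\<close>)
  have m: "(\<lambda>\<theta>. g (r *\<^sub>R \<theta>)) \<in> borel_measurable ?N"
    by (rule borel_measurable_unit_sphere[OF c])
  have fin: "finite_measure ?N"
  proof
    have "emeasure lborel (cball 0 1 - {0::'a}) \<noteq> \<infinity>"
      using emeasure_bounded_finite[of "cball 0 1 - {0::'a}"] by (simp add: bounded_subset[OF bounded_cball Diff_subset])
    moreover have "emeasure ?N (space ?N) = of_nat DIM('a) * emeasure lborel (cball 0 1 - {0::'a})"
    proof -
      have "sgn -` sphere 0 1 \<inter> space (restrict_space lborel (cball 0 1 - {0::'a})) = cball 0 1 - {0::'a}"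
        by (auto simp: space_restrict_space norm_sgn)
      moreover have "sphere 0 1 \<in> sets (restrict_space borel (sphere (0::'a) 1))"
        by (simp add: sets_restrict_space_iff)
      ultimately show ?thesis
        unfolding space_unit_sphere_measure unfolding unit_sphere_measure_def emeasure_scale_measure
        by (simp add: emeasure_distr[OF measurable_sgn_punctured_ball] emeasure_restrict_space)
    qed
    ultimately show "emeasure ?N (space ?N) \<noteq> \<infinity>" by (simp add: ennreal_mult_eq_top_iff)
  qed
  have "bounded ((\<lambda>\<theta>. g (r *\<^sub>R \<theta>)) ` sphere 0 1)"
    by (rule compact_imp_bounded[OF compact_continuous_image[OF c compact_sphere]])
  then obtain B where "\<And>\<theta>. \<theta> \<in> sphere 0 1 \<Longrightarrow> norm (g (r *\<^sub>R \<theta>)) \<le> B" unfolding bounded_iff by blast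
  then have "integrable ?N (\<lambda>\<theta>. g (r *\<^sub>R \<theta>))"
    by (intro finite_measure.integrable_const_bound[OF fin _ m, of B] AE_I2) (simp add: space_unit_sphere_measure)
  then have "(\<integral>\<^sup>+\<theta>. ennreal (g (r *\<^sub>R \<theta>)) \<partial>?N) = ennreal (\<integral>\<theta>. g (r *\<^sub>R \<theta>) \<partial>?N)"
    by (rule nn_integral_eq_integral) (simp add: g(2))
  then show ?thesis unfolding sphere_integral_def using r by (simp add: ennreal_mult')
qed

lemma c1_norm_square: "c1 UNIV (\<lambda>x::real^'n. (norm x)\<^sup>2) (\<lambda>j x. 2 * x$j)"
proof -
  have c: "c1 UNIV (\<lambda>x::real^'n. \<Sum>i\<in>UNIV. x$i * x$i) (\<lambda>j x. \<Sum>i\<in>UNIV. x$i * (if j = i then 1 else 0) + (if j = i then 1 else 0) * x$i)"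
    by (intro c1_sum c1_mult c1_coordinate)
  show ?thesis
  proof (rule c1_eqI[OF c])
    fix j :: 'n and x :: "real^'n"
    have "(\<Sum>i\<in>UNIV. x$i * (if j = i then 1 else 0) + (if j = i then 1 else 0) * x$i) = (\<Sum>i\<in>UNIV. if i = j then 2 * x$i else 0)"
      by (intro sum.cong) auto
    then show "(\<Sum>i\<in>UNIV. x$i * (if j = i then 1 else 0) + (if j = i then 1 else 0) * x$i) = 2 * x$j" by simp
  qed (simp_all add: power2_norm_eq_inner inner_vec_def)
qed

context radiating
begin

abbreviation (input) vr where "vr \<equiv> \<lambda>x. \<Sum>j\<in>UNIV. (sgn x $ j) *\<^sub>R v' j x"

lemma cc_weight:
  fixes g :: "real^'n \<Rightarrow> 'b::real_normed_vector"
  assumes \<psi>: "cc R \<psi>" and flat: "\<And>x. norm x \<le> R\<^sub>0 + 2 \<Longrightarrow> \<psi> x = 0" and g: "continuous_on S g"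
  shows "cc R (\<lambda>x. \<psi> x *\<^sub>R g x)"
proof -
  have "continuous_on S (\<lambda>x. \<psi> x *\<^sub>R g x)"
    by (intro continuous_intros g cc_continuous[OF \<psi>])
  moreover have "continuous_on (ball 0 (R\<^sub>0 + 2)) (\<lambda>x. \<psi> x *\<^sub>R g x)"
    by (rule continuous_on_eq[OF continuous_on_const[of _ 0]]) (use flat in auto)
  ultimately have L: "continuous_on (S \<union> ball 0 (R\<^sub>0 + 2)) (\<lambda>x. \<psi> x *\<^sub>R g x)"
    by (intro continuous_on_open_Un) (auto simp: open_Compl)
  have U: "S \<union> ball 0 (R\<^sub>0 + 2) = UNIV" by auto
  show ?thesis using L cc_zero[OF \<psi>] unfolding U by (simp add: cc_def)
qed

text \<open>Minus the radial derivative of plateau (1 + (|x|^2 / R^2 - 1/16) / 10). The argument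
  passes 1 at |x| = R/4 and 2 before |x| = 4 R, so the weight lives in that shell; on R/2 <= |x| <=
  3 R it stays strictly inside the interval from 1 to 2, which gives a lower bound of order
  1/R.\<close>

definition weight :: "real \<Rightarrow> real^'n \<Rightarrow> real" where
  "weight R x = - plateau' (1 + ((norm x)\<^sup>2 / R\<^sup>2 - 1/16) / 10) * (norm x / (5 * R\<^sup>2))"

text \<open>\<open>10 \<beta>\<close> bounds \<open>- plateau'\<close> from below on the values that its argument in \<open>weight\<close> takes for \<open>R/2 \<le> |x| \<le> 3R\<close>.\<close>

definition \<beta> :: real where "\<beta> = 9 * (271 / 1000)\<^sup>2 * (3 / 160)\<^sup>2 / 10"

lemma weight_bounds:
  assumes R: "R > 0"
  shows "0 \<le> weight R x" and "norm x \<le> R / 4 \<Longrightarrow> weight R x = 0" and "norm x \<ge> 4 * R \<Longrightarrow> weight R x = 0"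
    and "weight R x \<le> 8 / R" and "R / 2 \<le> norm x \<Longrightarrow> norm x \<le> 3 * R \<Longrightarrow> \<beta> / R \<le> weight R x"
proof -
  define s where "s = norm x / R"
  have s0: "s \<ge> 0" using R by (simp add: s_def)
  have w: "weight R x = (- plateau' (1 + (s\<^sup>2 - 1/16) / 10)) * (s / (5 * R))"
    using R by (simp add: weight_def s_def power_divide power2_eq_square)
  show nn: "0 \<le> weight R x" unfolding w using s0 R plateau_bounds(4) by (intro mult_nonneg_nonneg) auto
  show "weight R x = 0" if "norm x \<le> R / 4"
  proof -
    have "s \<le> 1/4" using that R by (simp add: s_def field_simps)
    then have "s\<^sup>2 \<le> (1/4)\<^sup>2" using s0 by (intro power_mono)
    then have "s\<^sup>2 \<le> 1/16" by (simp add: power2_eq_square)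
    then show ?thesis unfolding w by (subst plateau_low(2)) auto
  qed
  show big: "weight R x = 0" if "norm x \<ge> 4 * R"
  proof -
    have "4 \<le> s" using that R by (simp add: s_def field_simps)
    then have "4\<^sup>2 \<le> s\<^sup>2" by (intro power_mono) auto
    then show ?thesis unfolding w by (subst plateau_high(2)) auto
  qed
  show "weight R x \<le> 8 / R"
  proof (cases "norm x \<ge> 4 * R")
    case True then show ?thesis using big R by simp
  next
    case False
    then have "s \<le> 4" using R by (simp add: s_def field_simps)
    moreover have "- plateau' u \<le> 9" for u using plateau_bounds(3)[of u] by linarith
    ultimately have "weight R x \<le> 9 * (4 / (5 * R))"
      unfolding w using s0 R plateau_bounds(4) by (intro mult_mono divide_right_mono divide_nonneg_nonneg) auto
    also have "\<dots> \<le> 8 / R" using R by (simp add: field_simps)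
    finally show ?thesis .
  qed
  show "\<beta> / R \<le> weight R x" if "R / 2 \<le> norm x" "norm x \<le> 3 * R"
  proof -
    have s: "1/2 \<le> s" "s \<le> 3" using that R by (simp_all add: s_def field_simps)
    \<comment> \<open>For s between 1/2 and 3 this number lies between (1/4 - 1/16) / 10 = 3/160 and
      9/10, and 1 - (9/10)^3 = 271/1000; these are the constants in \<open>\<beta>\<close>.\<close>
    define y where "y = (s\<^sup>2 - 1/16) / 10"
    have "(1/2)\<^sup>2 \<le> s\<^sup>2" "s\<^sup>2 \<le> 3\<^sup>2" using s by (intro power_mono; simp)+
    then have y: "3/160 \<le> y" "y \<le> 9/10" by (simp_all add: y_def power2_eq_square)
    have "y ^ 3 \<le> (9/10) ^ 3" using y by (intro power_mono) auto
    then have y3: "1 - y ^ 3 \<ge> 271/1000" by (simp add: eval_nat_numeral)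
    have "- plateau' (1 + y) = 9 * (1 - y ^ 3)\<^sup>2 * y\<^sup>2"
      using y y3 by (simp add: plateau'_def mp_def max_absorb2)
    also have "\<dots> \<ge> 9 * (271/1000)\<^sup>2 * (3/160)\<^sup>2"
      using y y3 by (intro mult_mono power_mono) auto
    finally have "10 * \<beta> \<le> - plateau' (1 + y)" by (simp add: \<beta>_def mult_ac)
    \<comment> \<open>With s >= 1/2 the second factor is at least 1 / (10 R), so the 10 in front of
      \<beta> cancels.\<close>
    then have "10 * \<beta> * (1/2 / (5 * R)) \<le> - plateau' (1 + y) * (s / (5 * R))"
      using s R plateau_bounds(4) by (intro mult_mono divide_right_mono divide_nonneg_nonneg) auto
    then show ?thesis unfolding w y_def[symmetric] by simp
  qed
qed

lemma weight_cc:
  assumes R: "R > 0" shows "cc (4 * R) (weight R)"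
  unfolding cc_def weight_def[abs_def]
proof (intro conjI allI impI)
  show "continuous_on UNIV (\<lambda>x::real^'n. - plateau' (1 + ((norm x)\<^sup>2 / R\<^sup>2 - 1 / 16) / 10) * (norm x / (5 * R\<^sup>2)))"
    using R by (intro continuous_intros) auto
  show "- plateau' (1 + ((norm x)\<^sup>2 / R\<^sup>2 - 1 / 16) / 10) * (norm x / (5 * R\<^sup>2)) = 0" if "4 * R < norm x" for x :: "real^'n"
    using weight_bounds(3)[OF R, of x] that by (simp add: weight_def)
qed

text \<open>
  Testing the flux against a radial cutoff removes the cross term of the radiation condition, which
  therefore controls the field itself.
\<close>

lemma weighted_energy:
  assumes R: "R / 4 \<ge> R\<^sub>0 + 2"
  shows "k\<^sup>2 * (LINT x|lborel. weight R x * (cmod (v x))\<^sup>2)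
    \<le> (LINT x|lborel. weight R x * (cmod (vr x - \<i> * of_real k * v x))\<^sup>2)"
proof -
  have Rp: "R > 0" using R R0 by simp
  define \<xi> where "\<xi> = (\<lambda>x::real^'n. plateau (1 + ((norm x)\<^sup>2 / R\<^sup>2 - 1/16) / 10))"
  define \<xi>' where "\<xi>' = (\<lambda>j (x::real^'n). - weight R x * sgn x $ j)"
  have cx: "c1 UNIV \<xi> (\<lambda>j x. plateau' (1 + ((norm x)\<^sup>2 / R\<^sup>2 - 1/16) / 10) * ((1 / (10 * R\<^sup>2)) * (2 * x$j)))"
    unfolding \<xi>_def
  proof (rule c1_compose_real[where f="\<lambda>x. 1 + ((norm x)\<^sup>2 / R\<^sup>2 - 1/16) / 10"])
    show "c1 UNIV (\<lambda>x::real^'n. 1 + ((norm x)\<^sup>2 / R\<^sup>2 - 1/16) / 10) (\<lambda>j x. (1 / (10 * R\<^sup>2)) * (2 * x$j))"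
      by (rule c1_eqI[OF c1_add[OF c1_const[of _ "1 - 1/160"] c1_cmult[OF c1_norm_square, where c="1 / (10 * R\<^sup>2)"]]]) (auto simp: field_simps)
  qed (auto intro!: plateau_derivative continuous_intros simp: Rp less_imp_neq[OF Rp, symmetric])
  have c1\<xi>: "c1 UNIV \<xi> \<xi>'"
  proof (rule c1_eqI[OF cx])
    fix j :: 'n and x :: "real^'n"
    have "x$j = norm x * sgn x $ j" by (cases "x = 0") (auto simp: sgn_vec_def)
    then show "plateau' (1 + ((norm x)\<^sup>2 / R\<^sup>2 - 1/16) / 10) * ((1 / (10 * R\<^sup>2)) * (2 * x$j)) = \<xi>' j x"
      unfolding \<xi>'_def weight_def by simp
  qed auto
  have cc\<xi>: "cc (4 * R) \<xi>"
    unfolding cc_def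
  proof (intro conjI allI impI)
    show "continuous_on UNIV \<xi>" by (rule c1_continuous[OF c1\<xi>])
    fix x :: "real^'n" assume "4 * R < norm x"
    then have "4 \<le> norm x / R" using Rp by (simp add: field_simps)
    then have "4\<^sup>2 \<le> (norm x / R)\<^sup>2" by (intro power_mono) auto
    then show "\<xi> x = 0" unfolding \<xi>_def by (subst plateau_high(1)) (auto simp: power_divide)
  qed
  have flat: "weight R x = 0" if "norm x \<le> R\<^sub>0 + 2" for x using weight_bounds(2)[OF Rp, of x] that R by simp
  have W: "integrable lborel (\<lambda>x. weight R x * g x)" if "continuous_on S g" for g :: "real^'n \<Rightarrow> real"
    using cc_integrable[OF cc_weight[OF weight_cc[OF Rp] flat that]] by simp
  have cv: "continuous_on S v" "continuous_on S vr"
    using R0 by (auto intro!: continuous_intros c1_continuous[OF v] c1_continuous_partial[OF v] continuous_on_sgn)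
  have "(LINT x|lborel. (\<Sum>j\<in>UNIV. \<xi>' j x * Im (cnj (v x) * v' j x))) = 0"
    by (rule flux_vanishes[OF c1\<xi> cc\<xi>]) (simp add: \<xi>'_def flat)
  also have "(\<lambda>x. \<Sum>j\<in>UNIV. \<xi>' j x * Im (cnj (v x) * v' j x)) = (\<lambda>x. - (weight R x * Im (cnj (v x) * vr x)))"
    by (rule ext) (simp add: \<xi>'_def sum_distrib_left sum_negf mult_ac right_diff_distrib sum_subtractf)
  finally have flux: "(LINT x|lborel. weight R x * Im (cnj (v x) * vr x)) = 0" by simp
  have expand: "(cmod (a - \<i> * of_real k * b))\<^sup>2 = (cmod a)\<^sup>2 + k\<^sup>2 * (cmod b)\<^sup>2 - 2 * k * Im (cnj b * a)" for a b
    unfolding cmod_power2 by (simp add: power2_eq_square) (simp add: algebra_simps)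
  have I: "integrable lborel (\<lambda>x. weight R x * (cmod (vr x))\<^sup>2)" "integrable lborel (\<lambda>x. weight R x * (cmod (v x))\<^sup>2)"
    "integrable lborel (\<lambda>x. weight R x * Im (cnj (v x) * vr x))"
    by (rule W, intro continuous_on_power continuous_on_norm continuous_on_Im continuous_on_mult continuous_on_cnj cv)+
  have "(LINT x|lborel. weight R x * (cmod (vr x - \<i> * of_real k * v x))\<^sup>2)
    = (LINT x|lborel. weight R x * (cmod (vr x))\<^sup>2 + k\<^sup>2 * (weight R x * (cmod (v x))\<^sup>2) - 2 * k * (weight R x * Im (cnj (v x) * vr x)))"
    unfolding expand by (simp only: algebra_simps)
  also have "\<dots> = (LINT x|lborel. weight R x * (cmod (vr x))\<^sup>2) + k\<^sup>2 * (LINT x|lborel. weight R x * (cmod (v x))\<^sup>2) - 2 * k * (LINT x|lborel. weight R x * Im (cnj (v x) * vr x))"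
    using I by simp
  finally have "(LINT x|lborel. weight R x * (cmod (vr x - \<i> * of_real k * v x))\<^sup>2)
    = (LINT x|lborel. weight R x * (cmod (vr x))\<^sup>2) + k\<^sup>2 * (LINT x|lborel. weight R x * (cmod (v x))\<^sup>2)" unfolding flux by simp
  moreover have "(LINT x|lborel. weight R x * (cmod (vr x))\<^sup>2) \<ge> 0"
    by (intro Bochner_Integration.integral_nonneg) (simp add: weight_bounds(1)[OF Rp])
  ultimately show ?thesis by simp
qed

text \<open>In polar coordinates the weight contributes at most 8 / R, on radii between R/4 and 4 R,
  an interval of length less than 4 R. Hence the factor 8 * 4 = 32.\<close>

lemma weighted_flux_small:
  assumes R: "R / 4 \<ge> R\<^sub>0 + 2" and \<epsilon>: "\<epsilon> \<ge> 0"
    and small: "\<And>r. r \<ge> R / 4 \<Longrightarrow> sphere_integral r (\<lambda>x. (cmod (vr x - \<i> * of_real k * v x))\<^sup>2) \<le> \<epsilon>"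
  shows "(LINT x|lborel. weight R x * (cmod (vr x - \<i> * of_real k * v x))\<^sup>2) \<le> 32 * \<epsilon>"
proof -
  have Rp: "R > 0" using R R0 by simp
  let ?f = "\<lambda>x. (cmod (vr x - \<i> * of_real k * v x))\<^sup>2"
  let ?h = "\<lambda>x. weight R x * ?f x"
  have flat: "weight R x = 0" if "norm x \<le> R\<^sub>0 + 2" for x using weight_bounds(2)[OF Rp, of x] that R by simp
  have cf: "continuous_on S ?f"
    by (auto intro!: continuous_intros c1_continuous[OF v] c1_continuous_partial[OF v] continuous_on_sgn) (use R0 in auto)
  have cch: "cc (4 * R) ?h" using cc_weight[OF weight_cc[OF Rp] flat cf] by simp
  have hm: "(\<lambda>x. ennreal (?h x)) \<in> borel_measurable borel"
    using borel_measurable_continuous_onI[OF cc_continuous[OF cch]] by measurable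
  have "ennreal (LINT x|lborel. ?h x) = (\<integral>\<^sup>+x. ennreal (?h x) \<partial>lborel)"
    by (rule nn_integral_eq_integral[symmetric, OF cc_integrable[OF cch]]) (simp add: weight_bounds(1)[OF Rp])
  also have "\<dots> = (\<integral>\<^sup>+r. indicator {0<..} r * ennreal (r ^ (DIM(real^'n) - 1)) * (\<integral>\<^sup>+\<theta>. ennreal (?h (r *\<^sub>R \<theta>)) \<partial>unit_sphere_measure) \<partial>lborel)"
    by (rule polar_coordinates[OF hm]) (simp add: weight_def)
  also have "\<dots> \<le> (\<integral>\<^sup>+r. ennreal (8 / R * \<epsilon>) * indicator {R/4..4*R} r \<partial>lborel)"
  proof (rule nn_integral_mono)
    fix r :: real
    let ?I = "\<integral>\<^sup>+\<theta>. ennreal (?h (r *\<^sub>R \<theta>)) \<partial>(unit_sphere_measure :: (real^'n) measure)"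
    show "indicator {0<..} r * ennreal (r ^ (DIM(real^'n) - 1)) * ?I \<le> ennreal (8 / R * \<epsilon>) * indicator {R/4..4*R} r"
    proof (cases "r > 0")
      case False
      then show ?thesis by simp
    next
      case r: True
      show ?thesis
      proof (cases "r \<in> {R/4..4*R}")
        case False
        have "?I = (\<integral>\<^sup>+\<theta>. 0 \<partial>(unit_sphere_measure :: (real^'n) measure))"
        proof (rule nn_integral_cong)
          fix \<theta> :: "real^'n" assume "\<theta> \<in> space unit_sphere_measure"
          then have "norm (r *\<^sub>R \<theta>) = r" using r by (simp add: space_unit_sphere_measure)
          then have "weight R (r *\<^sub>R \<theta>) = 0" using weight_bounds(2,3)[OF Rp, of "r *\<^sub>R \<theta>"] False by auto
          then show "ennreal (?h (r *\<^sub>R \<theta>)) = 0" by simp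
        qed
        then show ?thesis by simp
      next
        case True
        have S: "sphere 0 r \<subseteq> S" using True R R0 by auto
        have "?I \<le> (\<integral>\<^sup>+\<theta>. ennreal (8 / R) * ennreal (?f (r *\<^sub>R \<theta>)) \<partial>(unit_sphere_measure :: (real^'n) measure))"
        proof (rule nn_integral_mono)
          fix \<theta> :: "real^'n"
          show "ennreal (?h (r *\<^sub>R \<theta>)) \<le> ennreal (8 / R) * ennreal (?f (r *\<^sub>R \<theta>))"
            unfolding ennreal_mult'[symmetric, OF order.strict_implies_order[OF divide_pos_pos[OF zero_less_numeral Rp]]]
            by (intro ennreal_leI mult_right_mono weight_bounds(4)[OF Rp] zero_le_power2)
        qed
        also have "\<dots> = ennreal (8 / R) * (\<integral>\<^sup>+\<theta>. ennreal (?f (r *\<^sub>R \<theta>)) \<partial>(unit_sphere_measure :: (real^'n) measure))"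
        proof (rule nn_integral_cmult)
          have c: "continuous_on (sphere 0 1) (\<lambda>\<theta>. ?f (r *\<^sub>R \<theta>))"
            by (rule continuous_on_compose2[OF continuous_on_subset[OF cf S]]) (use r in \<open>auto intro!: continuous_intros\<close>)
          have "(\<lambda>\<theta>. ?f (r *\<^sub>R \<theta>)) \<in> borel_measurable unit_sphere_measure"
            by (rule borel_measurable_unit_sphere[OF c])
          then show "(\<lambda>\<theta>. ennreal (?f (r *\<^sub>R \<theta>))) \<in> borel_measurable unit_sphere_measure" by measurable
        qed
        finally have "ennreal (r ^ (DIM(real^'n) - 1)) * ?I \<le> ennreal (r ^ (DIM(real^'n) - 1)) * (ennreal (8 / R) * (\<integral>\<^sup>+\<theta>. ennreal (?f (r *\<^sub>R \<theta>)) \<partial>(unit_sphere_measure :: (real^'n) measure)))"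
          by (rule mult_left_mono) simp
        also have "\<dots> = ennreal (8 / R) * (ennreal (r ^ (DIM(real^'n) - 1)) * (\<integral>\<^sup>+\<theta>. ennreal (?f (r *\<^sub>R \<theta>)) \<partial>(unit_sphere_measure :: (real^'n) measure)))"
          by (simp only: mult_ac)
        also have "\<dots> = ennreal (8 / R) * ennreal (sphere_integral r ?f)"
          by (subst nn_integral_sphere[OF r continuous_on_subset[OF cf S]]) simp_all
        also have "\<dots> \<le> ennreal (8 / R) * ennreal \<epsilon>"
          using True by (intro mult_left_mono ennreal_leI small) auto
        also have "\<dots> = ennreal (8 / R * \<epsilon>)" using Rp by (intro ennreal_mult'[symmetric]) auto
        finally show ?thesis using r True by simp
      qed
    qed
  qed
  also have "\<dots> = ennreal (8 / R * \<epsilon>) * ennreal (4 * R - R / 4)"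
    using Rp by (subst nn_integral_cmult_indicator) auto
  also have "\<dots> = ennreal (8 / R * \<epsilon> * (4 * R - R / 4))" using Rp \<epsilon> by (intro ennreal_mult[symmetric]) auto
  also have "\<dots> \<le> ennreal (32 * \<epsilon>)" using Rp \<epsilon> by (intro ennreal_leI) (simp add: field_simps)
  finally show ?thesis using \<epsilon> by (simp add: ennreal_le_iff)
qed

text \<open>The weight is at least \<beta> / R on this shell, so the squared mass of
  \<open>v\<close> there is at most a constant multiple of R times the weighted energy, which tends
  to 0. The factor R is exactly what the smallness of \<kappa> can compensate.\<close>

theorem radiation_decay:
  assumes som: "((\<lambda>r. sphere_integral r (\<lambda>x. (cmod (vr x - \<i> * of_real k * v x))\<^sup>2)) \<longlongrightarrow> 0) at_top"
    and \<epsilon>: "\<epsilon> > 0"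
  shows "\<forall>\<^sub>F R in at_top. (LINT x|lborel. indicat_real {x. R/2 \<le> norm x \<and> norm x \<le> 3*R} x * (cmod (v x))\<^sup>2) \<le> \<epsilon> * R"
proof -
  \<comment> \<open>Chosen so that 32 \<delta> = k^2 \<beta> \<epsilon>, the product of the
    constants lost in \<open>weighted_energy\<close> and in the lower bound of the weight with the
    target \<epsilon>.\<close>
  define \<delta> where "\<delta> = \<beta> * k\<^sup>2 * \<epsilon> / 32"
  have \<beta>: "\<beta> > 0" by (simp add: \<beta>_def)
  have \<delta>: "\<delta> > 0" using k \<epsilon> \<beta> by (simp add: \<delta>_def)
  have "\<forall>\<^sub>F r in at_top. sphere_integral r (\<lambda>x. (cmod (vr x - \<i> * of_real k * v x))\<^sup>2) < \<delta>"
    by (rule order_tendstoD(2)[OF som \<delta>])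
  then obtain N where N: "\<And>r. r \<ge> N \<Longrightarrow> sphere_integral r (\<lambda>x. (cmod (vr x - \<i> * of_real k * v x))\<^sup>2) < \<delta>"
    unfolding eventually_at_top_linorder by blast
  show ?thesis
    unfolding eventually_at_top_linorder
  proof (intro exI[of _ "4 * max N (R\<^sub>0 + 2)"] allI impI)
    fix R assume "R \<ge> 4 * max N (R\<^sub>0 + 2)"
    then have R: "R / 4 \<ge> N" "R / 4 \<ge> R\<^sub>0 + 2" by (auto simp: max_def split: if_splits)
    then have Rp: "R > 0" using R0 by simp
    have flat: "weight R x = 0" if "norm x \<le> R\<^sub>0 + 2" for x using weight_bounds(2)[OF Rp, of x] that R by simp
    have cv: "continuous_on S (\<lambda>x. (cmod (v x))\<^sup>2)" by (intro continuous_intros c1_continuous[OF v])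
    have I: "integrable lborel (\<lambda>x. weight R x * (cmod (v x))\<^sup>2)"
      using cc_integrable[OF cc_weight[OF weight_cc[OF Rp] flat cv]] by simp
    let ?A = "{x::real^'n. R/2 \<le> norm x \<and> norm x \<le> 3*R}"
    have "?A = cball 0 (3*R) - ball 0 (R/2)" by auto
    then have cA: "compact ?A" by (simp add: compact_diff)
    have "?A \<subseteq> S" using R R0 by auto
    then have J: "integrable lborel (\<lambda>x. indicat_real ?A x * (cmod (v x))\<^sup>2)"
      using borel_integrable_compact[OF cA continuous_on_subset[OF cv]] by simp
    have "k\<^sup>2 * (\<beta> / R * (LINT x|lborel. indicat_real ?A x * (cmod (v x))\<^sup>2)) = k\<^sup>2 * (LINT x|lborel. \<beta> / R * (indicat_real ?A x * (cmod (v x))\<^sup>2))"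
      by simp
    also have "\<dots> \<le> k\<^sup>2 * (LINT x|lborel. weight R x * (cmod (v x))\<^sup>2)"
    proof (intro mult_left_mono integral_mono)
      show "integrable lborel (\<lambda>x. \<beta> / R * (indicat_real ?A x * (cmod (v x))\<^sup>2))" using J by simp
      show "\<beta> / R * (indicat_real ?A x * (cmod (v x))\<^sup>2) \<le> weight R x * (cmod (v x))\<^sup>2" for x
      proof (cases "x \<in> ?A")
        case True
        then have "\<beta> / R * (cmod (v x))\<^sup>2 \<le> weight R x * (cmod (v x))\<^sup>2"
          by (intro mult_right_mono weight_bounds(5)[OF Rp]) auto
        then show ?thesis using True by simp
      qed (auto simp: weight_bounds(1)[OF Rp])
    qed (use I in auto)
    also have "\<dots> \<le> 32 * \<delta>"
      using weighted_energy[OF R(2)] weighted_flux_small[OF R(2), of \<delta>] N R(1) \<delta> by (smt (verit))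
    also have "\<dots> = k\<^sup>2 * (\<beta> / R * (\<epsilon> * R))" using Rp by (simp add: \<delta>_def)
    finally have "\<beta> / R * (LINT x|lborel. indicat_real ?A x * (cmod (v x))\<^sup>2) \<le> \<beta> / R * (\<epsilon> * R)"
      using k by (subst (asm) mult_le_cancel_left_pos) auto
    then show "(LINT x|lborel. indicat_real ?A x * (cmod (v x))\<^sup>2) \<le> \<epsilon> * R"
      using Rp \<beta> by (subst (asm) mult_le_cancel_left_pos) auto
  qed
qed

text \<open>The function \<rho> + \<kappa> is annihilated by \<open>l\<close> and vanishes on
  \<Omega>, so the pairing of \<open>us\<close> with \<rho> is minus its pairing with \<kappa>. The
  latter is carried by the part R <= |x - x0| <= 2 R of the space, which lies in the shell of
  \<open>radiation_decay\<close>, and is estimated by Young's inequality with a free parameter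
  \<open>s\<close>.\<close>

theorem exterior_pairing:
  fixes \<rho> :: "real \<Rightarrow> real"
  assumes som: "((\<lambda>r. sphere_integral r (\<lambda>x. (cmod (vr x - \<i> * of_real k * v x))\<^sup>2)) \<longlongrightarrow> 0) at_top"
    and a: "a > 0" and \<rho>: "continuous_on UNIV \<rho>" "\<And>r. r \<le> a \<Longrightarrow> \<rho> r = 0" "\<And>r. r \<ge> b \<Longrightarrow> \<rho> r = 0"
    and disj: "cball x\<^sub>0 b \<inter> \<Omega> = {}"
  shows "(LINT x|lebesgue. us x * of_real (\<rho> (norm (x - x\<^sub>0)))) = 0"
proof -
  let ?d = "CARD('n)"
  obtain C \<kappa> where C: "C \<ge> 0"
    and \<kappa>b: "\<And>R r. R \<ge> max 1 b \<Longrightarrow> \<bar>\<kappa> R r\<bar> \<le> C * R powr (- (real ?d + 1) / 2)"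
    and \<kappa>0: "\<And>R r. R \<ge> max 1 b \<Longrightarrow> r < R \<or> 2 * R < r \<Longrightarrow> \<kappa> R r = 0"
    and \<phi>: "\<And>R. R \<ge> max 1 b \<Longrightarrow> \<exists>\<phi> \<phi>' \<phi>''. c1 UNIV \<phi> \<phi>' \<and> (\<forall>i. c1 UNIV (\<phi>' i) (\<phi>'' i)) \<and> cc (norm x\<^sub>0 + 2 * R) \<phi> \<and>
       (\<forall>x::real^'n. (\<Sum>i\<in>UNIV. \<phi>'' i i x) + k\<^sup>2 * \<phi> x = \<rho> (norm (x - x\<^sub>0)) + \<kappa> R (norm (x - x\<^sub>0)))"
  proof (rule radial_test_family[OF k a \<rho>, where ?x0.0=x\<^sub>0], assumption, assumption, goal_cases)
    case (1 C \<kappa>)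
    show ?case by (rule 1(1); fact)
  qed
  define P where "P = (LINT x|lebesgue. us x * of_real (\<rho> (norm (x - x\<^sub>0))))"
  \<comment> \<open>Collects C^2 and the volume of the ball of radius 3 R after the powers of R have
    cancelled: R from Young's inequality, R^(-d-1) from \<kappa>^2 and R^d from the volume.\<close>
  define K where "K = C\<^sup>2 * (unit_ball_vol (real ?d) * 3 ^ ?d)"
  have K: "K \<ge> 0" by (simp add: K_def)
  have c\<rho>: "cc (norm x\<^sub>0 + b) (\<lambda>x. \<rho> (norm (x - x\<^sub>0)))"
    unfolding cc_def
  proof (intro conjI allI impI)
    show "continuous_on UNIV (\<lambda>x. \<rho> (norm (x - x\<^sub>0)))"
      by (rule continuous_on_compose2[OF \<rho>(1)]) (auto intro!: continuous_intros)
    show "\<rho> (norm (x - x\<^sub>0)) = 0" if "norm x\<^sub>0 + b < norm x" for x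
      using norm_triangle_sub[of x x\<^sub>0] that by (intro \<rho>(3)) simp
  qed
  have bound: "cmod P \<le> s / 2 * \<epsilon> + K / (2 * s)" if s: "s > 0" and \<epsilon>: "\<epsilon> > 0" for s \<epsilon>
  proof -
    let ?A = "\<lambda>R. {x::real^'n. R/2 \<le> norm x \<and> norm x \<le> 3*R}"
    have "\<forall>\<^sub>F R in at_top. (LINT x|lborel. indicat_real (?A R) x * (cmod (v x))\<^sup>2) \<le> \<epsilon> * R \<and> R \<ge> 2 * R\<^sub>0 + 2 * norm x\<^sub>0 + 1 + max 1 b"
      by (intro eventually_conj radiation_decay[OF som \<epsilon>] eventually_ge_at_top)
    then obtain R where decay: "(LINT x|lborel. indicat_real (?A R) x * (cmod (v x))\<^sup>2) \<le> \<epsilon> * R"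
      and R: "R \<ge> 2 * R\<^sub>0 + 2 * norm x\<^sub>0 + 1 + max 1 b" unfolding eventually_at_top_linorder by blast
    have mb: "max 1 b \<ge> 1" by simp
    have nx: "norm x\<^sub>0 \<ge> 0" by simp
    have R': "R \<ge> max 1 b" "R > 0" "R / 2 > R\<^sub>0" "R > R\<^sub>0 + norm x\<^sub>0" "R \<ge> 2 * norm x\<^sub>0" using R R0 mb nx by linarith+
    obtain \<phi> \<phi>' \<phi>'' where p: "c1 UNIV \<phi> \<phi>'" "\<And>i. c1 UNIV (\<phi>' i) (\<phi>'' i)" "cc (norm x\<^sub>0 + 2 * R) \<phi>"
      and L: "\<And>x::real^'n. (\<Sum>i\<in>UNIV. \<phi>'' i i x) + k\<^sup>2 * \<phi> x = \<rho> (norm (x - x\<^sub>0)) + \<kappa> R (norm (x - x\<^sub>0))"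
      using \<phi>[OF R'(1)] by blast
    define \<psi> where "\<psi> = (\<lambda>x. \<rho> (norm (x - x\<^sub>0)) + \<kappa> R (norm (x - x\<^sub>0)))"
    have L': "(\<lambda>x. (\<Sum>i\<in>UNIV. \<phi>'' i i x) + k\<^sup>2 * \<phi> x) = \<psi>" unfolding \<psi>_def by (rule ext) (rule L)
    have c': "cc (norm x\<^sub>0 + 2 * R) (\<phi>' i)" for i by (rule c1_cc_partial[OF p(1)]) (rule cc_zero[OF p(3)])
    have c'': "cc (norm x\<^sub>0 + 2 * R) (\<phi>'' i j)" for i j by (rule c1_cc_partial[OF p(2)]) (rule cc_zero[OF c'])
    have c\<psi>: "cc (norm x\<^sub>0 + 2 * R) \<psi>" unfolding L'[symmetric] by (intro cc_add cc_sum cc_cmult c'' p(3))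
    have c\<kappa>: "cc (norm x\<^sub>0 + 2 * R) (\<lambda>x. \<kappa> R (norm (x - x\<^sub>0)))"
    proof -
      have "cc (norm x\<^sub>0 + 2 * R) (\<lambda>x. \<psi> x - \<rho> (norm (x - x\<^sub>0)))"
        by (intro cc_diff c\<psi> cc_mono[OF c\<rho>]) (use R' in auto)
      then show ?thesis by (simp add: \<psi>_def)
    qed
    have \<psi>0: "\<psi> x = 0" if "x \<in> \<Omega>" for x
    proof -
      have "x \<notin> cball x\<^sub>0 b" using that disj by blast
      then have "norm (x - x\<^sub>0) > b" by (simp add: dist_norm norm_minus_commute)
      moreover have "norm (x - x\<^sub>0) < R"
        using norm_triangle_ineq4[of x x\<^sub>0] subsetD[OF dom that] R'(4) by simp
      ultimately show ?thesis unfolding \<psi>_def using \<rho>(3) \<kappa>0[OF R'(1)] by simp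
    qed
    note i1 = loc_int_cc[OF us c\<rho>] and i2 = loc_int_cc[OF us c\<kappa>]
    have "0 = l \<psi>" using annihilates[OF p] unfolding L' by simp
    also have "\<dots> = (LINT x|lebesgue. us x * of_real (\<psi> x))" by (rule represents[OF c\<psi> \<psi>0])
    also have "\<dots> = (LINT x|lebesgue. (us x * of_real (\<rho> (norm (x - x\<^sub>0))) + us x * of_real (\<kappa> R (norm (x - x\<^sub>0)))))"
      by (simp only: \<psi>_def of_real_add distrib_left)
    also have "\<dots> = P + (LINT x|lebesgue. us x * of_real (\<kappa> R (norm (x - x\<^sub>0))))"
      unfolding P_def by (rule Bochner_Integration.integral_add[OF i1 i2])
    finally have "P = - (LINT x|lebesgue. us x * of_real (\<kappa> R (norm (x - x\<^sub>0))))" by (simp add: eq_neg_iff_add_eq_0)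
    then have "cmod P = cmod (LINT x|lebesgue. us x * of_real (\<kappa> R (norm (x - x\<^sub>0))))" by simp
    also have "\<dots> \<le> (LINT x|lebesgue. cmod (us x * of_real (\<kappa> R (norm (x - x\<^sub>0)))))" by (rule integral_norm_bound)
    finally have P1: "cmod P \<le> (LINT x|lebesgue. cmod (us x * of_real (\<kappa> R (norm (x - x\<^sub>0)))))" .
    have "?A R = cball 0 (3*R) - ball 0 (R/2)" by auto
    then have cA: "compact (?A R)" by (simp add: compact_diff)
    have AS: "?A R \<subseteq> S" using R'(3) by auto
    have J: "integrable lborel (\<lambda>x. indicat_real (?A R) x * (cmod (v x))\<^sup>2)"
      using borel_integrable_compact[OF cA, of "\<lambda>x. (cmod (v x))\<^sup>2"] continuous_on_subset[OF c1_continuous[OF v] AS]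
      by (simp add: continuous_intros)
    have Am: "emeasure lborel (cball (0::real^'n) (3*R)) < \<infinity>" by (rule emeasure_bounded_finite) simp
    have J1: "integrable lborel (indicat_real (cball (0::real^'n) (3*R)))" using Am by (intro integrable_real_indicator) auto
    define D where "D = R / (2 * s) * (C * R powr (- (real ?d + 1) / 2))\<^sup>2"
    let ?w = "\<lambda>x. s / (2 * R) * (indicat_real (?A R) x * (cmod (v x))\<^sup>2) + D * indicat_real (cball 0 (3*R)) x"
    have iw: "integrable lborel ?w" using J J1 by (intro Bochner_Integration.integrable_add integrable_mult_right)
    have D0: "D \<ge> 0" using R' s by (simp add: D_def)
    have "(LINT x|lebesgue. cmod (us x * of_real (\<kappa> R (norm (x - x\<^sub>0))))) \<le> (LINT x|lebesgue. ?w x)"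
    proof (rule integral_mono_AE)
      show "integrable lebesgue (\<lambda>x. cmod (us x * of_real (\<kappa> R (norm (x - x\<^sub>0)))))" using i2 by (rule integrable_norm)
      show "integrable lebesgue ?w" by (rule integrable_completion[THEN iffD2, OF _ iw]) (use iw in auto)
      show "AE x in lebesgue. cmod (us x * of_real (\<kappa> R (norm (x - x\<^sub>0)))) \<le> ?w x"
        using us_v
      proof eventually_elim
        case (elim x)
        show ?case
        proof (cases "\<kappa> R (norm (x - x\<^sub>0)) = 0")
          case True
          then show ?thesis using s R' D0 by simp
        next
          case False
          then have "R \<le> norm (x - x\<^sub>0)" "norm (x - x\<^sub>0) \<le> 2 * R" using \<kappa>0[OF R'(1)] by force+
          then have x: "R / 2 \<le> norm x" "norm x \<le> 3 * R"
            using norm_triangle_ineq4[of x x\<^sub>0] norm_triangle_sub[of x x\<^sub>0] R' by linarith+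
          then have e: "us x = v x" using elim R' by simp
          define y z where "y = cmod (v x)" and "z = \<bar>\<kappa> R (norm (x - x\<^sub>0))\<bar>"
          have z: "0 \<le> z" "z \<le> C * R powr (- (real ?d + 1) / 2)" unfolding z_def using \<kappa>b[OF R'(1)] by auto
          \<comment> \<open>Young's inequality with weights s / R and R / s, for which the field
            contributes s \<epsilon> / 2 and the contribution of \<kappa> does not depend on
            \<open>R\<close>.\<close>
          have "0 \<le> (s * y - R * z)\<^sup>2" by simp
          then have "2 * (s * R) * (y * z) \<le> s\<^sup>2 * y\<^sup>2 + R\<^sup>2 * z\<^sup>2" by (simp add: power2_eq_square algebra_simps)
          then have "y * z \<le> s / (2 * R) * y\<^sup>2 + R / (2 * s) * z\<^sup>2" using s R' by (simp add: field_simps power2_eq_square)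
          also have "R / (2 * s) * z\<^sup>2 \<le> D" unfolding D_def using s R' z by (intro mult_left_mono power_mono) auto
          finally show ?thesis using x by (simp add: e norm_mult y_def z_def)
        qed
      qed
    qed
    also have "(LINT x|lebesgue. ?w x) = (LINT x|lborel. ?w x)" by (rule integral_completion) (use iw in auto)
    also have "\<dots> = s / (2 * R) * (LINT x|lborel. indicat_real (?A R) x * (cmod (v x))\<^sup>2) + D * measure lborel (cball (0::real^'n) (3*R))"
      using J J1 Am by simp
    also have "\<dots> \<le> s / (2 * R) * (\<epsilon> * R) + D * measure lborel (cball (0::real^'n) (3*R))"
      using s R' decay by (intro add_right_mono mult_left_mono) auto
    also have "s / (2 * R) * (\<epsilon> * R) = s / 2 * \<epsilon>" using R' by simp
    also have "D * measure lborel (cball (0::real^'n) (3*R)) = K / (2 * s)"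
    proof -
      have "(R powr (- (real ?d + 1) / 2))\<^sup>2 = R powr (- real (?d + 1))"
      proof -
        have "- (real ?d + 1) / 2 + - (real ?d + 1) / 2 = - real (?d + 1)" by (simp add: field_simps)
        then show ?thesis by (simp only: power2_eq_square powr_add[symmetric])
      qed
      also have "\<dots> = 1 / R ^ (?d + 1)" unfolding powr_minus powr_realpow[OF R'(2)] by (rule inverse_eq_divide)
      finally have "D = C\<^sup>2 * (R / (R ^ (?d + 1))) / (2 * s)" by (simp add: D_def power_mult_distrib)
      also have "R / (R ^ (?d + 1)) = 1 / R ^ ?d" using R' by simp
      finally have "D = C\<^sup>2 / (2 * s) / R ^ ?d" by simp
      moreover have "measure lborel (cball (0::real^'n) (3*R)) = unit_ball_vol (real ?d) * (3 ^ ?d * R ^ ?d)"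
        using R' by (subst content_cball) (auto simp: power_mult_distrib)
      ultimately show ?thesis using R' s by (simp add: K_def field_simps)
    qed
    finally show ?thesis using P1 by simp
  qed
  have "cmod P \<le> \<epsilon>" if "\<epsilon> > 0" for \<epsilon>
  proof -
    \<comment> \<open>The parameter is fixed first, so that the \<kappa> term is at most \<epsilon>
      / 2; the decay is then used with \<epsilon> / s, which makes the other term \<epsilon> / 2 as
      well.\<close>
    define s where "s = (K + 1) / \<epsilon>"
    have s: "s > 0" using K that by (simp add: s_def)
    have "K / (2 * s) \<le> \<epsilon> / 2"
    proof -
      have "K / (2 * s) = K / (K + 1) * (\<epsilon> / 2)" using K that by (simp add: s_def)
      also have "\<dots> \<le> 1 * (\<epsilon> / 2)" using K that by (intro mult_right_mono) auto
      finally show ?thesis by simp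
    qed
    then show ?thesis using bound[OF s, of "\<epsilon> / s"] s that by simp
  qed
  then have "cmod P \<le> 0" by (rule field_le_epsilon[where y=0, simplified])
  then show ?thesis by (simp add: P_def)
qed

end

section \<open>Vanishing off the scatterer\<close>

lemma sigma_finite_lebesgue: "sigma_finite_measure (lebesgue :: 'a::euclidean_space measure)"
proof
  show "\<exists>A. countable A \<and> A \<subseteq> sets (lebesgue :: 'a measure) \<and> \<Union>A = space lebesgue \<and> (\<forall>a\<in>A. emeasure lebesgue a \<noteq> \<infinity>)"
  proof (intro exI[of _ "range (\<lambda>n::nat. ball (0::'a) (real n))"] conjI, goal_cases)
    case 3
    have "x \<in> (\<Union>n::nat. ball 0 (real n))" for x :: 'a using reals_Archimedean2[of "norm x"] by auto
    then show ?case by auto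
  next
    case 4
    have "emeasure lebesgue (ball (0::'a) r) \<noteq> \<infinity>" for r
      using emeasure_bounded_finite[of "ball (0::'a) r"] by simp
    then show ?case by blast
  qed auto
qed

text \<open>Open sets are stable under intersection and generate the Borel sets, so vanishing
  integrals extend to all Borel sets by the pi-lambda theorem. A Lebesgue set differs from an
  F-sigma set by a null set, and uniqueness of densities concludes.\<close>

lemma set_integral_open_imp_AE_0:
  fixes f :: "'a::euclidean_space \<Rightarrow> complex"
  assumes f: "integrable lebesgue f" and 0: "\<And>U. open U \<Longrightarrow> (LINT x|lebesgue. indicat_real U x *\<^sub>R f x) = 0"
  shows "AE x in lebesgue. f x = 0"
proof -
  have I: "integrable lebesgue (\<lambda>x. indicat_real A x *\<^sub>R f x)" if "A \<in> sets lebesgue" for A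
    by (rule integrable_mult_indicator[OF that f])
  have borel: "(LINT x|lebesgue. indicat_real A x *\<^sub>R f x) = 0" if "A \<in> sigma_sets UNIV {U. open U}" for A
    using _ _ that
  proof (rule sigma_sets_induct_disjoint)
    have m: "B \<in> sets lebesgue" if "B \<in> sigma_sets UNIV {U::'a set. open U}" for B
      using that by (simp add: borel_def)
    show "Int_stable {U::'a set. open U}" by (auto simp: Int_stable_def)
    show "(LINT x|lebesgue. indicat_real B x *\<^sub>R f x) = 0" if "B \<in> {U. open U}" for B using 0 that by simp
    show "(LINT x|lebesgue. indicat_real (UNIV - B) x *\<^sub>R f x) = 0"
      if B: "B \<in> sigma_sets UNIV {U. open U}" and z: "(LINT x|lebesgue. indicat_real B x *\<^sub>R f x) = 0" for B
    proof -
      have "(LINT x|lebesgue. indicat_real (UNIV - B) x *\<^sub>R f x) = (LINT x|lebesgue. indicat_real UNIV x *\<^sub>R f x - indicat_real B x *\<^sub>R f x)"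
        by (intro Bochner_Integration.integral_cong) (auto simp: indicator_def)
      also have "\<dots> = (LINT x|lebesgue. indicat_real UNIV x *\<^sub>R f x) - (LINT x|lebesgue. indicat_real B x *\<^sub>R f x)"
        by (intro Bochner_Integration.integral_diff I m B) simp
      finally show ?thesis using z 0[OF open_UNIV] by simp
    qed
    show "(LINT x|lebesgue. indicat_real (\<Union> (range B)) x *\<^sub>R f x) = 0"
      if B: "disjoint_family B" "range B \<subseteq> sigma_sets UNIV {U. open U}" and z: "\<And>i. (LINT x|lebesgue. indicat_real (B i) x *\<^sub>R f x) = 0"
      for B :: "nat \<Rightarrow> 'a set"
    proof -
      have Bm: "B i \<in> sets lebesgue" for i using B(2) m by blast
      have "(LINT x:(\<Union> (range B))|lebesgue. f x) = (\<Sum>i. (LINT x:B i|lebesgue. f x))"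
        by (rule lebesgue_integral_countable_add)
          (use Bm B(1) I in \<open>auto simp: disjoint_family_on_def set_integrable_def\<close>)
      then show ?thesis using z by (simp add: set_lebesgue_integral_def)
    qed
  qed auto
  show ?thesis
  proof (rule sigma_finite_measure.density_unique_banach[OF sigma_finite_lebesgue f])
    fix A :: "'a set" assume "A \<in> sets lebesgue"
    then obtain C T where CT: "fsigma C" "T \<in> null_sets lebesgue" "C \<union> T = A" "disjnt C T" by (rule lebesgue_set_almost_fsigma)
    have Cb: "C \<in> sets borel" using CT(1) by cases auto
    then have C: "C \<in> sigma_sets UNIV {U. open U}" by (simp add: borel_def)
    have "(LINT x|lebesgue. indicat_real A x *\<^sub>R f x) = (LINT x|lebesgue. indicat_real C x *\<^sub>R f x)"
    proof (rule integral_cong_AE)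
      show "(\<lambda>x. indicat_real A x *\<^sub>R f x) \<in> borel_measurable lebesgue" using I[OF \<open>A \<in> sets lebesgue\<close>] by auto
      show "(\<lambda>x. indicat_real C x *\<^sub>R f x) \<in> borel_measurable lebesgue" using I[of C] Cb by auto
      have "AE x in lebesgue. x \<notin> T" by (rule AE_not_in[OF CT(2)])
      then show "AE x in lebesgue. indicat_real A x *\<^sub>R f x = indicat_real C x *\<^sub>R f x"
        by eventually_elim (use CT(3) in \<open>auto simp: indicator_def\<close>)
    qed
    then show "(LINT x:A|lebesgue. f x) = (LINT x:A|lebesgue. 0)"
      using borel[OF C] by (simp add: set_lebesgue_integral_def)
  qed simp
qed

text \<open>Radial profiles approximate the indicator of a ball, so \<open>u\<close> has integral 0
  over every ball whose closure lies in \<open>W\<close>. Vitali's theorem fills bounded open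
  subsets of \<open>W\<close> with disjoint balls up to a null set, and the integrals over open sets
  determine \<open>u\<close>.\<close>

lemma AE_zero_of_radial_integrals:
  fixes u :: "real^'n \<Rightarrow> complex"
  assumes u: "locally_integrable_on UNIV u" and W: "open W"
    and pair: "\<And>a b \<rho> x\<^sub>0. a > 0 \<Longrightarrow> continuous_on UNIV \<rho> \<Longrightarrow> (\<And>r. r \<le> a \<Longrightarrow> \<rho> r = 0) \<Longrightarrow> (\<And>r. r \<ge> b \<Longrightarrow> \<rho> r = 0) \<Longrightarrow>
      cball x\<^sub>0 b \<subseteq> W \<Longrightarrow> (LINT x|lebesgue. u x * of_real (\<rho> (norm (x - x\<^sub>0)))) = 0"
  shows "AE x in lebesgue. x \<in> W \<longrightarrow> u x = 0"
proof -
  have I: "integrable lebesgue (\<lambda>x. indicat_real A x *\<^sub>R u x)" if bdd: "bounded A" and A: "A \<in> sets lebesgue" for A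
  proof -
    obtain R where "A \<subseteq> cball 0 R" using bdd unfolding bounded_iff subset_iff mem_cball_0 by blast
    have "integrable lebesgue (\<lambda>x. indicat_real A x *\<^sub>R (indicat_real (cball 0 R) x *\<^sub>R u x))"
      by (rule integrable_mult_indicator[OF A locally_integrable_ball[OF u]])
    also have "(\<lambda>x. indicat_real A x *\<^sub>R (indicat_real (cball 0 R) x *\<^sub>R u x)) = (\<lambda>x. indicat_real A x *\<^sub>R u x)"
      using \<open>A \<subseteq> cball 0 R\<close> by (intro ext) (auto simp: indicator_def)
    finally show ?thesis .
  qed
  have ball: "(LINT x|lebesgue. indicat_real (ball x\<^sub>0 b) x *\<^sub>R u x) = 0" if sub: "cball x\<^sub>0 b \<subseteq> W" for x\<^sub>0 b
  proof -
    \<comment> \<open>Trapezoids that vanish up to 1 / (n + 1) and from \<open>b\<close> on, as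
      \<open>pair\<close> requires, and converge to 1 between 0 and \<open>b\<close>; only the
      centre of the ball, a null set, is lost.\<close>
    define \<rho> where "\<rho> n r = max 0 (min 1 (min (real (Suc n) * r - 1) (real (Suc n) * (b - r))))" for n r
    have \<rho>01: "0 \<le> \<rho> n r" "\<rho> n r \<le> 1" for n r by (auto simp: \<rho>_def)
    have hi: "\<rho> n r = 0" if "r \<ge> b" for n r
    proof -
      have "real (Suc n) * (b - r) \<le> 0" using that by (intro mult_nonneg_nonpos) auto
      then show ?thesis by (simp add: \<rho>_def)
    qed
    have lo: "\<rho> n r = 0" if "r \<le> 1 / real (Suc n)" for n r
    proof -
      have "real (Suc n) * r - 1 \<le> 0" using that by (simp add: field_simps)
      then show ?thesis by (simp add: \<rho>_def)
    qed
    have z: "(LINT x|lebesgue. u x * of_real (\<rho> n (norm (x - x\<^sub>0)))) = 0" for n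
    proof (rule pair[OF _ _ lo hi sub])
      show "continuous_on UNIV (\<rho> n)" unfolding \<rho>_def by (intro continuous_intros)
    qed auto
    have lim: "(\<lambda>n. \<rho> n r) \<longlonglongrightarrow> 1" if r: "0 < r" "r < b" for r
    proof (rule tendsto_eventually)
      obtain N where N: "real N * r > 2" using reals_Archimedean3[OF r(1)] by blast
      obtain M where M: "real M * (b - r) > 1" using reals_Archimedean3[of "b - r"] r(2) by auto
      show "\<forall>\<^sub>F n in sequentially. \<rho> n r = 1"
        unfolding eventually_sequentially
      proof (intro exI[of _ "max N M"] allI impI)
        fix n assume "n \<ge> max N M"
        then have "real N * r \<le> real (Suc n) * r" "real M * (b - r) \<le> real (Suc n) * (b - r)"
          using r by (intro mult_right_mono; simp)+
        then show "\<rho> n r = 1" using N M unfolding \<rho>_def by linarith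
      qed
    qed
    have im: "integrable lebesgue (\<lambda>x. indicat_real (ball x\<^sub>0 b) x *\<^sub>R u x)" by (rule I) auto
    have "(\<lambda>n. LINT x|lebesgue. u x * of_real (\<rho> n (norm (x - x\<^sub>0)))) \<longlonglongrightarrow> (LINT x|lebesgue. indicat_real (ball x\<^sub>0 b) x *\<^sub>R u x)"
    proof (rule integral_dominated_convergence[where w="\<lambda>x. norm (indicat_real (ball x\<^sub>0 b) x *\<^sub>R u x)"])
      show "(\<lambda>x. indicat_real (ball x\<^sub>0 b) x *\<^sub>R u x) \<in> borel_measurable lebesgue" using im by auto
      show "integrable lebesgue (\<lambda>x. norm (indicat_real (ball x\<^sub>0 b) x *\<^sub>R u x))" using im by (rule integrable_norm)
      have out: "\<rho> n (norm (x - x\<^sub>0)) = 0" if "x \<notin> ball x\<^sub>0 b" for n x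
        using that by (intro hi) (simp add: dist_norm norm_minus_commute)
      show "(\<lambda>x. u x * of_real (\<rho> n (norm (x - x\<^sub>0)))) \<in> borel_measurable lebesgue" for n
      proof (rule borel_measurable_integrable[OF loc_int_cc[OF u]])
        show "cc (norm x\<^sub>0 + \<bar>b\<bar>) (\<lambda>x. \<rho> n (norm (x - x\<^sub>0)))"
          unfolding cc_def
        proof (intro conjI allI impI)
          show "continuous_on UNIV (\<lambda>x. \<rho> n (norm (x - x\<^sub>0)))" unfolding \<rho>_def by (intro continuous_intros)
          show "\<rho> n (norm (x - x\<^sub>0)) = 0" if "norm x\<^sub>0 + \<bar>b\<bar> < norm x" for x
            using norm_triangle_sub[of x x\<^sub>0] that by (intro hi) simp
        qed
      qed
      show "AE x in lebesgue. norm (u x * of_real (\<rho> n (norm (x - x\<^sub>0)))) \<le> norm (indicat_real (ball x\<^sub>0 b) x *\<^sub>R u x)" for n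
      proof (rule AE_I2)
        fix x show "norm (u x * of_real (\<rho> n (norm (x - x\<^sub>0)))) \<le> norm (indicat_real (ball x\<^sub>0 b) x *\<^sub>R u x)"
          using out[of x n] \<rho>01[of n "norm (x - x\<^sub>0)"] by (cases "x \<in> ball x\<^sub>0 b") (simp_all add: norm_mult mult_left_le)
      qed
      have "AE x in lebesgue. x \<notin> {x\<^sub>0}" by (intro AE_not_in) (simp flip: negligible_iff_null_sets)
      then show "AE x in lebesgue. (\<lambda>n. u x * of_real (\<rho> n (norm (x - x\<^sub>0)))) \<longlonglongrightarrow> indicat_real (ball x\<^sub>0 b) x *\<^sub>R u x"
      proof eventually_elim
        case (elim x)
        show ?case
        proof (cases "x \<in> ball x\<^sub>0 b")
          case True
          have "(\<lambda>n. u x * of_real (\<rho> n (norm (x - x\<^sub>0)))) \<longlonglongrightarrow> u x * of_real 1"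
            using elim True by (intro tendsto_intros lim) (auto simp: dist_norm norm_minus_commute)
          then show ?thesis using True by simp
        qed (simp add: out)
      qed
    qed
    then show ?thesis using z by (simp add: LIMSEQ_const_iff)
  qed
  have opn: "(LINT x|lebesgue. indicat_real V x *\<^sub>R u x) = 0" if V: "open V" "bounded V" "V \<subseteq> W" for V
  proof -
    \<comment> \<open>Every point of \<open>V\<close> is the centre of arbitrarily small closed
      balls contained in \<open>V\<close>, so these balls form a Vitali cover of
      \<open>V\<close>.\<close>
    let ?K = "{(x, r). cball x r \<subseteq> V}"
    obtain C where C: "countable C" "C \<subseteq> ?K"
      "pairwise (\<lambda>i j. disjnt (ball (fst i) (snd i)) (ball (fst j) (snd j))) C"
      "negligible (V - (\<Union>i\<in>C. ball (fst i) (snd i)))"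
    proof (rule Vitali_covering_theorem_balls[of V ?K fst snd])
      fix x and d :: real assume "x \<in> V" "0 < d"
      then obtain e where e: "e > 0" "cball x e \<subseteq> V" using V(1) open_contains_cball by blast
      then have "cball x (min e (d / 2)) \<subseteq> V" by auto
      then show "\<exists>i. i \<in> ?K \<and> x \<in> ball (fst i) (snd i) \<and> snd i < d"
        using e(1) \<open>0 < d\<close> by (intro exI[of _ "(x, min e (d / 2))"]) auto
    qed blast
    define A where "A n = (if n \<in> to_nat_on C ` C then ball (fst (from_nat_into C n)) (snd (from_nat_into C n)) else {})" for n
    have fni: "from_nat_into C n \<in> C" "to_nat_on C (from_nat_into C n) = n" if "n \<in> to_nat_on C ` C" for n
      using that C(1) by auto
    have UA: "\<Union> (range A) = (\<Union>i\<in>C. ball (fst i) (snd i))"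
    proof
      show "\<Union> (range A) \<subseteq> (\<Union>i\<in>C. ball (fst i) (snd i))" using fni(1) by (auto simp: A_def split: if_splits)
      show "(\<Union>i\<in>C. ball (fst i) (snd i)) \<subseteq> \<Union> (range A)"
      proof
        fix x assume "x \<in> (\<Union>i\<in>C. ball (fst i) (snd i))"
        then obtain i where i: "i \<in> C" "x \<in> ball (fst i) (snd i)" by blast
        then have "x \<in> A (to_nat_on C i)" using C(1) by (simp add: A_def)
        then show "x \<in> \<Union> (range A)" by blast
      qed
    qed
    have UV: "\<Union> (range A) \<subseteq> V"
    proof -
      have "ball (fst i) (snd i) \<subseteq> V" if "i \<in> C" for i
      proof -
        have "cball (fst i) (snd i) \<subseteq> V" using subsetD[OF C(2) that] by (simp add: case_prod_unfold)
        then show ?thesis using ball_subset_cball by blast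
      qed
      then show ?thesis unfolding UA by blast
    qed
    have Ao: "open (A n)" for n by (simp add: A_def)
    have U: "open (\<Union> (range A))" using Ao by blast
    have "(LINT x|lebesgue. indicat_real V x *\<^sub>R u x) = (LINT x|lebesgue. indicat_real (\<Union> (range A)) x *\<^sub>R u x)"
    proof (rule integral_cong_AE)
      show "(\<lambda>x. indicat_real V x *\<^sub>R u x) \<in> borel_measurable lebesgue" using I[OF V(2)] V(1) by auto
      show "(\<lambda>x. indicat_real (\<Union> (range A)) x *\<^sub>R u x) \<in> borel_measurable lebesgue" using I[OF bounded_subset[OF V(2) UV]] U by auto
      have "AE x in lebesgue. x \<notin> V - \<Union> (range A)" using C(4) unfolding UA by (intro AE_not_in) (simp add: negligible_iff_null_sets)
      then show "AE x in lebesgue. indicat_real V x *\<^sub>R u x = indicat_real (\<Union> (range A)) x *\<^sub>R u x"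
        by eventually_elim (use UV in \<open>auto simp: indicator_def\<close>)
    qed
    also have "\<dots> = (LINT x:(\<Union> (range A))|lebesgue. u x)" by (simp add: set_lebesgue_integral_def)
    also have "\<dots> = (\<Sum>n. (LINT x:A n|lebesgue. u x))"
    proof (rule lebesgue_integral_countable_add)
      show "A n \<in> sets lebesgue" for n using Ao by auto
      show "set_integrable lebesgue (\<Union> (range A)) u" unfolding set_integrable_def using I[OF bounded_subset[OF V(2) UV]] U by auto
      show "A i \<inter> A j = {}" if "i \<noteq> j" for i j
      proof (cases "i \<in> to_nat_on C ` C \<and> j \<in> to_nat_on C ` C")
        case True
        then have "from_nat_into C i \<noteq> from_nat_into C j" using fni(2) that by metis
        then show ?thesis using C(3) fni(1) True by (auto simp: A_def pairwise_def disjnt_def)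
      qed (auto simp: A_def)
    qed
    also have "\<dots> = (\<Sum>n::nat. 0)"
    proof (rule suminf_cong)
      fix n
      show "(LINT x:A n|lebesgue. u x) = 0"
    proof (cases "n \<in> to_nat_on C ` C")
      case True
      then have "cball (fst (from_nat_into C n)) (snd (from_nat_into C n)) \<subseteq> W" using subsetD[OF C(2) fni(1)[OF True]] V(3) by (auto simp: case_prod_unfold)
      from ball[OF this] show ?thesis using True by (simp add: A_def set_lebesgue_integral_def)
    qed (simp add: A_def set_lebesgue_integral_def)
    qed
    finally show ?thesis by simp
  qed
  have "AE x in lebesgue. \<forall>N::nat. indicat_real (W \<inter> ball 0 (real N)) x *\<^sub>R u x = 0"
    unfolding AE_all_countable
  proof
    fix N :: nat
    show "AE x in lebesgue. indicat_real (W \<inter> ball 0 (real N)) x *\<^sub>R u x = 0"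
    proof (rule set_integral_open_imp_AE_0)
      show "integrable lebesgue (\<lambda>x. indicat_real (W \<inter> ball 0 (real N)) x *\<^sub>R u x)" using W by (intro I) (auto intro: bounded_subset)
      fix U :: "(real^'n) set" assume U: "open U"
      have "(LINT x|lebesgue. indicat_real U x *\<^sub>R (indicat_real (W \<inter> ball 0 (real N)) x *\<^sub>R u x)) = (LINT x|lebesgue. indicat_real (U \<inter> W \<inter> ball 0 (real N)) x *\<^sub>R u x)"
        by (intro Bochner_Integration.integral_cong) (auto simp: indicator_def)
      also have "\<dots> = 0" using U W by (intro opn) (auto intro: bounded_subset[OF bounded_ball])
      finally show "(LINT x|lebesgue. indicat_real U x *\<^sub>R (indicat_real (W \<inter> ball 0 (real N)) x *\<^sub>R u x)) = 0" .
    qed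
  qed
  then show ?thesis
  proof eventually_elim
    case (elim x)
    obtain N where N: "norm x < real N" using reals_Archimedean2 by blast
    show ?case using elim[rule_format, of N] N by (auto simp: indicator_def split: if_splits)
  qed
qed

theorem (in radiating) vanishes_outside:
  assumes som: "((\<lambda>r. sphere_integral r (\<lambda>x. (cmod (vr x - \<i> * of_real k * v x))\<^sup>2)) \<longlongrightarrow> 0) at_top"
  shows "AE x in lebesgue. x \<in> - closure \<Omega> \<longrightarrow> us x = 0"
proof (rule AE_zero_of_radial_integrals[OF us])
  fix a b :: real and \<rho> :: "real \<Rightarrow> real" and x\<^sub>0 :: "real^'n"
  assume "a > 0" "continuous_on UNIV \<rho>" "\<And>r. r \<le> a \<Longrightarrow> \<rho> r = 0" "\<And>r. r \<ge> b \<Longrightarrow> \<rho> r = 0" "cball x\<^sub>0 b \<subseteq> - closure \<Omega>"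
  then show "(LINT x|lebesgue. us x * of_real (\<rho> (norm (x - x\<^sub>0)))) = 0"
    using closure_subset[of \<Omega>] by (intro exterior_pairing[OF som, of a]) auto
qed (simp add: open_Compl)

section \<open>The transformed medium\<close>

lemma extends_to_closure_continuous: "extends_to_closure S f \<Longrightarrow> continuous_on S f"
  unfolding extends_to_closure_def
  by (metis closure_subset continuous_on_eq continuous_on_subset)

lemma extends_to_closure_bounded:
  assumes "extends_to_closure S f" "bounded S" obtains B where "\<And>x. x \<in> S \<Longrightarrow> norm (f x) \<le> B"
proof -
  obtain g where g: "continuous_on (closure S) g" "\<And>x. x \<in> S \<Longrightarrow> g x = f x"
    using assms(1) unfolding extends_to_closure_def by blast
  have "bounded (g ` closure S)"
    by (rule compact_imp_bounded[OF compact_continuous_image[OF g(1)]]) (simp add: assms(2))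
  then obtain B where B: "\<forall>y\<in>g ` closure S. norm y \<le> B" unfolding bounded_iff by blast
  show ?thesis
  proof (rule that)
    fix x assume x: "x \<in> S"
    then have "g x \<in> g ` closure S" using closure_subset by blast
    then show "norm (f x) \<le> B" using B g(2)[OF x] by auto
  qed
qed

lemma Ck_extends_imp_Ck_on: "Ck_extends m S f \<Longrightarrow> Ck_on m S f"
  by (induction m arbitrary: f) (auto intro: extends_to_closure_continuous)

lemma Ck_closure_2:
  fixes f :: "real^'n \<Rightarrow> real^'n"
  assumes f: "Ck_closure 2 S f" and S: "open S" "bounded S"
  defines "d \<equiv> \<lambda>a b x. frechet_derivative f (at x) (axis b 1) $ a"
  shows "c1 S (\<lambda>x. f x $ a) (d a)"
    and "\<exists>d2. \<forall>a b. c1 S (d a b) (d2 a b)"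
    and "\<exists>L. \<forall>a b. \<forall>x\<in>S. \<bar>d a b x\<bar> \<le> L"
    and "x \<in> S \<Longrightarrow> (f has_derivative (\<lambda>h. jacobian f (at x) *v h)) (at x)"
    and "jacobian f (at x) $ a $ b = d a b x"
    and "continuous_on (closure S) f"
proof -
  have e: "Ck_extends (Suc (Suc 0)) S f" and cl: "continuous_on (closure S) f"
    using f by (simp_all only: Ck_closure_def numeral_2_eq_2)
  show "continuous_on (closure S) f" by (rule cl)
  note k = Ck_on_Suc_c1[OF Ck_extends_imp_Ck_on[OF e] S(1)]
  show "c1 S (\<lambda>x. f x $ a) (d a)" for a
    unfolding d_def by (rule c1_bounded_linear[OF bounded_linear_vec_nth k(1)])
  have "c1 S (d a b) (\<lambda>c x. frechet_derivative (\<lambda>x. frechet_derivative f (at x) (axis b 1)) (at x) (axis c 1) $ a)" for a b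
    unfolding d_def by (rule c1_bounded_linear[OF bounded_linear_vec_nth Ck_on_Suc_c1(1)[OF k(2) S(1)]])
  then show "\<exists>d2. \<forall>a b. c1 S (d a b) (d2 a b)"
    by (intro exI[of _ "\<lambda>a b c x. frechet_derivative (\<lambda>x. frechet_derivative f (at x) (axis b 1)) (at x) (axis c 1) $ a"]) simp
  have "\<exists>B. \<forall>x\<in>S. norm (frechet_derivative f (at x) (axis b 1)) \<le> B" for b :: 'n
  proof -
    have "extends_to_closure S (\<lambda>x. frechet_derivative f (at x) (axis b 1))"
      using e Basis_axis[of "axis b 1"] by auto
    then show ?thesis by (rule extends_to_closure_bounded[OF _ S(2)]) blast
  qed
  then obtain B where B: "\<And>b x. x \<in> S \<Longrightarrow> norm (frechet_derivative f (at x) (axis b 1)) \<le> B b" by metis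
  show "\<exists>L. \<forall>a b. \<forall>x\<in>S. \<bar>d a b x\<bar> \<le> L"
  proof (intro exI[of _ "Max (range B)"] allI ballI)
    fix a b x assume x: "x \<in> S"
    have "\<bar>d a b x\<bar> \<le> norm (frechet_derivative f (at x) (axis b 1))" unfolding d_def by (rule component_le_norm_cart)
    also have "\<dots> \<le> B b" by (rule B[OF x])
    also have "\<dots> \<le> Max (range B)" by (intro Max_ge) auto
    finally show "\<bar>d a b x\<bar> \<le> Max (range B)" .
  qed
  show "(f has_derivative (\<lambda>h. jacobian f (at x) *v h)) (at x)" if x: "x \<in> S"
  proof -
    have "f differentiable (at x)" using c1_derivative[OF k(1) x] unfolding differentiable_def by blast
    then show ?thesis using jacobian_works by blast
  qed
  show "jacobian f (at x) $ a $ b = d a b x" by (simp add: jacobian_def matrix_def d_def)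
qed

locale transformation =
  fixes \<Omega> :: "(real^'n) set" and \<Psi> :: "real^'n \<Rightarrow> real^'n"
  assumes domain: "bounded_lipschitz_domain \<Omega>" and diffeo: "Ck_closure_diffeomorphism 2 \<Omega> \<Psi>"
    and boundary: "\<And>x. x \<in> frontier \<Omega> \<Longrightarrow> \<Psi> x = x"
begin

definition \<Phi> where "\<Phi> = inv_into (closure \<Omega>) \<Psi>"
definition \<theta> where "\<theta> x = (if x \<in> \<Omega> then \<Phi> x else x)"
definition D where "D a b x = frechet_derivative \<Phi> (at x) (axis b 1) $ a"
definition P where "P a b x = frechet_derivative \<Psi> (at x) (axis b 1) $ a"
abbreviation J where "J x \<equiv> jacobian \<Psi> (at (\<Phi> x))"
abbreviation K where "K x \<equiv> jacobian \<Phi> (at x)"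

lemma dom: "open \<Omega>" "connected \<Omega>" "\<Omega> \<noteq> {}" "bounded \<Omega>" "lipschitz_boundary \<Omega>"
  using domain by (auto simp: bounded_lipschitz_domain_def domain_set_def)

lemma bij: "bij_betw \<Psi> (closure \<Omega>) (closure \<Omega>)"
  using diffeo by (simp add: Ck_closure_diffeomorphism_def)

lemma \<Psi>_class: "Ck_closure 2 \<Omega> \<Psi>" and \<Phi>_class: "Ck_closure 2 \<Omega> \<Phi>"
  using diffeo by (simp_all add: Ck_closure_diffeomorphism_def \<Phi>_def)

lemma frontier_dom: "frontier \<Omega> = closure \<Omega> - \<Omega>" using dom(1) by (simp add: frontier_def interior_open)

lemma \<Phi>_closure: "x \<in> closure \<Omega> \<Longrightarrow> \<Phi> x \<in> closure \<Omega>" and \<Psi>_\<Phi>: "x \<in> closure \<Omega> \<Longrightarrow> \<Psi> (\<Phi> x) = x"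
  unfolding \<Phi>_def using bij by (auto simp: bij_betw_def inv_into_into f_inv_into_f)

lemma \<Phi>_frontier: assumes x: "x \<in> frontier \<Omega>" shows "\<Phi> x = x"
proof -
  have "\<Phi> (\<Psi> x) = x" unfolding \<Phi>_def by (rule bij_betw_inv_into_left[OF bij]) (use x frontier_dom in auto)
  then show ?thesis using boundary[OF x] by simp
qed

text \<open>\<Psi> fixes the frontier pointwise, so a preimage on the frontier would put
  \<open>x\<close> itself on the frontier, which the open set \<Omega> does not meet.\<close>

lemma \<Phi>_dom: assumes x: "x \<in> \<Omega>" shows "\<Phi> x \<in> \<Omega>"
proof (rule ccontr)
  have xc: "x \<in> closure \<Omega>" using x closure_subset by blast
  assume "\<Phi> x \<notin> \<Omega>"
  then have "\<Phi> x \<in> frontier \<Omega>" using \<Phi>_closure[OF xc] frontier_dom by blast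
  then have "x \<in> frontier \<Omega>" using boundary[of "\<Phi> x"] \<Psi>_\<Phi>[OF xc] by simp
  then show False using x frontier_dom by blast
qed

lemma \<theta>_dom: "x \<in> \<Omega> \<Longrightarrow> \<theta> x \<in> \<Omega>" using \<Phi>_dom by (simp add: \<theta>_def)

lemma \<theta>_out: "x \<notin> \<Omega> \<Longrightarrow> \<theta> x = x" by (simp add: \<theta>_def)

text \<open>The inverse and the identity agree on the frontier, and the closure of \<Omega> and the
  complement of \<Omega> are closed sets that cover the space.\<close>

lemma \<theta>_continuous: "continuous_on UNIV \<theta>"
proof -
  have "continuous_on (closure \<Omega>) \<theta>"
  proof (rule continuous_on_eq[OF Ck_closure_2(6)[OF \<Phi>_class dom(1,4)]])
    fix x assume "x \<in> closure \<Omega>"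
    then show "\<Phi> x = \<theta> x" using \<Phi>_frontier[of x] frontier_dom by (cases "x \<in> \<Omega>") (auto simp: \<theta>_def)
  qed
  moreover have "continuous_on (- \<Omega>) \<theta>"
    by (rule continuous_on_eq[OF continuous_on_id]) (simp add: \<theta>_def)
  moreover have "closed (- \<Omega>)" using dom(1) by (simp add: closed_Compl)
  ultimately have c: "continuous_on (closure \<Omega> \<union> - \<Omega>) \<theta>" by (intro continuous_on_closed_Un) auto
  have U: "closure \<Omega> \<union> - \<Omega> = UNIV" using closure_subset by blast
  show ?thesis using c unfolding U .
qed

lemma J_entry: "J x $ a $ b = P a b (\<Phi> x)" and K_entry: "K x $ a $ b = D a b x"
  using Ck_closure_2(5)[OF \<Psi>_class dom(1,4)] Ck_closure_2(5)[OF \<Phi>_class dom(1,4)] by (simp_all add: P_def D_def)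

lemma J_K: assumes x: "x \<in> \<Omega>" shows "J x ** K x = mat 1" "K x ** J x = mat 1"
proof -
  have "(\<Psi> \<circ> \<Phi> has_derivative (\<lambda>h. J x *v (K x *v h))) (at x)"
    using diff_chain_at[OF Ck_closure_2(4)[OF \<Phi>_class dom(1,4) x] Ck_closure_2(4)[OF \<Psi>_class dom(1,4) \<Phi>_dom[OF x]]]
    by (simp add: o_def)
  moreover have "(\<Psi> \<circ> \<Phi> has_derivative (\<lambda>h. h)) (at x)"
    by (rule has_derivative_transform_within_open[OF has_derivative_ident dom(1) x])
      (use \<Psi>_\<Phi> closure_subset in force)
  ultimately have "(\<lambda>h. J x *v (K x *v h)) = (\<lambda>h. h)" by (rule has_derivative_unique)
  then have "(J x ** K x) *v h = mat 1 *v h" for h by (metis matrix_vector_mul_assoc matrix_vector_mul_lid)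
  then show "J x ** K x = mat 1" unfolding matrix_eq by blast
  then show "K x ** J x = mat 1" by (simp only: matrix_left_right_inverse)
qed

lemma det_J_K: assumes x: "x \<in> \<Omega>" shows "det (J x) * det (K x) = 1"
  using J_K(1)[OF x] by (metis det_I det_mul)

lemma det_D: "det (\<chi> a b. D b a x) = det (K x)"
proof -
  have "(\<chi> a b. D b a x) = transpose (K x)" by (simp add: vec_eq_iff transpose_def K_entry)
  then show ?thesis by (simp add: det_transpose)
qed

definition D2 where "D2 = (SOME d2. \<forall>a b. c1 \<Omega> (D a b) (d2 a b))"
definition L where "L = (SOME L. \<forall>a b. \<forall>x\<in>\<Omega>. \<bar>D a b x\<bar> \<le> L)"

lemma D_c1: "c1 \<Omega> (\<lambda>x. \<theta> x $ a) (D a)"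
  using Ck_closure_2(1)[OF \<Phi>_class dom(1,4)] unfolding D_def[abs_def]
  by (rule c1_eqI[OF _ dom(1)]) (auto simp: \<theta>_def)

lemma D2_c1: "c1 \<Omega> (D a b) (D2 a b)"
  unfolding D2_def using someI_ex[OF Ck_closure_2(2)[OF \<Phi>_class dom(1,4), folded D_def]] by blast

lemma L_bound: "x \<in> \<Omega> \<Longrightarrow> \<bar>D a b x\<bar> \<le> L"
  unfolding L_def using someI_ex[OF Ck_closure_2(3)[OF \<Phi>_class dom(1,4), folded D_def]] by blast

lemma P_bound: obtains B where "B \<ge> 0" "\<And>x a b. x \<in> \<Omega> \<Longrightarrow> \<bar>P a b x\<bar> \<le> B"
proof -
  obtain B where "\<forall>a b. \<forall>x\<in>\<Omega>. \<bar>P a b x\<bar> \<le> B" using Ck_closure_2(3)[OF \<Psi>_class dom(1,4), folded P_def] by blast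
  then show ?thesis by (intro that[of "max 0 B"]) (auto simp: le_max_iff_disj)
qed

lemma P_continuous: "continuous_on \<Omega> (P a b)"
  using c1_continuous_partial[OF Ck_closure_2(1)[OF \<Psi>_class dom(1,4)]] by (simp add: P_def[abs_def])

lemma \<Phi>_continuous: "continuous_on \<Omega> \<Phi>"
  by (rule continuous_on_subset[OF Ck_closure_2(6)[OF \<Phi>_class dom(1,4)] closure_subset])

lemma inner_change: "\<Omega> \<subseteq> cball 0 R\<^sub>0 \<Longrightarrow> R\<^sub>0 > 0 \<Longrightarrow> inner_change \<Omega> \<theta> D D2 L R\<^sub>0"
proof
  show "det (\<chi> a b. D b a x) \<noteq> 0" if "x \<in> \<Omega>" for x using det_J_K[OF that] unfolding det_D by auto
qed (use dom \<theta>_continuous \<theta>_out D_c1 D2_c1 L_bound in auto)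

abbreviation A where "A \<equiv> transformed_A \<Psi> \<Omega>"
abbreviation q where "q \<equiv> transformed_q \<Psi> \<Omega>"

lemma q_in: assumes x: "x \<in> \<Omega>" shows "q x = 1 / \<bar>det (J x)\<bar>" "q x = \<bar>det (K x)\<bar>" "q x > 0"
proof -
  have d: "\<bar>det (J x)\<bar> * \<bar>det (K x)\<bar> = 1" using det_J_K[OF x] by (simp flip: abs_mult)
  then have n: "\<bar>det (J x)\<bar> \<noteq> 0" by auto
  show e: "q x = 1 / \<bar>det (J x)\<bar>" using x by (simp add: transformed_q_def \<Phi>_def)
  show "q x = \<bar>det (K x)\<bar>" unfolding e using d n by (metis nonzero_mult_div_cancel_left)
  show "q x > 0" unfolding e using n by simp
qed

lemma A_in: "x \<in> \<Omega> \<Longrightarrow> A x = q x *\<^sub>R (J x ** transpose (J x))"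
  using q_in(1)[of x] by (simp add: transformed_A_def Let_def \<Phi>_def)

lemma A_entry: "x \<in> \<Omega> \<Longrightarrow> A x $ i $ j = q x * (\<Sum>l\<in>UNIV. P i l (\<Phi> x) * P j l (\<Phi> x))"
  by (simp add: A_in matrix_matrix_mult_def transpose_def J_entry)

lemma A_out: "x \<notin> \<Omega> \<Longrightarrow> A x = mat 1" and q_out: "x \<notin> \<Omega> \<Longrightarrow> q x = 1"
  by (simp_all add: transformed_A_def transformed_q_def)

lemma q_continuous: "continuous_on \<Omega> q"
proof -
  have "continuous_on \<Omega> (\<lambda>x. \<bar>det (\<chi> a b. D b a x)\<bar>)"
    unfolding det_def by (simp, intro continuous_intros c1_continuous_partial[OF D_c1])
  then show ?thesis by (rule continuous_on_eq) (simp add: q_in(2) det_D)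
qed

lemma A_entry_continuous: "continuous_on \<Omega> (\<lambda>x. A x $ i $ j)"
proof -
  have "continuous_on \<Omega> (\<lambda>x. q x * (\<Sum>l\<in>UNIV. P i l (\<Phi> x) * P j l (\<Phi> x)))"
    by (intro continuous_intros q_continuous continuous_on_compose2[OF P_continuous \<Phi>_continuous]) (use \<Phi>_dom in auto)
  then show ?thesis by (rule continuous_on_eq) (simp add: A_entry)
qed

text \<open>Both formulas for \<open>q\<close> are used: 1 / |det J| with bounded entries of J gives
  the lower bound, |det K| with bounded entries of K the upper one. The derivatives of \<Psi> and of
  its inverse are bounded because they extend continuously to the compact closure.\<close>

lemma q_bounds: obtains c C where "c > 0" "\<And>x. x \<in> \<Omega> \<Longrightarrow> c \<le> q x" "\<And>x. x \<in> \<Omega> \<Longrightarrow> q x \<le> C"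
proof -
  obtain B where B: "B \<ge> 0" "\<And>x a b. x \<in> \<Omega> \<Longrightarrow> \<bar>P a b x\<bar> \<le> B" by (rule P_bound) blast
  obtain C where C: "C \<ge> 0" "\<And>M::real^'n^'n. (\<And>a b. \<bar>M$a$b\<bar> \<le> B) \<Longrightarrow> \<bar>det M\<bar> \<le> C" by (rule det_bound[of B]) blast
  obtain C' where C': "C' \<ge> 0" "\<And>M::real^'n^'n. (\<And>a b. \<bar>M$a$b\<bar> \<le> L) \<Longrightarrow> \<bar>det M\<bar> \<le> C'" by (rule det_bound[of L]) blast
  show ?thesis
  proof (rule that[of "1 / (C + 1)" C'])
    fix x assume x: "x \<in> \<Omega>"
    have d: "\<bar>det (J x)\<bar> \<le> C + 1" using C(2)[of "J x"] B(2)[OF \<Phi>_dom[OF x]] by (simp add: J_entry add_increasing2)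
    have "\<bar>det (J x)\<bar> > 0" using det_J_K[OF x] by auto
    then show "1 / (C + 1) \<le> q x" unfolding q_in(1)[OF x] using d by (intro divide_left_mono) auto
    show "q x \<le> C'" unfolding q_in(2)[OF x] using C'(2)[of "K x"] L_bound[OF x] by (simp add: K_entry)
  qed (use C(1) in auto)
qed

lemma A_bound: obtains B where "\<And>i j x. \<bar>A x $ i $ j\<bar> \<le> B"
proof -
  obtain B where B: "B \<ge> 0" "\<And>x a b. x \<in> \<Omega> \<Longrightarrow> \<bar>P a b x\<bar> \<le> B" by (rule P_bound) blast
  obtain c C where C: "c > 0" "\<And>x. x \<in> \<Omega> \<Longrightarrow> c \<le> q x" "\<And>x. x \<in> \<Omega> \<Longrightarrow> q x \<le> C" by (rule q_bounds) blast
  show ?thesis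
  proof (rule that[of "max 1 (C * (\<Sum>l\<in>(UNIV::'n set). B * B))"])
    fix i j x
    show "\<bar>A x $ i $ j\<bar> \<le> max 1 (C * (\<Sum>l\<in>(UNIV::'n set). B * B))"
    proof (cases "x \<in> \<Omega>")
      case True
      have "\<bar>\<Sum>l\<in>UNIV. P i l (\<Phi> x) * P j l (\<Phi> x)\<bar> \<le> (\<Sum>l\<in>(UNIV::'n set). B * B)"
        unfolding abs_mult using B \<Phi>_dom[OF True] by (intro order_trans[OF sum_abs] sum_mono) (auto simp: abs_mult intro!: mult_mono)
      then have "q x * \<bar>\<Sum>l\<in>UNIV. P i l (\<Phi> x) * P j l (\<Phi> x)\<bar> \<le> C * (\<Sum>l\<in>(UNIV::'n set). B * B)"
        using q_in(3)[OF True] C(3)[OF True] by (intro mult_mono) auto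
      then show ?thesis using q_in(3)[OF True] by (simp add: A_entry[OF True] abs_mult)
    qed (auto simp: A_out mat_def intro: max.coboundedI1)
  qed
qed

lemma A_entry_measurable: "(\<lambda>x. A x $ i $ j) \<in> borel_measurable borel"
proof -
  have "(\<lambda>x. if x \<in> \<Omega> then A x $ i $ j else mat 1 $ i $ j) \<in> borel_measurable borel"
    by (rule borel_measurable_continuous_on_if) (use dom(1) A_entry_continuous in auto)
  also have "(\<lambda>x. if x \<in> \<Omega> then A x $ i $ j else mat 1 $ i $ j) = (\<lambda>x. A x $ i $ j)"
    using A_out by (intro ext) simp
  finally show ?thesis .
qed

lemma A_symmetric: "A x $ i $ j = A x $ j $ i"
proof -
  have "A x $ i $ j = transpose (A x) $ i $ j" by (simp only: transformed_A_symmetric)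
  then show ?thesis by (simp add: transpose_def)
qed

lemma Linfty_A: "Linfty_on \<Omega> A"
proof -
  obtain B where B: "\<And>i j x. \<bar>A x $ i $ j\<bar> \<le> B" by (rule A_bound) blast
  have c: "continuous_on \<Omega> A"
  proof -
    have "continuous_on \<Omega> (\<lambda>x. \<chi> i j. A x $ i $ j)" by (intro continuous_on_vec_lambda A_entry_continuous)
    then show ?thesis by simp
  qed
  have m: "A \<in> borel_measurable (lebesgue_on \<Omega>)"
    by (rule continuous_imp_measurable_on_sets_lebesgue[OF c]) (use dom(1) in auto)
  have "norm (A x) \<le> (\<Sum>i\<in>(UNIV::'n set). \<Sum>j\<in>(UNIV::'n set). B)" for x :: "real^'n"
  proof -
    have "norm (A x) \<le> (\<Sum>i\<in>UNIV. norm (A x $ i))" unfolding norm_vec_def by (rule L2_set_le_sum) simp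
    also have "\<dots> \<le> (\<Sum>i\<in>UNIV. \<Sum>j\<in>UNIV. \<bar>A x $ i $ j\<bar>)" by (intro sum_mono norm_le_l1_cart)
    also have "\<dots> \<le> (\<Sum>i\<in>(UNIV::'n set). \<Sum>j\<in>(UNIV::'n set). B)" by (intro sum_mono B)
    finally show ?thesis .
  qed
  then have "esssup (lebesgue_on \<Omega>) (\<lambda>x. ereal (norm (A x))) \<le> ereal (\<Sum>i\<in>(UNIV::'n set). \<Sum>j\<in>(UNIV::'n set). B)"
    using m by (intro esssup_I) auto
  then have "esssup (lebesgue_on \<Omega>) (\<lambda>x. ereal (norm (A x))) < \<infinity>" by (rule le_less_trans) simp
  then show ?thesis unfolding Linfty_on_def using m by blast
qed

lemma q_measurable: "q \<in> borel_measurable (lebesgue_on \<Omega>)"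
  by (rule continuous_imp_measurable_on_sets_lebesgue[OF q_continuous]) (use dom(1) in auto)

lemma Linfty_q: "Linfty_on \<Omega> q"
proof -
  obtain c C where C: "c > 0" "\<And>x. x \<in> \<Omega> \<Longrightarrow> c \<le> q x" "\<And>x. x \<in> \<Omega> \<Longrightarrow> q x \<le> C" by (rule q_bounds) blast
  have "esssup (lebesgue_on \<Omega>) (\<lambda>x. ereal (norm (q x))) \<le> ereal C"
    using q_measurable C(3) q_in(3) by (intro esssup_I AE_I2) (auto simp: abs_of_pos)
  then have "esssup (lebesgue_on \<Omega>) (\<lambda>x. ereal (norm (q x))) < \<infinity>" by (rule le_less_trans) simp
  then show ?thesis unfolding Linfty_on_def using q_measurable by blast
qed

end

text \<open>A pointwise lower bound alone would not do: \<open>esssup\<close> of a non-measurable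
  function is \<open>top\<close>, which would make \<open>essinf\<close> equal to minus
  infinity.\<close>

lemma essinf_lower:
  assumes "f \<in> borel_measurable M" "\<And>x. x \<in> space M \<Longrightarrow> ereal c \<le> f x" "c > 0"
  shows "essinf M f > 0"
proof -
  have "esssup M (\<lambda>x. - f x) \<le> - ereal c"
  proof (intro esssup_I AE_I2)
    show "- f x \<le> - ereal c" if "x \<in> space M" for x unfolding ereal_minus_le_minus by (rule assms(2)[OF that])
  qed (use assms(1) in measurable)
  then have "- (- ereal c) \<le> essinf M f" unfolding essinf_def ereal_minus_le_minus .
  then have "ereal c \<le> essinf M f" by simp
  then show ?thesis using assms(3) by (simp add: less_le_trans[of 0 "ereal c"])
qed

context transformation
begin

lemma essinf_q: "essinf (lebesgue_on \<Omega>) (\<lambda>x. ereal (q x)) > 0"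
proof -
  obtain c C where C: "c > 0" "\<And>x. x \<in> \<Omega> \<Longrightarrow> c \<le> q x" "\<And>x. x \<in> \<Omega> \<Longrightarrow> q x \<le> C" by (rule q_bounds) blast
  show ?thesis by (rule essinf_lower[of _ _ c]) (use q_measurable C in auto)
qed

text \<open>Since A = q J J^T with real J, the form is q times the squared norm of J^T
  \<xi>.\<close>

lemma A_form:
  assumes x: "x \<in> \<Omega>"
  shows "Re (cdot \<xi> (cmat (A x) *v cconj \<xi>)) = q x * (\<Sum>l\<in>UNIV. (cmod (\<Sum>i\<in>UNIV. of_real (J x $ i $ l) * \<xi> $ i))\<^sup>2)"
proof -
  define \<eta> where "\<eta> l = (\<Sum>i\<in>UNIV. of_real (J x $ i $ l) * \<xi> $ i)" for l
  have "cdot \<xi> (cmat (A x) *v cconj \<xi>) = (\<Sum>i\<in>UNIV. \<Sum>j\<in>UNIV. \<Sum>l\<in>UNIV. of_real (q x) * (of_real (J x $ i $ l) * \<xi> $ i) * (of_real (J x $ j $ l) * cnj (\<xi> $ j)))"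
    by (simp add: cdot_def cmat_def cconj_def matrix_vector_mult_def sum_distrib_left sum_distrib_right map_matrix_def
        A_entry[OF x] J_entry mult_ac)
  also have "\<dots> = (\<Sum>l\<in>UNIV. \<Sum>i\<in>UNIV. \<Sum>j\<in>UNIV. of_real (q x) * (of_real (J x $ i $ l) * \<xi> $ i) * (of_real (J x $ j $ l) * cnj (\<xi> $ j)))"
  proof -
    have "(\<Sum>i\<in>UNIV. \<Sum>j\<in>UNIV. \<Sum>l\<in>UNIV. f i j l) = (\<Sum>l\<in>UNIV. \<Sum>i\<in>UNIV. \<Sum>j\<in>UNIV. f i j l)"
      for f :: "'n \<Rightarrow> 'n \<Rightarrow> 'n \<Rightarrow> complex"
    proof -
      have "(\<Sum>i\<in>UNIV. \<Sum>j\<in>UNIV. \<Sum>l\<in>UNIV. f i j l) = (\<Sum>i\<in>UNIV. \<Sum>l\<in>UNIV. \<Sum>j\<in>UNIV. f i j l)"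
        by (intro sum.cong refl sum.swap)
      also have "\<dots> = (\<Sum>l\<in>UNIV. \<Sum>i\<in>UNIV. \<Sum>j\<in>UNIV. f i j l)" by (rule sum.swap)
      finally show ?thesis .
    qed
    then show ?thesis .
  qed
  also have "\<dots> = (\<Sum>l\<in>UNIV. of_real (q x) * (\<eta> l * cnj (\<eta> l)))"
  proof (rule sum.cong[OF refl])
    fix l
    have "\<eta> l * cnj (\<eta> l) = (\<Sum>i\<in>UNIV. \<Sum>j\<in>UNIV. (of_real (J x $ i $ l) * \<xi> $ i) * (of_real (J x $ j $ l) * cnj (\<xi> $ j)))"
      by (simp only: \<eta>_def cnj_sum sum_product complex_cnj_mult complex_cnj_complex_of_real)
    then show "(\<Sum>i\<in>UNIV. \<Sum>j\<in>UNIV. of_real (q x) * (of_real (J x $ i $ l) * \<xi> $ i) * (of_real (J x $ j $ l) * cnj (\<xi> $ j))) = of_real (q x) * (\<eta> l * cnj (\<eta> l))"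
      by (simp only: sum_distrib_left mult.assoc)
  qed
  also have "\<dots> = of_real (q x * (\<Sum>l\<in>UNIV. (cmod (\<eta> l))\<^sup>2))"
    by (simp only: of_real_mult of_real_sum complex_norm_square sum_distrib_left)
  finally show ?thesis unfolding \<eta>_def by simp
qed

text \<open>The vector \<xi> is recovered from \<eta> = J^T \<xi> through the transpose of the
  inverse Jacobian K, whose entries are bounded by \<open>L\<close>; hence \<eta> cannot be small
  when \<xi> has norm 1.\<close>

lemma A_form_lower:
  obtains c where "c > 0" "\<And>x \<xi>. x \<in> \<Omega> \<Longrightarrow> norm \<xi> = 1 \<Longrightarrow> c \<le> Re (cdot \<xi> (cmat (A x) *v cconj \<xi>))"
proof -
  obtain c C where C: "c > 0" "\<And>x. x \<in> \<Omega> \<Longrightarrow> c \<le> q x" "\<And>x. x \<in> \<Omega> \<Longrightarrow> q x \<le> C" by (rule q_bounds) blast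
  define N where "N = real CARD('n) * \<bar>L\<bar>"
  have N0: "N \<ge> 0" by (simp add: N_def)
  define M where "M = N + 1"
  have M0: "M > 0" using N0 by (simp add: M_def add_nonneg_pos)
  show ?thesis
  proof (rule that[of "c * (1 / (real CARD('n) * M))\<^sup>2"])
    show "c * (1 / (real CARD('n) * M))\<^sup>2 > 0" using C(1) M0 by simp
    fix x and \<xi> :: "complex^'n" assume x: "x \<in> \<Omega>" and \<xi>: "norm \<xi> = 1"
    define \<eta> where "\<eta> l = (\<Sum>i\<in>UNIV. of_real (J x $ i $ l) * \<xi> $ i)" for l
    have inv: "\<xi> $ i = (\<Sum>l\<in>UNIV. of_real (K x $ l $ i) * \<eta> l)" for i
    proof -
      have "(\<Sum>l\<in>UNIV. of_real (K x $ l $ i) * \<eta> l) = (\<Sum>j\<in>UNIV. of_real (\<Sum>l\<in>UNIV. J x $ j $ l * K x $ l $ i) * \<xi> $ j)"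
        unfolding \<eta>_def sum_distrib_left by (subst sum.swap) (simp add: sum_distrib_left mult_ac)
      also have "\<dots> = (\<Sum>j\<in>UNIV. of_real ((J x ** K x) $ j $ i) * \<xi> $ j)" by (simp add: matrix_matrix_mult_def)
      also have "\<dots> = (\<Sum>j\<in>UNIV. if j = i then \<xi> $ j else 0)"
        unfolding J_K(1)[OF x] by (intro sum.cong) (auto simp: mat_def)
      finally show ?thesis by simp
    qed
    define s where "s = (\<Sum>l\<in>UNIV. cmod (\<eta> l))"
    have s0: "s \<ge> 0" by (simp add: s_def sum_nonneg)
    have "1 \<le> (\<Sum>i\<in>UNIV. cmod (\<xi> $ i))"
    proof -
      have "norm \<xi> \<le> (\<Sum>i\<in>UNIV. cmod (\<xi> $ i))" unfolding norm_vec_def by (rule L2_set_le_sum) simp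
      then show ?thesis using \<xi> by simp
    qed
    also have "\<dots> \<le> (\<Sum>i\<in>(UNIV::'n set). \<bar>L\<bar> * s)"
    proof (rule sum_mono)
      fix i
      have "cmod (\<xi> $ i) \<le> (\<Sum>l\<in>UNIV. cmod (of_real (K x $ l $ i) * \<eta> l))" unfolding inv[of i] by (rule norm_sum)
      also have "\<dots> \<le> (\<Sum>l\<in>UNIV. \<bar>L\<bar> * cmod (\<eta> l))"
        using L_bound[OF x] by (intro sum_mono) (auto simp: norm_mult K_entry intro!: mult_right_mono intro: order_trans[OF _ abs_ge_self])
      finally show "cmod (\<xi> $ i) \<le> \<bar>L\<bar> * s" by (simp add: s_def sum_distrib_left)
    qed
    also have "\<dots> = N * s" by (simp add: N_def)
    also have "\<dots> \<le> M * s" using s0 N0 unfolding M_def by (intro mult_right_mono) auto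
    finally have s1: "1 / M \<le> s" using M0 by (simp add: field_simps)
    \<comment> \<open>Some summand is at least the mean, which converts the bound on the sum of
      moduli into one on the sum of squares.\<close>
    have "\<exists>l. s / real CARD('n) \<le> cmod (\<eta> l)"
    proof (rule ccontr)
      assume "\<not> ?thesis"
      then have "(\<Sum>l\<in>UNIV. cmod (\<eta> l)) < (\<Sum>l\<in>(UNIV::'n set). s / real CARD('n))" by (intro sum_strict_mono) (auto simp: not_le)
      then show False by (simp add: s_def)
    qed
    then obtain l where l: "s / real CARD('n) \<le> cmod (\<eta> l)" by blast
    have "1 / (real CARD('n) * M) = (1 / M) / real CARD('n)" by simp
    also have "\<dots> \<le> s / real CARD('n)" by (rule divide_right_mono[OF s1]) simp
    finally have "1 / (real CARD('n) * M) \<le> cmod (\<eta> l)" using l by linarith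
    then have "(1 / (real CARD('n) * M))\<^sup>2 \<le> (cmod (\<eta> l))\<^sup>2" using M0 by (intro power_mono) auto
    also have "\<dots> \<le> (\<Sum>l\<in>UNIV. (cmod (\<eta> l))\<^sup>2)" by (rule member_le_sum) auto
    finally have "c * (1 / (real CARD('n) * M))\<^sup>2 \<le> q x * (\<Sum>l\<in>UNIV. (cmod (\<eta> l))\<^sup>2)"
      using C(1,2) x q_in(3)[OF x] by (intro mult_mono) auto
    then show "c * (1 / (real CARD('n) * M))\<^sup>2 \<le> Re (cdot \<xi> (cmat (A x) *v cconj \<xi>))"
      unfolding A_form[OF x] \<eta>_def .
  qed
qed

lemma essinf_A:
  "essinf (lebesgue_on \<Omega>) (\<lambda>x. INF \<xi>\<in>{\<xi>::complex^'n. norm \<xi> = 1}. ereal (Re (cdot \<xi> (cmat (A x) *v cconj \<xi>)))) > 0"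
proof -
  obtain c where c: "c > 0" "\<And>x \<xi>. x \<in> \<Omega> \<Longrightarrow> norm \<xi> = 1 \<Longrightarrow> c \<le> Re (cdot \<xi> (cmat (A x) *v cconj \<xi>))"
    by (rule A_form_lower) blast
  let ?S = "{\<xi>::complex^'n. norm \<xi> = 1}"
  let ?g = "\<lambda>\<xi> x. Re (cdot \<xi> (cmat (A x) *v cconj \<xi>))"
  have cont: "continuous_on \<Omega> (?g \<xi>)" for \<xi>
  proof -
    have "continuous_on \<Omega> (\<lambda>x. Re (\<Sum>i\<in>UNIV. \<xi> $ i * (\<Sum>j\<in>UNIV. of_real (A x $ i $ j) * cnj (\<xi> $ j))))"
      by (intro continuous_intros A_entry_continuous)
    then show ?thesis by (simp only: cdot_def cmat_def cconj_def matrix_vector_mult_def map_matrix_def vec_lambda_beta)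
  qed
  show ?thesis
  proof (rule essinf_lower[of _ _ c])
    show "(\<lambda>x. INF \<xi>\<in>?S. ereal (?g \<xi> x)) \<in> borel_measurable (lebesgue_on \<Omega>)"
    \<comment> \<open>The infimum runs over an uncountable family, so measurability is obtained
      topologically: each strict sublevel set is a union of open sets.\<close>
    proof (rule borel_measurableI_less)
      fix y :: ereal
      have "{x \<in> space (lebesgue_on \<Omega>). (INF \<xi>\<in>?S. ereal (?g \<xi> x)) < y} = (\<Union>\<xi>\<in>?S. {x\<in>\<Omega>. ereal (?g \<xi> x) < y})"
        by (auto simp: INF_less_iff)
      moreover have "open {x\<in>\<Omega>. ereal (?g \<xi> x) < y}" for \<xi>
      proof -
        have "continuous_on \<Omega> (\<lambda>x. ereal (?g \<xi> x))" by (rule continuous_on_compose2[OF continuous_on_ereal[OF continuous_on_id] cont]) auto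
        then have "open ((\<lambda>x. ereal (?g \<xi> x)) -` {..<y} \<inter> \<Omega>)"
          using dom(1) continuous_on_open_vimage[of \<Omega>] by (metis open_lessThan)
        moreover have "(\<lambda>x. ereal (?g \<xi> x)) -` {..<y} \<inter> \<Omega> = {x\<in>\<Omega>. ereal (?g \<xi> x) < y}" by auto
        ultimately show ?thesis by simp
      qed
      ultimately have o: "open {x \<in> space (lebesgue_on \<Omega>). (INF \<xi>\<in>?S. ereal (?g \<xi> x)) < y}" by auto
      have s: "{x \<in> space (lebesgue_on \<Omega>). (INF \<xi>\<in>?S. ereal (?g \<xi> x)) < y} \<subseteq> \<Omega>" by auto
      show "{x \<in> space (lebesgue_on \<Omega>). (INF \<xi>\<in>?S. ereal (?g \<xi> x)) < y} \<in> sets (lebesgue_on \<Omega>)"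
        using o s dom(1) by (simp add: sets_restrict_space_iff)
    qed
    show "ereal c \<le> (INF \<xi>\<in>?S. ereal (?g \<xi> x))" if "x \<in> space (lebesgue_on \<Omega>)" for x
      using c(2) that by (intro INF_greatest) auto
  qed (rule c(1))
qed

end

section \<open>The functional attached to the scattered field and the conclusion\<close>

lemma radon_pullback:
  fixes c :: "real^'n \<Rightarrow> complex"
  assumes c: "locally_integrable_on UNIV c" and \<theta>: "continuous_on UNIV \<theta>" "\<And>x. norm x > R\<^sub>0 \<Longrightarrow> \<theta> x = x"
  shows "radon (\<lambda>f. LINT x|lebesgue. c x * of_real (f (\<theta> x)))"
  unfolding radon_def
proof (intro conjI allI impI)
  \<comment> \<open>The map is the identity beyond a fixed radius, so composition with it keeps
    supports in a common ball; it does not increase the sup norm either.\<close>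
  have cc: "cc (max R R\<^sub>0) (\<lambda>x. f (\<theta> x))" if "cc R f" for R and f :: "real^'n \<Rightarrow> real"
    unfolding cc_def
  proof (intro conjI allI impI)
    show "continuous_on UNIV (\<lambda>x. f (\<theta> x))" by (rule continuous_on_compose2[OF cc_continuous[OF that] \<theta>(1)]) auto
    show "f (\<theta> x) = 0" if "max R R\<^sub>0 < norm x" for x using that cc_zero[OF \<open>cc R f\<close>, of x] \<theta>(2)[of x] by simp
  qed
  have I: "integrable lebesgue (\<lambda>x. c x * of_real (f (\<theta> x)))" if "cc R f" for R f by (rule loc_int_cc[OF c cc[OF that]])
  show "(LINT x|lebesgue. c x * of_real (f (\<theta> x) + g (\<theta> x))) = (LINT x|lebesgue. c x * of_real (f (\<theta> x))) + (LINT x|lebesgue. c x * of_real (g (\<theta> x)))"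
    if "cc R f" "cc R g" for R and f g :: "real^'n \<Rightarrow> real"
    using Bochner_Integration.integral_add[OF I[OF that(1)] I[OF that(2)]] by (simp add: distrib_left)
  show "(LINT x|lebesgue. c x * of_real (s * f (\<theta> x))) = s *\<^sub>R (LINT x|lebesgue. c x * of_real (f (\<theta> x)))" for s and f :: "real^'n \<Rightarrow> real"
  proof -
    have "(LINT x|lebesgue. c x * of_real (s * f (\<theta> x))) = (LINT x|lebesgue. of_real s * (c x * of_real (f (\<theta> x))))"
      by (intro Bochner_Integration.integral_cong) auto
    then show ?thesis by (simp add: scaleR_conv_of_real)
  qed
  fix R
  define R' where "R' = max R R\<^sub>0"
  define C where "C = (LINT x|lebesgue. norm (indicat_real (cball 0 R') x *\<^sub>R c x))"
  show "\<exists>C. \<forall>f B. cc R f \<longrightarrow> (\<forall>x. \<bar>f x\<bar> \<le> B) \<longrightarrow> norm (LINT x|lebesgue. c x * of_real (f (\<theta> x))) \<le> C * B"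
  proof (intro exI[of _ C] allI impI)
    fix f B assume f: "cc R (f :: real^'n \<Rightarrow> real)" and B: "\<forall>x. \<bar>f x\<bar> \<le> B"
    have "norm (LINT x|lebesgue. c x * of_real (f (\<theta> x))) \<le> (LINT x|lebesgue. norm (c x * of_real (f (\<theta> x))))" by (rule integral_norm_bound)
    also have "\<dots> \<le> (LINT x|lebesgue. norm (indicat_real (cball 0 R') x *\<^sub>R c x) * B)"
    proof (rule integral_mono)
      show "integrable lebesgue (\<lambda>x. norm (c x * of_real (f (\<theta> x))))" by (rule integrable_norm[OF I[OF f]])
      show "integrable lebesgue (\<lambda>x. norm (indicat_real (cball 0 R') x *\<^sub>R c x) * B)"
        by (intro integrable_mult_left integrable_norm locally_integrable_ball c)
      show "norm (c x * of_real (f (\<theta> x))) \<le> norm (indicat_real (cball 0 R') x *\<^sub>R c x) * B" for x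
      proof (cases "norm x \<le> R'")
        case True
        then show ?thesis using B by (simp add: norm_mult mult_left_mono)
      next
        case False
        then have "f (\<theta> x) = 0" by (intro cc_zero[OF cc[OF f]]) (simp only: R'_def not_le)
        then show ?thesis using False by simp
      qed
    qed
    also have "\<dots> = C * B" by (simp add: C_def)
    finally show "norm (LINT x|lebesgue. c x * of_real (f (\<theta> x))) \<le> C * B" .
  qed
qed

lemma radon_plus:
  fixes l m :: "(real^'n \<Rightarrow> real) \<Rightarrow> 'b::real_normed_vector"
  assumes "radon l" "radon m" shows "radon (\<lambda>f. l f + m f)"
  unfolding radon_def
proof (intro conjI allI impI)
  show "l (\<lambda>x. f x + g x) + m (\<lambda>x. f x + g x) = l f + m f + (l g + m g)" if "cc R f" "cc R g" for R and f g :: "real^'n \<Rightarrow> real"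
    using radon_add[OF assms(1) that] radon_add[OF assms(2) that] by simp
  show "l (\<lambda>x. c * f x) + m (\<lambda>x. c * f x) = c *\<^sub>R (l f + m f)" if "cc R f" for R c and f :: "real^'n \<Rightarrow> real"
    using radon_cmult[OF assms(1) that] radon_cmult[OF assms(2) that] by (simp add: scaleR_add_right)
  fix R
  obtain C C' where C: "\<forall>f B. cc R f \<longrightarrow> (\<forall>x. \<bar>f x\<bar> \<le> B) \<longrightarrow> norm (l f) \<le> C * B"
    "\<forall>f B. cc R f \<longrightarrow> (\<forall>x. \<bar>f x\<bar> \<le> B) \<longrightarrow> norm (m f) \<le> C' * B"
    using assms unfolding radon_def by meson
  show "\<exists>C. \<forall>f B. cc R f \<longrightarrow> (\<forall>x. \<bar>f x\<bar> \<le> B) \<longrightarrow> norm (l f + m f) \<le> C * B"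
  proof (intro exI[of _ "C + C'"] allI impI)
    fix f B assume "cc R (f :: real^'n \<Rightarrow> real)" "\<forall>x. \<bar>f x\<bar> \<le> B"
    then have "norm (l f) \<le> C * B" "norm (m f) \<le> C' * B" using C by blast+
    then show "norm (l f + m f) \<le> (C + C') * B" using norm_triangle_ineq[of "l f" "m f"] by (simp add: distrib_right)
  qed
qed

lemma sphere_integral_cong:
  assumes "r > 0" "\<And>x. norm x = r \<Longrightarrow> f x = g x"
  shows "sphere_integral r f = sphere_integral r g"
  unfolding sphere_integral_def using assms
  by (intro arg_cong2[of _ _ _ _ "(*)"] refl Bochner_Integration.integral_cong) (simp_all add: space_unit_sphere_measure)

text \<open>The radius is enlarged beyond a given \<open>M\<close>, so that the representative lives
  off a ball containing the scatterer, and the radial derivative is rewritten through partial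
  derivatives. The rewriting is valid for large radii only, which is enough for the limit.\<close>

lemma sommerfeld_radiatingE:
  fixes us :: "real^'n \<Rightarrow> complex"
  assumes "sommerfeld_radiating k us"
  obtains R\<^sub>0 v where "R\<^sub>0 \<ge> M" "c1 (- cball 0 R\<^sub>0) v (\<lambda>j x. frechet_derivative v (at x) (axis j 1))"
    "AE x in lebesgue. norm x > R\<^sub>0 \<longrightarrow> us x = v x"
    "((\<lambda>r. sphere_integral r (\<lambda>x. (cmod ((\<Sum>j\<in>UNIV. (sgn x $ j) *\<^sub>R frechet_derivative v (at x) (axis j 1)) - \<i> * of_real k * v x))\<^sup>2)) \<longlongrightarrow> 0) at_top"
proof -
  obtain R' v where v: "Ck_on 1 (- cball 0 R') v" "AE x in lebesgue_on (- cball 0 R'). us x = v x"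
    and lim: "((\<lambda>R. sphere_integral R (\<lambda>x. (cmod (frechet_derivative v (at x) (sgn x) - \<i> * of_real k * v x))\<^sup>2)) \<longlongrightarrow> 0) at_top"
    using assms unfolding sommerfeld_radiating_def by blast
  have c: "c1 (- cball 0 R') v (\<lambda>j x. frechet_derivative v (at x) (axis j 1))"
    by (rule Ck_on_Suc_c1(1)[of 0]) (use v(1) in \<open>simp_all add: open_Compl\<close>)
  show ?thesis
  proof (rule that[of "max M R'" v])
    show "c1 (- cball 0 (max M R')) v (\<lambda>j x. frechet_derivative v (at x) (axis j 1))" by (rule c1_subset[OF c]) auto
    have "AE x in lebesgue. x \<in> - cball 0 R' \<longrightarrow> us x = v x"
      using v(2) by (subst (asm) AE_restrict_space_iff) auto
    then show "AE x in lebesgue. norm x > max M R' \<longrightarrow> us x = v x" by eventually_elim auto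
    have eq: "sphere_integral r (\<lambda>x. (cmod (frechet_derivative v (at x) (sgn x) - \<i> * of_real k * v x))\<^sup>2)
      = sphere_integral r (\<lambda>x. (cmod ((\<Sum>j\<in>UNIV. (sgn x $ j) *\<^sub>R frechet_derivative v (at x) (axis j 1)) - \<i> * of_real k * v x))\<^sup>2)"
      if r: "r > max 0 R'" for r
    proof (rule sphere_integral_cong)
      fix x :: "real^'n" assume "norm x = r"
      then have "x \<in> - cball 0 R'" using r by simp
      then have "frechet_derivative v (at x) (sgn x) = (\<Sum>j\<in>UNIV. (sgn x $ j) *\<^sub>R frechet_derivative v (at x) (axis j 1))"
        by (rule fun_cong[OF frechet_derivative_at[OF c1_derivative[OF c], symmetric]])
      then show "(cmod (frechet_derivative v (at x) (sgn x) - \<i> * of_real k * v x))\<^sup>2 =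
        (cmod ((\<Sum>j\<in>UNIV. (sgn x $ j) *\<^sub>R frechet_derivative v (at x) (axis j 1)) - \<i> * of_real k * v x))\<^sup>2" by simp
    qed (use r in simp)
    show "((\<lambda>r. sphere_integral r (\<lambda>x. (cmod ((\<Sum>j\<in>UNIV. (sgn x $ j) *\<^sub>R frechet_derivative v (at x) (axis j 1)) - \<i> * of_real k * v x))\<^sup>2)) \<longlongrightarrow> 0) at_top"
      by (rule Lim_transform_eventually[OF lim]) (use eq eventually_gt_at_top[of "max 0 R'"] in \<open>auto elim: eventually_mono\<close>)
  qed simp
qed

context transformation
begin

text \<open>With K the Jacobian of \<theta> in \<Omega> and J its inverse, A K^T W = q J J^T K^T W =
  q J W, and q = |det K| = det K by \<open>q_pos\<close> of the locale. Cramer's rule identifies det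
  K times K^(-1) W with the determinant in \<open>piola\<close>. Off \<Omega> everything is the
  identity.\<close>

lemma change_of_variables:
  assumes "\<Omega> \<subseteq> cball 0 R\<^sub>0" "R\<^sub>0 > 0"
  shows "inner_change.q \<Omega> D = q"
    and "(\<Sum>j\<in>UNIV. A x $ i $ j * (\<Sum>a\<in>UNIV. inner_change.\<theta>' \<Omega> D a j x * w a)) = piola (inner_change.\<theta>' \<Omega> D) w i x"
proof -
  interpret I: inner_change \<Omega> \<theta> D D2 L R\<^sub>0 by (rule inner_change[OF assms])
  have qd: "I.q x = det (K x)" if "x \<in> \<Omega>" for x
    using that by (simp add: I.q_def I.\<theta>'_in det_D)
  show qq: "I.q = q"
  proof
    fix x show "I.q x = q x"
      using q_in(2)[of x] I.q_pos[of x] qd[of x] by (cases "x \<in> \<Omega>") (simp_all add: q_out I.q_out)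
  qed
  show "(\<Sum>j\<in>UNIV. A x $ i $ j * (\<Sum>a\<in>UNIV. I.\<theta>' a j x * w a)) = piola I.\<theta>' w i x"
  proof (cases "x \<in> \<Omega>")
    case True
    define W where "W = (\<chi> a. w a)"
    have "(\<Sum>j\<in>UNIV. A x $ i $ j * (\<Sum>a\<in>UNIV. I.\<theta>' a j x * w a)) = (A x *v (transpose (K x) *v W)) $ i"
      using True by (simp add: matrix_vector_mult_def transpose_def K_entry I.\<theta>'_in W_def)
    also have "A x *v (transpose (K x) *v W) = det (K x) *\<^sub>R (J x *v W)"
    proof -
      have "transpose (J x) ** transpose (K x) = mat 1"
        unfolding matrix_transpose_mul[symmetric] J_K(2)[OF True] by (rule transpose_mat)
      moreover have "(J x ** transpose (J x)) *v (transpose (K x) *v W) = J x *v ((transpose (J x) ** transpose (K x)) *v W)"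
        by (simp only: matrix_vector_mul_assoc matrix_mul_assoc)
      ultimately have "(J x ** transpose (J x)) *v (transpose (K x) *v W) = J x *v W" by (simp only: matrix_vector_mul_lid)
      moreover have "q x = det (K x)" using qd[OF True] qq by simp
      ultimately show ?thesis by (simp add: A_in[OF True] scaleR_matrix_vector_assoc[symmetric])
    qed
    also have "(det (K x) *\<^sub>R (J x *v W)) $ i = (J x *v W) $ i * det (K x)" by simp
    also have "\<dots> = det (\<chi> a b. if b = i then (K x *v (J x *v W)) $ a else K x $ a $ b)"
      by (rule cramer_lemma[symmetric])
    also have "K x *v (J x *v W) = W" by (simp add: matrix_vector_mul_assoc J_K(2)[OF True])
    also have "det (\<chi> a b. if b = i then W $ a else K x $ a $ b) = det (transpose (\<chi> a b. if b = i then W $ a else K x $ a $ b))"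
      by (rule det_transpose[symmetric])
    also have "transpose (\<chi> a b. if b = i then W $ a else K x $ a $ b) = (\<chi> a b. if a = i then w b else I.\<theta>' b a x)"
      using True by (simp add: vec_eq_iff transpose_def W_def K_entry I.\<theta>'_in)
    finally show ?thesis unfolding piola_def .
  next
    case False
    have "(\<Sum>j\<in>UNIV. A x $ i $ j * (\<Sum>a\<in>UNIV. I.\<theta>' a j x * w a)) = (\<Sum>j\<in>UNIV. if j = i then w j else 0)"
    proof (rule sum.cong[OF refl])
      fix j
      have "(\<Sum>a\<in>UNIV. I.\<theta>' a j x * w a) = (\<Sum>a\<in>UNIV. if a = j then w a else 0)"
        using False by (intro sum.cong) (auto simp: I.\<theta>'_out)
      then show "A x $ i $ j * (\<Sum>a\<in>UNIV. I.\<theta>' a j x * w a) = (if j = i then w j else 0)"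
        using False by (simp add: A_out mat_def)
    qed
    then have "(\<Sum>j\<in>UNIV. A x $ i $ j * (\<Sum>a\<in>UNIV. I.\<theta>' a j x * w a)) = w i" by simp
    moreover have "piola I.\<theta>' w i x = piola (\<lambda>a b x. if b = a then 1 else 0) w i x"
      unfolding piola_def using False by (simp add: I.\<theta>'_out cong: if_cong)
    ultimately show ?thesis by (simp add: piola_identity)
  qed
qed

theorem non_scattering_transformed:
  assumes k: "k > 0" and inc: "incident_field k \<Omega> T u"
  shows "non_scattering A q \<Omega> k T u"
  unfolding non_scattering_def
proof (intro allI impI)
  fix us assume scat: "scattered_field k A q T u us"
  obtain M where M: "\<Omega> \<subseteq> cball 0 M" using dom(4) unfolding bounded_iff subset_iff mem_cball_0 by blast
  obtain R\<^sub>0 v where R: "R\<^sub>0 \<ge> max 1 M" and v: "c1 (- cball 0 R\<^sub>0) v (\<lambda>j x. frechet_derivative v (at x) (axis j 1))"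
    "AE x in lebesgue. norm x > R\<^sub>0 \<longrightarrow> us x = v x"
    and som: "((\<lambda>r. sphere_integral r (\<lambda>x. (cmod ((\<Sum>j\<in>UNIV. (sgn x $ j) *\<^sub>R frechet_derivative v (at x) (axis j 1)) - \<i> * of_real k * v x))\<^sup>2)) \<longlongrightarrow> 0) at_top"
    using scat unfolding scattered_field_def by (elim conjE) (rule sommerfeld_radiatingE[where M="max 1 M"])
  have dR: "\<Omega> \<subseteq> cball 0 R\<^sub>0" and R0: "R\<^sub>0 > 0" using M R by auto
  interpret I: inner_change \<Omega> \<theta> D D2 L R\<^sub>0 by (rule inner_change[OF dR R0])
  note cov = change_of_variables[OF dR R0]
  obtain G where G: "has_weak_gradient UNIV us G" "scattering_equation k A q (zero_extension T u) us G"
    using scat unfolding scattered_field_def by blast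
  have us: "locally_integrable_on UNIV us" using G(1) by (simp add: has_weak_gradient_def)
  have T: "open T" "closure \<Omega> \<subseteq> T" "Ck_on (Suc (Suc 0)) T u"
    and helm: "\<And>x. x \<in> T \<Longrightarrow> laplacian u x + (of_real k)\<^sup>2 * u x = 0"
    using inc by (auto simp: incident_field_def domain_set_def numeral_2_eq_2 simp del: Ck_on.simps)
  have \<Omega>T: "\<Omega> \<subseteq> T" using T(2) closure_subset by blast
  have u: "c1 T u (\<lambda>j. partial j u)" unfolding partial_def[abs_def] by (rule Ck_on_Suc_c1(1)[OF T(3,1)])
  have u': "c1 T (partial j u) (\<lambda>i. partial i (partial j u))" for j
    using Ck_on_Suc_c1(1)[OF Ck_on_Suc_c1(2)[OF T(3,1)] T(1)] unfolding partial_def[abs_def] .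
  have comp: "compact (closure \<Omega>)" using dom(4) by simp
  have "\<exists>B. \<forall>x\<in>closure \<Omega>. norm (f x) \<le> B" if "continuous_on T f" for f :: "real^'n \<Rightarrow> complex"
  proof -
    have "bounded (f ` closure \<Omega>)"
      by (rule compact_imp_bounded[OF compact_continuous_image[OF continuous_on_subset[OF that T(2)] comp]])
    then show ?thesis unfolding bounded_iff by blast
  qed
  note bdd = this
  obtain B0 where B0: "\<forall>x\<in>closure \<Omega>. norm (u x) \<le> B0" using bdd[OF c1_continuous[OF u]] by blast
  have "\<forall>j. \<exists>B. \<forall>x\<in>closure \<Omega>. norm (partial j u x) \<le> B" using bdd[OF c1_continuous_partial[OF u]] by blast
  then obtain B1 where B1: "\<And>j. \<forall>x\<in>closure \<Omega>. norm (partial j u x) \<le> B1 j" by metis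
  define B where "B = max B0 (Max (range B1))"
  have Bu: "norm (u x) \<le> B" "norm (partial j u x) \<le> B" if "x \<in> \<Omega>" for x j
  proof -
    have x: "x \<in> closure \<Omega>" using that closure_subset by blast
    show "norm (u x) \<le> B" using bspec[OF B0 x] by (simp add: B_def)
    have "B1 j \<le> B" unfolding B_def by (intro max.coboundedI2 Max_ge) auto
    then show "norm (partial j u x) \<le> B" by (rule order_trans[OF bspec[OF B1[of j] x]])
  qed
  have grad_ext: "grad (zero_extension T u) x = (\<chi> j. partial j u x)" if "x \<in> \<Omega>" for x
  proof -
    have "c1 T (zero_extension T u) (\<lambda>j. partial j u)"
      by (rule c1_eqI[OF u T(1)]) (auto simp: zero_extension_def)
    then show ?thesis unfolding grad_def using c1_partial[of T "zero_extension T u"] that \<Omega>T by (auto simp: vec_eq_iff)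
  qed
  obtain BA where BA: "\<And>i j x. \<bar>A x $ i $ j\<bar> \<le> BA" by (rule A_bound) blast
  define U where "U x = (if x \<in> \<Omega> then u x else 0)" for x
  have U: "locally_integrable_on UNIV U"
    unfolding U_def[abs_def] by (rule I.inner_field[OF continuous_on_subset[OF c1_continuous[OF u] \<Omega>T] Bu(1)])
  obtain Cq where Cq: "\<And>x. \<bar>q x\<bar> \<le> Cq" using I.q_bound unfolding cov(1) by blast
  have qm: "(\<lambda>x. complex_of_real (q x)) \<in> borel_measurable lebesgue"
    using I.q_measurable unfolding cov(1) by (intro measurable_completion) (simp add: measurable_lborel1)
  have qus: "locally_integrable_on UNIV (\<lambda>x. of_real (q x) * us x)" and qU: "locally_integrable_on UNIV (\<lambda>x. of_real (q x) * U x)"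
    using Cq by (auto intro!: loc_int_mult_bounded[OF us qm, of Cq] loc_int_mult_bounded[OF U qm, of Cq])
  have \<theta>R: "\<theta> x = x" if "norm x > R\<^sub>0" for x by (rule I.\<theta>_norm_out[OF that])
  define l where "l = (\<lambda>\<psi>. (LINT x|lebesgue. of_real (q x) * us x * of_real (\<psi> (\<theta> x)))
    + ((LINT x|lebesgue. of_real (q x) * U x * of_real (\<psi> (\<theta> x))) + (LINT x|lebesgue. - U x * of_real (\<psi> x))))"
  have l: "radon l"
    unfolding l_def
    by (intro radon_plus radon_pullback[OF qus \<theta>_continuous \<theta>R] radon_pullback[OF qU \<theta>_continuous \<theta>R]
        radon_pullback[OF loc_int_minus[OF U] continuous_on_id]) auto
  have R: "radiating l \<Omega> k R\<^sub>0 us v (\<lambda>j x. frechet_derivative v (at x) (axis j 1))"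
  proof (rule radiating.intro[OF l k R0 dR _ _ us v])
    fix \<phi> :: "real^'n \<Rightarrow> real" and \<phi>' :: "'n \<Rightarrow> real^'n \<Rightarrow> real" and \<phi>'' :: "'n \<Rightarrow> 'n \<Rightarrow> real^'n \<Rightarrow> real" and R
    assume \<phi>: "c1 UNIV \<phi> \<phi>'" "\<And>i. c1 UNIV (\<phi>' i) (\<phi>'' i)" "cc R \<phi>"
    have "(LINT x|lebesgue. us x * of_real (q x * ((\<Sum>a\<in>UNIV. \<phi>'' a a (\<theta> x)) + k\<^sup>2 * \<phi> (\<theta> x))))
      + (LINT x|lebesgue. (if x \<in> \<Omega> then u x else 0) * of_real (q x * ((\<Sum>a\<in>UNIV. \<phi>'' a a (\<theta> x)) + k\<^sup>2 * \<phi> (\<theta> x))))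
      - (LINT x|lebesgue. (if x \<in> \<Omega> then u x else 0) * of_real ((\<Sum>a\<in>UNIV. \<phi>'' a a x) + k\<^sup>2 * \<phi> x)) = 0"
    proof (rule I.pulled_back_equation[where A=A and B=B and BA=BA and ue="zero_extension T u",
          OF c1_subset[OF u \<Omega>T] c1_subset[OF u' \<Omega>T] _ _ _ _ _ G(1) _ _ _ _ _ _ \<phi>, unfolded cov(1)])
      show "(\<Sum>j\<in>UNIV. partial j (partial j u) x) + (of_real k)\<^sup>2 * u x = 0" if "x \<in> \<Omega>" for x
        using helm[of x] that \<Omega>T by (auto simp: laplacian_def)
      show "zero_extension T u x = u x" if "x \<in> \<Omega>" for x using that \<Omega>T by (auto simp: zero_extension_def)
      show "\<bar>A x $ i $ j\<bar> \<le> BA" for x i j by (rule BA)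
      show "A x = mat 1" if "x \<notin> \<Omega>" for x by (rule A_out[OF that])
      show "cmod (u x) \<le> B" if "x \<in> \<Omega>" for x by (rule Bu(1)[OF that])
      show "cmod (partial j u x) \<le> B" if "x \<in> \<Omega>" for j x by (rule Bu(2)[OF that])
      show "grad (zero_extension T u) x = (\<chi> j. partial j u x)" if "x \<in> \<Omega>" for x by (rule grad_ext[OF that])
    qed (rule G(2) A_entry_measurable A_symmetric cov(2))+
    then show "l (\<lambda>x. (\<Sum>i\<in>UNIV. \<phi>'' i i x) + k\<^sup>2 * \<phi> x) = 0"
      by (simp add: l_def U_def[symmetric] mult_ac add_diff_eq)
  next
    fix \<psi> :: "real^'n \<Rightarrow> real" and R assume \<psi>: "cc R \<psi>" "\<And>x. x \<in> \<Omega> \<Longrightarrow> \<psi> x = 0"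
    \<comment> \<open>\<theta> maps \<Omega> into itself and is the identity elsewhere, so a
      function vanishing on \<Omega> still vanishes there after composition with \<theta>; outside,
      q = 1.\<close>
    have e: "of_real (q x) * us x * of_real (\<psi> (\<theta> x)) = us x * of_real (\<psi> x)"
      and e2: "of_real (q x) * U x * of_real (\<psi> (\<theta> x)) = 0" and e3: "- U x * of_real (\<psi> x) = 0" for x
      using \<psi>(2)[of x] \<psi>(2)[OF \<theta>_dom, of x] by (cases "x \<in> \<Omega>"; simp add: U_def q_out \<theta>_out)+
    show "l \<psi> = (LINT x|lebesgue. us x * of_real (\<psi> x))" unfolding l_def e e2 e3 by simp
  qed
  have 1: "AE x in lebesgue. x \<in> - closure \<Omega> \<longrightarrow> us x = 0" by (rule radiating.vanishes_outside[OF R som])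
  \<comment> \<open>\<open>vanishes_outside\<close> speaks of the complement of the closure; the
    remaining points of the complement of \<Omega> form the frontier, which is null because it is
    locally a Lipschitz graph.\<close>
  have "AE x in lebesgue. x \<notin> frontier \<Omega>"
    using negligible_lipschitz_boundary[OF dom(1,5)] by (intro AE_not_in) (simp add: negligible_iff_null_sets)
  then have "AE x in lebesgue. x \<in> - \<Omega> \<longrightarrow> us x = 0"
    using 1 by eventually_elim (use frontier_dom in auto)
  then show "AE x in lebesgue_on (- \<Omega>). us x = 0"
    using dom(1) by (subst AE_restrict_space_iff) auto
qed

end

theorem lemma3p1:
  fixes \<Omega> :: "(real^'n) set" and \<Psi> :: "real^'n \<Rightarrow> real^'n"
  assumes "CARD('n) \<ge> 2"
    and "bounded_lipschitz_domain \<Omega>"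
    and "connected (- closure \<Omega>)"
    and "Ck_closure_diffeomorphism 2 \<Omega> \<Psi>"
    and "\<forall>x\<in>frontier \<Omega>. \<Psi> x = x"
  shows "Linfty_on \<Omega> (transformed_A \<Psi> \<Omega>) \<and>
    Linfty_on \<Omega> (transformed_q \<Psi> \<Omega>) \<and>
    essinf (lebesgue_on \<Omega>)
      (\<lambda>x. INF \<xi>\<in>{\<xi>::complex^'n. norm \<xi> = 1}.
        ereal (Re (cdot \<xi> (cmat (transformed_A \<Psi> \<Omega> x) *v cconj \<xi>)))) > 0 \<and>
    essinf (lebesgue_on \<Omega>) (\<lambda>x. ereal (transformed_q \<Psi> \<Omega> x)) > 0 \<and>
    (\<forall>k>0. \<forall>T u\<^sub>i. incident_field k \<Omega> T u\<^sub>i \<longrightarrow>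
      non_scattering (transformed_A \<Psi> \<Omega>) (transformed_q \<Psi> \<Omega>) \<Omega> k T u\<^sub>i)"
proof -
  interpret transformation \<Omega> \<Psi> using assms by unfold_locales auto
  show ?thesis using Linfty_A Linfty_q essinf_A essinf_q non_scattering_transformed by blast
qed

end
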